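(* Let $\alpha>0$, $\beta>0$, $1<p\le q\le\infty$ and $m>\alpha-1$. For a double indexed sequence of complex numbers $c=\{c_k^j : k\ge 0,\ 1\le j\le d_k\}$ the following conditions are equivalent: 1. $c\in M_H(B^{p,1}_\alpha, B^{q,1}_\beta)$. 2. The function $g(x)=\sum_{k\ge 0} r^k\sum_{j=1}^{d_k} c_k^j Y_j^{(k)}(x')$, $x=rx'$, is harmonic in $\mathbb B$ and $$N_1(g)=\sup_{0\le\rho<1}\ \sup_{y'\in\mathbb S}\ (1-\rho)^{m+1-\alpha+\beta}\int_{\mathbb S}|\Lambda_{m+1}(g\ast P_{x'})(\rho y')|\,dx'<\infty .$$
   Context: Let $n\ge 2$, let $\mathbb B$ be the open unit ball of $\mathbb R^n$, $\mathbb S=\partial\mathbb B$, and write $x=rx'$ with $r=|x|$, $x'\in\mathbb S$. $dx'$ is the rotation-invariant surface measure on $\mathbb S$ (fixed normalization). $h(\mathbb B)$ is the space of (complex-valued) harmonic functions on $\mathbb B$. For each $k\ge0$ let $Y^{(k)}_j$, $1\le j\le d_k$, be real-valued spherical harmonics of order $k$ ($d_k$ is the dimension of the space of spherical harmonics of order $k$), chosen so that the whole family $\{Y_j^{(k)}\}_{k\ge 0,\,1\le j\le d_k}$ is an orthonormal basis of $L^2(\mathbb S,dx')$; this basis is fixed. Every $f\in h(\mathbb B)$ has an expansion $f(rx')=\sum_{k\ge0} r^k\sum_{j=1}^{d_k} b_k^j(f)Y_j^{(k)}(x')$. For $y'\in\mathbb S$ the Poisson kernel is $P_{y'}(rx')=\sum_{k\ge0}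 r^k\sum_{j=1}^{d_k}Y_j^{(k)}(y')Y_j^{(k)}(x')$. For $f,g\in h(\mathbb B)$ the convolution is $(f\ast g)(rx')=\sum_{k\ge 0}\sum_{j=1}^{d_k} r^k b_k^j(f)b_k^j(g)Y_j^{(k)}(x')$, which is harmonic in $\mathbb B$. For a double indexed sequence $c$ and $f\in h(\mathbb B)$, $(c\ast f)(rx')=\sum_{k\ge 0}\sum_{j=1}^{d_k} r^k c_k^j b_k^j(f)Y_j^{(k)}(x')$, if the series converges in $\mathbb B$. For $t>0$ the fractional derivative of $f\in h(\mathbb B)$ of order $t$ is $$(\Lambda_t f)(rx')=\sum_{k\ge 0} r^k\frac{\Gamma(k+n/2+t)}{\Gamma(k+n/2)\Gamma(t)}\sum_{j=1}^{d_k}b_k^j(f)Y_j^{(k)}(x').$$ In $\Lambda_{m+1}(g\ast P_{x'})(\rho y')$ the operator acts on the harmonic function $g\ast P_{x'}$ ($x'$ fixed), and the result is evaluated at $\rho y'$. For subspaces $X,Y\subset h(\mathbb B)$, $M_H(X,Y)$ is the set of all double indexed sequences $c$ such that $c\ast f\in Y$ for every $f\in X$ (multipliers from $X$ to $Y$). $M_q(f,r)=\left(\int_{\mathbb S}|f(rx')|^q dx'\right)^{1/q}$ for $0<q<\infty$ and $M_\infty(f,r)=\sup_{x'\in\mathbb S}|f(rx')|$. For $0<p,q\le\infty$, $\alpha>0$, $B^{p,q}_\alpha$ is the space of $f\in h(\mathbb B)$ with $\|f\|_{p,q;\alpha}<\infty$, where $\|f\|_{p,q;\alpha}=\left(\int_0^1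 M_q(f,r)^p(1-r^2)^{\alpha p-1}r^{n-1}dr\right)^{1/p}$ for $p<\infty$ and $\|f\|_{\infty,q;\alpha}=\sup_{0\le r<1}M_q(f,r)(1-r^2)^\alpha$. *)

theory Defs
  imports "HOL-Analysis.Analysis" "HOL-Library.Function_Algebras"
begin

text \<open>
  Polar coordinates: a Borel set \<open>A\<close> of the unit sphere of \<open>n\<close>-space has surface measure
  \<open>n\<close> times the volume of the cone over \<open>A\<close> inside the unit ball.  Other normalizations of the
  rotation-invariant measure are obtained with \<^const>\<open>scale_measure\<close>.
\<close>
definition surface_measure :: "(real^'n) measure" where
  "surface_measure =
     scale_measure (of_nat CARD('n))
       (distr (restrict_space lborel (ball 0 1 - {0})) (restrict_space borel (sphere 0 1))
          (\<lambda>x. x /\<^sub>R norm x))"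

definition partial_deriv :: "'n \<Rightarrow> (real^'n \<Rightarrow> 'b::real_normed_vector) \<Rightarrow> real^'n \<Rightarrow> 'b" where
  "partial_deriv i f x = frechet_derivative f (at x) (axis i 1)"

text \<open>Meant for open sets \<open>S\<close>; the first three conjuncts say that \<open>f\<close> is of class \<open>C\<^sup>2\<close> on \<open>S\<close>.\<close>
definition harmonic_on :: "(real^'n \<Rightarrow> 'b::real_normed_vector) \<Rightarrow> (real^'n) set \<Rightarrow> bool" where
  "harmonic_on f S \<longleftrightarrow>
     f differentiable_on S \<and>
     (\<forall>i. partial_deriv i f differentiable_on S) \<and>
     (\<forall>i j. continuous_on S (partial_deriv j (partial_deriv i f))) \<and>
     (\<forall>x\<in>S. (\<Sum>i\<in>UNIV. partial_deriv i (partial_deriv i f) x) = 0)"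

text \<open>
  Functions on the sphere are represented by functions on the whole space that vanish off the
  sphere, so that the spherical harmonics of order \<open>k\<close> form a vector space with the pointwise
  operations.
\<close>
definition spherical_harmonics :: "nat \<Rightarrow> (real^'n \<Rightarrow> real) set" where
  "spherical_harmonics k =
     {Y. (\<exists>p. real_polynomial_function p \<and> (\<forall>t x. p (t *\<^sub>R x) = t ^ k * p x) \<and>
              harmonic_on p UNIV \<and> (\<forall>x\<in>sphere 0 1. Y x = p x)) \<and>
         (\<forall>x. x \<notin> sphere 0 1 \<longrightarrow> Y x = 0)}"

lemma vector_space_real_fun: "vector_space (\<lambda>(a::real) (f::'a \<Rightarrow> real) x. a * f x)"
  by unfold_locales (auto simp: fun_eq_iff algebra_simps)

definition sph_dim :: "'n::finite itself \<Rightarrow> nat \<Rightarrow> nat" where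
  "sph_dim _ k =
     vector_space.dim (\<lambda>(a::real) f x. a * f x) (spherical_harmonics k :: (real^'n \<Rightarrow> real) set)"

text \<open>
  An orthonormal basis of the complex Hilbert space \<open>L\<^sup>2(\<sigma>)\<close> consisting of real spherical harmonics:
  the functions \<open>Y k j\<close> with \<open>1 \<le> j \<le> sph_dim k\<close> are orthonormal and their linear span is dense.
  All other \<open>Y k j\<close> are irrelevant.
\<close>
definition spherical_basis :: "(real^'n) measure \<Rightarrow> (nat \<Rightarrow> nat \<Rightarrow> real^'n \<Rightarrow> real) \<Rightarrow> bool" where
  "spherical_basis \<sigma> Y \<longleftrightarrow>
     (\<forall>k. \<forall>j\<in>{1..sph_dim TYPE('n) k}. Y k j \<in> spherical_harmonics k) \<and>
     (\<forall>k l. \<forall>j\<in>{1..sph_dim TYPE('n) k}. \<forall>i\<in>{1..sph_dim TYPE('n) l}.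
        (\<integral>x. Y k j x * Y l i x \<partial>\<sigma>) = (if k = l \<and> j = i then 1 else 0)) \<and>
     (\<forall>f :: real^'n \<Rightarrow> complex. f \<in> borel_measurable \<sigma> \<and> integrable \<sigma> (\<lambda>x. (cmod (f x))\<^sup>2) \<longrightarrow>
        (\<forall>\<epsilon>>0. \<exists>N a. (\<integral>x. (cmod (f x -
             (\<Sum>k<N. \<Sum>j=1..sph_dim TYPE('n) k. a k j * of_real (Y k j x))))\<^sup>2 \<partial>\<sigma>) < \<epsilon>))"

text \<open>
  At the origin \<open>r = 0\<close> and the direction \<open>x'\<close> is arbitrary; it does not affect the series below,
  since \<open>r ^ k = 0\<close> for \<open>k > 0\<close> and spherical harmonics of order \<open>0\<close> are constant.
\<close>
definition direction :: "real^'n \<Rightarrow> real^'n" where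
  "direction x = (if x = 0 then (SOME u. norm u = 1) else x /\<^sub>R norm x)"

definition sph_term ::
    "(nat \<Rightarrow> nat \<Rightarrow> real^'n \<Rightarrow> real) \<Rightarrow> (nat \<Rightarrow> nat \<Rightarrow> complex) \<Rightarrow> real^'n \<Rightarrow> nat \<Rightarrow> complex" where
  "sph_term Y a x k =
     of_real (norm x ^ k) *
       (\<Sum>j=1..sph_dim TYPE('n) k. a k j * of_real (Y k j (direction x)))"

definition sph_series ::
    "(nat \<Rightarrow> nat \<Rightarrow> real^'n \<Rightarrow> real) \<Rightarrow> (nat \<Rightarrow> nat \<Rightarrow> complex) \<Rightarrow> real^'n \<Rightarrow> complex" where
  "sph_series Y a x = (\<Sum>k. sph_term Y a x k)"

definition sph_converges ::
    "(nat \<Rightarrow> nat \<Rightarrow> real^'n \<Rightarrow> real) \<Rightarrow> (nat \<Rightarrow> nat \<Rightarrow> complex) \<Rightarrow> bool" where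
  "sph_converges Y a \<longleftrightarrow> (\<forall>x\<in>ball 0 1. summable (sph_term Y a x))"

text \<open>
  The coefficients \<open>b\<^sub>k\<^sup>j(f)\<close> of a harmonic function \<open>f\<close> on the unit ball; they are determined by
  \<open>f\<close> for \<open>1 \<le> j \<le> sph_dim k\<close>, and only these indices are ever used.
\<close>
definition sph_coeff ::
    "(nat \<Rightarrow> nat \<Rightarrow> real^'n \<Rightarrow> real) \<Rightarrow> (real^'n \<Rightarrow> complex) \<Rightarrow> nat \<Rightarrow> nat \<Rightarrow> complex" where
  "sph_coeff Y f = (SOME b. \<forall>x\<in>ball 0 1. sph_term Y b x sums f x)"

definition poisson_kernel ::
    "(nat \<Rightarrow> nat \<Rightarrow> real^'n \<Rightarrow> real) \<Rightarrow> real^'n \<Rightarrow> real^'n \<Rightarrow> complex" where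
  "poisson_kernel Y y' = sph_series Y (\<lambda>k j. of_real (Y k j y'))"

definition harmonic_conv ::
    "(nat \<Rightarrow> nat \<Rightarrow> real^'n \<Rightarrow> real) \<Rightarrow> (real^'n \<Rightarrow> complex) \<Rightarrow> (real^'n \<Rightarrow> complex) \<Rightarrow>
     real^'n \<Rightarrow> complex" where
  "harmonic_conv Y f g = sph_series Y (\<lambda>k j. sph_coeff Y f k j * sph_coeff Y g k j)"

definition frac_deriv ::
    "(nat \<Rightarrow> nat \<Rightarrow> real^'n \<Rightarrow> real) \<Rightarrow> real \<Rightarrow> (real^'n \<Rightarrow> complex) \<Rightarrow> real^'n \<Rightarrow> complex" where
  "frac_deriv Y t f =
     sph_series Y (\<lambda>k j.
       of_real (Gamma (real k + real CARD('n) / 2 + t) /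
                (Gamma (real k + real CARD('n) / 2) * Gamma t)) * sph_coeff Y f k j)"

definition multipliers ::
    "(nat \<Rightarrow> nat \<Rightarrow> real^'n \<Rightarrow> real) \<Rightarrow> (real^'n \<Rightarrow> complex) set \<Rightarrow> (real^'n \<Rightarrow> complex) set \<Rightarrow>
     (nat \<Rightarrow> nat \<Rightarrow> complex) set" where
  "multipliers Y A B =
     {c. \<forall>f\<in>A. sph_converges Y (\<lambda>k j. c k j * sph_coeff Y f k j) \<and>
               sph_series Y (\<lambda>k j. c k j * sph_coeff Y f k j) \<in> B}"

text \<open>Powers of extended nonnegative reals, meant for exponents \<open>a > 0\<close>.\<close>
definition epowr :: "ennreal \<Rightarrow> real \<Rightarrow> ennreal" where
  "epowr x a = (if x = \<infinity> then \<infinity> else ennreal (enn2real x powr a))"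

definition integral_mean ::
    "(real^'n) measure \<Rightarrow> ennreal \<Rightarrow> (real^'n \<Rightarrow> complex) \<Rightarrow> real \<Rightarrow> ennreal" where
  "integral_mean \<sigma> q f r =
     (if q = \<infinity> then (SUP x\<in>sphere 0 1. ennreal (cmod (f (r *\<^sub>R x))))
      else epowr (\<integral>\<^sup>+x. ennreal (cmod (f (r *\<^sub>R x)) powr enn2real q) \<partial>\<sigma>) (1 / enn2real q))"

definition mixed_norm ::
    "(real^'n) measure \<Rightarrow> ennreal \<Rightarrow> ennreal \<Rightarrow> real \<Rightarrow> (real^'n \<Rightarrow> complex) \<Rightarrow> ennreal" where
  "mixed_norm \<sigma> p q \<alpha> f =
     (if p = \<infinity> then (SUP r\<in>{0..<1}. integral_mean \<sigma> q f r * ennreal ((1 - r\<^sup>2) powr \<alpha>))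
      else epowr
        (\<integral>\<^sup>+r\<in>{0<..<1}. epowr (integral_mean \<sigma> q f r) (enn2real p) *
            ennreal ((1 - r\<^sup>2) powr (\<alpha> * enn2real p - 1) * r ^ (CARD('n) - 1)) \<partial>lborel)
        (1 / enn2real p))"

definition mixed_norm_space ::
    "(real^'n) measure \<Rightarrow> ennreal \<Rightarrow> ennreal \<Rightarrow> real \<Rightarrow> (real^'n \<Rightarrow> complex) set" where
  "mixed_norm_space \<sigma> p q \<alpha> = {f. harmonic_on f (ball 0 1) \<and> mixed_norm \<sigma> p q \<alpha> f < \<infinity>}"

definition N1 ::
    "(real^'n) measure \<Rightarrow> (nat \<Rightarrow> nat \<Rightarrow> real^'n \<Rightarrow> real) \<Rightarrow> real \<Rightarrow> real \<Rightarrow> real \<Rightarrow>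
     (real^'n \<Rightarrow> complex) \<Rightarrow> ennreal" where
  "N1 \<sigma> Y \<alpha> \<beta> m g =
     (SUP \<rho>\<in>{0..<1}. SUP y'\<in>sphere 0 1.
        ennreal ((1 - \<rho>) powr (m + 1 - \<alpha> + \<beta>)) *
        (\<integral>\<^sup>+x'. ennreal (cmod (frac_deriv Y (m + 1)
            (harmonic_conv Y g (poisson_kernel Y x')) (\<rho> *\<^sub>R y'))) \<partial>\<sigma>))"

end

theory Submission imports Defs begin

text \<open>
  Everything is expressed through the coefficients \<open>a\<^sub>k\<^sub>j\<close> of a harmonic function. By Young's inequality for integral
  kernels on the sphere, \<open>N\<^sub>1 < \<infinity>\<close> gives an \<open>L\<^sup>1\<close> bound for the map with multipliers \<open>\<lambda>\<^sub>k c\<^sub>k\<^sub>j\<close> on each sphere, where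
  \<open>\<lambda>\<^sub>k\<close> are the factors of \<open>\<Lambda>\<^bsub>m+1\<^esub>\<close>. As \<open>1 / \<lambda>\<^sub>k\<close> is a Beta integral, the means of \<open>c * f\<close> are controlled by a
  one-dimensional integral operator applied to the means of \<open>f\<close>; Schur's test bounds it on the weighted
  \<open>L\<^sup>q\<close> space, and \<open>p \<le> q\<close> enters through the embedding given by monotonicity of the means.

  Conversely, a multiplier is tested on the functions \<open>(1 - \<tau>)\<^bsup>m+1-\<alpha>\<^esup> \<Lambda>\<^bsub>m+1\<^esub> P\<^sub>y(\<tau> x)\<close>. No completeness of the
  spaces and no closed graph theorem are needed: if the images were unbounded, a gliding hump would
  produce a single function whose image lies outside the target space.
\<close>

section \<open>Surface measure and rotation invariance\<close>

text \<open>Two exponents shape both directions. At radius r the mean of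
  \<open>\<Lambda>_(m+1) P_y(\<tau> x)\<close> is O((1-\<tau> r)^-(m+1)), so the factor
  (1-\<tau>)^(m+1-\<alpha>) is what keeps the test functions bounded in the source space, uniformly
  in \<tau> and y. Reading the image at radius \<tau> itself produces the radius \<tau>^2 and the
  exponent m+1-\<alpha>+\<beta> of \<open>N1\<close>. The mean estimate is proved for integer order,
  by multiplying kernels of radial derivatives, and reaches real m because a Gamma quotient is a
  Beta integral times a Pochhammer symbol. The obstacle is that coefficients are given by a choice
  operator and harmonicity by second derivatives. Solving the Dirichlet problem removes it: the
  coefficient arrays of harmonic functions turn out to be those of subexponential growth. From then
  on dilation, convolution and fractional derivative are all multiplications of arrays, and
  harmonicity of g in condition 2 is what upgrades mere convergence to such growth.\<close>

lemma nn_integral_lborel_translate: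
  fixes f :: "'a::euclidean_space \<Rightarrow> ennreal"
  assumes [measurable]: "f \<in> borel_measurable borel"
  shows "(\<integral>\<^sup>+y. f (y + c) \<partial>lborel) = (\<integral>\<^sup>+y. f y \<partial>lborel)"
proof -
  have "(\<integral>\<^sup>+y. f y \<partial>lborel) = (\<integral>\<^sup>+y. f y \<partial>distr lborel borel ((+) c))"
    by (simp add: lborel_distr_plus)
  also have "\<dots> = (\<integral>\<^sup>+y. f (c + y) \<partial>lborel)" by (subst nn_integral_distr) auto
  finally show ?thesis by (simp add: add.commute)
qed

text \<open>
  The uniqueness argument for Haar measure: integrate \<open>1\<^sub>B(x) 1\<^sub>E(T y)\<close> over \<open>x\<close> and \<open>y\<close>, where \<open>B\<close> is
  the unit ball, which is invariant under \<open>T\<close>.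
\<close>
lemma emeasure_lborel_orthogonal_vimage:
  fixes T :: "'a::euclidean_space \<Rightarrow> 'a"
  assumes T: "orthogonal_transformation T" and E: "E \<in> sets borel"
  shows "emeasure lborel (T -` E) = emeasure lborel E"
proof -
  have lin: "linear T" using T by (rule orthogonal_transformation_linear)
  have n: "norm (T x) = norm x" for x using T by (rule orthogonal_transformation_norm)
  have Tb[measurable]: "T \<in> borel_measurable borel"
    by (intro borel_measurable_continuous_onI linear_continuous_on linear_linear[THEN iffD2] lin)
  define B :: "'a set" where "B = ball 0 1"
  have [measurable]: "B \<in> sets borel" "E \<in> sets borel" using E by (auto simp: B_def)
  have B_iff: "x \<in> B \<longleftrightarrow> norm x < 1" for x by (simp add: B_def)
  have surj: "T (inv T x) = x" for x
    using orthogonal_transformation_surj[OF T] by (rule surj_f_inv_f)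
  have "emeasure lborel B * emeasure lborel (T -` E)
      = (\<integral>\<^sup>+x. indicator B x * emeasure lborel (T -` E) \<partial>lborel)"
    by (subst nn_integral_multc) (auto simp: mult.commute)
  also have "\<dots> = (\<integral>\<^sup>+x. \<integral>\<^sup>+y. indicator B x * indicator E (T y + x) \<partial>lborel \<partial>lborel)"
  proof (rule nn_integral_cong)
    fix x
    have "emeasure lborel (T -` E) = (\<integral>\<^sup>+y. indicator (T -` E) y \<partial>lborel)"
      using measurable_sets[OF Tb E] by simp
    also have "\<dots> = (\<integral>\<^sup>+y. indicator E (T y) \<partial>lborel)" by (simp add: indicator_def)
    \<comment> \<open>Shifting \<open>y\<close> by the preimage of \<open>x\<close> turns a
      translation outside \<open>T\<close> into one inside, where Lebesgue measure does not see
      it.\<close>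
    also have "\<dots> = (\<integral>\<^sup>+y. indicator E (T (y + inv T x)) \<partial>lborel)"
      by (rule nn_integral_lborel_translate[symmetric, where f="\<lambda>y. indicator E (T y)"]) measurable
    also have "\<dots> = (\<integral>\<^sup>+y. indicator E (T y + x) \<partial>lborel)"
      by (simp add: linear_add[OF lin] surj)
    finally show "indicator B x * emeasure lborel (T -` E) = (\<integral>\<^sup>+y. indicator B x * indicator E (T y + x) \<partial>lborel)"
      by (simp add: nn_integral_cmult)
  qed
  also have "\<dots> = (\<integral>\<^sup>+y. \<integral>\<^sup>+x. indicator B x * indicator E (T y + x) \<partial>lborel \<partial>lborel)"
    by (rule lborel_pair.Fubini') measurable
  also have "\<dots> = (\<integral>\<^sup>+y. \<integral>\<^sup>+x. indicator B (x - T y) * indicator E x \<partial>lborel \<partial>lborel)"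
  proof (rule nn_integral_cong)
    fix y
    show "(\<integral>\<^sup>+x. indicator B x * indicator E (T y + x) \<partial>lborel) = (\<integral>\<^sup>+x. indicator B (x - T y) * indicator E x \<partial>lborel)"
      using nn_integral_lborel_translate[of "\<lambda>x. indicator B (x - T y) * indicator E x" "T y"]
      by (simp add: add.commute)
  qed
  also have "\<dots> = (\<integral>\<^sup>+x. \<integral>\<^sup>+y. indicator B (x - T y) * indicator E x \<partial>lborel \<partial>lborel)"
    by (rule lborel_pair.Fubini') measurable
  also have "\<dots> = (\<integral>\<^sup>+x. emeasure lborel B * indicator E x \<partial>lborel)"
  proof (rule nn_integral_cong)
    fix x
    \<comment> \<open>Only here the isometry enters: the ball is the same set before and after
      applying \<open>T\<close>. Its measure is positive and finite, so it can be cancelled at the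
      end.\<close>
    have "indicator B (x - T y) = (indicator B (y + - inv T x) :: ennreal)" for y
    proof -
      have "norm (x - T y) = norm (T (inv T x) - T y)" by (simp add: surj)
      also have "\<dots> = norm (T (inv T x - y))" by (simp add: linear_diff[OF lin])
      also have "\<dots> = norm (y + - inv T x)" by (simp add: n norm_minus_commute)
      finally show ?thesis by (simp add: indicator_def B_iff)
    qed
    then have "(\<integral>\<^sup>+y. indicator B (x - T y) * indicator E x \<partial>lborel) = (\<integral>\<^sup>+y. indicator B (y + - inv T x) * indicator E x \<partial>lborel)"
      by simp
    also have "\<dots> = (\<integral>\<^sup>+y. indicator B y * indicator E x \<partial>lborel)"
      by (rule nn_integral_lborel_translate[where f="\<lambda>y. indicator B y * indicator E x"]) measurable
    also have "\<dots> = emeasure lborel B * indicator E x"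
      by (subst nn_integral_multc) auto
    finally show "(\<integral>\<^sup>+y. indicator B (x - T y) * indicator E x \<partial>lborel) = emeasure lborel B * indicator E x" .
  qed
  also have "\<dots> = emeasure lborel B * emeasure lborel E"
    by (subst nn_integral_cmult) auto
  finally have eq: "emeasure lborel B * emeasure lborel (T -` E) = emeasure lborel B * emeasure lborel E" .
  have fin: "emeasure lborel B < \<infinity>" unfolding B_def by (rule emeasure_lborel_ball_finite)
  moreover have "emeasure lborel B \<noteq> 0"
    using content_ball_pos[of 1 "0::'a"] by (auto simp: measure_def B_def)
  ultimately show ?thesis using eq
    by (auto simp: ennreal_mult_cancel_left)
qed

text \<open>\<open>\<kappa>\<close> is the free normalization of the surface measure. Later formulas
  carry it through the total mass \<open>\<omega>\<close>, by which the Poisson kernel is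
  divided.\<close>

locale sphere_measure =
  fixes \<sigma> :: "(real^'n) measure" and \<kappa> :: real
  assumes card_ge_2: "CARD('n) \<ge> 2" and kappa_pos: "\<kappa> > 0"
    and sigma_def: "\<sigma> = scale_measure (ennreal \<kappa>) surface_measure"
begin

lemma sets_sigma: "sets \<sigma> = sets (restrict_space borel (sphere 0 1))"
  by (simp add: sigma_def surface_measure_def)

lemma space_sigma [simp]: "space \<sigma> = sphere 0 1"
  using sets_eq_imp_space_eq[OF sets_sigma] by (simp add: space_restrict_space)

lemma sets_sigma_iff: "A \<in> sets \<sigma> \<longleftrightarrow> A \<subseteq> sphere 0 1 \<and> A \<in> sets borel"
  by (simp add: sets_sigma sets_restrict_space_iff)

lemma radial_projection_measurable:
  "(\<lambda>x. x /\<^sub>R norm x) \<in> restrict_space lborel (ball 0 1 - {0}) \<rightarrow>\<^sub>M restrict_space borel (sphere (0::real^'n) 1)"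
proof (rule measurable_restrict_space2)
  show "(\<lambda>x. x /\<^sub>R norm x) \<in> space (restrict_space lborel (ball (0::real^'n) 1 - {0})) \<rightarrow> sphere 0 1"
    by (auto simp: space_restrict_space)
  have "(\<lambda>x::real^'n. x /\<^sub>R norm x) \<in> borel_measurable lborel" by measurable
  then show "(\<lambda>x::real^'n. x /\<^sub>R norm x) \<in> borel_measurable (restrict_space lborel (ball 0 1 - {0}))"
    by (rule measurable_restrict_space1)
qed

definition cone :: "(real^'n) set \<Rightarrow> (real^'n) set" where
  "cone A = {x \<in> ball 0 1 - {0}. x /\<^sub>R norm x \<in> A}"

lemma cone_borel: assumes "A \<in> sets \<sigma>" shows "cone A \<in> sets borel"
proof -
  have A: "A \<in> sets borel" using assms by (simp add: sets_sigma_iff)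
  have "(\<lambda>x::real^'n. x /\<^sub>R norm x) -` A \<inter> space borel \<in> sets borel"
    by (rule measurable_sets[OF _ A]) measurable
  moreover have "cone A = ((\<lambda>x::real^'n. x /\<^sub>R norm x) -` A \<inter> space borel) \<inter> (ball 0 1 - {0})"
    by (auto simp: cone_def)
  ultimately show ?thesis by auto
qed

lemma emeasure_sigma:
  assumes "A \<in> sets \<sigma>"
  shows "emeasure \<sigma> A = ennreal \<kappa> * (of_nat CARD('n) * emeasure lborel (cone A))"
proof -
  have A: "A \<in> sets (restrict_space borel (sphere 0 1))" using assms by (simp add: sets_sigma)
  have "emeasure (distr (restrict_space lborel (ball 0 1 - {0})) (restrict_space borel (sphere (0::real^'n) 1))
          (\<lambda>x. x /\<^sub>R norm x)) A = emeasure (restrict_space lborel (ball 0 1 - {0})) ((\<lambda>x. x /\<^sub>R norm x) -` A \<inter> (ball 0 1 - {0}))"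
    by (subst emeasure_distr[OF radial_projection_measurable A]) (simp add: space_restrict_space)
  also have "\<dots> = emeasure lborel ((\<lambda>x. x /\<^sub>R norm x) -` A \<inter> (ball 0 1 - {0}))"
    by (rule emeasure_restrict_space) auto
  also have "(\<lambda>x. x /\<^sub>R norm x) -` A \<inter> (ball 0 1 - {0}) = cone A" by (auto simp: cone_def)
  finally show ?thesis by (simp add: sigma_def surface_measure_def mult.assoc)
qed

lemma emeasure_cone_finite: "emeasure lborel (cone A) < \<infinity>"
proof -
  have "emeasure lborel (cone A) \<le> emeasure lborel (ball (0::real^'n) 1)"
    by (rule emeasure_mono) (auto simp: cone_def)
  also have "\<dots> < \<infinity>" by (rule emeasure_lborel_ball_finite)
  finally show ?thesis .
qed

sublocale finite_measure \<sigma>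
proof
  show "emeasure \<sigma> (space \<sigma>) \<noteq> \<infinity>"
    using emeasure_sigma[OF sets.top] emeasure_cone_finite[of "space \<sigma>"]
    by (auto simp: ennreal_mult_eq_top_iff)
qed

definition \<omega> :: real where "\<omega> = measure \<sigma> (space \<sigma>)"

lemma omega_pos: "\<omega> > 0"
proof -
  have "emeasure lborel (cone (sphere 0 1)) \<noteq> 0"
  proof
    have eq: "cone (sphere 0 1) = ball 0 1 - {0}" by (auto simp: cone_def)
    assume "emeasure lborel (cone (sphere 0 1)) = 0"
    then have "emeasure lborel (ball (0::real^'n) 1 - {0}) = 0" by (simp add: eq)
    then have "emeasure lborel (ball (0::real^'n) 1) = 0"
      by (subst (asm) emeasure_Diff_null_set) auto
    then show False using content_ball_pos[of 1 "0::real^'n"] by (simp add: measure_def)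
  qed
  then have "emeasure \<sigma> (space \<sigma>) \<noteq> 0"
    using emeasure_sigma[OF sets.top] kappa_pos by (auto simp: ennreal_eq_0_iff)
  then show ?thesis by (simp add: \<omega>_def emeasure_eq_measure measure_nonneg less_le)
qed

text \<open>Taking cones commutes with an orthogonal map, so the claim is inherited from Lebesgue
  measure.\<close>

lemma distr_rotation:
  assumes T: "orthogonal_transformation T"
  shows "T \<in> \<sigma> \<rightarrow>\<^sub>M \<sigma>" and "distr \<sigma> \<sigma> T = \<sigma>"
proof -
  have lin: "linear T" using T by (rule orthogonal_transformation_linear)
  have n: "norm (T x) = norm x" for x using T by (rule orthogonal_transformation_norm)
  have Tb: "T \<in> borel_measurable borel"
    by (intro borel_measurable_continuous_onI linear_continuous_on linear_linear[THEN iffD2] lin)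
  have "T \<in> restrict_space borel (sphere 0 1) \<rightarrow>\<^sub>M restrict_space borel (sphere 0 1)"
    by (rule measurable_restrict_space3) (use Tb n in auto)
  then show meas: "T \<in> \<sigma> \<rightarrow>\<^sub>M \<sigma>" using sets_sigma by (metis measurable_cong_sets)
  show "distr \<sigma> \<sigma> T = \<sigma>"
  proof (rule measure_eqI)
    fix A assume "A \<in> sets (distr \<sigma> \<sigma> T)"
    then have A: "A \<in> sets \<sigma>" by simp
    have B: "T -` A \<inter> space \<sigma> \<in> sets \<sigma>" by (rule measurable_sets[OF meas A])
    have eq: "cone (T -` A \<inter> space \<sigma>) = T -` cone A"
      using A n by (auto simp: cone_def linear_cmul[OF lin] sets_sigma_iff)
    have "emeasure lborel (cone A) = emeasure lborel (cone (T -` A \<inter> space \<sigma>))"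
      unfolding eq by (rule emeasure_lborel_orthogonal_vimage[OF T cone_borel[OF A], symmetric])
    then show "emeasure (distr \<sigma> \<sigma> T) A = emeasure \<sigma> A"
      using emeasure_sigma[OF A] emeasure_sigma[OF B] by (simp add: emeasure_distr[OF meas A] del: space_sigma)
  qed simp
qed

lemma continuous_on_sphere_measurable:
  fixes f :: "real^'n \<Rightarrow> 'b::{banach, second_countable_topology}"
  assumes "continuous_on (sphere 0 1) f"
  shows "f \<in> borel_measurable \<sigma>"
proof -
  have "f \<in> borel_measurable (restrict_space borel (sphere 0 1))"
    by (rule borel_measurable_continuous_on_restrict[OF assms])
  then show ?thesis using sets_sigma by (metis measurable_cong_sets)
qed

lemma continuous_on_sphere_integrable:
  fixes f :: "real^'n \<Rightarrow> 'b::{banach, second_countable_topology}"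
  assumes "continuous_on (sphere 0 1) f"
  shows "integrable \<sigma> f"
proof -
  have "bounded (f ` sphere 0 1)"
    by (intro compact_imp_bounded compact_continuous_image assms compact_sphere)
  then obtain B where "\<And>x. x \<in> sphere 0 1 \<Longrightarrow> norm (f x) \<le> B"
    unfolding bounded_iff by blast
  then show ?thesis
    by (intro integrable_const_bound[where B=B] continuous_on_sphere_measurable assms AE_I2) auto
qed

lemma rotation_integral:
  fixes f :: "real^'n \<Rightarrow> 'b::{banach, second_countable_topology}"
  assumes T: "orthogonal_transformation T" and f: "continuous_on (sphere 0 1) f"
  shows "(\<integral>y. f (T y) \<partial>\<sigma>) = (\<integral>y. f y \<partial>\<sigma>)"
  using integral_distr[OF distr_rotation(1)[OF T] continuous_on_sphere_measurable[OF f]]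
  by (simp add: distr_rotation(2)[OF T])

end

section \<open>Harmonic functions and the maximum principle\<close>

text \<open>\<open>partial_deriv\<close> is an iterated Frechet derivative and awkward to compute
  with. This rule and its converse \<open>harmonic_onE\<close> trade it for explicit families
  \<open>D\<close> and \<open>E\<close> of first and second partial derivatives.\<close>

lemma harmonic_onI:
  fixes f :: "real^'n \<Rightarrow> 'b::real_normed_vector"
  assumes S: "open S"
    and D: "\<And>x. x \<in> S \<Longrightarrow> (f has_derivative (\<lambda>h. \<Sum>i\<in>UNIV. h$i *\<^sub>R D i x)) (at x)"
    and E: "\<And>i x. x \<in> S \<Longrightarrow> (D i has_derivative (\<lambda>h. \<Sum>j\<in>UNIV. h$j *\<^sub>R E i j x)) (at x)"
    and cont: "\<And>i j. continuous_on S (E i j)"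
    and lap: "\<And>x. x \<in> S \<Longrightarrow> (\<Sum>i\<in>UNIV. E i i x) = 0"
  shows "harmonic_on f S"
proof -
  have delta: "(\<Sum>j\<in>UNIV. axis i (1::real) $ j *\<^sub>R g j) = g i" for i :: 'n and g :: "'n \<Rightarrow> 'b"
  proof -
    have "(\<Sum>j\<in>UNIV. axis i (1::real) $ j *\<^sub>R g j) = (\<Sum>j\<in>UNIV. if i = j then g j else 0)"
      by (rule sum.cong) (auto simp: axis_def)
    then show ?thesis by simp
  qed
  have p1: "partial_deriv i f x = D i x" if "x \<in> S" for i x
    using frechet_derivative_at[OF D[OF that]] delta[of i "\<lambda>j. D j x"]
    by (simp add: partial_deriv_def fun_eq_iff)
  have p1d: "(partial_deriv i f has_derivative (\<lambda>h. \<Sum>j\<in>UNIV. h$j *\<^sub>R E i j x)) (at x)" if "x \<in> S" for i x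
    by (rule has_derivative_transform_within_open[OF E[OF that] S that]) (simp add: p1)
  have p2: "partial_deriv j (partial_deriv i f) x = E i j x" if "x \<in> S" for i j x
    using frechet_derivative_at[OF p1d[OF that]] delta[of j "\<lambda>j. E i j x"]
    by (simp add: partial_deriv_def fun_eq_iff)
  show ?thesis unfolding harmonic_on_def
  proof (intro conjI allI ballI)
    show "f differentiable_on S" using D S
      by (meson differentiable_at_imp_differentiable_on differentiableI)
    show "partial_deriv i f differentiable_on S" for i using p1d S
      by (meson differentiable_at_imp_differentiable_on differentiableI)
    show "continuous_on S (partial_deriv j (partial_deriv i f))" for i j
      using cont[of i j] p2 by (simp cong: continuous_on_cong)
    show "(\<Sum>i\<in>UNIV. partial_deriv i (partial_deriv i f) x) = 0" if "x \<in> S" for x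
      using lap[OF that] p2[OF that] by simp
  qed
qed

lemma has_derivative_partials:
  fixes f :: "real^'n \<Rightarrow> 'b::real_normed_vector"
  assumes "f differentiable (at x)"
  shows "(f has_derivative (\<lambda>h. \<Sum>i\<in>UNIV. h$i *\<^sub>R partial_deriv i f x)) (at x)"
proof -
  let ?F = "frechet_derivative f (at x)"
  have d: "(f has_derivative ?F) (at x)" using assms by (simp add: frechet_derivative_works)
  then have lin: "linear ?F" by (rule has_derivative_linear)
  have "?F h = (\<Sum>i\<in>UNIV. h$i *\<^sub>R partial_deriv i f x)" for h
  proof -
    have "h = (\<Sum>i\<in>UNIV. h$i *\<^sub>R axis i 1)"
      using basis_expansion[of h] by (simp add: scalar_mult_eq_scaleR)
    then have "?F h = ?F (\<Sum>i\<in>UNIV. h$i *\<^sub>R axis i 1)" by simp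
    then show ?thesis by (simp add: linear_sum[OF lin] linear_cmul[OF lin] partial_deriv_def)
  qed
  then have "?F = (\<lambda>h. \<Sum>i\<in>UNIV. h$i *\<^sub>R partial_deriv i f x)" by auto
  with d show ?thesis by simp
qed

lemma harmonic_onE:
  fixes f :: "real^'n \<Rightarrow> 'b::real_normed_vector"
  assumes S: "open S" and f: "harmonic_on f S"
  obtains D E where
    "\<And>x. x \<in> S \<Longrightarrow> (f has_derivative (\<lambda>h. \<Sum>i\<in>UNIV. h$i *\<^sub>R D i x)) (at x)"
    "\<And>i x. x \<in> S \<Longrightarrow> (D i has_derivative (\<lambda>h. \<Sum>j\<in>UNIV. h$j *\<^sub>R E i j x)) (at x)"
    "\<And>i j. continuous_on S (E i j)"
    "\<And>x. x \<in> S \<Longrightarrow> (\<Sum>i\<in>UNIV. E i i x) = 0"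
proof
  let ?D = "\<lambda>i. partial_deriv i f" and ?E = "\<lambda>i j. partial_deriv j (partial_deriv i f)"
  show "(f has_derivative (\<lambda>h. \<Sum>i\<in>UNIV. h$i *\<^sub>R ?D i x)) (at x)" if "x \<in> S" for x
    using f S that by (intro has_derivative_partials) (auto simp: harmonic_on_def differentiable_on_eq_differentiable_at)
  show "(?D i has_derivative (\<lambda>h. \<Sum>j\<in>UNIV. h$j *\<^sub>R ?E i j x)) (at x)" if "x \<in> S" for x i
    using f S that by (intro has_derivative_partials) (auto simp: harmonic_on_def differentiable_on_eq_differentiable_at)
  show "continuous_on S (?E i j)" for i j using f by (simp add: harmonic_on_def)
  show "(\<Sum>i\<in>UNIV. ?E i i x) = 0" if "x \<in> S" for x using f that by (simp add: harmonic_on_def)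
qed

lemma harmonic_on_imp_continuous_on:
  "harmonic_on f S \<Longrightarrow> continuous_on S f"
  by (simp add: harmonic_on_def differentiable_imp_continuous_on)

lemma harmonic_on_subset:
  assumes "harmonic_on f T" "S \<subseteq> T"
  shows "harmonic_on f S"
  using assms unfolding harmonic_on_def
  by (meson continuous_on_subset differentiable_on_subset subsetD)

lemma harmonic_on_cong:
  assumes S: "open S" and f: "harmonic_on f S" and eq: "\<And>x. x \<in> S \<Longrightarrow> f x = g x"
  shows "harmonic_on g S"
proof -
  obtain D E where *:
    "\<And>x. x \<in> S \<Longrightarrow> (f has_derivative (\<lambda>h. \<Sum>i\<in>UNIV. h$i *\<^sub>R D i x)) (at x)"
    "\<And>i x. x \<in> S \<Longrightarrow> (D i has_derivative (\<lambda>h. \<Sum>j\<in>UNIV. h$j *\<^sub>R E i j x)) (at x)"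
    "\<And>i j. continuous_on S (E i j)"
    "\<And>x. x \<in> S \<Longrightarrow> (\<Sum>i\<in>UNIV. E i i x) = 0" by (rule harmonic_onE[OF S f]) (rule that)
  show ?thesis
    by (rule harmonic_onI[OF S _ *(2,3,4)], rule has_derivative_transform_within_open[OF *(1) S])
      (auto simp: eq)
qed

lemma harmonic_on_bounded_linear:
  assumes S: "open S" and f: "harmonic_on f S" and L: "bounded_linear L"
  shows "harmonic_on (\<lambda>x. L (f x)) S"
proof -
  interpret L: bounded_linear L by (rule L)
  obtain D E where *:
    "\<And>x. x \<in> S \<Longrightarrow> (f has_derivative (\<lambda>h. \<Sum>i\<in>UNIV. h$i *\<^sub>R D i x)) (at x)"
    "\<And>i x. x \<in> S \<Longrightarrow> (D i has_derivative (\<lambda>h. \<Sum>j\<in>UNIV. h$j *\<^sub>R E i j x)) (at x)"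
    "\<And>i j. continuous_on S (E i j)"
    "\<And>x. x \<in> S \<Longrightarrow> (\<Sum>i\<in>UNIV. E i i x) = 0" by (rule harmonic_onE[OF S f]) (rule that)
  show ?thesis
  proof (rule harmonic_onI[OF S, where D="\<lambda>i x. L (D i x)" and E="\<lambda>i j x. L (E i j x)"])
    show "((\<lambda>x. L (f x)) has_derivative (\<lambda>h. \<Sum>i\<in>UNIV. h$i *\<^sub>R L (D i x))) (at x)" if "x \<in> S" for x
      using L.has_derivative[OF *(1)[OF that]] by (simp add: L.sum L.scaleR)
    show "((\<lambda>x. L (D i x)) has_derivative (\<lambda>h. \<Sum>j\<in>UNIV. h$j *\<^sub>R L (E i j x))) (at x)" if "x \<in> S" for x i
      using L.has_derivative[OF *(2)[OF that]] by (simp add: L.sum L.scaleR)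
    show "continuous_on S (\<lambda>x. L (E i j x))" for i j by (rule L.continuous_on[OF *(3)])
    show "(\<Sum>i\<in>UNIV. L (E i i x)) = 0" if "x \<in> S" for x
      using *(4)[OF that] by (simp flip: L.sum)
  qed
qed

lemma harmonic_on_diff:
  assumes S: "open S" and f: "harmonic_on f S" and g: "harmonic_on g S"
  shows "harmonic_on (\<lambda>x. f x - g x) S"
proof -
  obtain D E where *:
    "\<And>x. x \<in> S \<Longrightarrow> (f has_derivative (\<lambda>h. \<Sum>i\<in>UNIV. h$i *\<^sub>R D i x)) (at x)"
    "\<And>i x. x \<in> S \<Longrightarrow> (D i has_derivative (\<lambda>h. \<Sum>j\<in>UNIV. h$j *\<^sub>R E i j x)) (at x)"
    "\<And>i j. continuous_on S (E i j)"
    "\<And>x. x \<in> S \<Longrightarrow> (\<Sum>i\<in>UNIV. E i i x) = 0" by (rule harmonic_onE[OF S f]) (rule that)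
  obtain D' E' where **:
    "\<And>x. x \<in> S \<Longrightarrow> (g has_derivative (\<lambda>h. \<Sum>i\<in>UNIV. h$i *\<^sub>R D' i x)) (at x)"
    "\<And>i x. x \<in> S \<Longrightarrow> (D' i has_derivative (\<lambda>h. \<Sum>j\<in>UNIV. h$j *\<^sub>R E' i j x)) (at x)"
    "\<And>i j. continuous_on S (E' i j)"
    "\<And>x. x \<in> S \<Longrightarrow> (\<Sum>i\<in>UNIV. E' i i x) = 0" by (rule harmonic_onE[OF S g]) (rule that)
  show ?thesis
  proof (rule harmonic_onI[OF S, where D="\<lambda>i x. D i x - D' i x" and E="\<lambda>i j x. E i j x - E' i j x"])
    show "((\<lambda>x. f x - g x) has_derivative (\<lambda>h. \<Sum>i\<in>UNIV. h$i *\<^sub>R (D i x - D' i x))) (at x)" if "x \<in> S" for x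
      using has_derivative_diff[OF *(1)[OF that] **(1)[OF that]] by (simp add: scaleR_diff_right sum_subtractf)
    show "((\<lambda>x. D i x - D' i x) has_derivative (\<lambda>h. \<Sum>j\<in>UNIV. h$j *\<^sub>R (E i j x - E' i j x))) (at x)" if "x \<in> S" for x i
      using has_derivative_diff[OF *(2)[OF that] **(2)[OF that]] by (simp add: scaleR_diff_right sum_subtractf)
    show "continuous_on S (\<lambda>x. E i j x - E' i j x)" for i j by (intro continuous_on_diff *(3) **(3))
    show "(\<Sum>i\<in>UNIV. (E i i x - E' i i x)) = 0" if "x \<in> S" for x
      using *(4)[OF that] **(4)[OF that] by (simp add: sum_subtractf)
  qed
qed

lemma harmonic_on_dilation:
  fixes f :: "real^'n \<Rightarrow> 'b::real_normed_vector"
  assumes S: "open S" and f: "harmonic_on f S" and T: "open T" and sub: "\<And>x. x \<in> T \<Longrightarrow> R *\<^sub>R x \<in> S"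
  shows "harmonic_on (\<lambda>x. f (R *\<^sub>R x)) T"
proof -
  obtain D E where *:
    "\<And>x. x \<in> S \<Longrightarrow> (f has_derivative (\<lambda>h. \<Sum>i\<in>UNIV. h$i *\<^sub>R D i x)) (at x)"
    "\<And>i x. x \<in> S \<Longrightarrow> (D i has_derivative (\<lambda>h. \<Sum>j\<in>UNIV. h$j *\<^sub>R E i j x)) (at x)"
    "\<And>i j. continuous_on S (E i j)"
    "\<And>x. x \<in> S \<Longrightarrow> (\<Sum>i\<in>UNIV. E i i x) = 0" by (rule harmonic_onE[OF S f]) (rule that)
  have R: "((\<lambda>x. R *\<^sub>R x) has_derivative (\<lambda>h. R *\<^sub>R h)) (at x)" for x :: "real^'n"
    by (auto intro!: derivative_eq_intros)
  show ?thesis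
  proof (rule harmonic_onI[OF T, where D="\<lambda>i x. R *\<^sub>R D i (R *\<^sub>R x)" and E="\<lambda>i j x. R *\<^sub>R R *\<^sub>R E i j (R *\<^sub>R x)"])
    show "((\<lambda>x. f (R *\<^sub>R x)) has_derivative (\<lambda>h. \<Sum>i\<in>UNIV. h$i *\<^sub>R R *\<^sub>R D i (R *\<^sub>R x))) (at x)" if "x \<in> T" for x
      using has_derivative_compose[OF R *(1)[OF sub[OF that]]] by (simp add: mult.commute)
    show "((\<lambda>x. R *\<^sub>R D i (R *\<^sub>R x)) has_derivative (\<lambda>h. \<Sum>j\<in>UNIV. h$j *\<^sub>R R *\<^sub>R R *\<^sub>R E i j (R *\<^sub>R x))) (at x)" if "x \<in> T" for x i
      using has_derivative_scaleR_right[OF has_derivative_compose[OF R *(2)[OF sub[OF that]]], of R i]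
      by (simp add: scaleR_sum_right mult_ac)
    show "continuous_on T (\<lambda>x. R *\<^sub>R R *\<^sub>R E i j (R *\<^sub>R x))" for i j
      by (intro continuous_intros continuous_on_compose2[OF *(3)]) (use sub in auto)
    show "(\<Sum>i\<in>UNIV. R *\<^sub>R R *\<^sub>R E i i (R *\<^sub>R x)) = 0" if "x \<in> T" for x
      using *(4)[OF sub[OF that]] by (simp flip: scaleR_sum_right)
  qed
qed

text \<open>At the maximum \<phi>' vanishes, so c > 0 would make \<phi>' positive just to the right
  of 0, and the mean value theorem would push \<phi> above its maximum.\<close>

lemma second_derivative_test_max:
  fixes \<phi> \<phi>' :: "real \<Rightarrow> real"
  assumes "d > 0" and \<phi>: "\<And>t. \<bar>t\<bar> < d \<Longrightarrow> (\<phi> has_real_derivative \<phi>' t) (at t)"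
    and \<phi>': "(\<phi>' has_real_derivative c) (at 0)"
    and max: "\<And>t. \<bar>t\<bar> < d \<Longrightarrow> \<phi> t \<le> \<phi> 0"
  shows "c \<le> 0"
proof (rule ccontr)
  assume "\<not> c \<le> 0"
  then have c: "c > 0" by simp
  have 0: "\<phi>' 0 = 0"
    by (rule DERIV_local_max[OF \<phi>, of 0 d]) (use assms in auto)
  obtain e where e: "e > 0" "\<And>h. h > 0 \<Longrightarrow> h < e \<Longrightarrow> \<phi>' 0 < \<phi>' (0 + h)"
    using DERIV_pos_inc_right[OF \<phi>' c] by auto
  define b where "b = min d e / 2"
  have b: "b > 0" "b < d" "b < e" using \<open>d > 0\<close> e(1) by (auto simp: b_def)
  have "\<phi> 0 < \<phi> b"
  proof -
    have "\<exists>z. 0 < z \<and> z < b \<and> \<phi> b - \<phi> 0 = (b - 0) * \<phi>' z"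
      by (rule MVT2) (use b \<phi> in auto)
    then obtain z where z: "0 < z" "z < b" "\<phi> b - \<phi> 0 = (b - 0) * \<phi>' z" by blast
    have "\<phi>' z > 0" using e(2)[of z] z b 0 by simp
    then show ?thesis using z b by (smt (verit) mult_pos_pos)
  qed
  then show False using max[of b] b by simp
qed

text \<open>Adding a small multiple of |x|^2 makes the Laplacian strictly positive. The sum of two
  functions then attains its maximum in the interior, where every second partial derivative would
  have to be nonpositive.\<close>

lemma harmonic_max_principle:
  fixes w :: "real^'n \<Rightarrow> real"
  assumes w: "harmonic_on w (ball 0 R)" and cont: "continuous_on (cball 0 R) w"
    and M: "\<And>x. norm x = R \<Longrightarrow> w x \<le> M" and x0: "norm x0 \<le> R"
  shows "w x0 \<le> M"
proof (rule ccontr)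
  assume "\<not> w x0 \<le> M"
  then have gt: "w x0 > M" by simp
  then have R: "R > 0" using M[of x0] x0 norm_ge_zero[of x0] by (cases "norm x0 = R") linarith+
  \<comment> \<open>On the sphere of radius R the perturbation costs \<epsilon> R^2, half of the
    excess of \<open>w x0\<close> over M, so the maximum stays off the boundary.\<close>
  define \<epsilon> where "\<epsilon> = (w x0 - M) / (2 * R\<^sup>2)"
  have eps: "\<epsilon> > 0" and epsR: "\<epsilon> * R\<^sup>2 < w x0 - M"
    using gt R by (auto simp: \<epsilon>_def field_simps)
  define v where "v = (\<lambda>x. w x + \<epsilon> * (x \<bullet> x))"
  have "continuous_on (cball 0 R) v" unfolding v_def by (intro continuous_intros cont)
  then obtain z where z: "z \<in> cball 0 R" and zmax: "\<And>x. x \<in> cball 0 R \<Longrightarrow> v x \<le> v z"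
    using continuous_attains_sup[of "cball 0 R" v] R by force
  have "w x0 \<le> v x0" using eps by (simp add: v_def)
  also have "\<dots> \<le> v z" using zmax x0 by simp
  finally have vz: "w x0 \<le> v z" .
  have "norm z \<noteq> R"
  proof
    assume "norm z = R"
    then have "v z \<le> M + \<epsilon> * R\<^sup>2" using M[of z] by (simp add: v_def power2_norm_eq_inner[symmetric])
    then show False using vz epsR by simp
  qed
  then have zR: "norm z < R" using z by simp
  obtain D E where *:
    "\<And>x. x \<in> ball 0 R \<Longrightarrow> (w has_derivative (\<lambda>h. \<Sum>i\<in>UNIV. h$i *\<^sub>R D i x)) (at x)"
    "\<And>i x. x \<in> ball 0 R \<Longrightarrow> (D i has_derivative (\<lambda>h. \<Sum>j\<in>UNIV. h$j *\<^sub>R E i j x)) (at x)"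
    "\<And>i j. continuous_on (ball 0 R) (E i j)"
    "\<And>x. x \<in> ball 0 R \<Longrightarrow> (\<Sum>i\<in>UNIV. E i i x) = 0" by (rule harmonic_onE[OF open_ball w]) (rule that)
  have "E i i z + 2 * \<epsilon> \<le> 0" for i
  proof -
    let ?l = "\<lambda>t. z + t *\<^sub>R axis i (1::real)"
    have delta: "(\<Sum>j\<in>UNIV. h * axis i (1::real) $ j * g j) = h * g i" for h and g :: "'n \<Rightarrow> real"
    proof -
      have "(\<Sum>j\<in>UNIV. h * axis i (1::real) $ j * g j) = (\<Sum>j\<in>UNIV. if i = j then h * g j else 0)"
        by (rule sum.cong) (auto simp: axis_def)
      then show ?thesis by simp
    qed
    have lb: "?l t \<in> ball 0 R" if "\<bar>t\<bar> < R - norm z" for t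
      using norm_triangle_ineq[of z "t *\<^sub>R axis i (1::real)"] that by simp
    have dl: "(?l has_derivative (\<lambda>h. h *\<^sub>R axis i 1)) (at t)" for t
      by (auto intro!: derivative_eq_intros)
    show ?thesis
    proof (rule second_derivative_test_max[where d="R - norm z" and \<phi>="\<lambda>t. v (?l t)" and \<phi>'="\<lambda>t. D i (?l t) + \<epsilon> * (2 * (z$i + t))"])
      show "R - norm z > 0" using zR by simp
      show "((\<lambda>t. v (?l t)) has_real_derivative (D i (?l t) + \<epsilon> * (2 * (z$i + t)))) (at t)" if "\<bar>t\<bar> < R - norm z" for t
      proof -
        have "((\<lambda>t. w (?l t)) has_derivative (\<lambda>h. h * D i (?l t))) (at t)"
          using has_derivative_compose[OF dl *(1)[OF lb[OF that]]] by (simp add: delta)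
        then have "((\<lambda>t. w (?l t)) has_real_derivative D i (?l t)) (at t)"
          by (simp add: has_field_derivative_def mult.commute[of _ "D i (?l t)"] mult_commute_abs)
        moreover have "(?l t \<bullet> ?l t) = z \<bullet> z + 2 * t * z$i + t\<^sup>2" for t
          by (simp add: inner_add_left inner_add_right inner_axis inner_axis' power2_eq_square inner_commute)
        ultimately show ?thesis unfolding v_def
          by (simp only:) (auto intro!: derivative_eq_intros)
      qed
      show "((\<lambda>t. D i (?l t) + \<epsilon> * (2 * (z$i + t))) has_real_derivative (E i i z + 2 * \<epsilon>)) (at 0)"
      proof -
        have "((\<lambda>t. D i (?l t)) has_derivative (\<lambda>h. h * E i i z)) (at 0)"
          using has_derivative_compose[OF dl[of 0] *(2)[of "?l 0" i]] zR by (simp add: delta)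
        then have "((\<lambda>t. D i (?l t)) has_real_derivative E i i z) (at 0)"
          by (simp add: has_field_derivative_def mult_commute_abs)
        then show ?thesis by (auto intro!: derivative_eq_intros)
      qed
      show "v (?l t) \<le> v (?l 0)" if "\<bar>t\<bar> < R - norm z" for t
        using zmax[of "?l t"] lb[OF that] by simp
    qed
  qed
  then have "(\<Sum>i\<in>UNIV. E i i z + 2 * \<epsilon>) \<le> 0" by (simp add: sum_nonpos)
  moreover have "(\<Sum>i\<in>UNIV. E i i z + 2 * \<epsilon>) = 2 * \<epsilon> * CARD('n)"
    using *(4)[of z] zR by (simp add: sum.distrib)
  ultimately show False using eps by (simp add: mult_le_0_iff)
qed

section \<open>Continuity and differentiation under the integral over the sphere\<close>

context sphere_measure
begin

lemma integral_sphere_norm_le: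
  fixes f :: "real^'n \<Rightarrow> 'b::{banach, second_countable_topology}"
  assumes "continuous_on (sphere 0 1) f" and "\<And>y. norm y = 1 \<Longrightarrow> norm (f y) \<le> B"
  shows "norm (\<integral>y. f y \<partial>\<sigma>) \<le> \<omega> * B"
proof -
  have "norm (\<integral>y. f y \<partial>\<sigma>) \<le> (\<integral>y. norm (f y) \<partial>\<sigma>)" by (rule integral_norm_bound)
  also have "\<dots> \<le> (\<integral>y. B \<partial>\<sigma>)"
    by (rule integral_mono) (auto intro!: continuous_on_sphere_integrable continuous_intros assms)
  finally show ?thesis by (simp add: \<omega>_def)
qed

lemma continuous_on_slice:
  assumes "continuous_on (S \<times> T) (\<lambda>(x, y). k x y)" and "x \<in> S"
  shows "continuous_on T (k x)"
  by (rule continuous_on_compose2[OF assms(1), where f="\<lambda>y. (x, y)", simplified])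
    (use assms(2) in \<open>auto intro!: continuous_intros\<close>)

text \<open>Uniform continuity on the compact set \<open>cball x0 r \<times> sphere 0 1\<close>
  makes \<open>d\<close> independent of \<open>y\<close>; this uniformity is what carries limits
  through the integral.\<close>

lemma uniform_near_point:
  fixes k :: "real^'n \<Rightarrow> real^'n \<Rightarrow> 'b::real_normed_vector"
  assumes S: "open S" and k: "continuous_on (S \<times> sphere 0 1) (\<lambda>(x, y). k x y)"
    and x0: "x0 \<in> S" and e: "e > 0"
  obtains d where "d > 0" "ball x0 d \<subseteq> S" "\<And>x y. dist x x0 < d \<Longrightarrow> norm y = 1 \<Longrightarrow> norm (k x y - k x0 y) < e"
proof -
  obtain r where r: "r > 0" "cball x0 r \<subseteq> S" using S x0 open_contains_cball by blast
  have "uniformly_continuous_on (cball x0 r \<times> sphere 0 1) (\<lambda>(x, y). k x y)"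
    by (rule compact_uniformly_continuous) (use r k in \<open>auto intro!: compact_Times elim!: continuous_on_subset\<close>)
  then obtain d where d: "d > 0" "\<And>p p'. p \<in> cball x0 r \<times> sphere 0 1 \<Longrightarrow> p' \<in> cball x0 r \<times> sphere 0 1 \<Longrightarrow>
      dist p' p < d \<Longrightarrow> dist ((\<lambda>(x, y). k x y) p') ((\<lambda>(x, y). k x y) p) < e"
    unfolding uniformly_continuous_on_def using e by metis
  show ?thesis
  proof
    show "min d r > 0" using d r by simp
    show "ball x0 (min d r) \<subseteq> S" using r by (auto simp: subset_iff)
    show "norm (k x y - k x0 y) < e" if "dist x x0 < min d r" "norm y = 1" for x y
      using d(2)[of "(x0, y)" "(x, y)"] that r by (simp add: dist_norm dist_Pair_Pair norm_minus_commute)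
  qed
qed

lemma continuous_on_integral_sphere:
  fixes k :: "real^'n \<Rightarrow> real^'n \<Rightarrow> 'b::{banach, second_countable_topology}"
  assumes S: "open S" and k: "continuous_on (S \<times> sphere 0 1) (\<lambda>(x, y). k x y)"
  shows "continuous_on S (\<lambda>x. \<integral>y. k x y \<partial>\<sigma>)"
proof (rule continuous_at_imp_continuous_on, rule ballI)
  fix x0 assume x0: "x0 \<in> S"
  show "isCont (\<lambda>x. \<integral>y. k x y \<partial>\<sigma>) x0"
    unfolding continuous_at_eps_delta
  proof (intro allI impI)
    fix e :: real assume e: "e > 0"
    then have e': "e / (2 * \<omega>) > 0" using omega_pos by simp
    obtain d where d: "d > 0" "ball x0 d \<subseteq> S" "\<And>x y. dist x x0 < d \<Longrightarrow> norm y = 1 \<Longrightarrow> norm (k x y - k x0 y) < e / (2 * \<omega>)"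
      by (rule uniform_near_point[OF S k x0 e']) (rule that)
    have "dist (\<integral>y. k x y \<partial>\<sigma>) (\<integral>y. k x0 y \<partial>\<sigma>) < e" if "dist x x0 < d" for x
    proof -
      have x: "x \<in> S" using d(2) that by (auto simp: dist_commute)
      have "(\<integral>y. k x y \<partial>\<sigma>) - (\<integral>y. k x0 y \<partial>\<sigma>) = (\<integral>y. k x y - k x0 y \<partial>\<sigma>)"
        by (rule Bochner_Integration.integral_diff[symmetric])
          (auto intro!: continuous_on_sphere_integrable continuous_on_slice[OF k] x x0)
      also have "norm \<dots> \<le> \<omega> * (e / (2 * \<omega>))"
        by (rule integral_sphere_norm_le) (auto intro!: continuous_intros continuous_on_slice[OF k] x x0 less_imp_le[OF d(3)] that)
      also have "\<dots> < e" using omega_pos e by simp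
      finally show ?thesis by (simp add: dist_norm)
    qed
    then show "\<exists>d>0. \<forall>x'. dist x' x0 < d \<longrightarrow> dist (\<integral>y. k x' y \<partial>\<sigma>) (\<integral>y. k x0 y \<partial>\<sigma>) < e" using d(1) by blast
  qed
qed

text \<open>The mean value inequality bounds the linearization error of \<open>k x y\<close> by a
  small multiple of |x - x0| uniformly in \<open>y\<close>; integrating over a sphere of mass
  \<open>\<omega>\<close> gives the claim.\<close>

lemma has_derivative_integral_sphere:
  fixes k :: "real^'n \<Rightarrow> real^'n \<Rightarrow> 'b::{banach, second_countable_topology}"
  assumes S: "open S" and k: "continuous_on (S \<times> sphere 0 1) (\<lambda>(x, y). k x y)"
    and deriv: "\<And>x y. x \<in> S \<Longrightarrow> norm y = 1 \<Longrightarrow> ((\<lambda>x. k x y) has_derivative (\<lambda>h. \<Sum>i\<in>UNIV. h$i *\<^sub>R d i x y)) (at x)"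
    and d: "\<And>i. continuous_on (S \<times> sphere 0 1) (\<lambda>(x, y). d i x y)" and x0: "x0 \<in> S"
  shows "((\<lambda>x. \<integral>y. k x y \<partial>\<sigma>) has_derivative (\<lambda>h. \<Sum>i\<in>UNIV. h$i *\<^sub>R (\<integral>y. d i x0 y \<partial>\<sigma>))) (at x0)"
  unfolding has_derivative_at_alt
proof (intro conjI allI impI)
  show "bounded_linear (\<lambda>h. \<Sum>i\<in>UNIV. h$i *\<^sub>R (\<integral>y. d i x0 y \<partial>\<sigma>))"
    by (intro bounded_linear_sum bounded_linear_scaleR_const bounded_linear_vec_nth)
  fix e :: real assume e: "e > 0"
  define e' where "e' = e / \<omega>"
  have e': "e' > 0" using e omega_pos by (simp add: e'_def)
  \<comment> \<open>This sum dominates the operator norm of the difference of the two derivatives.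
    It vanishes at \<open>x0\<close>, so closeness to its value there is smallness.\<close>
  let ?g = "\<lambda>x y. \<Sum>i\<in>UNIV. norm (d i x y - d i x0 y)"
  have g: "continuous_on (S \<times> sphere 0 1) (\<lambda>(x, y). ?g x y)"
  proof -
    have 1: "continuous_on (S \<times> sphere 0 1) (\<lambda>p. d i (fst p) (snd p))" for i
      using d[of i] by (simp add: split_beta)
    have 2: "continuous_on (S \<times> sphere 0 1) (\<lambda>p. d i x0 (snd p))" for i
      by (rule continuous_on_compose2[OF continuous_on_slice[OF d[of i] x0] continuous_on_snd[OF continuous_on_id]]) auto
    show ?thesis unfolding split_beta
      by (intro continuous_on_sum continuous_on_norm continuous_on_diff 1 2)
  qed
  obtain \<delta> where \<delta>: "\<delta> > 0" "ball x0 \<delta> \<subseteq> S" "\<And>x y. dist x x0 < \<delta> \<Longrightarrow> norm y = 1 \<Longrightarrow> norm (?g x y - ?g x0 y) < e'"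
    by (rule uniform_near_point[OF S g x0 e']) (rule that)
  have "norm ((\<integral>y. k x y \<partial>\<sigma>) - (\<integral>y. k x0 y \<partial>\<sigma>) - (\<Sum>i\<in>UNIV. (x - x0)$i *\<^sub>R (\<integral>y. d i x0 y \<partial>\<sigma>))) \<le> e * norm (x - x0)"
    if "norm (x - x0) < \<delta>" for x
  proof -
    have xb: "x \<in> ball x0 \<delta>" using that by (simp add: dist_norm norm_minus_commute)
    then have x: "x \<in> S" using \<delta>(2) by auto
    have ptw: "norm (k x y - k x0 y - (\<Sum>i\<in>UNIV. (x - x0)$i *\<^sub>R d i x0 y)) \<le> norm (x - x0) * e'" if y: "norm y = 1" for y
    proof (rule differentiable_bound_linearization[where S="ball x0 \<delta>" and f'="\<lambda>x h. \<Sum>i\<in>UNIV. h$i *\<^sub>R d i x y"])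
      show "x0 + t *\<^sub>R (x - x0) \<in> ball x0 \<delta>" if "t \<in> {0..1}" for t
      proof -
        have "norm (t *\<^sub>R (x - x0)) \<le> norm (x - x0)" using that by (simp add: mult_left_le_one_le)
        then show ?thesis using \<open>norm (x - x0) < \<delta>\<close> by (simp add: dist_norm)
      qed
      show "((\<lambda>x. k x y) has_derivative (\<lambda>h. \<Sum>i\<in>UNIV. h$i *\<^sub>R d i x y)) (at x within ball x0 \<delta>)" if "x \<in> ball x0 \<delta>" for x
        using deriv[OF _ y] \<delta>(2) that has_derivative_at_withinI by blast
      show "onorm ((\<lambda>h. \<Sum>i\<in>UNIV. h$i *\<^sub>R d i x y) - (\<lambda>h. \<Sum>i\<in>UNIV. h$i *\<^sub>R d i x0 y)) \<le> e'" if "x \<in> ball x0 \<delta>" for x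
      proof (rule onorm_bound)
        have "?g x y < e'" using \<delta>(3)[of x y] that y by (simp add: dist_commute)
        then have g: "?g x y \<le> e'" by simp
        fix h :: "real^'n"
        have "norm (((\<lambda>h. \<Sum>i\<in>UNIV. h$i *\<^sub>R d i x y) - (\<lambda>h. \<Sum>i\<in>UNIV. h$i *\<^sub>R d i x0 y)) h)
           = norm (\<Sum>i\<in>UNIV. h$i *\<^sub>R (d i x y - d i x0 y))" by (simp add: scaleR_diff_right sum_subtractf)
        also have "\<dots> \<le> (\<Sum>i\<in>UNIV. norm h * norm (d i x y - d i x0 y))"
          by (rule sum_norm_le) (simp add: mult_right_mono component_le_norm_cart)
        also have "\<dots> = ?g x y * norm h" by (simp add: sum_distrib_left mult.commute)
        also have "\<dots> \<le> e' * norm h" using g by (rule mult_right_mono) simp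
        finally show "norm (((\<lambda>h. \<Sum>i\<in>UNIV. h$i *\<^sub>R d i x y) - (\<lambda>h. \<Sum>i\<in>UNIV. h$i *\<^sub>R d i x0 y)) h) \<le> e' * norm h" .
      qed (use e' in simp)
      show "x0 \<in> ball x0 \<delta>" using \<delta>(1) by simp
    qed
    have ki: "integrable \<sigma> (k x)" "integrable \<sigma> (k x0)" "integrable \<sigma> (d i x0)" for i
      by (auto intro!: continuous_on_sphere_integrable continuous_on_slice[OF k] continuous_on_slice[OF d] x x0)
    have "(\<integral>y. k x y \<partial>\<sigma>) - (\<integral>y. k x0 y \<partial>\<sigma>) - (\<Sum>i\<in>UNIV. (x - x0)$i *\<^sub>R (\<integral>y. d i x0 y \<partial>\<sigma>))
        = (\<integral>y. k x y - k x0 y - (\<Sum>i\<in>UNIV. (x - x0)$i *\<^sub>R d i x0 y) \<partial>\<sigma>)"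
      using ki by (simp add: Bochner_Integration.integral_diff integrable_scaleR_right
          Bochner_Integration.integrable_sum Bochner_Integration.integral_sum)
    also have "norm \<dots> \<le> \<omega> * (norm (x - x0) * e')"
      by (rule integral_sphere_norm_le[OF _ ptw])
        (auto intro!: continuous_intros continuous_on_slice[OF k] continuous_on_slice[OF d] x x0)
    also have "\<dots> = e * norm (x - x0)" using omega_pos by (simp add: e'_def)
    finally show ?thesis .
  qed
  then show "\<exists>d'>0. \<forall>y. norm (y - x0) < d' \<longrightarrow>
      norm ((\<integral>y'. k y y' \<partial>\<sigma>) - (\<integral>y. k x0 y \<partial>\<sigma>) - (\<Sum>i\<in>UNIV. (y - x0)$i *\<^sub>R (\<integral>y. d i x0 y \<partial>\<sigma>))) \<le> e * norm (y - x0)"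
    using \<delta>(1) by blast
qed

lemma harmonic_on_integral_sphere:
  fixes k :: "real^'n \<Rightarrow> real^'n \<Rightarrow> 'b::{banach, second_countable_topology}"
  assumes S: "open S" and k: "continuous_on (S \<times> sphere 0 1) (\<lambda>(x, y). k x y)"
    and D: "\<And>x y. x \<in> S \<Longrightarrow> norm y = 1 \<Longrightarrow> ((\<lambda>x. k x y) has_derivative (\<lambda>h. \<Sum>i\<in>UNIV. h$i *\<^sub>R D i x y)) (at x)"
    and E: "\<And>i x y. x \<in> S \<Longrightarrow> norm y = 1 \<Longrightarrow> ((\<lambda>x. D i x y) has_derivative (\<lambda>h. \<Sum>j\<in>UNIV. h$j *\<^sub>R E i j x y)) (at x)"
    and Dc: "\<And>i. continuous_on (S \<times> sphere 0 1) (\<lambda>(x, y). D i x y)"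
    and Ec: "\<And>i j. continuous_on (S \<times> sphere 0 1) (\<lambda>(x, y). E i j x y)"
    and lap: "\<And>x y. x \<in> S \<Longrightarrow> norm y = 1 \<Longrightarrow> (\<Sum>i\<in>UNIV. E i i x y) = 0"
  shows "harmonic_on (\<lambda>x. \<integral>y. k x y \<partial>\<sigma>) S"
proof (rule harmonic_onI[OF S])
  show "((\<lambda>x. \<integral>y. k x y \<partial>\<sigma>) has_derivative (\<lambda>h. \<Sum>i\<in>UNIV. h$i *\<^sub>R (\<integral>y. D i x y \<partial>\<sigma>))) (at x)" if "x \<in> S" for x
    by (rule has_derivative_integral_sphere[OF S k D Dc that])
  show "((\<lambda>x. \<integral>y. D i x y \<partial>\<sigma>) has_derivative (\<lambda>h. \<Sum>j\<in>UNIV. h$j *\<^sub>R (\<integral>y. E i j x y \<partial>\<sigma>))) (at x)" if "x \<in> S" for x i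
    by (rule has_derivative_integral_sphere[OF S Dc E Ec that])
  show "continuous_on S (\<lambda>x. \<integral>y. E i j x y \<partial>\<sigma>)" for i j by (rule continuous_on_integral_sphere[OF S Ec])
  show "(\<Sum>i\<in>UNIV. \<integral>y. E i i x y \<partial>\<sigma>) = 0" if "x \<in> S" for x
  proof -
    have "(\<Sum>i\<in>UNIV. \<integral>y. E i i x y \<partial>\<sigma>) = (\<integral>y. (\<Sum>i\<in>UNIV. E i i x y) \<partial>\<sigma>)"
      by (rule Bochner_Integration.integral_sum[symmetric])
        (auto intro!: continuous_on_sphere_integrable continuous_on_slice[OF Ec] that)
    also have "\<dots> = (\<integral>y. 0 \<partial>\<sigma>)" by (rule Bochner_Integration.integral_cong) (use lap that in auto)
    finally show ?thesis by simp
  qed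
qed

end

section \<open>The Poisson kernel and the Dirichlet problem\<close>

text \<open>The classical kernel (1 - |x|^2) / |x - y|^n, written with the squared distance so that
  it is smooth by the chain rule. Its integral over the sphere is \<open>\<omega>\<close>, not
  1.\<close>

definition poisson :: "real^'n \<Rightarrow> real^'n \<Rightarrow> real" where
  "poisson x y = (1 - x \<bullet> x) * ((x - y) \<bullet> (x - y)) powr (- (real CARD('n) / 2))"

lemma inner_vec_sum: "x \<bullet> (y::real^'n) = (\<Sum>i\<in>UNIV. x$i * y$i)"
  by (simp add: inner_vec_def)

context
  fixes x y :: "real^'n"
  assumes xy: "x \<noteq> y"
begin

lemma inner_diff_self_pos: "(x - y) \<bullet> (x - y) > 0" using xy by simp

lemma has_derivative_inner_diff_powr:
  "((\<lambda>x. ((x - y) \<bullet> (x - y)) powr s) has_derivative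
     (\<lambda>h. \<Sum>i\<in>UNIV. h$i *\<^sub>R (2 * s * (x$i - y$i) * ((x - y) \<bullet> (x - y)) powr (s - 1)))) (at x)"
proof -
  have "((\<lambda>x. ((x - y) \<bullet> (x - y)) powr s) has_derivative
     (\<lambda>h. s * ((x - y) \<bullet> (x - y)) powr (s - 1) * (2 * ((x - y) \<bullet> h)))) (at x)"
    using inner_diff_self_pos
    by (auto intro!: derivative_eq_intros simp: powr_diff inner_commute field_simps inner_diff_left inner_diff_right)
  moreover have "s * ((x - y) \<bullet> (x - y)) powr (s - 1) * (2 * ((x - y) \<bullet> h))
     = (\<Sum>i\<in>UNIV. h$i *\<^sub>R (2 * s * (x$i - y$i) * ((x - y) \<bullet> (x - y)) powr (s - 1)))" for h
    by (simp add: inner_vec_sum[of "x - y" h] sum_distrib_left mult_ac)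
  ultimately show ?thesis by simp
qed

lemma has_derivative_one_minus_inner:
  "((\<lambda>x. 1 - x \<bullet> x) has_derivative (\<lambda>h. \<Sum>i\<in>UNIV. h$i *\<^sub>R (- 2 * x$i))) (at x)"
proof -
  have "((\<lambda>x. 1 - x \<bullet> x) has_derivative (\<lambda>h. - 2 * (x \<bullet> h))) (at x)"
    by (auto intro!: derivative_eq_intros simp: inner_commute)
  moreover have "- 2 * (x \<bullet> h) = (\<Sum>i\<in>UNIV. h$i *\<^sub>R (- 2 * x$i))" for h
    by (simp add: inner_vec_sum[of x h] sum_distrib_left mult_ac flip: sum_negf)
  ultimately show ?thesis by simp
qed

lemma has_derivative_nth: "((\<lambda>x. x$i) has_derivative (\<lambda>h. \<Sum>j\<in>UNIV. h$j *\<^sub>R (if i = j then 1 else 0))) (at (x::real^'n))"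
proof -
  have "((\<lambda>x. x$i) has_derivative (\<lambda>h. h$i)) (at x)"
    by (rule bounded_linear_imp_has_derivative[OF bounded_linear_vec_nth])
  then show ?thesis by (simp add: if_distrib cong: if_cong)
qed

lemma has_derivative_mult_partials:
  fixes f g :: "real^'n \<Rightarrow> real"
  assumes "(f has_derivative (\<lambda>h. \<Sum>i\<in>UNIV. h$i *\<^sub>R F i)) (at x)" "(g has_derivative (\<lambda>h. \<Sum>i\<in>UNIV. h$i *\<^sub>R G i)) (at x)"
  shows "((\<lambda>x. f x * g x) has_derivative (\<lambda>h. \<Sum>i\<in>UNIV. h$i *\<^sub>R (F i * g x + f x * G i))) (at x)"
proof -
  have "((\<lambda>x. f x * g x) has_derivative (\<lambda>h. f x * (\<Sum>i\<in>UNIV. h$i *\<^sub>R G i) + (\<Sum>i\<in>UNIV. h$i *\<^sub>R F i) * g x)) (at x)"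
    by (rule has_derivative_mult[OF assms])
  moreover have "f x * (\<Sum>i\<in>UNIV. h$i *\<^sub>R G i) + (\<Sum>i\<in>UNIV. h$i *\<^sub>R F i) * g x = (\<Sum>i\<in>UNIV. h$i *\<^sub>R (F i * g x + f x * G i))" for h :: "real^'n"
    by (simp add: sum_distrib_left sum_distrib_right sum.distrib algebra_simps)
  ultimately show ?thesis by simp
qed

lemma has_derivative_add_partials:
  fixes f g :: "real^'n \<Rightarrow> real"
  assumes "(f has_derivative (\<lambda>h. \<Sum>i\<in>UNIV. h$i *\<^sub>R F i)) (at x)" "(g has_derivative (\<lambda>h. \<Sum>i\<in>UNIV. h$i *\<^sub>R G i)) (at x)"
  shows "((\<lambda>x. f x + g x) has_derivative (\<lambda>h. \<Sum>i\<in>UNIV. h$i *\<^sub>R (F i + G i))) (at x)"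
  using has_derivative_add[OF assms] by (simp add: sum.distrib algebra_simps)

end

text \<open>Left in the unsimplified shape that the product rule yields, so that
  \<open>has_derivative_poisson\<close> is an instance of that rule; \<open>poisson_E\<close> stays
  close to it for the same reason.\<close>

definition poisson_D :: "'n \<Rightarrow> real^'n \<Rightarrow> real^'n \<Rightarrow> real" where
  "poisson_D i x y = (let \<nu> = real CARD('n) / 2; q = (x - y) \<bullet> (x - y) in
     (- 2 * x$i) * q powr (- \<nu>) + (1 - x \<bullet> x) * (2 * (- \<nu>) * (x$i - y$i) * q powr (- \<nu> - 1)))"

definition poisson_E :: "'n \<Rightarrow> 'n \<Rightarrow> real^'n \<Rightarrow> real^'n \<Rightarrow> real" where
  "poisson_E i j x y = (let \<nu> = real CARD('n) / 2; q = (x - y) \<bullet> (x - y); \<delta> = (if i = j then 1 else 0) in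
     (- 2 * \<delta>) * q powr (- \<nu>) + (- 2 * x$i) * (2 * (- \<nu>) * (x$j - y$j) * q powr (- \<nu> - 1)) +
     ((- 2 * x$j) * (2 * (- \<nu>) * (x$i - y$i) * q powr (- \<nu> - 1)) +
      (1 - x \<bullet> x) * (2 * (- \<nu>) * (\<delta> * q powr (- \<nu> - 1) +
         (x$i - y$i) * (2 * (- \<nu> - 1) * (x$j - y$j) * q powr (- \<nu> - 1 - 1))))))"

lemma has_derivative_poisson:
  fixes x y :: "real^'n"
  assumes "x \<noteq> y"
  shows "((\<lambda>x. poisson x y) has_derivative (\<lambda>h. \<Sum>i\<in>UNIV. h$i *\<^sub>R poisson_D i x y)) (at x)"
  using has_derivative_mult_partials[OF assms has_derivative_one_minus_inner[OF assms] has_derivative_inner_diff_powr[OF assms, of "- (real CARD('n) / 2)"]]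
  unfolding poisson_def poisson_D_def Let_def .

lemma has_derivative_poisson_D:
  fixes x y :: "real^'n"
  assumes xy: "x \<noteq> y"
  shows "((\<lambda>x. poisson_D i x y) has_derivative (\<lambda>h. \<Sum>j\<in>UNIV. h$j *\<^sub>R poisson_E i j x y)) (at x)"
proof -
  let ?\<nu> = "real CARD('n) / 2"
  have lin: "((\<lambda>x. c * (x$i - d)) has_derivative (\<lambda>h. \<Sum>j\<in>UNIV. h$j *\<^sub>R (c * (if i = j then 1 else 0)))) (at x)" for c d
    using has_derivative_mult_right[OF has_derivative_diff[OF has_derivative_nth[OF xy] has_derivative_const[of d]], of c]
    by (simp add: sum_distrib_left mult_ac)
  note 1 = has_derivative_mult_partials[OF xy lin[of "- 2" 0] has_derivative_inner_diff_powr[OF xy, of "- ?\<nu>"]]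
  note 2 = has_derivative_mult_partials[OF xy lin[of "2 * (- ?\<nu>)" "y$i"] has_derivative_inner_diff_powr[OF xy, of "- ?\<nu> - 1"]]
  note 3 = has_derivative_mult_partials[OF xy has_derivative_one_minus_inner[OF xy] 2]
  note 4 = has_derivative_add_partials[OF xy 1 3]
  have eq: "(\<Sum>j\<in>UNIV. h$j *\<^sub>R poisson_E i j x y) = (\<Sum>j\<in>UNIV. h$j *\<^sub>R
      (- 2 * (if i = j then 1 else 0) * ((x - y) \<bullet> (x - y)) powr - ?\<nu> +
       - 2 * (x$i - 0) * (2 * - ?\<nu> * (x$j - y$j) * ((x - y) \<bullet> (x - y)) powr (- ?\<nu> - 1)) +
      (- 2 * x$j * (2 * - ?\<nu> * (x$i - y$i) * ((x - y) \<bullet> (x - y)) powr (- ?\<nu> - 1)) +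
       (1 - x \<bullet> x) * (2 * - ?\<nu> * (if i = j then 1 else 0) * ((x - y) \<bullet> (x - y)) powr (- ?\<nu> - 1) +
         2 * - ?\<nu> * (x$i - y$i) * (2 * (- ?\<nu> - 1) * (x$j - y$j) * ((x - y) \<bullet> (x - y)) powr (- ?\<nu> - 1 - 1))))))" for h :: "real^'n"
    by (intro sum.cong refl) (simp add: poisson_E_def Let_def distrib_left mult.assoc)
  show ?thesis using 4 unfolding poisson_D_def Let_def eq diff_zero .
qed

text \<open>All powers of the squared distance q are multiples of Q = q^(-\<nu>-2), where 2\<nu> is
  the dimension. The sum becomes 4\<nu>Qq times -q + 2(x.x - x.y) + (1 - x.x), and this bracket is
  zero because |y| = 1.\<close>

lemma poisson_laplace:
  fixes x y :: "real^'n"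
  assumes xy: "x \<noteq> y" and y: "norm y = 1"
  shows "(\<Sum>i\<in>UNIV. poisson_E i i x y) = 0"
proof -
  define \<nu> where "\<nu> = real CARD('n) / 2"
  define q where "q = (x - y) \<bullet> (x - y)"
  have q: "q > 0" using inner_diff_self_pos[OF xy] by (simp add: q_def)
  have p1: "q powr (- \<nu>) = q powr (- \<nu> - 1 - 1) * q\<^sup>2"
    using powr_add[of q "- \<nu> - 1 - 1" 2] q by simp
  have p2: "q powr (- \<nu> - 1) = q powr (- \<nu> - 1 - 1) * q"
  proof -
    have "q powr ((- \<nu> - 1 - 1) + 1) = q powr (- \<nu> - 1 - 1) * q" unfolding powr_add using q by simp
    moreover have "(- \<nu> - 1 - 1) + 1 = - \<nu> - 1" by simp
    ultimately show ?thesis by (simp only:)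
  qed
  define Q where "Q = q powr (- \<nu> - 1 - 1)"
  have s1: "(\<Sum>i\<in>UNIV. x$i * (x$i - y$i)) = x \<bullet> x - x \<bullet> y"
    by (simp add: inner_vec_sum sum_subtractf algebra_simps)
  have s2: "(\<Sum>i\<in>UNIV. (x$i - y$i) * (x$i - y$i)) = q"
    by (simp add: q_def inner_vec_sum)
  have qe: "q = x \<bullet> x - 2 * (x \<bullet> y) + 1"
    using y by (simp add: q_def inner_diff_left inner_diff_right inner_commute norm_eq_sqrt_inner)
  have gen: "(\<Sum>i\<in>(UNIV::'n set). A + B * a i + C + D * b i) =
      2 * \<nu> * A + B * (\<Sum>i\<in>UNIV. a i) + 2 * \<nu> * C + D * (\<Sum>i\<in>UNIV. b i)" for A B C D :: real and a b
    by (simp add: sum.distrib sum_distrib_left \<nu>_def)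
  have "poisson_E i i x y = - 2 * Q * q\<^sup>2 + 8 * \<nu> * Q * q * (x$i * (x$i - y$i))
      + (1 - x \<bullet> x) * (- 2 * \<nu>) * (Q * q) + (1 - x \<bullet> x) * 4 * \<nu> * (\<nu> + 1) * Q * ((x$i - y$i) * (x$i - y$i))" for i
    unfolding poisson_E_def Let_def \<nu>_def[symmetric] q_def[symmetric] p1 p2 Q_def[symmetric]
    by (simp add: algebra_simps)
  then have "(\<Sum>i\<in>UNIV. poisson_E i i x y) = 2 * \<nu> * (- 2 * Q * q\<^sup>2) + 8 * \<nu> * Q * q * (x \<bullet> x - x \<bullet> y)
      + 2 * \<nu> * ((1 - x \<bullet> x) * (- 2 * \<nu>) * (Q * q)) + (1 - x \<bullet> x) * 4 * \<nu> * (\<nu> + 1) * Q * q"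
    using gen[of "- 2 * Q * q\<^sup>2" "8 * \<nu> * Q * q" "\<lambda>i. x$i * (x$i - y$i)"
        "(1 - x \<bullet> x) * (- 2 * \<nu>) * (Q * q)" "(1 - x \<bullet> x) * 4 * \<nu> * (\<nu> + 1) * Q" "\<lambda>i. (x$i - y$i) * (x$i - y$i)"]
    by (simp only: s1 s2)
  also have "\<dots> = 4 * \<nu> * Q * q * (- q + 2 * (x \<bullet> x - x \<bullet> y) + (1 - x \<bullet> x))"
    by (simp add: algebra_simps power2_eq_square)
  also have "\<dots> = 0" by (simp add: qe)
  finally show ?thesis .
qed

lemma ball_sphere_neq: "x \<in> ball 0 1 \<Longrightarrow> norm y = 1 \<Longrightarrow> x \<noteq> y"
  by auto

lemma continuous_on_poisson:
  "continuous_on (ball 0 1 \<times> sphere 0 1) (\<lambda>(x, y). poisson x (y::real^'n))"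
  unfolding poisson_def split_beta
  by (intro continuous_intros) (auto dest: ball_sphere_neq)

lemma continuous_on_poisson_D:
  "continuous_on (ball 0 1 \<times> sphere 0 1) (\<lambda>(x, y). poisson_D i x (y::real^'n))"
  unfolding poisson_D_def split_beta Let_def
  by (intro continuous_intros) (auto dest: ball_sphere_neq)

lemma continuous_on_poisson_E:
  "continuous_on (ball 0 1 \<times> sphere 0 1) (\<lambda>(x, y). poisson_E i j x (y::real^'n))"
  unfolding poisson_E_def split_beta Let_def
  by (intro continuous_intros) (auto dest: ball_sphere_neq)

lemma poisson_nonneg: "norm x \<le> 1 \<Longrightarrow> poisson x y \<ge> 0"
  unfolding poisson_def by (intro mult_nonneg_nonneg) (auto simp: dot_square_norm power_le_one)

lemma poisson_0: "norm y = 1 \<Longrightarrow> poisson 0 y = 1"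
  by (simp add: poisson_def dot_square_norm)

lemma poisson_orthogonal:
  fixes T :: "real^'n \<Rightarrow> real^'n"
  assumes "orthogonal_transformation T"
  shows "poisson (T x) (T y) = poisson x y"
proof -
  have lin: "linear T" using assms by (rule orthogonal_transformation_linear)
  have "T a \<bullet> T b = a \<bullet> b" for a b using assms by (simp add: orthogonal_transformation_def)
  then show ?thesis by (simp add: poisson_def flip: linear_diff[OF lin])
qed

context sphere_measure
begin

definition poisson_integral :: "(real^'n \<Rightarrow> 'b::{banach, second_countable_topology}) \<Rightarrow> real^'n \<Rightarrow> 'b" where
  "poisson_integral F x = (\<integral>y. (poisson x y / \<omega>) *\<^sub>R F y \<partial>\<sigma>)"

lemma continuous_on_poisson_snd:
  "norm x < 1 \<Longrightarrow> continuous_on (sphere 0 1) (poisson (x::real^'n))"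
  by (rule continuous_on_slice[OF continuous_on_poisson]) auto

lemma harmonic_on_poisson_integral:
  fixes F :: "real^'n \<Rightarrow> 'b::{banach, second_countable_topology}"
  assumes F: "continuous_on (sphere 0 1) F"
  shows "harmonic_on (poisson_integral F) (ball 0 1)"
  unfolding poisson_integral_def
proof (rule harmonic_on_integral_sphere[where D="\<lambda>i x y. (poisson_D i x y / \<omega>) *\<^sub>R F y" and E="\<lambda>i j x y. (poisson_E i j x y / \<omega>) *\<^sub>R F y"])
  have Fs: "continuous_on (ball 0 1 \<times> sphere 0 1) (\<lambda>p. F (snd (p :: (real^'n) \<times> (real^'n))))"
    by (rule continuous_on_compose2[OF F continuous_on_snd[OF continuous_on_id]]) auto
  have *: "continuous_on (ball 0 1 \<times> sphere 0 1) (\<lambda>(x, y). (k x y / \<omega>) *\<^sub>R F y)"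
    if "continuous_on (ball 0 1 \<times> sphere 0 1) (\<lambda>(x, y). k x y)" for k :: "real^'n \<Rightarrow> real^'n \<Rightarrow> real"
  proof -
    have "continuous_on (ball 0 1 \<times> sphere 0 1) (\<lambda>p. k (fst p) (snd p))"
      using that by (simp add: split_beta)
    then show ?thesis unfolding split_beta divide_inverse
      by (intro continuous_on_scaleR continuous_on_mult continuous_on_const Fs)
  qed
  show "continuous_on (ball 0 1 \<times> sphere 0 1) (\<lambda>(x, y). (poisson x y / \<omega>) *\<^sub>R F y)"
    "continuous_on (ball 0 1 \<times> sphere 0 1) (\<lambda>(x, y). (poisson_D i x y / \<omega>) *\<^sub>R F y)"
    "continuous_on (ball 0 1 \<times> sphere 0 1) (\<lambda>(x, y). (poisson_E i j x y / \<omega>) *\<^sub>R F y)" for i j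
    by (intro * continuous_on_poisson continuous_on_poisson_D continuous_on_poisson_E)+
  fix x y :: "real^'n" assume "x \<in> ball 0 1" and y: "norm y = 1"
  then have xy: "x \<noteq> y" by auto
  have div: "(\<Sum>i\<in>UNIV. h$i *\<^sub>R (c i / \<omega>) *\<^sub>R F y) = (1 / \<omega> * (\<Sum>i\<in>UNIV. h$i *\<^sub>R c i)) *\<^sub>R F y" for h :: "real^'n" and c
    by (simp add: scaleR_sum_left sum_distrib_left)
  show "((\<lambda>x. (poisson x y / \<omega>) *\<^sub>R F y) has_derivative (\<lambda>h. \<Sum>i\<in>UNIV. h$i *\<^sub>R (poisson_D i x y / \<omega>) *\<^sub>R F y)) (at x)"
    using has_derivative_scaleR_left[OF has_derivative_mult_right[OF has_derivative_poisson[OF xy], of "1/\<omega>"], of "F y"]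
    unfolding div by simp
  show "((\<lambda>x. (poisson_D i x y / \<omega>) *\<^sub>R F y) has_derivative (\<lambda>h. \<Sum>j\<in>UNIV. h$j *\<^sub>R (poisson_E i j x y / \<omega>) *\<^sub>R F y)) (at x)" for i
    using has_derivative_scaleR_left[OF has_derivative_mult_right[OF has_derivative_poisson_D[OF xy, of i], of "1/\<omega>"], of "F y"]
    unfolding div by simp
  have "(\<Sum>i\<in>UNIV. (poisson_E i i x y / \<omega>) *\<^sub>R F y) = ((\<Sum>i\<in>UNIV. poisson_E i i x y) / \<omega>) *\<^sub>R F y"
    by (simp add: scaleR_sum_left sum_divide_distrib)
  then show "(\<Sum>i\<in>UNIV. (poisson_E i i x y / \<omega>) *\<^sub>R F y) = 0"
    by (simp add: poisson_laplace[OF xy y])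
qed simp

text \<open>
  The integral of the kernel over the sphere is harmonic and radial, so by the maximum principle
  it is constant on each ball.
\<close>
lemma integral_poisson:
  assumes x: "norm x < 1"
  shows "(\<integral>y. poisson x y \<partial>\<sigma>) = \<omega>"
proof -
  let ?u = "poisson_integral (\<lambda>y. 1::real)"
  have radial: "?u a = ?u b" if ab: "norm a = norm b" and b: "norm b < 1" for a b
  proof -
    obtain T where T: "orthogonal_transformation T" "T a = b"
      using orthogonal_transformation_exists[OF ab] by blast
    have c: "continuous_on (sphere 0 1) (\<lambda>y. poisson b y / \<omega>)"
      unfolding divide_inverse by (intro continuous_on_mult continuous_on_const continuous_on_poisson_snd b)
    have "?u b = (\<integral>y. poisson b (T y) / \<omega> \<partial>\<sigma>)" unfolding poisson_integral_def
      using rotation_integral[OF T(1) c, symmetric] by simp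
    also have "\<dots> = ?u a" by (simp add: poisson_integral_def poisson_orthogonal[OF T(1)] flip: T(2))
    finally show ?thesis by simp
  qed
  have h: "harmonic_on ?u (ball 0 1)" by (rule harmonic_on_poisson_integral) simp
  have h1: "harmonic_on ?u (ball 0 (norm x))"
    by (rule harmonic_on_subset[OF h]) (use x in auto)
  have h2: "continuous_on (cball 0 (norm x)) ?u"
    by (rule continuous_on_subset[OF harmonic_on_imp_continuous_on[OF h]]) (use x in auto)
  have "?u 0 \<le> ?u x"
  proof (rule harmonic_max_principle[OF h1 h2])
    show "?u z \<le> ?u x" if "norm z = norm x" for z using radial[OF that x] by simp
  qed simp
  moreover have "- ?u 0 \<le> - ?u x"
  proof (rule harmonic_max_principle[where R="norm x" and w="\<lambda>x. - ?u x"])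
    show "harmonic_on (\<lambda>x. - ?u x) (ball 0 (norm x))"
      by (rule harmonic_on_bounded_linear[OF _ h1 bounded_linear_minus[OF bounded_linear_ident]]) simp
    show "continuous_on (cball 0 (norm x)) (\<lambda>x. - ?u x)" by (intro continuous_on_minus h2)
    show "- ?u z \<le> - ?u x" if "norm z = norm x" for z using radial[OF that x] by simp
  qed simp
  ultimately have "?u x = ?u 0" by simp
  also have "\<dots> = (\<integral>y. 1 / \<omega> \<partial>\<sigma>)" unfolding poisson_integral_def
    by (rule Bochner_Integration.integral_cong) (auto simp: poisson_0)
  also have "\<dots> = 1" using omega_pos by (simp add: \<omega>_def)
  finally show ?thesis using omega_pos by (simp add: poisson_integral_def)
qed

lemma poisson_le_far:
  fixes x y :: "real^'n"
  assumes "norm x \<le> 1" and d: "d > 0" "d \<le> dist x y"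
  shows "poisson x y \<le> (1 - norm x ^ 2) * d powr (- real CARD('n))"
proof -
  have "((x - y) \<bullet> (x - y)) powr (- (real CARD('n) / 2)) = dist x y powr (- real CARD('n))"
  proof -
    have "((x - y) \<bullet> (x - y)) = dist x y powr 2" using d by (simp add: dist_norm dot_square_norm)
    then show ?thesis by (simp only: powr_powr) simp
  qed
  also have "\<dots> \<le> d powr (- real CARD('n))" using d by (intro powr_mono2') auto
  finally show ?thesis using assms(1) unfolding poisson_def dot_square_norm
    by (intro mult_left_mono) (auto simp: power_le_one)
qed

text \<open>The kernel is an approximate identity: it is nonnegative with mean 1 and concentrates at
  \<open>y0\<close>. Near \<open>y0\<close> continuity of F decides; far from \<open>y0\<close> the
  factor 1 - |x|^2 does.\<close>

lemma poisson_integral_tendsto_boundary: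
  fixes F :: "real^'n \<Rightarrow> 'b::{banach, second_countable_topology}"
  assumes F: "continuous_on (sphere 0 1) F" and y0: "norm y0 = 1"
  shows "(poisson_integral F \<longlongrightarrow> F y0) (at y0 within ball 0 1)"
proof (rule tendstoI)
  fix e :: real assume e: "e > 0"
  have "\<exists>d>0. \<forall>y. norm y = 1 \<longrightarrow> dist y y0 < d \<longrightarrow> norm (F y - F y0) < e / 2"
    using F[unfolded continuous_on_iff, rule_format, of y0 "e / 2"] y0 e by (auto simp: dist_norm)
  then obtain d where d: "d > 0" "\<And>y. norm y = 1 \<Longrightarrow> dist y y0 < d \<Longrightarrow> norm (F y - F y0) < e / 2"
    by blast
  have "bounded (F ` sphere 0 1)" by (intro compact_imp_bounded compact_continuous_image F compact_sphere)
  then obtain B where "\<forall>z\<in>F ` sphere 0 1. norm z \<le> B" unfolding bounded_iff by blast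
  then have B: "norm (F y) \<le> B" if "norm y = 1" for y using that by simp
  have B0: "B \<ge> 0" using B[OF y0] norm_ge_zero order_trans by blast
  \<comment> \<open>Distance d/2 instead of d: the points y are at distance at least d from
    \<open>y0\<close>, while x itself may be up to d/2 away from it. The 2B bounds the oscillation
    of F.\<close>
  define C where "C = (d / 2) powr (- real CARD('n)) * 2 * B"
  have "((\<lambda>x. (1 - norm x ^ 2) * C) \<longlongrightarrow> (1 - norm y0 ^ 2) * C) (at y0 within ball 0 1)"
    by (intro tendsto_intros)
  then have "eventually (\<lambda>x. (1 - norm x ^ 2) * C < e / 2) (at y0 within ball 0 1)"
    by (rule order_tendstoD) (use y0 e in simp)
  moreover have "eventually (\<lambda>x. dist x y0 < d / 2) (at y0 within ball 0 1)"
    unfolding eventually_at by (intro exI[of _ "d / 2"]) (use d(1) in auto)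
  moreover have "eventually (\<lambda>x. x \<in> ball 0 1) (at y0 within ball 0 1)"
    by (simp add: eventually_at_filter)
  ultimately show "eventually (\<lambda>x. dist (poisson_integral F x) (F y0) < e) (at y0 within ball 0 1)"
  proof eventually_elim
    case (elim x)
    then have x: "norm x < 1" by simp
    have cp: "continuous_on (sphere 0 1) (\<lambda>y. poisson x y / \<omega>)"
      unfolding divide_inverse by (intro continuous_on_mult continuous_on_const continuous_on_poisson_snd x)
    have int: "integrable \<sigma> (\<lambda>y. (poisson x y / \<omega>) *\<^sub>R F y)" "integrable \<sigma> (\<lambda>y. (poisson x y / \<omega>) *\<^sub>R F y0)"
      "integrable \<sigma> (\<lambda>y. poisson x y / \<omega>)"
      by (intro continuous_on_sphere_integrable continuous_on_scaleR cp F continuous_on_const)+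
    have int1: "(\<integral>y. poisson x y / \<omega> \<partial>\<sigma>) = 1" using integral_poisson[OF x] omega_pos by simp
    have "(\<integral>y. (poisson x y / \<omega>) *\<^sub>R F y0 \<partial>\<sigma>) = (\<integral>y. poisson x y / \<omega> \<partial>\<sigma>) *\<^sub>R F y0"
      by (rule Bochner_Integration.integral_scaleR_left) (use int in auto)
    then have "F y0 = (\<integral>y. (poisson x y / \<omega>) *\<^sub>R F y0 \<partial>\<sigma>)" using int1 by simp
    then have "poisson_integral F x - F y0 = (\<integral>y. (poisson x y / \<omega>) *\<^sub>R (F y - F y0) \<partial>\<sigma>)"
      using int by (simp add: poisson_integral_def scaleR_diff_right)
    also have "norm \<dots> \<le> (\<integral>y. norm ((poisson x y / \<omega>) *\<^sub>R (F y - F y0)) \<partial>\<sigma>)" by (rule integral_norm_bound)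
    also have "\<dots> \<le> (\<integral>y. (poisson x y / \<omega>) * (e / 2) + (1 - norm x ^ 2) * C / \<omega> \<partial>\<sigma>)"
    proof (rule integral_mono)
      show "integrable \<sigma> (\<lambda>y. norm ((poisson x y / \<omega>) *\<^sub>R (F y - F y0)))"
        "integrable \<sigma> (\<lambda>y. (poisson x y / \<omega>) * (e / 2) + (1 - norm x ^ 2) * C / \<omega>)"
        by (intro continuous_on_sphere_integrable continuous_on_scaleR continuous_on_norm continuous_on_mult
            continuous_on_add continuous_on_diff cp F continuous_on_const)+
      fix y assume "y \<in> space \<sigma>"
      then have y: "norm y = 1" by simp
      have pos: "poisson x y \<ge> 0" using poisson_nonneg[of x y] x by simp
      have Cpos: "(1 - norm x ^ 2) * C \<ge> 0" unfolding C_def using x B0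
        by (intro mult_nonneg_nonneg) (auto simp: power_le_one)
      have "poisson x y * norm (F y - F y0) \<le> poisson x y * (e / 2) + (1 - norm x ^ 2) * C"
      proof (cases "dist y y0 < d")
        case True
        then have "poisson x y * norm (F y - F y0) \<le> poisson x y * (e / 2)"
          using d(2)[OF y] pos by (intro mult_left_mono) auto
        then show ?thesis using Cpos by simp
      next
        case False
        have "d / 2 \<le> dist x y" using False elim dist_triangle[of y y0 x] by (simp add: dist_commute)
        then have "poisson x y \<le> (1 - norm x ^ 2) * (d / 2) powr (- real CARD('n))"
          using poisson_le_far[of x "d / 2" y] x d by simp
        moreover have "norm (F y - F y0) \<le> 2 * B"
          using norm_triangle_ineq4[of "F y" "F y0"] B[OF y] B[OF y0] by simp
        ultimately have "poisson x y * norm (F y - F y0) \<le> (1 - norm x ^ 2) * (d / 2) powr (- real CARD('n)) * (2 * B)"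
          using pos by (intro mult_mono) (auto intro: order_trans)
        also have "\<dots> = (1 - norm x ^ 2) * C" by (simp add: C_def)
        finally show ?thesis using e mult_nonneg_nonneg[OF pos, of "e / 2"] by linarith
      qed
      then have "(poisson x y * norm (F y - F y0)) / \<omega> \<le> (poisson x y * (e / 2) + (1 - norm x ^ 2) * C) / \<omega>"
        using omega_pos by (intro divide_right_mono) auto
      then show "norm ((poisson x y / \<omega>) *\<^sub>R (F y - F y0)) \<le> (poisson x y / \<omega>) * (e / 2) + (1 - norm x ^ 2) * C / \<omega>"
        using pos omega_pos by (simp add: add_divide_distrib abs_of_pos)
    qed
    also have "\<dots> = (\<integral>y. (poisson x y / \<omega>) * (e / 2) \<partial>\<sigma>) + (\<integral>y. (1 - norm x ^ 2) * C / \<omega> \<partial>\<sigma>)"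
      by (intro Bochner_Integration.integral_add integrable_mult_left int(3)) simp
    also have "\<dots> = (\<integral>y. poisson x y / \<omega> \<partial>\<sigma>) * (e / 2) + measure \<sigma> (space \<sigma>) * ((1 - norm x ^ 2) * C / \<omega>)"
    proof (rule arg_cong2[where f="(+)"])
      show "(\<integral>y. (poisson x y / \<omega>) * (e / 2) \<partial>\<sigma>) = (\<integral>y. poisson x y / \<omega> \<partial>\<sigma>) * (e / 2)"
        by (rule Bochner_Integration.integral_mult_left) (rule int(3))
    qed (simp only: lebesgue_integral_const real_scaleR_def)
    also have "\<dots> = e / 2 + (1 - norm x ^ 2) * C"
      unfolding int1 \<omega>_def[symmetric] using omega_pos by simp
    also have "\<dots> < e" using elim by simp
    finally show ?case by (simp add: dist_norm)
  qed
qed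

text \<open>The difference of f and its Poisson integral, extended by 0 to the sphere, is continuous
  on the closed ball by the boundary limit. The maximum principle for it and for its negative makes
  it vanish.\<close>

lemma harmonic_eq_poisson_integral_real:
  fixes f :: "real^'n \<Rightarrow> real"
  assumes f: "harmonic_on f (ball 0 1)" and cont: "continuous_on (cball 0 1) f" and x: "norm x < 1"
  shows "f x = poisson_integral f x"
proof -
  have fs: "continuous_on (sphere 0 1) f" by (rule continuous_on_subset[OF cont]) auto
  define w where "w z = (if z \<in> ball 0 1 then f z - poisson_integral f z else 0)" for z
  have diff: "harmonic_on (\<lambda>z. f z - poisson_integral f z) (ball 0 1)"
    by (intro harmonic_on_diff f harmonic_on_poisson_integral fs open_ball)
  have hw: "harmonic_on w (ball 0 1)"
    by (rule harmonic_on_cong[OF open_ball diff]) (simp add: w_def)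
  have cw: "continuous_on (cball 0 1) w"
    unfolding continuous_on_def
  proof
    fix z :: "real^'n" assume z: "z \<in> cball 0 1"
    show "(w \<longlongrightarrow> w z) (at z within cball 0 1)"
    proof (cases "norm z = 1")
      case False
      then have z: "z \<in> ball 0 1" using z by simp
      have "continuous_on (ball 0 1) w" by (rule harmonic_on_imp_continuous_on[OF hw])
      then have "isCont w z" using z by (simp add: continuous_on_eq_continuous_at)
      then show ?thesis unfolding isCont_def by (rule tendsto_within_subset) simp
    next
      case True
      have "(f \<longlongrightarrow> f z) (at z within cball 0 1)"
        using cont z by (simp add: continuous_on_def)
      then have "(f \<longlongrightarrow> f z) (at z within ball 0 1)"
        by (rule tendsto_within_subset) simp
      then have "((\<lambda>z. f z - poisson_integral f z) \<longlongrightarrow> f z - f z) (at z within ball 0 1)"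
        by (intro tendsto_diff poisson_integral_tendsto_boundary fs True)
      then have "((\<lambda>z. f z - poisson_integral f z) \<longlongrightarrow> 0) (at z within ball 0 1)" by simp
      then have "(w \<longlongrightarrow> 0) (at z within ball 0 1)"
        by (rule Lim_transform_within[OF _ zero_less_one]) (auto simp: w_def)
      moreover have "(w \<longlongrightarrow> 0) (at z within sphere 0 1)"
        by (rule tendsto_eventually) (auto simp: eventually_at_filter w_def)
      ultimately have "(w \<longlongrightarrow> 0) (at z within (ball 0 1 \<union> sphere 0 1))" by (rule Lim_Un)
      moreover have "ball 0 1 \<union> sphere 0 1 = cball (0::real^'n) 1" by auto
      ultimately show ?thesis using True by (simp add: w_def)
    qed
  qed
  have "w x \<le> 0" by (rule harmonic_max_principle[OF hw cw]) (use x in \<open>auto simp: w_def\<close>)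
  moreover have "- w x \<le> 0"
  proof (rule harmonic_max_principle[where R=1 and w="\<lambda>x. - w x"])
    show "harmonic_on (\<lambda>x. - w x) (ball 0 1)"
      by (rule harmonic_on_bounded_linear[OF open_ball hw bounded_linear_minus[OF bounded_linear_ident]])
    show "continuous_on (cball 0 1) (\<lambda>x. - w x)" by (intro continuous_on_minus cw)
  qed (use x in \<open>auto simp: w_def\<close>)
  ultimately show ?thesis using x by (simp add: w_def)
qed

lemma harmonic_eq_poisson_integral:
  fixes f :: "real^'n \<Rightarrow> complex"
  assumes f: "harmonic_on f (ball 0 1)" and cont: "continuous_on (cball 0 1) f" and x: "norm x < 1"
  shows "f x = poisson_integral f x"
proof (rule complex_eqI)
  have fs: "continuous_on (sphere 0 1) f" by (rule continuous_on_subset[OF cont]) auto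
  have int: "integrable \<sigma> (\<lambda>y. (poisson x y / \<omega>) *\<^sub>R f y)"
    unfolding divide_inverse
    by (intro continuous_on_sphere_integrable continuous_on_scaleR continuous_on_mult continuous_on_const fs continuous_on_poisson_snd[OF x])
  have "Re (f x) = poisson_integral (\<lambda>y. Re (f y)) x"
    by (intro harmonic_eq_poisson_integral_real harmonic_on_bounded_linear[OF open_ball f] bounded_linear_Re
        continuous_on_Re cont x)
  also have "\<dots> = Re (poisson_integral f x)" using integral_Re[OF int] by (simp add: poisson_integral_def)
  finally show "Re (f x) = Re (poisson_integral f x)" .
  have "Im (f x) = poisson_integral (\<lambda>y. Im (f y)) x"
    by (intro harmonic_eq_poisson_integral_real harmonic_on_bounded_linear[OF open_ball f] bounded_linear_Im
        continuous_on_Im cont x)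
  also have "\<dots> = Im (poisson_integral f x)" using integral_Im[OF int] by (simp add: poisson_integral_def)
  finally show "Im (f x) = Im (poisson_integral f x)" .
qed

end

section \<open>Series in spherical harmonics\<close>

text \<open>By strong induction the lower coefficients are gone; dividing by r^k and letting the
  real r tend to 0 from the right isolates \<open>D k\<close>.\<close>

lemma power_series_eq_0:
  fixes D :: "nat \<Rightarrow> complex"
  assumes "\<And>r::real. 0 \<le> r \<Longrightarrow> r < 1 \<Longrightarrow> (\<lambda>k. D k * of_real r ^ k) sums 0"
  shows "D k = 0"
proof (induction k rule: less_induct)
  case (less k)
  define D' where "D' i = D (i + k)" for i
  have z: "(\<lambda>i. D' i * of_real r ^ i) sums 0" if r: "0 < r" "r < 1" for r :: real
  proof -
    have "(\<lambda>i. D (i + k) * of_real r ^ (i + k)) sums (0 - (\<Sum>i<k. D i * of_real r ^ i))"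
      by (rule sums_split_initial_segment[OF assms]) (use r in auto)
    also have "0 - (\<Sum>i<k. D i * of_real r ^ i) = 0" using less by simp
    finally have "(\<lambda>i. of_real (1 / r) ^ k * (D (i + k) * of_real r ^ (i + k))) sums (of_real (1 / r) ^ k * 0)"
      by (rule sums_mult)
    then show ?thesis using r by (simp add: D'_def power_add field_simps)
  qed
  have "summable (\<lambda>i. D' i * (of_real (1/2)) ^ i)" by (rule sums_summable[OF z]) auto
  then have sm: "(\<lambda>i. D' i * z ^ i) sums suminf (\<lambda>i. D' i * z ^ i)" if "norm z < 1/2" for z :: complex
    by (rule summable_sums[OF powser_inside]) (use that in simp)
  have "((\<lambda>z. suminf (\<lambda>i. D' i * z ^ i)) \<longlongrightarrow> D' 0) (at 0)"
    by (rule powser_limit_0[OF _ sm, of "1/2"]) auto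
  moreover have "filterlim (\<lambda>r::real. complex_of_real r) (at 0) (at_right 0)"
    unfolding filterlim_at by (auto intro!: tendsto_eq_intros simp: eventually_at_filter)
  ultimately have "((\<lambda>r::real. suminf (\<lambda>i. D' i * of_real r ^ i)) \<longlongrightarrow> D' 0) (at_right 0)"
    by (rule filterlim_compose)
  moreover have "eventually (\<lambda>r::real. suminf (\<lambda>i. D' i * of_real r ^ i) = 0) (at_right 0)"
    unfolding eventually_at_right_field by (intro exI[of _ 1]) (auto intro: sums_unique[symmetric] z)
  then have "((\<lambda>r::real. suminf (\<lambda>i. D' i * of_real r ^ i)) \<longlongrightarrow> 0) (at_right 0)"
    by (rule tendsto_eventually)
  ultimately have "D' 0 = 0" by (rule tendsto_unique[rotated 1]) simp
  then show ?case by (simp add: D'_def)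
qed

context sphere_measure
begin

text \<open>The squared distance from g to its projection on the span is nonnegative; expanding it
  leaves the norm of g minus the sum of squared coefficients.\<close>

lemma bessel:
  fixes \<phi> :: "'j \<Rightarrow> real^'n \<Rightarrow> real"
  assumes J: "finite J" and \<phi>: "\<And>j. j \<in> J \<Longrightarrow> continuous_on (sphere 0 1) (\<phi> j)"
    and g: "continuous_on (sphere 0 1) g"
    and orth: "\<And>i j. i \<in> J \<Longrightarrow> j \<in> J \<Longrightarrow> (\<integral>x. \<phi> i x * \<phi> j x \<partial>\<sigma>) = (if i = j then 1 else 0)"
  shows "(\<Sum>j\<in>J. (\<integral>x. g x * \<phi> j x \<partial>\<sigma>)\<^sup>2) \<le> (\<integral>x. (g x)\<^sup>2 \<partial>\<sigma>)"
proof -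
  define c where "c j = (\<integral>x. g x * \<phi> j x \<partial>\<sigma>)" for j
  let ?S = "\<lambda>x. \<Sum>j\<in>J. c j * \<phi> j x"
  have int1: "integrable \<sigma> (\<lambda>x. (g x)\<^sup>2)"
    by (intro continuous_on_sphere_integrable continuous_intros g)
  have int2: "integrable \<sigma> (\<lambda>x. g x * \<phi> j x)" if "j \<in> J" for j
    by (intro continuous_on_sphere_integrable continuous_on_mult g \<phi> that)
  have int3: "integrable \<sigma> (\<lambda>x. \<phi> i x * \<phi> j x)" if "i \<in> J" "j \<in> J" for i j
    by (intro continuous_on_sphere_integrable continuous_on_mult \<phi> that)
  have e: "(g x - ?S x)\<^sup>2 = (g x)\<^sup>2 - (\<Sum>j\<in>J. 2 * c j * (g x * \<phi> j x)) + (\<Sum>i\<in>J. \<Sum>j\<in>J. c i * c j * (\<phi> i x * \<phi> j x))" for x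
  proof -
    have "?S x * ?S x = (\<Sum>i\<in>J. \<Sum>j\<in>J. c i * c j * (\<phi> i x * \<phi> j x))"
      unfolding sum_product by (intro sum.cong refl) (simp add: mult_ac)
    moreover have "2 * g x * ?S x = (\<Sum>j\<in>J. 2 * c j * (g x * \<phi> j x))"
      unfolding sum_distrib_left by (intro sum.cong refl) (simp add: mult_ac)
    ultimately show ?thesis by (simp add: power2_diff power2_eq_square[of "?S x"])
  qed
  have s: "(\<Sum>i\<in>J. c j * c i * (if j = i then 1 else 0)) = (c j)\<^sup>2" if "j \<in> J" for j
  proof -
    have "(\<Sum>i\<in>J. c j * c i * (if j = i then 1 else 0)) = (\<Sum>i\<in>J. if j = i then c j * c i else 0)"
      by (intro sum.cong) auto
    then show ?thesis using J that by (simp add: power2_eq_square)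
  qed
  have "0 \<le> (\<integral>x. (g x - ?S x)\<^sup>2 \<partial>\<sigma>)" by (rule integral_nonneg_AE) simp
  also have "\<dots> = (\<integral>x. (g x)\<^sup>2 \<partial>\<sigma>) - (\<Sum>j\<in>J. 2 * c j * c j) + (\<Sum>i\<in>J. \<Sum>j\<in>J. c i * c j * (\<integral>x. \<phi> i x * \<phi> j x \<partial>\<sigma>))"
    unfolding e using int1 int2 int3
    by (subst Bochner_Integration.integral_add Bochner_Integration.integral_diff Bochner_Integration.integral_sum;
        (intro Bochner_Integration.integrable_diff Bochner_Integration.integrable_sum integrable_mult_right)?; simp add: c_def)+
  also have "(\<Sum>i\<in>J. \<Sum>j\<in>J. c i * c j * (\<integral>x. \<phi> i x * \<phi> j x \<partial>\<sigma>)) = (\<Sum>i\<in>J. (c i)\<^sup>2)"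
    by (rule sum.cong[OF refl]) (simp add: orth s cong: sum.cong)
  also have "(\<Sum>j\<in>J. 2 * c j * c j) = 2 * (\<Sum>j\<in>J. (c j)\<^sup>2)"
    by (simp add: sum_distrib_left power2_eq_square mult.assoc)
  finally show ?thesis by (simp add: c_def)
qed

end

text \<open>\<open>d\<close> abbreviates \<open>sph_dim\<close>. Its growth is read off from the
  orthonormal system in \<open>sum_weight_le\<close> instead of from a dimension formula.\<close>

locale spherical_expansion = sphere_measure \<sigma> \<kappa>
  for \<sigma> :: "(real^'n) measure" and \<kappa> +
  fixes Y :: "nat \<Rightarrow> nat \<Rightarrow> real^'n \<Rightarrow> real"
    and d :: "nat \<Rightarrow> nat"
  assumes basis: "spherical_basis \<sigma> Y"
    and d_eq: "d = sph_dim TYPE('n)"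
begin

lemma Y_polynomial:
  assumes "j \<in> {1..d k}"
  obtains p where "real_polynomial_function p" "\<And>t x. p (t *\<^sub>R x) = t ^ k * p x" "harmonic_on p UNIV"
    "\<And>x. norm x = 1 \<Longrightarrow> Y k j x = p x"
proof -
  have "Y k j \<in> spherical_harmonics k" using basis assms by (auto simp: spherical_basis_def d_eq)
  then show ?thesis using that by (auto simp: spherical_harmonics_def)
qed

lemma Y_continuous: assumes "j \<in> {1..d k}" shows "continuous_on (sphere 0 1) (Y k j)"
proof -
  obtain p where p: "real_polynomial_function p" "\<And>x. norm x = 1 \<Longrightarrow> Y k j x = p x"
    using Y_polynomial[OF assms] by metis
  have "continuous_on (sphere 0 1) p"
    using continuous_real_polymonial_function[OF p(1)] continuous_at_imp_continuous_on by blast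
  then show ?thesis by (rule continuous_on_eq) (simp add: p(2))
qed

lemma Y_orthonormal:
  assumes "j \<in> {1..d k}" "i \<in> {1..d l}"
  shows "(\<integral>x. Y k j x * Y l i x \<partial>\<sigma>) = (if k = l \<and> j = i then 1 else 0)"
  using basis assms by (simp add: spherical_basis_def d_eq)

text \<open>Serves the origin, where \<open>direction\<close> is an arbitrary unit vector and only
  the term of order 0 survives.\<close>

lemma Y_0_constant:
  assumes "j \<in> {1..d 0}" "norm x = 1" "norm y = 1"
  shows "Y 0 j x = Y 0 j y"
proof -
  obtain p where "\<And>t x. p (t *\<^sub>R x) = t ^ 0 * p x" and Y: "\<And>x. norm x = 1 \<Longrightarrow> Y 0 j x = p x"
    using Y_polynomial[OF assms(1)] by metis
  then have p: "p (t *\<^sub>R x) = p x" for t x by simp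
  have "p x = p 0" for x using p[of 0 x] by simp
  then show ?thesis using Y assms by metis
qed

text \<open>A homogeneous harmonic polynomial is the Poisson integral of its own boundary values, so
  the kernel acts on order k as multiplication by r^k.\<close>

lemma poisson_Y:
  assumes "j \<in> {1..d k}" "norm x = 1" "0 \<le> r" "r < 1"
  shows "(\<integral>y. poisson (r *\<^sub>R x) y / \<omega> * Y k j y \<partial>\<sigma>) = r ^ k * Y k j x"
proof -
  obtain p where p: "real_polynomial_function p" "\<And>t x. p (t *\<^sub>R x) = t ^ k * p x" "harmonic_on p UNIV"
    "\<And>x. norm x = 1 \<Longrightarrow> Y k j x = p x"
    using Y_polynomial[OF assms(1)] by metis
  have "p (r *\<^sub>R x) = poisson_integral p (r *\<^sub>R x)"
    using assms by (intro harmonic_eq_poisson_integral_real harmonic_on_subset[OF p(3)]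
        continuous_on_subset[OF harmonic_on_imp_continuous_on[OF p(3)]]) auto
  also have "\<dots> = (\<integral>y. poisson (r *\<^sub>R x) y / \<omega> * Y k j y \<partial>\<sigma>)"
    unfolding poisson_integral_def by (rule Bochner_Integration.integral_cong) (auto simp: p(4))
  finally show ?thesis using p(2,4) assms by simp
qed

lemma continuous_on_poisson_omega:
  "norm x < 1 \<Longrightarrow> continuous_on (sphere 0 1) (\<lambda>y. poisson (x::real^'n) y / \<omega>)"
  unfolding divide_inverse by (intro continuous_on_mult continuous_on_const continuous_on_poisson_snd)

text \<open>Bessel's inequality for the Poisson kernel at radius sqrt r, whose coefficients of order
  k are sqrt r^k times the values of the basis functions. The bounded kernel supplies the
  constant.\<close>

lemma sum_Y_sq_le:
  assumes r: "0 < r" "r < 1"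
  obtains B where "B \<ge> 0" "\<And>k x. norm x = 1 \<Longrightarrow> r ^ k * (\<Sum>j=1..d k. (Y k j x)\<^sup>2) \<le> B"
proof -
  define s where "s = sqrt r"
  have s: "0 < s" "s < 1" and s2: "s ^ 2 = r" using r by (auto simp: s_def)
  define P where "P = (1 - s) powr (- real CARD('n)) / \<omega>"
  show ?thesis
  proof
    show "\<omega> * P\<^sup>2 \<ge> 0" using omega_pos by simp
    fix k and x :: "real^'n" assume x: "norm x = 1"
    have sx: "norm (s *\<^sub>R x) < 1" using x s by simp
    have le: "poisson (s *\<^sub>R x) y / \<omega> \<le> P" if y: "norm y = 1" for y
    proof -
      have "1 - s \<le> dist (s *\<^sub>R x) y"
        using norm_triangle_ineq2[of y "s *\<^sub>R x"] x y s by (simp add: dist_norm norm_minus_commute)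
      then have "poisson (s *\<^sub>R x) y \<le> (1 - norm (s *\<^sub>R x) ^ 2) * (1 - s) powr (- real CARD('n))"
        by (intro poisson_le_far) (use sx s in auto)
      also have "\<dots> \<le> 1 * (1 - s) powr (- real CARD('n))" by (intro mult_right_mono) auto
      finally show ?thesis using omega_pos by (simp add: P_def divide_right_mono)
    qed
    have "r ^ k * (\<Sum>j=1..d k. (Y k j x)\<^sup>2) = (\<Sum>j=1..d k. (\<integral>y. poisson (s *\<^sub>R x) y / \<omega> * Y k j y \<partial>\<sigma>)\<^sup>2)"
    proof -
      have "r ^ k * (Y k j x)\<^sup>2 = (s ^ k * Y k j x)\<^sup>2" for j
        by (simp add: power_mult_distrib flip: s2 power_mult) (simp add: mult.commute)
      moreover have "(\<integral>y. poisson (s *\<^sub>R x) y / \<omega> * Y k j y \<partial>\<sigma>) = s ^ k * Y k j x" if "j \<in> {1..d k}" for j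
        by (rule poisson_Y[OF that x]) (use s in auto)
      ultimately show ?thesis unfolding sum_distrib_left by (intro sum.cong refl) simp
    qed
    also have "\<dots> \<le> (\<integral>y. (poisson (s *\<^sub>R x) y / \<omega>)\<^sup>2 \<partial>\<sigma>)"
      by (rule bessel) (auto intro!: Y_continuous continuous_on_poisson_omega[OF sx] simp: Y_orthonormal)
    also have "\<dots> \<le> \<omega> * P\<^sup>2"
    proof -
      have "norm (\<integral>y. (poisson (s *\<^sub>R x) y / \<omega>)\<^sup>2 \<partial>\<sigma>) \<le> \<omega> * P\<^sup>2"
      proof (rule integral_sphere_norm_le)
        show "continuous_on (sphere 0 1) (\<lambda>y. (poisson (s *\<^sub>R x) y / \<omega>)\<^sup>2)"
          by (intro continuous_on_power continuous_on_poisson_omega sx)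
        fix y :: "real^'n" assume "norm y = 1"
        then have "poisson (s *\<^sub>R x) y / \<omega> \<le> P" by (rule le)
        moreover have "poisson (s *\<^sub>R x) y / \<omega> \<ge> 0" using poisson_nonneg[of "s *\<^sub>R x" y] sx omega_pos by simp
        ultimately show "norm ((poisson (s *\<^sub>R x) y / \<omega>)\<^sup>2) \<le> P\<^sup>2" by (simp add: power_mono flip: power_divide)
      qed
      then show ?thesis by simp
    qed
    finally show "r ^ k * (\<Sum>j=1..d k. (Y k j x)\<^sup>2) \<le> \<omega> * P\<^sup>2" .
  qed
qed

lemma integrable_Y_mult: "j \<in> {1..d k} \<Longrightarrow> i \<in> {1..d l} \<Longrightarrow> integrable \<sigma> (\<lambda>x. Y k j x * Y l i x)"
  by (intro continuous_on_sphere_integrable continuous_on_mult Y_continuous)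

text \<open>
  The weights \<open>1 + Y\<^sup>2\<close> bound the number of basis functions, their absolute values and their squares at
  once; they grow subexponentially in the order.
\<close>
lemma sum_weight_le:
  assumes r: "0 < r" "r < 1"
  obtains B where "B \<ge> 0" "\<And>k x. norm x = 1 \<Longrightarrow> r ^ k * (\<Sum>j=1..d k. 1 + (Y k j x)\<^sup>2) \<le> B"
proof -
  obtain B where B: "B \<ge> 0" "\<And>k x. norm x = 1 \<Longrightarrow> r ^ k * (\<Sum>j=1..d k. (Y k j x)\<^sup>2) \<le> B"
    by (rule sum_Y_sq_le[OF r]) (rule that)
  show ?thesis
  proof
    show "\<omega> * B + B \<ge> 0" using B omega_pos by simp
    fix k and x :: "real^'n" assume x: "norm x = 1"
    \<comment> \<open>Each basis function has norm 1, so integrating the sum of squares counts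
      them.\<close>
    have "r ^ k * d k = (\<integral>x. r ^ k * (\<Sum>j=1..d k. (Y k j x)\<^sup>2) \<partial>\<sigma>)"
      by (simp add: power2_eq_square Bochner_Integration.integral_sum integrable_Y_mult Y_orthonormal)
    also have "norm \<dots> \<le> \<omega> * B"
      by (rule integral_sphere_norm_le)
        (use B r in \<open>auto intro!: continuous_intros Y_continuous simp: abs_of_nonneg sum_nonneg\<close>)
    finally have "r ^ k * d k \<le> \<omega> * B" by simp
    then show "r ^ k * (\<Sum>j=1..d k. 1 + (Y k j x)\<^sup>2) \<le> \<omega> * B + B"
      using B(2)[OF x, of k] by (simp add: sum.distrib distrib_left)
  qed
qed

section \<open>Exponentially decaying coefficient arrays and their series on the sphere\<close>

definition block :: "(nat \<Rightarrow> nat \<Rightarrow> complex) \<Rightarrow> nat \<Rightarrow> real^'n \<Rightarrow> complex" where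
  "block a k x = (\<Sum>j=1..d k. a k j * of_real (Y k j x))"

text \<open>Series live on the unit sphere only. The radius is moved into the coefficients by
  \<open>dilate\<close>, so a single theory of decaying arrays covers all radii and, with one point
  frozen, all kernels.\<close>

definition sphere_series :: "(nat \<Rightarrow> nat \<Rightarrow> complex) \<Rightarrow> real^'n \<Rightarrow> complex" where
  "sphere_series a x = (\<Sum>k. block a k x)"

text \<open>The constants are explicit because the gliding hump needs families of arrays that share
  them; \<open>exp_decay\<close> forgets them.\<close>

definition decays :: "real \<Rightarrow> real \<Rightarrow> (nat \<Rightarrow> nat \<Rightarrow> complex) \<Rightarrow> bool" where
  "decays C s a \<longleftrightarrow> 0 \<le> C \<and> 0 < s \<and> s < 1 \<and> (\<forall>k. \<forall>j\<in>{1..d k}. cmod (a k j) \<le> C * s ^ k)"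

definition exp_decay :: "(nat \<Rightarrow> nat \<Rightarrow> complex) \<Rightarrow> bool" where
  "exp_decay a \<longleftrightarrow> (\<exists>C s. decays C s a)"

text \<open>A constant depending on \<open>s\<close> alone. Of s^k = sqrt s^k sqrt s^k one factor
  absorbs the growth of the basis functions, the other remains as a geometric majorant.\<close>

definition weight_const :: "real \<Rightarrow> real" where
  "weight_const s = (SOME B. B \<ge> 0 \<and> (\<forall>k x. norm x = 1 \<longrightarrow> sqrt s ^ k * (\<Sum>j=1..d k. 1 + (Y k j x)\<^sup>2) \<le> B))"

lemma weight_const:
  assumes "0 < s" "s < 1"
  shows "weight_const s \<ge> 0"
    and "norm x = 1 \<Longrightarrow> s ^ k * (\<Sum>j=1..d k. 1 + (Y k j x)\<^sup>2) \<le> weight_const s * sqrt s ^ k"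
proof -
  have "0 < sqrt s" "sqrt s < 1" using assms by auto
  then have "\<exists>B. B \<ge> 0 \<and> (\<forall>k x. norm x = 1 \<longrightarrow> sqrt s ^ k * (\<Sum>j=1..d k. 1 + (Y k j x)\<^sup>2) \<le> B)"
    by (rule sum_weight_le) blast
  from someI_ex[OF this] have *: "weight_const s \<ge> 0 \<and> (\<forall>k x. norm x = 1 \<longrightarrow>
      sqrt s ^ k * (\<Sum>j=1..d k. 1 + (Y k j x)\<^sup>2) \<le> weight_const s)"
    unfolding weight_const_def .
  then show "weight_const s \<ge> 0" by blast
  assume "norm x = 1"
  then have "sqrt s ^ k * (\<Sum>j=1..d k. 1 + (Y k j x)\<^sup>2) \<le> weight_const s" using * by blast
  then have "sqrt s ^ k * (sqrt s ^ k * (\<Sum>j=1..d k. 1 + (Y k j x)\<^sup>2)) \<le> sqrt s ^ k * weight_const s"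
    using assms by (intro mult_left_mono) auto
  moreover have "sqrt s ^ k * sqrt s ^ k = s ^ k" using assms by (simp flip: power_mult_distrib)
  ultimately show "s ^ k * (\<Sum>j=1..d k. 1 + (Y k j x)\<^sup>2) \<le> weight_const s * sqrt s ^ k"
    by (simp add: mult.assoc[symmetric] mult.commute)
qed

lemma decays_weighted_sum:
  assumes a: "decays C s a" and x: "norm x = 1"
    and w: "\<And>j. j \<in> {1..d k} \<Longrightarrow> 0 \<le> w j" "\<And>j. j \<in> {1..d k} \<Longrightarrow> w j \<le> 1 + (Y k j x)\<^sup>2"
  shows "(\<Sum>j=1..d k. cmod (a k j) * w j) \<le> C * weight_const s * sqrt s ^ k"
proof -
  have C: "0 \<le> C" "0 < s" "s < 1" "\<And>k j. j \<in> {1..d k} \<Longrightarrow> cmod (a k j) \<le> C * s ^ k"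
    using a by (auto simp: decays_def)
  have "(\<Sum>j=1..d k. cmod (a k j) * w j) \<le> (\<Sum>j=1..d k. (C * s ^ k) * (1 + (Y k j x)\<^sup>2))"
    by (intro sum_mono mult_mono C w) (use C in auto)
  also have "\<dots> = C * (s ^ k * (\<Sum>j=1..d k. 1 + (Y k j x)\<^sup>2))" by (simp add: sum_distrib_left mult.assoc)
  also have "\<dots> \<le> C * (weight_const s * sqrt s ^ k)"
    by (intro mult_left_mono weight_const C x)
  finally show ?thesis by (simp add: mult.assoc)
qed

lemma abs_le_weight: "\<bar>y\<bar> \<le> 1 + (y::real)\<^sup>2"
proof -
  have "0 \<le> (\<bar>y\<bar> - 1)\<^sup>2" by simp
  also have "\<dots> = y\<^sup>2 - 2 * \<bar>y\<bar> + 1" by (simp add: power2_diff)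
  finally have "2 * \<bar>y\<bar> \<le> 1 + y\<^sup>2" by simp
  then show ?thesis by linarith
qed

lemma block_bound:
  assumes "decays C s a" "norm x = 1"
  shows "cmod (block a k x) \<le> C * weight_const s * sqrt s ^ k"
proof -
  have "cmod (block a k x) \<le> (\<Sum>j=1..d k. cmod (a k j) * \<bar>Y k j x\<bar>)"
    unfolding block_def by (rule order_trans[OF norm_sum]) (simp add: norm_mult)
  also have "\<dots> \<le> C * weight_const s * sqrt s ^ k"
    by (rule decays_weighted_sum[OF assms]) (auto simp: abs_le_weight)
  finally show ?thesis .
qed

lemma summable_block_bound: "0 < s \<Longrightarrow> s < 1 \<Longrightarrow> summable (\<lambda>k. C * weight_const s * sqrt s ^ k)"
  by (intro summable_mult summable_geometric) auto

lemma summable_norm_block: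
  assumes "exp_decay a" "norm x = 1"
  shows "summable (\<lambda>k. cmod (block a k x))"
proof -
  obtain C s where a: "decays C s a" using assms by (auto simp: exp_decay_def)
  then have "0 < s" "s < 1" by (auto simp: decays_def)
  then have "summable (\<lambda>k. C * weight_const s * sqrt s ^ k)" by (rule summable_block_bound)
  then show ?thesis
    by (rule summable_comparison_test') (use block_bound[OF a assms(2)] in simp)
qed

lemma sphere_series_sums:
  assumes "exp_decay a" "norm x = 1"
  shows "(\<lambda>k. block a k x) sums sphere_series a x"
  unfolding sphere_series_def by (intro summable_sums summable_norm_cancel[OF summable_norm_block] assms)

lemma sphere_series_bound:
  assumes "decays C s a" "norm x = 1"
  shows "cmod (sphere_series a x) \<le> C * weight_const s / (1 - sqrt s)"
proof -
  have s: "0 < s" "s < 1" "0 \<le> C" using assms by (auto simp: decays_def)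
  have "cmod (sphere_series a x) \<le> (\<Sum>k. cmod (block a k x))"
    unfolding sphere_series_def using assms by (intro summable_norm summable_norm_block) (auto simp: exp_decay_def)
  also have "\<dots> \<le> (\<Sum>k. C * weight_const s * sqrt s ^ k)"
    using assms s by (intro suminf_le block_bound summable_norm_block summable_block_bound) (auto simp: exp_decay_def)
  also have "\<dots> = C * weight_const s / (1 - sqrt s)"
    using s by (subst suminf_mult) (auto simp: suminf_geometric intro!: summable_geometric)
  finally show ?thesis .
qed

lemma continuous_on_block: "continuous_on (sphere 0 1) (block a k)"
  unfolding block_def
  by (intro continuous_on_sum continuous_on_mult continuous_on_const continuous_on_of_real Y_continuous)

lemma continuous_on_sphere_series:
  assumes "exp_decay a"
  shows "continuous_on (sphere 0 1) (sphere_series a)"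
proof -
  obtain C s where a: "decays C s a" using assms by (auto simp: exp_decay_def)
  then have s: "0 < s" "s < 1" by (auto simp: decays_def)
  have "uniform_limit (sphere 0 1) (\<lambda>N x. \<Sum>k<N. block a k x) (sphere_series a) sequentially"
    unfolding sphere_series_def
    by (rule Weierstrass_m_test[OF _ summable_block_bound[OF s, of C]]) (use block_bound[OF a] in simp)
  then show ?thesis
    by (rule uniform_limit_theorem[rotated 1]) (auto intro!: continuous_on_sum continuous_on_block always_eventually)
qed

lemma integrable_Y_complex:
  fixes \<phi> :: "real^'n \<Rightarrow> complex"
  assumes "continuous_on (sphere 0 1) \<phi>" "j \<in> {1..d k}"
  shows "integrable \<sigma> (\<lambda>x. of_real (Y k j x) * \<phi> x)"
  by (intro continuous_on_sphere_integrable continuous_on_mult continuous_on_of_real Y_continuous assms)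

lemma integral_block:
  assumes \<phi>: "continuous_on (sphere 0 1) \<phi>"
  shows "(\<integral>x. block a k x * \<phi> x \<partial>\<sigma>) = (\<Sum>j=1..d k. a k j * (\<integral>x. of_real (Y k j x) * \<phi> x \<partial>\<sigma>))"
proof -
  have "(\<integral>x. block a k x * \<phi> x \<partial>\<sigma>) = (\<integral>x. (\<Sum>j=1..d k. a k j * (of_real (Y k j x) * \<phi> x)) \<partial>\<sigma>)"
    by (simp add: block_def sum_distrib_right mult.assoc)
  also have "\<dots> = (\<Sum>j=1..d k. \<integral>x. a k j * (of_real (Y k j x) * \<phi> x) \<partial>\<sigma>)"
    by (intro Bochner_Integration.integral_sum integrable_mult_right integrable_Y_complex \<phi>)
  finally show ?thesis by simp
qed

lemma integral_sphere_series:
  assumes "exp_decay a" and \<phi>: "continuous_on (sphere 0 1) \<phi>"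
  shows "(\<lambda>k. \<Sum>j=1..d k. a k j * (\<integral>x. of_real (Y k j x) * \<phi> x \<partial>\<sigma>)) sums (\<integral>x. sphere_series a x * \<phi> x \<partial>\<sigma>)"
proof -
  obtain C s where a: "decays C s a" using assms by (auto simp: exp_decay_def)
  then have s: "0 < s" "s < 1" by (auto simp: decays_def)
  have c: "continuous_on (sphere 0 1) (\<lambda>x. block a k x * \<phi> x)" for k
    by (intro continuous_on_mult continuous_on_block \<phi>)
  have "bounded (\<phi> ` sphere 0 1)" by (intro compact_imp_bounded compact_continuous_image \<phi> compact_sphere)
  then obtain B where "\<forall>z\<in>\<phi> ` sphere 0 1. norm z \<le> B" unfolding bounded_iff by blast
  then have B: "cmod (\<phi> y) \<le> B" if "norm y = 1" for y using that by simp
  let ?M = "\<lambda>k. C * weight_const s * sqrt s ^ k * B"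
  have le: "cmod (block a k x * \<phi> x) \<le> ?M k" if "norm x = 1" for k x
    unfolding norm_mult by (intro mult_mono block_bound[OF a] B that)
      (auto intro: order_trans[OF norm_ge_zero block_bound[OF a that]])
  have sM: "summable ?M" by (intro summable_mult2 summable_block_bound s)
  have "(\<lambda>k. \<integral>x. block a k x * \<phi> x \<partial>\<sigma>) sums (\<integral>x. (\<Sum>k. block a k x * \<phi> x) \<partial>\<sigma>)"
  proof (rule sums_integral)
    show "integrable \<sigma> (\<lambda>x. block a k x * \<phi> x)" for k
      by (intro continuous_on_sphere_integrable c)
    show "AE x in \<sigma>. summable (\<lambda>k. norm (block a k x * \<phi> x))"
      by (rule AE_I2) (auto intro!: summable_comparison_test'[OF sM] le)
    show "summable (\<lambda>k. \<integral>x. norm (block a k x * \<phi> x) \<partial>\<sigma>)"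
    proof (rule summable_comparison_test'[OF summable_mult[OF sM, of \<omega>]])
      show "norm (\<integral>x. norm (block a k x * \<phi> x) \<partial>\<sigma>) \<le> \<omega> * ?M k" for k
        by (rule integral_sphere_norm_le) (use le in \<open>auto intro!: continuous_on_norm c\<close>)
    qed
  qed
  moreover have "(\<integral>x. (\<Sum>k. block a k x * \<phi> x) \<partial>\<sigma>) = (\<integral>x. sphere_series a x * \<phi> x \<partial>\<sigma>)"
    by (rule Bochner_Integration.integral_cong)
      (auto simp: sphere_series_def suminf_mult2[OF summable_norm_cancel[OF summable_norm_block[OF assms(1)]]])
  ultimately show ?thesis by (simp add: integral_block[OF \<phi>])
qed

lemma integral_sphere_series_Y:
  assumes "exp_decay a" and i: "i \<in> {1..d l}"
  shows "(\<integral>x. sphere_series a x * of_real (Y l i x) \<partial>\<sigma>) = a l i"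
proof -
  have c: "continuous_on (sphere 0 1) (\<lambda>x. complex_of_real (Y l i x))"
    by (intro continuous_on_of_real Y_continuous i)
  have "(\<Sum>j=1..d k. a k j * (\<integral>x. of_real (Y k j x) * complex_of_real (Y l i x) \<partial>\<sigma>)) = (if k = l then a l i else 0)" for k
  proof -
    have "(\<integral>x. of_real (Y k j x) * complex_of_real (Y l i x) \<partial>\<sigma>) = of_real (if k = l \<and> j = i then 1 else 0)"
      if "j \<in> {1..d k}" for j
      by (subst Y_orthonormal[OF that i, symmetric]) (simp flip: of_real_mult add: integral_complex_of_real)
    then have "(\<Sum>j=1..d k. a k j * (\<integral>x. of_real (Y k j x) * complex_of_real (Y l i x) \<partial>\<sigma>))
      = (\<Sum>j=1..d k. if j = i then (if k = l then a k j else 0) else 0)"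
      by (intro sum.cong refl) auto
    then show ?thesis using i by auto
  qed
  then have "(\<lambda>k. if k = l then a l i else 0) sums (\<integral>x. sphere_series a x * of_real (Y l i x) \<partial>\<sigma>)"
    using integral_sphere_series[OF assms(1) c] by simp
  moreover have "(\<lambda>k. if k = l then a l i else 0) sums a l i" using sums_single[of l "\<lambda>_. a l i"] by simp
  ultimately show ?thesis by (rule sums_unique2)
qed

text \<open>Freezing one variable of a kernel replaces the rate \<open>s\<close> by
  \<open>sqrt s\<close>, with a constant that does not depend on the point.\<close>

lemma decays_mult_Y:
  assumes a: "decays C s a" and x: "norm x = 1"
  shows "decays (C * weight_const s) (sqrt s) (\<lambda>k j. a k j * of_real (Y k j x))"
proof -
  have C: "0 \<le> C" "0 < s" "s < 1" using a by (auto simp: decays_def)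
  have "cmod (a k j) * \<bar>Y k j x\<bar> \<le> C * weight_const s * sqrt s ^ k" if j: "j \<in> {1..d k}" for k j
  proof -
    have "cmod (a k j) * \<bar>Y k j x\<bar> \<le> (\<Sum>j=1..d k. cmod (a k j) * \<bar>Y k j x\<bar>)"
      by (rule member_le_sum[OF j]) auto
    also have "\<dots> \<le> C * weight_const s * sqrt s ^ k"
      by (rule decays_weighted_sum[OF a x]) (auto simp: abs_le_weight)
    finally show ?thesis .
  qed
  then show ?thesis using C weight_const(1)[OF C(2,3)] by (auto simp: decays_def norm_mult)
qed

lemma exp_decay_mult_Y:
  "exp_decay a \<Longrightarrow> norm x = 1 \<Longrightarrow> exp_decay (\<lambda>k j. a k j * of_real (Y k j x))"
  unfolding exp_decay_def using decays_mult_Y by blast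

lemma decays_mult_bounded:
  assumes "decays C s a" "\<And>k j. j \<in> {1..d k} \<Longrightarrow> cmod (b k j) \<le> D" "D \<ge> 0"
  shows "decays (D * C) s (\<lambda>k j. b k j * a k j)"
  using assms unfolding decays_def norm_mult
  by (auto simp: mult.assoc intro!: mult_mono)

lemma decays_bounded: "decays C s a \<Longrightarrow> j \<in> {1..d k} \<Longrightarrow> cmod (a k j) \<le> C"
  unfolding decays_def by (meson less_imp_le mult_left_le order_trans power_le_one)

lemma exp_decay_mult:
  assumes "exp_decay b" "exp_decay a"
  shows "exp_decay (\<lambda>k j. b k j * a k j)"
proof -
  obtain D t C s where b: "decays D t b" and a: "decays C s a" using assms by (auto simp: exp_decay_def)
  have "decays (D * C) s (\<lambda>k j. b k j * a k j)"
    by (rule decays_mult_bounded[OF a decays_bounded[OF b]]) (use b in \<open>auto simp: decays_def\<close>)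
  then show ?thesis unfolding exp_decay_def by blast
qed

text \<open>The integral kernel of the operator that multiplies coefficients by \<open>c\<close>,
  namely the sum of \<open>c k j\<close> Y(x) Y(y). It is symmetric in x and y.\<close>

definition sphere_kernel :: "(nat \<Rightarrow> nat \<Rightarrow> complex) \<Rightarrow> real^'n \<Rightarrow> real^'n \<Rightarrow> complex" where
  "sphere_kernel c x = sphere_series (\<lambda>k j. c k j * of_real (Y k j x))"

lemma sphere_kernel_commute: "sphere_kernel c x y = sphere_kernel c y x"
  by (simp add: sphere_kernel_def sphere_series_def block_def mult_ac)

lemma continuous_on_sphere_kernel:
  "exp_decay c \<Longrightarrow> norm x = 1 \<Longrightarrow> continuous_on (sphere 0 1) (sphere_kernel c x)"
  unfolding sphere_kernel_def by (intro continuous_on_sphere_series exp_decay_mult_Y)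

text \<open>Termwise integration and orthonormality; this is how products of coefficient arrays
  become integrals to which L^1 estimates apply.\<close>

lemma integral_sphere_kernel:
  assumes c: "exp_decay c" and b: "exp_decay b" and x: "norm x = 1"
  shows "(\<integral>y. sphere_kernel c x y * sphere_series b y \<partial>\<sigma>) = sphere_series (\<lambda>k j. c k j * b k j) x"
proof -
  have "(\<lambda>k. \<Sum>j=1..d k. c k j * of_real (Y k j x) * (\<integral>y. of_real (Y k j y) * sphere_series b y \<partial>\<sigma>)) sums
      (\<integral>y. sphere_kernel c x y * sphere_series b y \<partial>\<sigma>)"
    unfolding sphere_kernel_def
    by (rule integral_sphere_series[OF exp_decay_mult_Y[OF c x] continuous_on_sphere_series[OF b]])
  moreover have "(\<Sum>j=1..d k. c k j * of_real (Y k j x) * (\<integral>y. of_real (Y k j y) * sphere_series b y \<partial>\<sigma>))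
      = block (\<lambda>k j. c k j * b k j) k x" for k
    unfolding block_def
    by (intro sum.cong refl) (simp add: integral_sphere_series_Y[OF b] mult.commute[of "of_real _" "sphere_series b _"])
  ultimately have "(\<lambda>k. block (\<lambda>k j. c k j * b k j) k x) sums (\<integral>y. sphere_kernel c x y * sphere_series b y \<partial>\<sigma>)"
    by simp
  then show ?thesis by (rule sums_unique2[OF sphere_series_sums[OF exp_decay_mult[OF c b] x], symmetric])
qed

text \<open>Density of the span forces the L^2 norm of h to vanish, hence h = 0 almost everywhere.
  The Poisson integral ignores null sets, and its boundary limit recovers h(y) at every single
  point.\<close>

lemma orthogonal_imp_zero:
  fixes h :: "real^'n \<Rightarrow> complex"
  assumes h: "continuous_on (sphere 0 1) h"
    and orth: "\<And>k j. j \<in> {1..d k} \<Longrightarrow> (\<integral>x. h x * of_real (Y k j x) \<partial>\<sigma>) = 0"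
    and y: "norm y = 1"
  shows "h y = 0"
proof -
  have ih: "integrable \<sigma> (\<lambda>x. (cmod (h x))\<^sup>2)"
    by (intro continuous_on_sphere_integrable continuous_on_power continuous_on_norm h)
  have le: "(\<integral>x. (cmod (h x))\<^sup>2 \<partial>\<sigma>) < \<epsilon>" if eps: "\<epsilon> > 0" for \<epsilon>
  proof -
    obtain N a where Na: "(\<integral>x. (cmod (h x - (\<Sum>k<N. \<Sum>j=1..d k. a k j * of_real (Y k j x))))\<^sup>2 \<partial>\<sigma>) < \<epsilon>"
      using basis continuous_on_sphere_measurable[OF h] ih eps unfolding spherical_basis_def d_eq by blast
    define S where "S x = (\<Sum>k<N. \<Sum>j=1..d k. a k j * complex_of_real (Y k j x))" for x
    have S: "continuous_on (sphere 0 1) S" unfolding S_def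
      by (intro continuous_on_sum continuous_on_mult continuous_on_const continuous_on_of_real Y_continuous)
    have iY: "integrable \<sigma> (\<lambda>x. h x * of_real (Y k j x))" if "j \<in> {1..d k}" for k j
      by (intro continuous_on_sphere_integrable continuous_on_mult h continuous_on_of_real Y_continuous that)
    have "(\<integral>x. h x * cnj (S x) \<partial>\<sigma>) = (\<integral>x. (\<Sum>k<N. \<Sum>j=1..d k. cnj (a k j) * (h x * of_real (Y k j x))) \<partial>\<sigma>)"
      by (simp add: S_def sum_distrib_left mult_ac)
    also have "\<dots> = (\<Sum>k<N. \<Sum>j=1..d k. cnj (a k j) * (\<integral>x. h x * of_real (Y k j x) \<partial>\<sigma>))"
    proof -
      have i: "integrable \<sigma> (\<lambda>x. \<Sum>j=1..d k. cnj (a k j) * (h x * of_real (Y k j x)))" for k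
        by (intro Bochner_Integration.integrable_sum integrable_mult_right iY)
      have "(\<integral>x. (\<Sum>j=1..d k. cnj (a k j) * (h x * of_real (Y k j x))) \<partial>\<sigma>)
          = (\<Sum>j=1..d k. \<integral>x. cnj (a k j) * (h x * of_real (Y k j x)) \<partial>\<sigma>)" for k
        by (intro Bochner_Integration.integral_sum integrable_mult_right iY)
      then show ?thesis using i by (simp add: Bochner_Integration.integral_sum)
    qed
    also have "\<dots> = 0" using orth by simp
    finally have z: "(\<integral>x. h x * cnj (S x) \<partial>\<sigma>) = 0" .
    have i1: "integrable \<sigma> (\<lambda>x. (cmod (h x - S x))\<^sup>2)" and i2: "integrable \<sigma> (\<lambda>x. h x * cnj (S x))"
      by (intro continuous_on_sphere_integrable continuous_intros h S)+
    have "(\<integral>x. (cmod (h x))\<^sup>2 \<partial>\<sigma>) \<le> (\<integral>x. (cmod (h x - S x))\<^sup>2 + 2 * Re (h x * cnj (S x)) \<partial>\<sigma>)"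
    proof (rule integral_mono[OF ih])
      show "integrable \<sigma> (\<lambda>x. (cmod (h x - S x))\<^sup>2 + 2 * Re (h x * cnj (S x)))"
        by (intro Bochner_Integration.integrable_add integrable_mult_right i1 integrable_Re i2)
      \<comment> \<open>The two sides differ by |S|^2, and the cross term integrates to 0 by
        orthogonality.\<close>
      show "(cmod (h x))\<^sup>2 \<le> (cmod (h x - S x))\<^sup>2 + 2 * Re (h x * cnj (S x))" for x
      proof -
        have "(cmod (h x - S x))\<^sup>2 + 2 * Re (h x * cnj (S x)) = (cmod (h x))\<^sup>2 + (cmod (S x))\<^sup>2"
          unfolding cmod_power2 by (simp add: power2_eq_square algebra_simps)
        then show ?thesis by simp
      qed
    qed
    also have "\<dots> = (\<integral>x. (cmod (h x - S x))\<^sup>2 \<partial>\<sigma>) + 2 * (\<integral>x. Re (h x * cnj (S x)) \<partial>\<sigma>)"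
      by (subst Bochner_Integration.integral_add[OF i1 integrable_mult_right[OF integrable_Re[OF i2]]])
        (simp only: integral_mult_right_zero)
    also have "(\<integral>x. Re (h x * cnj (S x)) \<partial>\<sigma>) = 0" using integral_Re[OF i2] z by simp
    finally show ?thesis using Na by (simp add: S_def)
  qed
  have "(\<integral>x. (cmod (h x))\<^sup>2 \<partial>\<sigma>) \<le> 0"
    using le by (meson less_irrefl not_le)
  then have "(\<integral>x. (cmod (h x))\<^sup>2 \<partial>\<sigma>) = 0" by (simp add: integral_nonneg_AE order_antisym)
  then have "AE x in \<sigma>. (cmod (h x))\<^sup>2 = 0" using integral_nonneg_eq_0_iff_AE[OF ih] by simp
  then have ae: "AE x in \<sigma>. h x = 0" by simp
  have "poisson_integral h x = 0" if x: "norm x < 1" for x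
  proof -
    have "poisson_integral h x = (\<integral>y. 0 \<partial>\<sigma>)" unfolding poisson_integral_def
    proof (rule integral_cong_AE)
      show "(\<lambda>y. (poisson x y / \<omega>) *\<^sub>R h y) \<in> borel_measurable \<sigma>"
        by (intro continuous_on_sphere_measurable continuous_on_scaleR continuous_on_poisson_omega x h)
      show "AE y in \<sigma>. (poisson x y / \<omega>) *\<^sub>R h y = 0" using ae by eventually_elim simp
    qed simp
    then show ?thesis by simp
  qed
  then have "eventually (\<lambda>x. poisson_integral h x = 0) (at y within ball 0 1)"
    by (simp add: eventually_at_filter)
  then have "((\<lambda>x. 0) \<longlongrightarrow> h y) (at y within ball 0 1)"
    by (rule Lim_transform_eventually[OF poisson_integral_tendsto_boundary[OF h y]])
  moreover have "at y within ball 0 1 \<noteq> bot"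
  proof -
    have "y islimpt ball 0 1" using y by (simp add: islimpt_ball)
    then show ?thesis by (simp add: trivial_limit_within)
  qed
  ultimately show ?thesis by (metis tendsto_const tendsto_unique)
qed

lemma decays_power: "0 < r \<Longrightarrow> r < 1 \<Longrightarrow> decays 1 r (\<lambda>k j. of_real (r ^ k))"
  by (simp add: decays_def norm_power)

lemma exp_decay_power:
  assumes "0 \<le> r" "r < 1" shows "exp_decay (\<lambda>k j. of_real (r ^ k))"
proof (cases "r = 0")
  case True
  then have "decays 1 (1/2) (\<lambda>k j. of_real (r ^ k))" by (simp add: decays_def power_0_left)
  then show ?thesis by (auto simp: exp_decay_def)
next
  case False
  then show ?thesis using decays_power[of r] assms by (auto simp: exp_decay_def)
qed

text \<open>Series form and closed form of the Poisson kernel are continuous in y with the same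
  coefficients, so completeness of the basis identifies them.\<close>

lemma sphere_kernel_power:
  assumes x: "norm x = 1" and y: "norm y = 1" and r: "0 \<le> r" "r < 1"
  shows "sphere_kernel (\<lambda>k j. of_real (r ^ k)) x y = of_real (poisson (r *\<^sub>R x) y / \<omega>)"
proof -
  have rx: "norm (r *\<^sub>R x) < 1" using x r by simp
  let ?h = "\<lambda>y. sphere_kernel (\<lambda>k j. of_real (r ^ k)) x y - complex_of_real (poisson (r *\<^sub>R x) y / \<omega>)"
  have c1: "continuous_on (sphere 0 1) (sphere_kernel (\<lambda>k j. of_real (r ^ k)) x)"
    by (intro continuous_on_sphere_kernel exp_decay_power r x)
  have c2: "continuous_on (sphere 0 1) (\<lambda>y. complex_of_real (poisson (r *\<^sub>R x) y / \<omega>))"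
    by (intro continuous_on_of_real continuous_on_poisson_omega rx)
  have "?h y = 0"
  proof (rule orthogonal_imp_zero[OF _ _ y])
    show "continuous_on (sphere 0 1) ?h" by (intro continuous_on_diff c1 c2)
    fix k j assume j: "j \<in> {1..d k}"
    have cY: "continuous_on (sphere 0 1) (\<lambda>y. complex_of_real (Y k j y))"
      by (intro continuous_on_of_real Y_continuous j)
    have "(\<integral>y. ?h y * of_real (Y k j y) \<partial>\<sigma>) = (\<integral>y. sphere_kernel (\<lambda>k j. of_real (r ^ k)) x y * of_real (Y k j y) \<partial>\<sigma>)
        - (\<integral>y. complex_of_real (poisson (r *\<^sub>R x) y / \<omega>) * of_real (Y k j y) \<partial>\<sigma>)"
      unfolding left_diff_distrib
      by (intro Bochner_Integration.integral_diff continuous_on_sphere_integrable continuous_on_mult c1 c2 cY)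
    also have "(\<integral>y. sphere_kernel (\<lambda>k j. of_real (r ^ k)) x y * of_real (Y k j y) \<partial>\<sigma>) = of_real (r ^ k) * of_real (Y k j x)"
      unfolding sphere_kernel_def by (rule integral_sphere_series_Y[OF exp_decay_mult_Y[OF exp_decay_power[OF r] x] j])
    also have "(\<integral>y. complex_of_real (poisson (r *\<^sub>R x) y / \<omega>) * of_real (Y k j y) \<partial>\<sigma>) = of_real (r ^ k * Y k j x)"
      by (subst poisson_Y[OF j x r, symmetric]) (simp only: of_real_mult[symmetric] integral_complex_of_real)
    finally show "(\<integral>y. ?h y * of_real (Y k j y) \<partial>\<sigma>) = 0" by simp
  qed
  then show ?thesis by simp
qed

end

lemma harmonic_on_locally:
  assumes S: "open S" and loc: "\<And>x. x \<in> S \<Longrightarrow> \<exists>T. open T \<and> x \<in> T \<and> T \<subseteq> S \<and> harmonic_on f T"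
  shows "harmonic_on f S"
proof -
  have d: "g differentiable_on S" if "\<And>T. open T \<Longrightarrow> T \<subseteq> S \<Longrightarrow> harmonic_on f T \<Longrightarrow> g differentiable_on T" for g
    unfolding differentiable_on_eq_differentiable_at[OF S]
    using loc that differentiable_on_eq_differentiable_at by blast
  show ?thesis unfolding harmonic_on_def
  proof (intro conjI allI ballI)
    show "f differentiable_on S" "partial_deriv i f differentiable_on S" for i
      by (rule d; simp add: harmonic_on_def)+
    show "continuous_on S (partial_deriv j (partial_deriv i f))" for i j
    proof (rule continuous_at_imp_continuous_on, rule ballI)
      fix x assume "x \<in> S"
      then obtain T where "open T" "x \<in> T" "harmonic_on f T" using loc by blast
      then show "isCont (partial_deriv j (partial_deriv i f)) x"
        unfolding harmonic_on_def using continuous_on_eq_continuous_at by blast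
    qed
    show "(\<Sum>i\<in>UNIV. partial_deriv i (partial_deriv i f) x) = 0" if "x \<in> S" for x
      using loc[OF that] by (auto simp: harmonic_on_def)
  qed
qed

lemma ball_polar:
  fixes x :: "real^'n"
  assumes "norm x < R"
  obtains r u where "x = r *\<^sub>R u" "norm u = 1" "0 \<le> r" "r < R"
proof (cases "x = 0")
  case True
  have "x = 0 *\<^sub>R axis undefined 1" using True by simp
  then show ?thesis using that[of 0 "axis undefined 1"] assms True by (simp add: norm_axis_1)
next
  case False
  then have "x = norm x *\<^sub>R (x /\<^sub>R norm x)" "norm (x /\<^sub>R norm x) = 1" by auto
  then show ?thesis using that assms norm_ge_zero by blast
qed

context spherical_expansion
begin

section \<open>Expansion of harmonic functions\<close>

definition dilate :: "real \<Rightarrow> (nat \<Rightarrow> nat \<Rightarrow> complex) \<Rightarrow> nat \<Rightarrow> nat \<Rightarrow> complex" where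
  "dilate r a k j = of_real (r ^ k) * a k j"

text \<open>Subexponential growth. These are the coefficient arrays of harmonic functions on the
  ball, by \<open>harmonic_on_sph_series\<close> and \<open>harmonic_sph_coeff\<close>. Entries with
  \<open>j\<close> outside \<open>{1..d k}\<close> are meaningless and left unconstrained.\<close>

definition tame :: "(nat \<Rightarrow> nat \<Rightarrow> complex) \<Rightarrow> bool" where
  "tame a \<longleftrightarrow> (\<forall>s. 0 < s \<longrightarrow> s < 1 \<longrightarrow> (\<exists>C. \<forall>k. \<forall>j\<in>{1..d k}. s ^ k * cmod (a k j) \<le> C))"

lemma tameD:
  assumes "tame a" "0 < s" "s < 1"
  obtains C where "C \<ge> 0" "\<And>k j. j \<in> {1..d k} \<Longrightarrow> s ^ k * cmod (a k j) \<le> C"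
proof -
  obtain C where "\<forall>k. \<forall>j\<in>{1..d k}. s ^ k * cmod (a k j) \<le> C" using assms unfolding tame_def by blast
  then show ?thesis by (intro that[of "max C 0"]) (auto simp: le_max_iff_disj)
qed

text \<open>Of r^k = sqrt r^k sqrt r^k one factor tames the coefficients and the other is the decay;
  the pair of constants then works for all radii up to r.\<close>

lemma tame_decays:
  assumes "tame a" "0 < r" "r < 1"
  obtains C s where "\<And>t. 0 \<le> t \<Longrightarrow> t \<le> r \<Longrightarrow> decays C s (dilate t a)"
proof -
  have s: "0 < sqrt r" "sqrt r < 1" using assms by auto
  obtain C where C: "C \<ge> 0" "\<And>k j. j \<in> {1..d k} \<Longrightarrow> sqrt r ^ k * cmod (a k j) \<le> C"
    by (rule tameD[OF assms(1) s]) (rule that)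
  have "decays C (sqrt r) (dilate t a)" if t: "0 \<le> t" "t \<le> r" for t
    unfolding decays_def
  proof (intro conjI allI ballI)
    fix k j assume j: "j \<in> {1..d k}"
    have "cmod (dilate t a k j) \<le> r ^ k * cmod (a k j)"
      using t by (simp add: dilate_def norm_mult norm_power mult_right_mono power_mono)
    also have "r ^ k = sqrt r ^ k * sqrt r ^ k" using assms by (simp flip: power_mult_distrib)
    also have "sqrt r ^ k * sqrt r ^ k * cmod (a k j) \<le> sqrt r ^ k * C"
      using C(2)[OF j] assms by (simp add: mult.assoc mult_left_mono)
    finally show "cmod (dilate t a k j) \<le> C * sqrt r ^ k" by (simp add: mult.commute)
  qed (use C s in auto)
  then show ?thesis by (rule that)
qed

lemma tame_exp_decay:
  assumes "tame a" "0 \<le> r" "r < 1"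
  shows "exp_decay (dilate r a)"
proof -
  have "0 < (1 + r) / 2" "(1 + r) / 2 < 1" using assms by auto
  then obtain C s where "\<And>t. 0 \<le> t \<Longrightarrow> t \<le> (1 + r) / 2 \<Longrightarrow> decays C s (dilate t a)"
    by (rule tame_decays[OF assms(1)]) (rule that)
  then have "decays C s (dilate r a)" using assms by auto
  then show ?thesis unfolding exp_decay_def by blast
qed

lemma tame_cong:
  "(\<And>k j. j \<in> {1..d k} \<Longrightarrow> a k j = b k j) \<Longrightarrow> tame a \<longleftrightarrow> tame b"
  by (simp add: tame_def)

lemma block_cong:
  "(\<And>j. j \<in> {1..d k} \<Longrightarrow> a k j = b k j) \<Longrightarrow> block a k x = block b k x"
  by (auto simp: block_def intro!: sum.cong)

lemma sphere_series_cong: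
  "(\<And>k j. j \<in> {1..d k} \<Longrightarrow> a k j = b k j) \<Longrightarrow> sphere_series a x = sphere_series b x"
  unfolding sphere_series_def by (intro arg_cong[where f=suminf] ext block_cong)

lemma sph_term_cong:
  "(\<And>k j. j \<in> {1..d k} \<Longrightarrow> a k j = b k j) \<Longrightarrow> sph_term Y a = sph_term Y b"
  by (intro ext) (auto simp: sph_term_def d_eq intro!: sum.cong)

lemma block_dilate: "block (dilate r a) k x = of_real (r ^ k) * block a k x"
  by (simp add: block_def dilate_def sum_distrib_left mult.assoc)

lemma sph_term_eq_block:
  assumes u: "norm u = 1" and r: "0 \<le> r"
  shows "sph_term Y a (r *\<^sub>R u) k = block (dilate r a) k u"
proof (cases "r = 0")
  case False
  moreover have "u \<noteq> 0" using u by auto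
  ultimately have "direction (r *\<^sub>R u) = u" using u r by (simp add: direction_def)
  then show ?thesis using u r unfolding block_dilate by (simp add: sph_term_def block_def flip: d_eq)
next
  case True
  have dir: "norm (direction (0::real^'n)) = 1"
    unfolding direction_def using someI[of "\<lambda>u::real^'n. norm u = 1" u] u by simp
  show ?thesis
  proof (cases k)
    case 0
    have "Y 0 j (direction 0) = Y 0 j u" if "j \<in> {1..d 0}" for j by (rule Y_0_constant[OF that dir u])
    then show ?thesis using True 0 unfolding block_dilate
      by (auto simp: sph_term_def block_def simp flip: d_eq intro!: sum.cong)
  qed (use True in \<open>simp add: sph_term_def block_dilate\<close>)
qed

lemma sph_series_eq:
  "norm u = 1 \<Longrightarrow> 0 \<le> r \<Longrightarrow> sph_series Y a (r *\<^sub>R u) = sphere_series (dilate r a) u"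
  by (simp add: sph_series_def sphere_series_def sph_term_eq_block)

lemma tame_sums:
  assumes "tame a" "norm x < 1"
  shows "sph_term Y a x sums sph_series Y a x"
proof -
  obtain r u where x: "x = r *\<^sub>R u" "norm u = 1" "0 \<le> r" "r < 1" using ball_polar[OF assms(2)] by blast
  moreover have "sph_term Y a (r *\<^sub>R u) = (\<lambda>k. block (dilate r a) k u)"
    using x by (auto simp: sph_term_eq_block)
  ultimately show ?thesis using sphere_series_sums[OF tame_exp_decay[OF assms(1)], of r u]
    by (simp add: sph_series_eq)
qed

lemma tame_sph_converges: "tame a \<Longrightarrow> sph_converges Y a"
  unfolding sph_converges_def by (auto intro: sums_summable[OF tame_sums])

text \<open>Along each ray the expansion is a power series in r, so the blocks of each order agree
  on the sphere; orthonormality within one order separates the indices j.\<close>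

lemma coeff_unique:
  assumes a: "\<forall>x\<in>ball 0 1. sph_term Y a x sums f x" and b: "\<forall>x\<in>ball 0 1. sph_term Y b x sums f x"
    and j: "j \<in> {1..d k}"
  shows "a k j = b k j"
proof -
  have eq: "block a k u - block b k u = 0" if u: "norm u = 1" for k u
  proof (rule power_series_eq_0[of "\<lambda>k. block a k u - block b k u"])
    fix r :: real assume r: "0 \<le> r" "r < 1"
    then have "r *\<^sub>R u \<in> ball 0 1" using u by simp
    then have "(\<lambda>k. sph_term Y a (r *\<^sub>R u) k - sph_term Y b (r *\<^sub>R u) k) sums (f (r *\<^sub>R u) - f (r *\<^sub>R u))"
      using a b by (intro sums_diff) auto
    then show "(\<lambda>k. (block a k u - block b k u) * of_real r ^ k) sums 0"
      using u r by (simp add: sph_term_eq_block block_dilate algebra_simps)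
  qed
  have c: "continuous_on (sphere 0 1) (\<lambda>x. complex_of_real (Y k j x))"
    by (intro continuous_on_of_real Y_continuous j)
  have Y: "(\<integral>x. block a k x * of_real (Y k j x) \<partial>\<sigma>) = a k j" for a
  proof -
    have "(\<integral>x. of_real (Y k i x) * complex_of_real (Y k j x) \<partial>\<sigma>) = of_real (if i = j then 1 else 0)"
      if "i \<in> {1..d k}" for i
      using Y_orthonormal[OF that j] by (simp flip: of_real_mult add: integral_complex_of_real)
    then have "(\<integral>x. block a k x * of_real (Y k j x) \<partial>\<sigma>) = (\<Sum>i=1..d k. if i = j then a k i else 0)"
      unfolding integral_block[OF c] by (intro sum.cong refl) auto
    then show ?thesis using j by auto
  qed
  have "(\<integral>x. block a k x * of_real (Y k j x) \<partial>\<sigma>) = (\<integral>x. block b k x * of_real (Y k j x) \<partial>\<sigma>)"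
    by (rule Bochner_Integration.integral_cong) (use eq in auto)
  then show ?thesis by (simp add: Y)
qed

lemma sph_coeff_eq:
  assumes "\<forall>x\<in>ball 0 1. sph_term Y b x sums f x" and "j \<in> {1..d k}"
  shows "sph_coeff Y f k j = b k j"
proof -
  have "\<forall>x\<in>ball 0 1. sph_term Y (sph_coeff Y f) x sums f x"
    using someI[of "\<lambda>b. \<forall>x\<in>ball 0 1. sph_term Y b x sums f x" b] assms(1) unfolding sph_coeff_def by blast
  then show ?thesis by (rule coeff_unique) (rule assms)+
qed

lemma sph_coeff_sph_series:
  "tame a \<Longrightarrow> j \<in> {1..d k} \<Longrightarrow> sph_coeff Y (sph_series Y a) k j = a k j"
  by (rule sph_coeff_eq) (auto simp: tame_sums)

text \<open>No termwise differentiation: on the ball of radius R < 1 the series is the Poisson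
  integral of its own restriction to the sphere of radius R, hence harmonic there.\<close>

lemma harmonic_on_sph_series:
  assumes a: "tame a"
  shows "harmonic_on (sph_series Y a) (ball 0 1)"
proof (rule harmonic_on_locally)
  fix x :: "real^'n" assume x: "x \<in> ball 0 1"
  define R where "R = (1 + norm x) / 2"
  have R: "0 < R" "R < 1" "norm x < R" using x by (auto simp: R_def intro: add_pos_nonneg)
  let ?F = "sphere_series (dilate R a)"
  have F: "continuous_on (sphere 0 1) ?F"
    by (intro continuous_on_sphere_series tame_exp_decay a) (use R in auto)
  have h: "harmonic_on (\<lambda>x. poisson_integral ?F ((1 / R) *\<^sub>R x)) (ball 0 R)"
    by (rule harmonic_on_dilation[OF open_ball harmonic_on_poisson_integral[OF F]]) (use R in auto)
  have "poisson_integral ?F ((1 / R) *\<^sub>R z) = sph_series Y a z" if z: "z \<in> ball 0 R" for z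
  proof -
    have "norm z < R" using z by simp
    then obtain t u where u: "z = t *\<^sub>R u" "norm u = 1" "0 \<le> t" "t < R" using ball_polar[of z R] by blast
    have q: "0 \<le> t / R" "t / R < 1" using u R by auto
    have zz: "(1 / R) *\<^sub>R z = (t / R) *\<^sub>R u" by (simp add: u(1))
    have "poisson_integral ?F ((1 / R) *\<^sub>R z) = (\<integral>y. sphere_kernel (\<lambda>k j. of_real ((t / R) ^ k)) u y * ?F y \<partial>\<sigma>)"
      unfolding poisson_integral_def zz
      by (rule Bochner_Integration.integral_cong[OF refl], subst sphere_kernel_power[OF u(2) _ q])
        (simp_all only: space_sigma mem_sphere_0 scaleR_conv_of_real)
    also have "\<dots> = sphere_series (\<lambda>k j. of_real ((t / R) ^ k) * dilate R a k j) u"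
      by (rule integral_sphere_kernel[OF exp_decay_power[OF q] tame_exp_decay[OF a] u(2)]) (use R in auto)
    also have "(\<lambda>k j. of_real ((t / R) ^ k) * dilate R a k j) = dilate t a"
      using R by (auto simp: dilate_def fun_eq_iff power_divide)
    finally show ?thesis using u by (simp add: sph_series_eq)
  qed
  then have "harmonic_on (sph_series Y a) (ball 0 R)"
    by (rule harmonic_on_cong[OF open_ball h])
  then show "\<exists>T. open T \<and> x \<in> T \<and> T \<subseteq> ball 0 1 \<and> harmonic_on (sph_series Y a) T"
    using R by (intro exI[of _ "ball 0 R"]) auto
qed simp

lemma abs_Y_le:
  assumes s: "0 < s" "s < 1" and j: "j \<in> {1..d k}" and y: "norm y = 1"
  shows "s ^ k * \<bar>Y k j y\<bar> \<le> weight_const s"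
proof -
  have "s ^ k * \<bar>Y k j y\<bar> \<le> s ^ k * (1 + (Y k j y)\<^sup>2)"
    using s by (intro mult_left_mono abs_le_weight) auto
  also have "\<dots> \<le> s ^ k * (\<Sum>j=1..d k. 1 + (Y k j y)\<^sup>2)"
    using s by (intro mult_left_mono member_le_sum[OF j]) auto
  also have "\<dots> \<le> weight_const s * sqrt s ^ k" by (rule weight_const(2)[OF s y])
  also have "\<dots> \<le> weight_const s * 1"
    using s by (intro mult_left_mono weight_const(1)) (auto simp: power_le_one)
  finally show ?thesis by simp
qed

text \<open>f may be unbounded near the sphere, so the Poisson formula is applied to x -> f(Rx) with
  R < 1. Its kernel series gives an expansion with coefficients \<open>B R\<close>, and these have
  to be matched for different R.\<close>

lemma harmonic_expansion:
  fixes f :: "real^'n \<Rightarrow> complex"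
  assumes f: "harmonic_on f (ball 0 1)"
  obtains b where "tame b" "\<forall>x\<in>ball 0 1. sph_term Y b x sums f x"
proof -
  define B where "B R k j = (\<integral>y. of_real (Y k j y) * f (R *\<^sub>R y) \<partial>\<sigma>)" for R k j
  have fc: "continuous_on (ball 0 1) f" by (rule harmonic_on_imp_continuous_on[OF f])
  have gc: "continuous_on (cball 0 1) (\<lambda>y. f (R *\<^sub>R y))" if R: "0 < R" "R < 1" for R
  proof (rule continuous_on_compose2[OF fc])
    have "norm (R *\<^sub>R y) < 1" if "norm y \<le> 1" for y :: "real^'n"
      using that R by (simp add: mult_le_one le_less_trans[OF mult_left_le[of "norm y" R]])
    then show "(\<lambda>y. R *\<^sub>R y) ` cball 0 1 \<subseteq> ball (0::real^'n) 1" by auto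
  qed (intro continuous_intros)
  have gs: "continuous_on (sphere 0 1) (\<lambda>y. f (R *\<^sub>R y))" if R: "0 < R" "R < 1" for R
    by (rule continuous_on_subset[OF gc[OF R]]) auto
  have tB: "tame (B R)" if R: "0 < R" "R < 1" for R
    unfolding tame_def
  proof (intro allI impI)
    fix s :: real assume s: "0 < s" "s < 1"
    have "bounded ((\<lambda>y. f (R *\<^sub>R y)) ` sphere 0 1)" by (intro compact_imp_bounded compact_continuous_image gs R compact_sphere)
    then obtain M where "\<forall>z\<in>(\<lambda>y. f (R *\<^sub>R y)) ` sphere 0 1. norm z \<le> M" unfolding bounded_iff by blast
    then have M: "cmod (f (R *\<^sub>R y)) \<le> M" if "norm y = 1" for y using that by simp
    have "s ^ k * cmod (B R k j) \<le> \<omega> * (weight_const s * M)" if j: "j \<in> {1..d k}" for k j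
    proof -
      have "s ^ k * cmod (B R k j) = cmod (\<integral>y. of_real (s ^ k) * (of_real (Y k j y) * f (R *\<^sub>R y)) \<partial>\<sigma>)"
        using s by (simp add: B_def norm_mult norm_power)
      also have "\<dots> \<le> \<omega> * (weight_const s * M)"
      proof (rule integral_sphere_norm_le)
        show "continuous_on (sphere 0 1) (\<lambda>y. of_real (s ^ k) * (of_real (Y k j y) * f (R *\<^sub>R y)))"
          by (intro continuous_on_mult continuous_on_const continuous_on_of_real Y_continuous gs R j)
        fix y :: "real^'n" assume y: "norm y = 1"
        have "(s ^ k * \<bar>Y k j y\<bar>) * cmod (f (R *\<^sub>R y)) \<le> weight_const s * M"
          by (intro mult_mono abs_Y_le s j y M weight_const) auto
        then show "cmod (of_real (s ^ k) * (of_real (Y k j y) * f (R *\<^sub>R y))) \<le> weight_const s * M"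
          using s by (simp add: norm_mult norm_power mult.assoc)
      qed
      finally show ?thesis .
    qed
    then show "\<exists>C. \<forall>k. \<forall>j\<in>{1..d k}. s ^ k * cmod (B R k j) \<le> C" by blast
  qed
  have sums: "(\<lambda>k. block (dilate r (B R)) k u) sums f ((R * r) *\<^sub>R u)"
    if R: "0 < R" "R < 1" and r: "0 \<le> r" "r < 1" and u: "norm u = 1" for R r u
  proof -
    have h: "harmonic_on (\<lambda>y. f (R *\<^sub>R y)) (ball 0 1)"
    proof (rule harmonic_on_dilation[OF open_ball f open_ball])
      fix y :: "real^'n" assume "y \<in> ball 0 1"
      then have "norm y < 1" by simp
      then have "R * norm y < 1 * 1" using R by (intro mult_strict_mono) auto
      then show "R *\<^sub>R y \<in> ball 0 1" using R by simp
    qed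
    have ru: "norm (r *\<^sub>R u) < 1" using r u by simp
    have "f ((R * r) *\<^sub>R u) = poisson_integral (\<lambda>y. f (R *\<^sub>R y)) (r *\<^sub>R u)"
      using harmonic_eq_poisson_integral[OF h gc[OF R] ru] by simp
    also have "\<dots> = (\<integral>y. sphere_series (\<lambda>k j. of_real (r ^ k) * of_real (Y k j u)) y * f (R *\<^sub>R y) \<partial>\<sigma>)"
      unfolding poisson_integral_def
      by (rule Bochner_Integration.integral_cong[OF refl], subst sphere_kernel_power[OF u _ r, unfolded sphere_kernel_def])
        (simp_all only: space_sigma mem_sphere_0 scaleR_conv_of_real)
    finally have e: "f ((R * r) *\<^sub>R u) = (\<integral>y. sphere_series (\<lambda>k j. of_real (r ^ k) * of_real (Y k j u)) y * f (R *\<^sub>R y) \<partial>\<sigma>)" .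
    have "(\<Sum>j=1..d k. of_real (r ^ k) * of_real (Y k j u) * (\<integral>y. of_real (Y k j y) * f (R *\<^sub>R y) \<partial>\<sigma>)) = block (dilate r (B R)) k u" for k
      by (simp add: block_def dilate_def B_def mult_ac)
    then show ?thesis
      using integral_sphere_series[OF exp_decay_mult_Y[OF exp_decay_power[OF r] u] gs[OF R]] by (simp add: e)
  qed
  \<comment> \<open>f(R y) is the R'-dilated function at radius R/R', so its coefficients can also
    be read from the expansion with \<open>B R'\<close>.\<close>
  have compat: "B R k j = of_real ((R / R') ^ k) * B R' k j"
    if R: "0 < R" "R < R'" "R' < 1" and j: "j \<in> {1..d k}" for R R' k j
  proof -
    have q: "0 \<le> R / R'" "R / R' < 1" "0 < R'" using R by auto
    have "f (R *\<^sub>R y) = sphere_series (dilate (R / R') (B R')) y" if "norm y = 1" for y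
      using sums_unique[OF sums[OF q(3) R(3) q(1,2) that]] q(3) by (simp add: sphere_series_def)
    then have "B R k j = (\<integral>y. sphere_series (dilate (R / R') (B R')) y * of_real (Y k j y) \<partial>\<sigma>)"
      unfolding B_def by (intro Bochner_Integration.integral_cong) (auto simp: mult.commute)
    also have "\<dots> = dilate (R / R') (B R') k j"
      by (rule integral_sphere_series_Y[OF tame_exp_decay[OF tB] j]) (use R q in auto)
    finally show ?thesis by (simp add: dilate_def)
  qed
  \<comment> \<open>By compatibility R^(-k) \<open>B R\<close> does not depend on R; the value is
    taken at R = 1/2.\<close>
  define b where "b k j = of_real (2 ^ k) * B (1/2) k j" for k j
  have Bb: "B R k j = of_real (R ^ k) * b k j" if R: "0 < R" "R < 1" and j: "j \<in> {1..d k}" for R k j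
  proof -
    consider "R = 1/2" | "R < 1/2" | "R > 1/2" by linarith
    then show ?thesis
    proof cases
      case 1
      show ?thesis unfolding 1 b_def by (simp add: power_divide)
    next
      case 2
      then show ?thesis using compat[of R "1/2" j k] R j by (simp add: b_def power_mult_distrib)
    next
      case 3
      have "B (1/2) k j = of_real ((1/2 / R) ^ k) * B R k j" using compat[of "1/2" R j k] R j 3 by simp
      then show ?thesis using R by (simp add: b_def power_divide power_mult_distrib)
    qed
  qed
  show ?thesis
  proof
    show "tame b" unfolding tame_def
    proof (intro allI impI)
      fix s :: real assume s: "0 < s" "s < 1"
      then have q: "0 < sqrt s" "sqrt s < 1" by auto
      \<comment> \<open>At R = sqrt s the array \<open>b\<close> is \<open>B R\<close> divided by
        sqrt s^k. One half of s^k cancels this, the other is used by tameness of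
        \<open>B R\<close>.\<close>
      obtain C where C: "\<And>k j. j \<in> {1..d k} \<Longrightarrow> sqrt s ^ k * cmod (B (sqrt s) k j) \<le> C"
        by (rule tameD[OF tB[OF q] q]) (rule that)
      have "s ^ k * cmod (b k j) \<le> C" if j: "j \<in> {1..d k}" for k j
      proof -
        have "s ^ k = sqrt s ^ k * sqrt s ^ k" using s by (simp flip: power_mult_distrib)
        then show ?thesis using C[OF j] s by (simp add: Bb[OF q j] norm_mult norm_power mult.assoc)
      qed
      then show "\<exists>C. \<forall>k. \<forall>j\<in>{1..d k}. s ^ k * cmod (b k j) \<le> C" by blast
    qed
    show "\<forall>x\<in>ball 0 1. sph_term Y b x sums f x"
    proof
      fix x :: "real^'n" assume "x \<in> ball 0 1"
      then have "norm x < 1" by simp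
      then obtain r u where x: "x = r *\<^sub>R u" "norm u = 1" "0 \<le> r" "r < 1" using ball_polar[of x 1] by blast
      define R where "R = (1 + r) / 2"
      have R: "0 < R" "R < 1" "r < R" using x by (auto simp: R_def)
      have q: "0 \<le> r / R" "r / R < 1" using R x by auto
      have "block (dilate (r / R) (B R)) k u = sph_term Y b x k" for k
      proof -
        have "block (dilate (r / R) (B R)) k u = block (dilate r b) k u"
          by (rule block_cong) (use R in \<open>simp add: dilate_def Bb[OF R(1,2)] power_divide\<close>)
        then show ?thesis using x by (simp add: sph_term_eq_block)
      qed
      then show "sph_term Y b x sums f x" using sums[OF R(1,2) q x(2)] R x by simp
    qed
  qed
qed

lemma harmonic_sph_coeff:
  fixes f :: "real^'n \<Rightarrow> complex"
  assumes f: "harmonic_on f (ball 0 1)"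
  shows "tame (sph_coeff Y f)"
    and "norm u = 1 \<Longrightarrow> 0 \<le> r \<Longrightarrow> r < 1 \<Longrightarrow> f (r *\<^sub>R u) = sphere_series (dilate r (sph_coeff Y f)) u"
proof -
  obtain b where b: "tame b" "\<forall>x\<in>ball 0 1. sph_term Y b x sums f x" using harmonic_expansion[OF f] by blast
  have eq: "sph_coeff Y f k j = b k j" if "j \<in> {1..d k}" for k j by (rule sph_coeff_eq[OF b(2) that])
  then show "tame (sph_coeff Y f)" using tame_cong[of "sph_coeff Y f" b] b by blast
  assume u: "norm u = 1" "0 \<le> r" "r < 1"
  then have ru: "r *\<^sub>R u \<in> ball 0 1" by simp
  have "f (r *\<^sub>R u) = sph_series Y b (r *\<^sub>R u)"
    using b(2) ru unfolding sph_series_def by (simp add: sums_iff)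
  also have "\<dots> = sphere_series (dilate r b) u" using u by (simp add: sph_series_eq)
  also have "\<dots> = sphere_series (dilate r (sph_coeff Y f)) u"
    by (rule sphere_series_cong) (simp add: dilate_def eq)
  finally show "f (r *\<^sub>R u) = sphere_series (dilate r (sph_coeff Y f)) u" .
qed

section \<open>Kernels acting on integral means\<close>

definition L1 :: "(nat \<Rightarrow> nat \<Rightarrow> complex) \<Rightarrow> ennreal" where
  "L1 a = (\<integral>\<^sup>+x. ennreal (cmod (sphere_series a x)) \<partial>\<sigma>)"

lemma block_measurable: "block a k \<in> borel_measurable \<sigma>"
  by (intro continuous_on_sphere_measurable continuous_on_block)

lemma sphere_series_measurable: "sphere_series a \<in> borel_measurable \<sigma>"
  unfolding sphere_series_def using block_measurable by (intro borel_measurable_suminf)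

lemma L1_finite: assumes "exp_decay a" shows "L1 a < \<infinity>"
proof -
  have "integrable \<sigma> (sphere_series a)" by (intro continuous_on_sphere_integrable continuous_on_sphere_series assms)
  then show ?thesis by (simp add: integrable_iff_bounded L1_def)
qed

lemma L1_cong:
  assumes "\<And>k j. j \<in> {1..d k} \<Longrightarrow> a k j = b k j" shows "L1 a = L1 b"
proof -
  have "sphere_series a x = sphere_series b x" for x by (rule sphere_series_cong) (rule assms)
  then show ?thesis by (simp add: L1_def)
qed

lemma L1_scale:
  assumes "exp_decay a"
  shows "L1 (\<lambda>k j. z * a k j) = ennreal (cmod z) * L1 a"
proof -
  have blk: "block (\<lambda>k j. z * a k j) k x = z * block a k x" for k x
    by (simp add: block_def sum_distrib_left mult.assoc)
  have "sphere_series (\<lambda>k j. z * a k j) x = z * sphere_series a x" if "norm x = 1" for x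
    unfolding sphere_series_def blk
    by (rule suminf_mult[OF summable_norm_cancel[OF summable_norm_block[OF assms that]]])
  then have "L1 (\<lambda>k j. z * a k j) = (\<integral>\<^sup>+x. ennreal (cmod z) * ennreal (cmod (sphere_series a x)) \<partial>\<sigma>)"
    unfolding L1_def by (intro nn_integral_cong) (simp add: norm_mult ennreal_mult)
  also have "\<dots> = ennreal (cmod z) * L1 a"
    unfolding L1_def using sphere_series_measurable[of a] by (intro nn_integral_cmult) measurable
  finally show ?thesis .
qed

lemma sphere_kernel_measurable:
  "(\<lambda>(x, y). sphere_kernel c x y) \<in> borel_measurable (\<sigma> \<Otimes>\<^sub>M \<sigma>)"
proof -
  have Yc: "(\<lambda>x. complex_of_real (Y k j x)) \<in> borel_measurable \<sigma>" if "j \<in> {1..d k}" for k j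
    by (intro continuous_on_sphere_measurable continuous_on_of_real Y_continuous that)
  have "(\<lambda>p. c k j * of_real (Y k j (fst p)) * of_real (Y k j (snd p))) \<in> borel_measurable (\<sigma> \<Otimes>\<^sub>M \<sigma>)"
    if "j \<in> {1..d k}" for k j
    by (intro borel_measurable_times borel_measurable_const
        measurable_compose[OF measurable_fst Yc[OF that]] measurable_compose[OF measurable_snd Yc[OF that]])
  then show ?thesis unfolding sphere_kernel_def sphere_series_def block_def split_beta
    by (intro borel_measurable_suminf borel_measurable_sum)
qed

text \<open>The columns of the kernel have L^1 norm at most M, which makes M a bound for the
  operator on L^1 of the sphere. Decay is included so that the kernel is given by a uniformly
  convergent series in each variable.\<close>

definition kernel_bound :: "(nat \<Rightarrow> nat \<Rightarrow> complex) \<Rightarrow> real \<Rightarrow> bool" where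
  "kernel_bound c M \<longleftrightarrow> exp_decay c \<and> 0 \<le> M \<and>
     (\<forall>y. norm y = 1 \<longrightarrow> L1 (\<lambda>k j. c k j * of_real (Y k j y)) \<le> ennreal M)"

lemma L1_kernel:
  "L1 (\<lambda>k j. c k j * of_real (Y k j y)) = (\<integral>\<^sup>+x. ennreal (cmod (sphere_kernel c x y)) \<partial>\<sigma>)"
  by (simp add: L1_def sphere_kernel_commute[of c _ y]) (simp add: sphere_kernel_def)

text \<open>Young's inequality for kernels: bound the integral of
  \<open>integral_sphere_kernel\<close> absolutely, exchange the integrations, and use the column
  bound in the inner one.\<close>

lemma L1_mult:
  assumes c: "kernel_bound c M" and b: "exp_decay b"
  shows "L1 (\<lambda>k j. c k j * b k j) \<le> ennreal M * L1 b"
proof -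
  interpret P: pair_sigma_finite \<sigma> \<sigma> ..
  have cd: "exp_decay c" using c by (simp add: kernel_bound_def)
  have meas: "(\<lambda>(x, y). ennreal (cmod (sphere_kernel c x y)) * ennreal (cmod (sphere_series b y))) \<in> borel_measurable (\<sigma> \<Otimes>\<^sub>M \<sigma>)"
    using sphere_kernel_measurable[of c] measurable_compose[OF measurable_snd sphere_series_measurable[of b]]
    unfolding split_beta by measurable
  have "L1 (\<lambda>k j. c k j * b k j) \<le> (\<integral>\<^sup>+x. (\<integral>\<^sup>+y. ennreal (cmod (sphere_kernel c x y)) * ennreal (cmod (sphere_series b y)) \<partial>\<sigma>) \<partial>\<sigma>)"
    unfolding L1_def
  proof (rule nn_integral_mono)
    fix x assume "x \<in> space \<sigma>"
    then have x: "norm x = 1" by simp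
    have int: "integrable \<sigma> (\<lambda>y. sphere_kernel c x y * sphere_series b y)"
      by (intro continuous_on_sphere_integrable continuous_on_mult continuous_on_sphere_kernel continuous_on_sphere_series x b cd)
    have "ennreal (cmod (\<integral>y. sphere_kernel c x y * sphere_series b y \<partial>\<sigma>)) \<le> (\<integral>\<^sup>+y. ennreal (cmod (sphere_kernel c x y * sphere_series b y)) \<partial>\<sigma>)"
      by (rule integral_norm_bound_ennreal[OF int])
    then show "ennreal (cmod (sphere_series (\<lambda>k j. c k j * b k j) x)) \<le> (\<integral>\<^sup>+y. ennreal (cmod (sphere_kernel c x y)) * ennreal (cmod (sphere_series b y)) \<partial>\<sigma>)"
      by (simp add: integral_sphere_kernel[OF cd b x] norm_mult ennreal_mult)
  qed
  also have "\<dots> = (\<integral>\<^sup>+y. (\<integral>\<^sup>+x. ennreal (cmod (sphere_kernel c x y)) * ennreal (cmod (sphere_series b y)) \<partial>\<sigma>) \<partial>\<sigma>)"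
    by (rule P.Fubini'[symmetric]) (use meas in simp)
  also have "\<dots> \<le> (\<integral>\<^sup>+y. ennreal M * ennreal (cmod (sphere_series b y)) \<partial>\<sigma>)"
  proof (rule nn_integral_mono)
    fix y assume "y \<in> space \<sigma>"
    then have y: "norm y = 1" by simp
    have "(\<lambda>x. sphere_kernel c x y) \<in> borel_measurable \<sigma>"
      by (subst sphere_kernel_commute) (simp add: sphere_kernel_def sphere_series_measurable)
    then have "(\<integral>\<^sup>+x. ennreal (cmod (sphere_kernel c x y)) * ennreal (cmod (sphere_series b y)) \<partial>\<sigma>)
       = (\<integral>\<^sup>+x. ennreal (cmod (sphere_kernel c x y)) \<partial>\<sigma>) * ennreal (cmod (sphere_series b y))"
      by (intro nn_integral_multc) measurable
    also have "\<dots> \<le> ennreal M * ennreal (cmod (sphere_series b y))"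
      using c y by (intro mult_right_mono) (auto simp: kernel_bound_def L1_kernel)
    finally show "(\<integral>\<^sup>+x. ennreal (cmod (sphere_kernel c x y)) * ennreal (cmod (sphere_series b y)) \<partial>\<sigma>)
      \<le> ennreal M * ennreal (cmod (sphere_series b y))" .
  qed
  also have "\<dots> = ennreal M * L1 b"
    unfolding L1_def using sphere_series_measurable[of b] by (intro nn_integral_cmult) measurable
  finally show ?thesis .
qed

text \<open>\<open>L1_mult\<close> applied to a column of the second kernel.\<close>

lemma kernel_bound_mult:
  assumes c: "kernel_bound c M" and c': "kernel_bound c' M'"
  shows "kernel_bound (\<lambda>k j. c k j * c' k j) (M * M')"
  unfolding kernel_bound_def
proof (intro conjI allI impI)
  show "exp_decay (\<lambda>k j. c k j * c' k j)" "0 \<le> M * M'"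
    using c c' by (auto simp: kernel_bound_def intro: exp_decay_mult)
  fix y :: "real^'n" assume y: "norm y = 1"
  have "L1 (\<lambda>k j. c k j * (c' k j * of_real (Y k j y))) \<le> ennreal M * L1 (\<lambda>k j. c' k j * of_real (Y k j y))"
    by (rule L1_mult[OF c]) (use c' y in \<open>auto simp: kernel_bound_def intro: exp_decay_mult_Y\<close>)
  also have "\<dots> \<le> ennreal M * ennreal M'"
    using c' y by (intro mult_left_mono) (auto simp: kernel_bound_def)
  also have "\<dots> = ennreal (M * M')" using c c' by (simp add: kernel_bound_def ennreal_mult)
  finally show "L1 (\<lambda>k j. c k j * c' k j * of_real (Y k j y)) \<le> ennreal (M * M')" by (simp add: mult.assoc)
qed

lemma kernel_bound_mono: "kernel_bound c M \<Longrightarrow> M \<le> M' \<Longrightarrow> kernel_bound c M'"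
  unfolding kernel_bound_def by (meson ennreal_leI order_trans)

lemma nn_integral_poisson:
  assumes y: "norm y = 1" and r: "0 \<le> r" "r < 1" and T: "T \<ge> 0"
  shows "(\<integral>\<^sup>+x. ennreal (T * (poisson (r *\<^sub>R y) x / \<omega>)) \<partial>\<sigma>) = ennreal T"
proof -
  have ry: "norm (r *\<^sub>R y) < 1" using y r by simp
  have "(\<integral>\<^sup>+x. ennreal (T * (poisson (r *\<^sub>R y) x / \<omega>)) \<partial>\<sigma>) = ennreal (\<integral>x. T * (poisson (r *\<^sub>R y) x / \<omega>) \<partial>\<sigma>)"
    using poisson_nonneg[of "r *\<^sub>R y"] ry omega_pos T
    by (intro nn_integral_eq_integral continuous_on_sphere_integrable continuous_on_mult continuous_on_const continuous_on_poisson_omega) auto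
  then show ?thesis using integral_poisson[OF ry] omega_pos by simp
qed

lemma kernel_bound_by_poisson:
  assumes c: "exp_decay c" and r: "0 \<le> r" "r < 1" and M: "M \<ge> 0"
    and le: "\<And>x y. norm x = 1 \<Longrightarrow> norm y = 1 \<Longrightarrow> cmod (sphere_kernel c x y) \<le> M * (poisson (r *\<^sub>R x) y / \<omega>)"
  shows "kernel_bound c M"
  unfolding kernel_bound_def
proof (intro conjI allI impI c M)
  fix y :: "real^'n" assume y: "norm y = 1"
  have "(\<integral>\<^sup>+x. ennreal (cmod (sphere_kernel c x y)) \<partial>\<sigma>) \<le> (\<integral>\<^sup>+x. ennreal (M * (poisson (r *\<^sub>R y) x / \<omega>)) \<partial>\<sigma>)"
  proof (intro nn_integral_mono ennreal_leI)
    fix x assume "x \<in> space \<sigma>"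
    then show "cmod (sphere_kernel c x y) \<le> M * (poisson (r *\<^sub>R y) x / \<omega>)"
      using le[of y x] y by (simp add: sphere_kernel_commute)
  qed
  then show "L1 (\<lambda>k j. c k j * of_real (Y k j y)) \<le> ennreal M"
    by (simp only: L1_kernel nn_integral_poisson[OF y r M])
qed

lemma kernel_bound_power:
  assumes r: "0 \<le> r" "r < 1"
  shows "kernel_bound (\<lambda>k j. of_real (r ^ k)) 1"
proof (rule kernel_bound_by_poisson[OF exp_decay_power[OF r] r])
  fix x y :: "real^'n" assume "norm x = 1" "norm y = 1"
  then show "cmod (sphere_kernel (\<lambda>k j. of_real (r ^ k)) x y) \<le> 1 * (poisson (r *\<^sub>R x) y / \<omega>)"
    using poisson_nonneg[of "r *\<^sub>R x" y] omega_pos r by (simp only: sphere_kernel_power[OF _ _ r] norm_of_real) simp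
qed simp

lemma exp_decay_linear:
  assumes s: "0 < s" "s < 1"
  shows "exp_decay (\<lambda>k j. of_real ((real k + \<tau>) * s ^ k))"
proof -
  have q: "0 < sqrt s" "sqrt s < 1" using s by auto
  have "(\<lambda>k. real k * sqrt s ^ k + \<tau> * sqrt s ^ k) \<longlonglongrightarrow> 0 + \<tau> * 0"
    by (intro tendsto_add tendsto_mult tendsto_const LIMSEQ_power_zero powser_times_n_limit_0) (use q in auto)
  then have "Bseq (\<lambda>k. real k * sqrt s ^ k + \<tau> * sqrt s ^ k)"
    by (intro convergent_imp_Bseq convergentI)
  then obtain C where C: "C > 0" "\<And>k. \<bar>real k * sqrt s ^ k + \<tau> * sqrt s ^ k\<bar> \<le> C"
    unfolding Bseq_def by auto
  have "\<bar>(real k + \<tau>) * s ^ k\<bar> \<le> C * sqrt s ^ k" for k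
  proof -
    have "(real k + \<tau>) * s ^ k = (real k * sqrt s ^ k + \<tau> * sqrt s ^ k) * sqrt s ^ k"
      using s by (simp add: algebra_simps flip: power_mult_distrib)
    then show ?thesis using C(2)[of k] q by (simp add: abs_mult mult_right_mono)
  qed
  then have "decays C (sqrt s) (\<lambda>k j. of_real ((real k + \<tau>) * s ^ k))"
    unfolding decays_def norm_of_real using q C(1) by auto
  then show ?thesis unfolding exp_decay_def by blast
qed

lemma poisson_radial:
  fixes x y :: "real^'n"
  assumes "norm x = 1" "norm y = 1"
  shows "poisson (s *\<^sub>R x) y = (1 - s\<^sup>2) * (s\<^sup>2 - 2 * s * (x \<bullet> y) + 1) powr (- (real CARD('n) / 2))"
proof -
  have "(s *\<^sub>R x - y) \<bullet> (s *\<^sub>R x - y) = s\<^sup>2 - 2 * s * (x \<bullet> y) + 1"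
    using assms by (simp add: inner_diff_left inner_diff_right inner_commute norm_eq_sqrt_inner power2_eq_square)
  moreover have "(s *\<^sub>R x) \<bullet> (s *\<^sub>R x) = s\<^sup>2"
    using assms by (simp add: norm_eq_sqrt_inner power2_eq_square)
  ultimately show ?thesis by (simp add: poisson_def)
qed

text \<open>
  The radial derivative of the kernel is at most a constant multiple of the kernel divided by the
  distance to the boundary.
\<close>
lemma sphere_kernel_linear_bound:
  assumes s: "0 < s" "s < 1" and \<tau>: "\<tau> \<ge> 0" and x: "norm x = 1" and y: "norm y = 1"
  shows "cmod (sphere_kernel (\<lambda>k j. of_real ((real k + \<tau>) * s ^ k)) x y)
    \<le> (2 + real CARD('n) + \<tau>) / (1 - s) * (poisson (s *\<^sub>R x) y / \<omega>)"
proof -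
  \<comment> \<open>For fixed x and y the Poisson kernel is the power series with coefficients
    \<open>D k\<close> and has the closed form G. Differentiating both expressions in s produces the
    factor k. In the constant, 2 stems from 1 - s^2, the dimension from the power, and \<tau> from
    the added multiple of G.\<close>
  define D where "D k = (\<Sum>j=1..d k. Y k j x * Y k j y)" for k
  define \<nu> where "\<nu> = real CARD('n) / 2"
  define \<xi> where "\<xi> = x \<bullet> y"
  define G where "G s = poisson (s *\<^sub>R x) y / \<omega>" for s
  define q where "q = s\<^sup>2 - 2 * s * \<xi> + 1"
  define G' where "G' = ((- 2 * s) * q powr (- \<nu>) + (1 - s\<^sup>2) * (- \<nu> * q powr (- \<nu> - 1) * (2 * s - 2 * \<xi>))) / \<omega>"
  have xi: "\<bar>\<xi>\<bar> \<le> 1" using Cauchy_Schwarz_ineq2[of x y] x y by (simp add: \<xi>_def)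
  have blk: "block (\<lambda>k j. of_real (f k) * of_real (Y k j x)) k y = of_real (f k * D k)" for f :: "nat \<Rightarrow> real" and k
    by (simp add: block_def D_def sum_distrib_left mult.assoc)
  have sumsG: "(\<lambda>k. D k * t ^ k) sums G t" if t: "0 \<le> t" "t < 1" for t
  proof -
    have "(\<lambda>k. block (\<lambda>k j. of_real (t ^ k) * of_real (Y k j x)) k y) sums of_real (G t)"
      using sphere_series_sums[OF exp_decay_mult_Y[OF exp_decay_power[OF t] x] y] sphere_kernel_power[OF x y t]
      by (simp only: sphere_kernel_def G_def)
    then have "(\<lambda>k. complex_of_real (t ^ k * D k)) sums of_real (G t)" by (simp only: blk)
    then show ?thesis by (simp only: sums_of_real_iff mult.commute)
  qed
  define t where "t = (1 + s) / 2"
  have t: "0 < t" "t < 1" "s < t" using s by (auto simp: t_def)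
  have sm: "summable (\<lambda>k. D k * t ^ k)" using sumsG[of t] t by (simp add: sums_iff)
  have dF: "DERIV (\<lambda>s. \<Sum>k. D k * s ^ k) s :> (\<Sum>k. diffs D k * s ^ k)"
    by (rule termdiffs_strong[OF sm]) (use s t in auto)
  have "DERIV G s :> (\<Sum>k. diffs D k * s ^ k)"
    by (rule has_field_derivative_transform_within_open[OF dF, of "{0<..<1}"])
      (use s sumsG in \<open>auto simp: sums_iff\<close>)
  moreover have "DERIV G s :> G'"
  proof -
    have qp: "q > 0"
    proof -
      have "(1 - s)\<^sup>2 \<le> q" using mult_left_mono[of \<xi> 1 s] xi s by (simp add: q_def power2_eq_square algebra_simps)
      then show ?thesis using s by (smt (verit) zero_less_power)
    qed
    have "DERIV (\<lambda>s. (1 - s\<^sup>2) * (s\<^sup>2 - 2 * s * \<xi> + 1) powr (- \<nu>) / \<omega>) s :> G'"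
    proof -
      have "DERIV (\<lambda>s. s\<^sup>2 - 2 * s * \<xi> + 1) s :> 2 * s - 2 * \<xi>" by (auto intro!: derivative_eq_intros)
      then have 1: "DERIV (\<lambda>s. (s\<^sup>2 - 2 * s * \<xi> + 1) powr (- \<nu>)) s :> - \<nu> * q powr (- \<nu> - 1) * (2 * s - 2 * \<xi>)"
        using DERIV_fun_powr[of "\<lambda>s. s\<^sup>2 - 2 * s * \<xi> + 1" "2 * s - 2 * \<xi>" s "- \<nu>"] qp unfolding q_def by simp
      have 2: "DERIV (\<lambda>s. 1 - s\<^sup>2) s :> - 2 * s" by (auto intro!: derivative_eq_intros)
      show ?thesis using DERIV_cdivide[OF DERIV_mult[OF 2 1], of \<omega>]
        unfolding G'_def q_def by (simp add: mult.commute)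
    qed
    moreover have "G = (\<lambda>s. (1 - s\<^sup>2) * (s\<^sup>2 - 2 * s * \<xi> + 1) powr (- \<nu>) / \<omega>)"
      by (auto simp: G_def poisson_radial[OF x y] \<nu>_def \<xi>_def)
    ultimately show ?thesis by simp
  qed
  ultimately have eq: "(\<Sum>k. diffs D k * s ^ k) = G'" by (rule DERIV_unique)
  have "summable (\<lambda>k. diffs D k * s ^ k)"
  proof (rule termdiff_converges[of s 1])
    show "summable (\<lambda>k. D k * z ^ k)" if "norm z < 1" for z
    proof -
      have "(1 + \<bar>z\<bar>) / 2 < 1" "0 \<le> (1 + \<bar>z\<bar>) / 2" using that by auto
      then show ?thesis
        by (intro powser_inside[OF sums_summable[OF sumsG[of "(1 + \<bar>z\<bar>) / 2"]]]) (use that in auto)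
    qed
  qed (use s in auto)
  then have "(\<lambda>k. of_nat k * D k * s ^ (k - Suc 0)) sums G'" using diffs_equiv eq by metis
  then have "(\<lambda>k. s * (of_nat k * D k * s ^ (k - Suc 0))) sums (s * G')" by (rule sums_mult)
  moreover have "s * (of_nat k * D k * s ^ (k - Suc 0)) = real k * s ^ k * D k" for k by (cases k) auto
  ultimately have "(\<lambda>k. real k * s ^ k * D k + \<tau> * (D k * s ^ k)) sums (s * G' + \<tau> * G s)"
    by (intro sums_add sums_mult sumsG) (use s in auto)
  then have "(\<lambda>k. ((real k + \<tau>) * s ^ k) * D k) sums (s * G' + \<tau> * G s)" by (simp add: algebra_simps)
  then have "(\<lambda>k. complex_of_real (((real k + \<tau>) * s ^ k) * D k)) sums of_real (s * G' + \<tau> * G s)"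
    by (simp only: sums_of_real_iff)
  then have ker: "sphere_kernel (\<lambda>k j. of_real ((real k + \<tau>) * s ^ k)) x y = of_real (s * G' + \<tau> * G s)"
    unfolding sphere_kernel_def sphere_series_def blk by (simp only: sums_iff)
  have q1: "(1 - s)\<^sup>2 \<le> q" using mult_left_mono[of \<xi> 1 s] xi s by (simp add: q_def power2_eq_square algebra_simps)
  have q0: "q > 0" using q1 s by (smt (verit) zero_less_power)
  have q2: "\<bar>s - \<xi>\<bar>\<^sup>2 \<le> q"
    using xi abs_square_le_1[of \<xi>] by (simp add: q_def power2_diff)
  \<comment> \<open>q is the squared distance from s x to y, so its square root dominates both 1 - s
    and |s - \<xi>|. This trades the extra 1/q of the derivative for 1/(1 - s).\<close>
  have q3: "\<bar>s - \<xi>\<bar> * (1 - s) \<le> q"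
  proof -
    have "\<bar>s - \<xi>\<bar> \<le> sqrt q" using q2 real_le_rsqrt by blast
    moreover have "1 - s \<le> sqrt q" using q1 real_le_rsqrt by blast
    ultimately have "\<bar>s - \<xi>\<bar> * (1 - s) \<le> sqrt q * sqrt q" using s q0 by (intro mult_mono) auto
    then show ?thesis using q0 by simp
  qed
  define Q where "Q = q powr (- \<nu>)"
  have Q: "Q > 0" using q0 by (simp add: Q_def)
  have Q1: "q powr (- \<nu> - 1) = Q / q" using q0 by (simp add: Q_def powr_diff)
  have Gs: "G s * \<omega> = (1 - s\<^sup>2) * Q"
    using omega_pos by (simp add: G_def poisson_radial[OF x y] Q_def q_def \<nu>_def \<xi>_def)
  have nu: "\<nu> \<ge> 0" by (simp add: \<nu>_def)
  have ss: "1 - s\<^sup>2 = (1 - s) * (1 + s)" by (simp add: power2_eq_square algebra_simps)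
  have s2: "0 < 1 - s\<^sup>2" using s unfolding ss by simp
  have b1: "\<bar>G' * \<omega>\<bar> \<le> 2 * Q + (1 - s\<^sup>2) * (2 * \<nu> * (Q / (1 - s)))"
  proof -
    have "G' * \<omega> = (- 2 * s) * Q + (1 - s\<^sup>2) * (- \<nu> * (Q / q) * (2 * s - 2 * \<xi>))"
      using omega_pos by (simp add: G'_def Q1 Q_def)
    also have "\<bar>\<dots>\<bar> \<le> \<bar>(- 2 * s) * Q\<bar> + \<bar>(1 - s\<^sup>2) * (- \<nu> * (Q / q) * (2 * s - 2 * \<xi>))\<bar>" by (rule abs_triangle_ineq)
    also have "\<bar>(- 2 * s) * Q\<bar> \<le> 2 * Q" using s Q by (simp add: abs_mult)
    also have "\<bar>(1 - s\<^sup>2) * (- \<nu> * (Q / q) * (2 * s - 2 * \<xi>))\<bar> = (1 - s\<^sup>2) * (2 * \<nu> * (Q * (\<bar>s - \<xi>\<bar> / q)))"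
    proof -
      have "2 * s - 2 * \<xi> = 2 * (s - \<xi>)" by simp
      then have "\<bar>2 * s - 2 * \<xi>\<bar> = 2 * \<bar>s - \<xi>\<bar>" by (simp only: abs_mult abs_numeral)
      then show ?thesis using s2 nu Q q0 by (simp add: abs_mult)
    qed
    also have "\<bar>s - \<xi>\<bar> / q \<le> 1 / (1 - s)" using q3 q0 s by (simp add: field_simps)
    finally show ?thesis using s2 nu Q by (simp add: mult_left_mono)
  qed
  have b2: "2 * Q \<le> 2 * (G s * \<omega>) / (1 - s)"
    unfolding Gs ss using s Q by simp
  have "\<bar>G' * \<omega>\<bar> \<le> (2 + 2 * \<nu>) / (1 - s) * (G s * \<omega>)"
    using b1 b2 s unfolding Gs by (simp add: field_simps)
  then have "\<bar>G'\<bar> * \<omega> \<le> ((2 + 2 * \<nu>) / (1 - s) * G s) * \<omega>"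
    using omega_pos by (simp add: abs_mult mult.assoc)
  then have g1: "\<bar>G'\<bar> \<le> (2 + 2 * \<nu>) / (1 - s) * G s"
    by (rule mult_right_le_imp_le[OF _ omega_pos])
  have G0: "G s \<ge> 0" using poisson_nonneg[of "s *\<^sub>R x" y] omega_pos x s by (simp add: G_def)
  have "\<bar>s * G' + \<tau> * G s\<bar> \<le> s * \<bar>G'\<bar> + \<tau> * G s"
    using abs_triangle_ineq[of "s * G'" "\<tau> * G s"] s \<tau> G0 by (simp add: abs_mult)
  also have "\<dots> \<le> 1 * ((2 + 2 * \<nu>) / (1 - s) * G s) + (\<tau> / (1 - s)) * G s"
  proof (intro add_mono mult_mono g1)
    show "\<tau> \<le> \<tau> / (1 - s)" using s \<tau> by (simp add: field_simps mult_left_le)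
  qed (use s \<tau> G0 in auto)
  also have "\<dots> = (2 + 2 * \<nu> + \<tau>) / (1 - s) * G s" by (simp add: add_divide_distrib distrib_right)
  finally have "\<bar>s * G' + \<tau> * G s\<bar> \<le> (2 + real CARD('n) + \<tau>) / (1 - s) * G s" by (simp add: \<nu>_def)
  then show ?thesis unfolding ker norm_of_real by (simp only: G_def)
qed

lemma kernel_bound_linear:
  assumes s: "0 \<le> s" "s < 1" and \<tau>: "\<tau> \<ge> 0"
  shows "kernel_bound (\<lambda>k j. of_real ((real k + \<tau>) * s ^ k)) ((2 + real CARD('n) + \<tau>) / (1 - s))"
proof (cases "s = 0")
  case False
  then have s': "0 < s" using s by simp
  show ?thesis
    by (rule kernel_bound_by_poisson[OF exp_decay_linear[OF s' s(2)] s _ sphere_kernel_linear_bound[OF s' s(2) \<tau>]])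
      (use s \<tau> in auto)
next
  case True
  have eq: "(\<lambda>k j. complex_of_real ((real k + \<tau>) * s ^ k)) = (\<lambda>k j. of_real \<tau> * of_real (s ^ k))"
    by (auto simp: True power_0_left fun_eq_iff)
  have "kernel_bound (\<lambda>k j. of_real \<tau> * of_real (s ^ k)) (\<tau> * 1)"
    unfolding kernel_bound_def
  proof (intro conjI allI impI)
    show "exp_decay (\<lambda>k j. complex_of_real \<tau> * of_real (s ^ k))"
      using exp_decay_power[OF s] unfolding exp_decay_def decays_def
      apply (elim exE conjE)
      subgoal for C t using \<tau> by (intro exI[of _ "\<tau> * C"] exI[of _ t]) (auto simp: norm_mult mult.assoc intro!: mult_left_mono)
      done
    fix y :: "real^'n" assume y: "norm y = 1"
    then have "L1 (\<lambda>k j. of_real (s ^ k) * of_real (Y k j y)) \<le> ennreal 1"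
      using kernel_bound_power[OF s] by (auto simp: kernel_bound_def)
    then have "ennreal \<tau> * L1 (\<lambda>k j. of_real (s ^ k) * of_real (Y k j y)) \<le> ennreal \<tau> * ennreal 1"
      by (intro mult_left_mono) auto
    then show "L1 (\<lambda>k j. of_real \<tau> * of_real (s ^ k) * of_real (Y k j y)) \<le> ennreal (\<tau> * 1)"
      using L1_scale[OF exp_decay_mult_Y[OF exp_decay_power[OF s] y], of "of_real \<tau>"] \<tau> by (simp add: mult.assoc)
  qed (use \<tau> in simp)
  then have "kernel_bound (\<lambda>k j. of_real ((real k + \<tau>) * s ^ k)) (\<tau> * 1)" unfolding eq .
  then show ?thesis by (rule kernel_bound_mono) (use True in simp)
qed

end

section \<open>Beta integrals and fractional derivatives\<close>

definition I01 :: "real measure" where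
  "I01 = restrict_space lborel {0<..<1}"

lemma space_I01 [simp]: "space I01 = {0<..<1}"
  by (simp add: I01_def space_restrict_space)

lemma sigma_finite_I01: "sigma_finite_measure I01"
  unfolding I01_def by (rule sigma_finite_measure_restrict_space) (auto intro: lborel.sigma_finite_measure_axioms)

lemma nn_integral_I01: "(\<integral>\<^sup>+x. f x \<partial>I01) = (\<integral>\<^sup>+x\<in>{0<..<1}. f x \<partial>lborel)"
  unfolding I01_def by (subst nn_integral_restrict_space) auto

lemma measurable_I01: "f \<in> borel_measurable borel \<Longrightarrow> f \<in> borel_measurable I01"
  unfolding I01_def by (intro measurable_restrict_space1) simp

lemma nn_integral_Beta:
  assumes a: "a > 0" and b: "b > (0::real)"
  shows "(\<integral>\<^sup>+s. ennreal (s powr (a - 1) * (1 - s) powr (b - 1)) \<partial>I01) = ennreal (Beta a b)"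
proof -
  have "((\<lambda>t. t powr (a - 1) * (1 - t) powr (b - 1)) has_integral Beta a b) {0<..<1}"
    using has_integral_Beta_real[OF a b] by (simp add: has_integral_Icc_iff_Ioo)
  from nn_integral_has_integral_lebesgue[OF _ this]
  show ?thesis unfolding nn_integral_I01
    by (simp add: ennreal_mult' ennreal_indicator mult.commute)
qed

text \<open>The Beta integral after substituting t^2. The moments are then powers of t^2, which
  split evenly between two dilated factors.\<close>

lemma nn_integral_Beta_square:
  assumes a: "a > 0" and b: "b > (0::real)"
  shows "(\<integral>\<^sup>+t. ennreal (2 * t powr (2 * a - 1) * (1 - t\<^sup>2) powr (b - 1)) \<partial>I01) = ennreal (Beta a b)"
proof -
  let ?f = "\<lambda>t. t powr (a - 1) * (1 - t) powr (b - 1)"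
  have "ennreal (Beta a b) = (\<integral>\<^sup>+t. ennreal (?f t * indicator {0\<^sup>2..1\<^sup>2} t) \<partial>lborel)"
    using nn_integral_has_integral_lebesgue[OF _ has_integral_Beta_real[OF a b]] by (simp add: mult.commute)
  also have "\<dots> = (\<integral>\<^sup>+t. ennreal (?f (t\<^sup>2) * (2 * t) * indicator {0..1} t) \<partial>lborel)"
    by (subst nn_integral_substitution[where g = "\<lambda>x. x ^ 2" and g' = "\<lambda>x. 2 * x"])
       (auto intro!: derivative_eq_intros continuous_intros simp: set_borel_measurable_def)
  also have "\<dots> = (\<integral>\<^sup>+t. ennreal (2 * t powr (2 * a - 1) * (1 - t\<^sup>2) powr (b - 1)) * indicator {0<..<1} t \<partial>lborel)"
  proof (intro nn_integral_cong_AE)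
    have "AE t in lborel. t \<noteq> (0::real)" "AE t in lborel. t \<noteq> (1::real)" by (auto intro!: AE_lborel_singleton)
    then show "AE t in lborel. ennreal (?f (t\<^sup>2) * (2 * t) * indicator {0..1} t)
      = ennreal (2 * t powr (2 * a - 1) * (1 - t\<^sup>2) powr (b - 1)) * indicator {0<..<1} t"
    proof eventually_elim
      case (elim t)
      have "t\<^sup>2 powr (a - 1) * t = t powr (2 * a - 1)" if "t > 0"
      proof -
        have "t\<^sup>2 powr (a - 1) * t = (t powr 2) powr (a - 1) * t powr 1" using that by simp
        also have "\<dots> = t powr (2 * (a - 1) + 1)" by (simp only: powr_powr powr_add)
        finally show ?thesis by (simp add: algebra_simps)
      qed
      then show ?case using elim by (auto simp: indicator_def mult_ac)
    qed
  qed
  finally show ?thesis by (simp add: nn_integral_I01)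
qed

lemma nn_integral_powr_near_1:
  assumes a: "a > (0::real)" and r: "r \<le> 1"
  shows "(\<integral>\<^sup>+s. ennreal ((1 - s) powr (a - 1)) * indicator {r..1} s \<partial>lborel) = ennreal ((1 - r) powr a / a)"
proof -
  have "((\<lambda>s. (1 - s) powr (a - 1)) has_integral (- ((1 - 1) powr a / a) - (- ((1 - r) powr a / a)))) {r..1}"
  proof (rule fundamental_theorem_of_calculus_interior[OF r])
    show "continuous_on {r..1} (\<lambda>s. - ((1 - s) powr a / a))"
      using a by (intro continuous_intros continuous_on_powr') auto
    show "((\<lambda>s. - ((1 - s) powr a / a)) has_vector_derivative (1 - s) powr (a - 1)) (at s)" if "s \<in> {r<..<1}" for s
    proof -
      have "DERIV (\<lambda>s. 1 - s) s :> - 1" by (auto intro!: derivative_eq_intros)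
      from DERIV_fun_powr[OF this, of a] that
      have "DERIV (\<lambda>s. (1 - s) powr a) s :> a * (1 - s) powr (a - 1) * - 1" by simp
      from DERIV_minus[OF DERIV_cdivide[OF this, of a]] show ?thesis
        using a by (simp add: has_real_derivative_iff_has_vector_derivative)
    qed
  qed
  from nn_integral_has_integral_lebesgue[OF _ this]
  show ?thesis using a by (simp add: ennreal_mult' ennreal_indicator mult.commute)
qed

lemma nn_integral_powr_away_1:
  assumes b: "b > (0::real)" and r: "0 \<le> r" "r < 1"
  shows "(\<integral>\<^sup>+s. ennreal ((1 - s) powr (- b - 1)) * indicator {0..r} s \<partial>lborel) \<le> ennreal ((1 - r) powr (- b) / b)"
proof -
  have "(\<integral>\<^sup>+s. ennreal ((1 - s) powr (- b - 1)) * indicator {0..r} s \<partial>lborel) = ennreal ((1 - r) powr (- b) / b - (1 - 0) powr (- b) / b)"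
  proof (rule nn_integral_FTC_Icc)
    show "DERIV (\<lambda>s. (1 - s) powr (- b) / b) s :> (1 - s) powr (- b - 1)" if "s \<in> {0..r}" for s
    proof -
      have "DERIV (\<lambda>s. 1 - s) s :> - 1" by (auto intro!: derivative_eq_intros)
      from DERIV_fun_powr[OF this, of "- b"] that r
      have "DERIV (\<lambda>s. (1 - s) powr (- b)) s :> - b * (1 - s) powr (- b - 1) * - 1" by simp
      from DERIV_cdivide[OF this, of b] show ?thesis using b by simp
    qed
  qed (use r in auto)
  also have "\<dots> \<le> ennreal ((1 - r) powr (- b) / b)" using b by (intro ennreal_leI) simp
  finally show ?thesis .
qed

text \<open>Split at s = r. Below, 1 - r s is at least 1 - s and the integral gives 1/b; above, it
  is at least 1 - r and the integral gives 1/a.\<close>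

lemma nn_integral_two_powr_le:
  assumes a: "a > (0::real)" and b: "b > 0" and r: "0 \<le> r" "r < 1"
  shows "(\<integral>\<^sup>+s. ennreal ((1 - s) powr (a - 1) * (1 - r * s) powr (- (a + b))) \<partial>I01)
    \<le> ennreal ((1 / a + 1 / b) * (1 - r) powr (- b))"
proof -
  have "(\<integral>\<^sup>+s. ennreal ((1 - s) powr (a - 1) * (1 - r * s) powr (- (a + b))) \<partial>I01)
    \<le> (\<integral>\<^sup>+s. ennreal ((1 - s) powr (- b - 1)) * indicator {0..r} s +
         ennreal ((1 - r) powr (- (a + b))) * (ennreal ((1 - s) powr (a - 1)) * indicator {r..1} s) \<partial>lborel)"
    unfolding nn_integral_I01
  proof (rule nn_integral_mono)
    fix s :: real
    show "ennreal ((1 - s) powr (a - 1) * (1 - r * s) powr (- (a + b))) * indicator {0<..<1} s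
      \<le> ennreal ((1 - s) powr (- b - 1)) * indicator {0..r} s +
         ennreal ((1 - r) powr (- (a + b))) * (ennreal ((1 - s) powr (a - 1)) * indicator {r..1} s)"
    proof (cases "0 < s \<and> s < 1")
      case True
      have p: "x powr (- (a + b)) \<le> y powr (- (a + b))" if "0 < y" "y \<le> x" for x y
        using that a b by (intro powr_mono2') auto
      show ?thesis
      proof (cases "s \<le> r")
        case le: True
        have "(1 - r * s) powr (- (a + b)) \<le> (1 - s) powr (- (a + b))"
          using True r by (intro p) (auto simp: mult_left_le_one_le)
        then have "(1 - s) powr (a - 1) * (1 - r * s) powr (- (a + b)) \<le> (1 - s) powr (a - 1) * (1 - s) powr (- (a + b))"
          by (intro mult_left_mono) auto
        also have "\<dots> = (1 - s) powr (- b - 1)" by (simp only: powr_add[symmetric]) (rule arg_cong[where f="\<lambda>z. (1 - s) powr z"], simp)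
        finally have "ennreal ((1 - s) powr (a - 1) * (1 - r * s) powr (- (a + b))) \<le> ennreal ((1 - s) powr (- b - 1))"
          by (rule ennreal_leI)
        then show ?thesis using True le by (simp add: add_increasing2)
      next
        case gt: False
        have "r * s \<le> r" using True r by (simp add: mult_left_le)
        then have "(1 - r * s) powr (- (a + b)) \<le> (1 - r) powr (- (a + b))"
          using True r by (intro p) auto
        then have "(1 - s) powr (a - 1) * (1 - r * s) powr (- (a + b)) \<le> (1 - r) powr (- (a + b)) * (1 - s) powr (a - 1)"
          by (subst mult.commute) (intro mult_right_mono, auto)
        then have "ennreal ((1 - s) powr (a - 1) * (1 - r * s) powr (- (a + b))) \<le> ennreal ((1 - r) powr (- (a + b)) * (1 - s) powr (a - 1))"
          by (rule ennreal_leI)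
        then show ?thesis using True gt by (simp add: ennreal_mult)
      qed
    qed auto
  qed
  also have "\<dots> = (\<integral>\<^sup>+s. ennreal ((1 - s) powr (- b - 1)) * indicator {0..r} s \<partial>lborel) +
      ennreal ((1 - r) powr (- (a + b))) * (\<integral>\<^sup>+s. ennreal ((1 - s) powr (a - 1)) * indicator {r..1} s \<partial>lborel)"
    by (subst nn_integral_add) (auto simp: nn_integral_cmult)
  also have "\<dots> \<le> ennreal ((1 - r) powr (- b) / b) + ennreal ((1 - r) powr (- (a + b))) * ennreal ((1 - r) powr a / a)"
    using r by (intro add_mono nn_integral_powr_away_1 b) (auto simp: nn_integral_powr_near_1[OF a])
  also have "\<dots> = ennreal ((1 / a + 1 / b) * (1 - r) powr (- b))"
  proof -
    have "(1 - r) powr (- (a + b)) * (1 - r) powr a = (1 - r) powr (- b)" by (simp flip: powr_add)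
    then have "(1 - r) powr (- (a + b)) * ((1 - r) powr a / a) = (1 - r) powr (- b) / a" by simp
    moreover have "(1 / a + 1 / b) * (1 - r) powr (- b) = (1 - r) powr (- b) / b + (1 - r) powr (- b) / a"
      by (simp add: distrib_right)
    ultimately show ?thesis using a b by (simp add: ennreal_plus flip: ennreal_mult)
  qed
  finally show ?thesis .
qed

section \<open>Averages of dilations, and L^1 bounds for fractional derivatives of the Poisson
  kernel\<close>

context spherical_expansion
begin

lemma exp_decay_mult_bounded:
  assumes "exp_decay a" "\<And>k j. j \<in> {1..d k} \<Longrightarrow> cmod (b k j) \<le> D" "0 \<le> D"
  shows "exp_decay (\<lambda>k j. b k j * a k j)"
proof -
  obtain C s where "decays C s a" using assms(1) unfolding exp_decay_def by blast
  then have "decays (D * C) s (\<lambda>k j. b k j * a k j)" using assms(2,3) by (rule decays_mult_bounded)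
  then show ?thesis unfolding exp_decay_def by blast
qed

text \<open>The \<open>c k\<close> are moments, so multiplying by them averages the dilates of
  \<open>e\<close> with weight \<open>w\<close>, and the norm of an average is at most the average
  of the norms. The radius \<open>g t\<close> is kept general: it is t for Gamma quotients and t^2
  for convolutions.\<close>

lemma L1_mixture:
  assumes M: "sigma_finite_measure M" and e: "exp_decay e"
    and w[measurable]: "w \<in> borel_measurable M" and g[measurable]: "g \<in> borel_measurable M"
    and w0: "\<And>t. t \<in> space M \<Longrightarrow> 0 \<le> w t" and g01: "\<And>t. t \<in> space M \<Longrightarrow> 0 \<le> g t \<and> g t \<le> (1::real)"
    and c: "\<And>k. (\<integral>\<^sup>+t. ennreal (w t * g t ^ k) \<partial>M) = ennreal (c k)" and c0: "\<And>k. 0 \<le> c k"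
  shows "L1 (\<lambda>k j. of_real (c k) * e k j) \<le> (\<integral>\<^sup>+t. ennreal (w t) * L1 (dilate (g t) e) \<partial>M)"
proof -
  interpret M: sigma_finite_measure M by (rule M)
  interpret P: pair_sigma_finite M \<sigma> ..
  have wg: "integrable M (\<lambda>t. w t * g t ^ k)" "(\<integral>t. w t * g t ^ k \<partial>M) = c k" for k
  proof -
    have "AE t in M. 0 \<le> w t * g t ^ k" using w0 g01 by (intro AE_I2) auto
    then show "integrable M (\<lambda>t. w t * g t ^ k)" "(\<integral>t. w t * g t ^ k \<partial>M) = c k"
      using nn_integral_eq_integrable[of "\<lambda>t. w t * g t ^ k" M "c k"] c[of k] c0[of k] by auto
  qed
  \<comment> \<open>Moments of a function with values in [0,1] decrease, so \<open>c 0\<close>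
    serves as a majorant when sum and integral are exchanged.\<close>
  have cle: "c k \<le> c 0" for k
  proof -
    have "c k \<le> (\<integral>t. w t * g t ^ 0 \<partial>M)" unfolding wg(2)[of k, symmetric]
      by (intro integral_mono wg) (use w0 g01 in \<open>auto intro!: mult_left_le power_le_one\<close>)
    then show ?thesis by (simp only: wg)
  qed
  have meas: "(\<lambda>(t, x). sphere_series (dilate (g t) e) x) \<in> borel_measurable (M \<Otimes>\<^sub>M \<sigma>)"
  proof -
    have "(\<lambda>p. of_real (g (fst p) ^ k) * block e k (snd p)) \<in> borel_measurable (M \<Otimes>\<^sub>M \<sigma>)" for k
      by (intro borel_measurable_times measurable_compose[OF measurable_snd block_measurable]) measurable
    then show ?thesis unfolding sphere_series_def block_dilate split_beta
      by (intro borel_measurable_suminf)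
  qed
  have "L1 (\<lambda>k j. of_real (c k) * e k j) \<le> (\<integral>\<^sup>+x. (\<integral>\<^sup>+t. ennreal (w t) * ennreal (cmod (sphere_series (dilate (g t) e) x)) \<partial>M) \<partial>\<sigma>)"
    unfolding L1_def
  proof (rule nn_integral_mono)
    fix x assume "x \<in> space \<sigma>"
    then have x: "norm x = 1" by simp
    let ?f = "\<lambda>k t. (w t * g t ^ k) *\<^sub>R block e k x"
    have sb: "summable (\<lambda>k. cmod (block e k x))" by (rule summable_norm_block[OF e x])
    have le: "norm (?f k t) \<le> w t * cmod (block e k x)" if t: "t \<in> space M" for t k
      using w0[OF t] g01[OF t] by (auto simp: abs_mult intro!: mult_right_mono mult_left_le power_le_one)
    have i: "integrable M (?f k)" for k by (intro integrable_scaleR_left wg)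
    have sf: "summable (\<lambda>k. norm (?f k t))" if t: "t \<in> space M" for t
      by (rule summable_comparison_test'[OF summable_mult[OF sb, of "w t"]]) (use le[OF t] in simp)
    have s: "AE t in M. summable (\<lambda>k. norm (?f k t))" using sf by (rule AE_I2)
    have si: "summable (\<lambda>k. \<integral>t. norm (?f k t) \<partial>M)"
    proof (rule summable_comparison_test'[OF summable_mult[OF sb, of "c 0"]])
      fix k
      have "(\<integral>t. norm (?f k t) \<partial>M) = (\<integral>t. (w t * g t ^ k) * cmod (block e k x) \<partial>M)"
        using w0 g01 by (intro Bochner_Integration.integral_cong) auto
      also have "\<dots> = c k * cmod (block e k x)" using wg by simp
      also have "\<dots> \<le> c 0 * cmod (block e k x)" by (intro mult_right_mono cle) simp
      finally show "norm (\<integral>t. norm (?f k t) \<partial>M) \<le> c 0 * cmod (block e k x)" by simp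
    qed
    have "(\<integral>t. ?f k t \<partial>M) = block (\<lambda>k j. of_real (c k) * e k j) k x" for k
    proof -
      have "(\<integral>t. ?f k t \<partial>M) = (\<integral>t. w t * g t ^ k \<partial>M) *\<^sub>R block e k x"
        by (rule Bochner_Integration.integral_scaleR_left) (rule wg)
      then show ?thesis unfolding wg by (simp add: block_def sum_distrib_left mult.assoc scaleR_conv_of_real)
    qed
    then have "(\<lambda>k. block (\<lambda>k j. of_real (c k) * e k j) k x) sums (\<integral>t. (\<Sum>k. ?f k t) \<partial>M)"
      using sums_integral[OF i s si] by simp
    then have eq: "sphere_series (\<lambda>k j. of_real (c k) * e k j) x = (\<integral>t. (\<Sum>k. ?f k t) \<partial>M)"
      unfolding sphere_series_def by (rule sums_unique[symmetric])
    have "ennreal (cmod (sphere_series (\<lambda>k j. of_real (c k) * e k j) x)) \<le> (\<integral>\<^sup>+t. ennreal (cmod (\<Sum>k. ?f k t)) \<partial>M)"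
      unfolding eq by (rule integral_norm_bound_ennreal[OF integrable_suminf[OF i s si]])
    also have "\<dots> = (\<integral>\<^sup>+t. ennreal (w t) * ennreal (cmod (sphere_series (dilate (g t) e) x)) \<partial>M)"
    proof (rule nn_integral_cong)
      fix t assume t: "t \<in> space M"
      have "summable (\<lambda>k. of_real (g t ^ k) * block e k x)"
        by (rule summable_comparison_test'[OF sb])
          (use g01[OF t] in \<open>auto simp: norm_mult norm_power intro!: mult_left_le_one_le power_le_one\<close>)
      then have "(\<Sum>k. ?f k t) = of_real (w t) * sphere_series (dilate (g t) e) x"
        by (simp add: sphere_series_def block_dilate scaleR_conv_of_real mult.assoc suminf_mult)
      then show "ennreal (cmod (\<Sum>k. ?f k t)) = ennreal (w t) * ennreal (cmod (sphere_series (dilate (g t) e) x))"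
        using w0[OF t] by (simp add: norm_mult ennreal_mult)
    qed
    finally show "ennreal (cmod (sphere_series (\<lambda>k j. of_real (c k) * e k j) x))
      \<le> (\<integral>\<^sup>+t. ennreal (w t) * ennreal (cmod (sphere_series (dilate (g t) e) x)) \<partial>M)" .
  qed
  also have "\<dots> = (\<integral>\<^sup>+t. (\<integral>\<^sup>+x. ennreal (w t) * ennreal (cmod (sphere_series (dilate (g t) e) x)) \<partial>\<sigma>) \<partial>M)"
  proof (rule P.Fubini')
    have "(\<lambda>p. ennreal (w (fst p)) * ennreal (cmod ((\<lambda>(t, x). sphere_series (dilate (g t) e) x) p))) \<in> borel_measurable (M \<Otimes>\<^sub>M \<sigma>)"
      using meas by measurable
    then show "(\<lambda>(t, x). ennreal (w t) * ennreal (cmod (sphere_series (dilate (g t) e) x))) \<in> borel_measurable (M \<Otimes>\<^sub>M \<sigma>)"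
      by (simp add: split_beta)
  qed
  also have "\<dots> = (\<integral>\<^sup>+t. ennreal (w t) * L1 (dilate (g t) e) \<partial>M)"
  proof (rule nn_integral_cong)
    fix t
    show "(\<integral>\<^sup>+x. ennreal (w t) * ennreal (cmod (sphere_series (dilate (g t) e) x)) \<partial>\<sigma>) = ennreal (w t) * L1 (dilate (g t) e)"
      unfolding L1_def using sphere_series_measurable[of "dilate (g t) e"] by (intro nn_integral_cmult) measurable
  qed
  finally show ?thesis .
qed

text \<open>Passing from radius s to r is multiplication by (r/s)^k, that is, integration against a
  Poisson kernel of L^1 norm 1.\<close>

lemma L1_dilate_mono:
  assumes a: "tame a" and r: "0 \<le> r" "r \<le> s" "s < 1"
  shows "L1 (dilate r a) \<le> L1 (dilate s a)"
proof (cases "r = s")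
  case False
  then have rs: "0 \<le> r / s" "r / s < 1" "0 < s" using r by auto
  have "L1 (\<lambda>k j. of_real ((r / s) ^ k) * dilate s a k j) \<le> ennreal 1 * L1 (dilate s a)"
    by (rule L1_mult[OF kernel_bound_power[OF rs(1,2)] tame_exp_decay[OF a]]) (use r rs in auto)
  moreover have "(\<lambda>k j. of_real ((r / s) ^ k) * dilate s a k j) = dilate r a"
    using rs by (auto simp: dilate_def fun_eq_iff power_divide)
  ultimately show ?thesis by simp
qed simp

definition \<nu> :: real where "\<nu> = real CARD('n) / 2"

lemma nu_ge_1: "\<nu> \<ge> 1"
  using card_ge_2 by (simp add: \<nu>_def)

text \<open>A Pochhammer symbol is a product of N linear factors in k. Each of them takes its own
  power s^k, and so does the Poisson kernel of the base case, whence the radius s^(N+1).\<close>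

lemma kernel_bound_pochhammer_aux:
  "\<exists>C\<ge>0. \<forall>s. 0 \<le> s \<and> s < 1 \<longrightarrow>
     kernel_bound (\<lambda>k j. of_real (pochhammer (real k + \<nu>) N * (s ^ Suc N) ^ k)) (C / (1 - s) ^ N)"
proof (induction N)
  case 0
  then show ?case using kernel_bound_power by (intro exI[of _ 1]) auto
next
  case (Suc N)
  then obtain C where C: "C \<ge> 0" "\<And>s. 0 \<le> s \<Longrightarrow> s < 1 \<Longrightarrow>
      kernel_bound (\<lambda>k j. of_real (pochhammer (real k + \<nu>) N * (s ^ Suc N) ^ k)) (C / (1 - s) ^ N)" by blast
  define C' where "C' = C * (2 + real CARD('n) + (\<nu> + real N))"
  have "kernel_bound (\<lambda>k j. of_real (pochhammer (real k + \<nu>) (Suc N) * (s ^ Suc (Suc N)) ^ k)) (C' / (1 - s) ^ Suc N)"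
    if s: "0 \<le> s" "s < 1" for s
  proof -
    have kb: "kernel_bound (\<lambda>k j. of_real (pochhammer (real k + \<nu>) N * (s ^ Suc N) ^ k) * of_real ((real k + (\<nu> + real N)) * s ^ k))
      (C / (1 - s) ^ N * ((2 + real CARD('n) + (\<nu> + real N)) / (1 - s)))"
      by (intro kernel_bound_mult C kernel_bound_linear s) (use nu_ge_1 in auto)
    have eq1: "C / (1 - s) ^ N * ((2 + real CARD('n) + (\<nu> + real N)) / (1 - s)) = C' / (1 - s) ^ Suc N"
      by (simp add: C'_def mult.commute)
    have eq2: "(\<lambda>k j. of_real (pochhammer (real k + \<nu>) N * (s ^ Suc N) ^ k) * of_real ((real k + (\<nu> + real N)) * s ^ k))
      = (\<lambda>k j. complex_of_real (pochhammer (real k + \<nu>) (Suc N) * (s ^ Suc (Suc N)) ^ k))"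
      by (auto simp: fun_eq_iff pochhammer_Suc power_mult_distrib algebra_simps simp flip: of_real_mult)
    show ?thesis using kb unfolding eq1 eq2 .
  qed
  moreover have "C' \<ge> 0" using C nu_ge_1 by (simp add: C'_def)
  ultimately show ?case by blast
qed

text \<open>Take s as the root of r of order N+1. Bernoulli's inequality gives 1 - r \<le> (N+1)(1 -
  s), so the change of radius costs only the constant (N+1)^N.\<close>

lemma kernel_bound_pochhammer:
  obtains C where "C \<ge> 0" "\<And>r. 0 \<le> r \<Longrightarrow> r < 1 \<Longrightarrow>
     kernel_bound (\<lambda>k j. of_real (pochhammer (real k + \<nu>) N * r ^ k)) (C / (1 - r) ^ N)"
proof -
  obtain C where C: "C \<ge> 0" "\<And>s. 0 \<le> s \<Longrightarrow> s < 1 \<Longrightarrow>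
     kernel_bound (\<lambda>k j. of_real (pochhammer (real k + \<nu>) N * (s ^ Suc N) ^ k)) (C / (1 - s) ^ N)"
    using kernel_bound_pochhammer_aux[of N] by blast
  show ?thesis
  proof
    show "C * real (Suc N) ^ N \<ge> 0" using C by simp
    fix r :: real assume r: "0 \<le> r" "r < 1"
    define s where "s = root (Suc N) r"
    have s: "0 \<le> s" "s < 1" "s ^ Suc N = r"
      using r by (auto simp: s_def real_root_pow_pos2 simp del: power_Suc)
    have "1 + real (Suc N) * (s - 1) \<le> (1 + (s - 1)) ^ Suc N" by (rule Bernoulli_inequality) (use s in auto)
    then have "1 - r \<le> real (Suc N) * (1 - s)" using s by (simp add: algebra_simps)
    then have "(1 - r) ^ N \<le> real (Suc N) ^ N * (1 - s) ^ N"
      unfolding power_mult_distrib[symmetric] using r by (intro power_mono) auto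
    then have "C * (1 - r) ^ N \<le> C * (real (Suc N) ^ N * (1 - s) ^ N)" using C(1) by (rule mult_left_mono)
    then have "C / (1 - s) ^ N \<le> C * real (Suc N) ^ N / (1 - r) ^ N"
      using r s by (simp add: frac_le_eq field_simps)
    with C(2)[OF s(1,2)] show "kernel_bound (\<lambda>k j. of_real (pochhammer (real k + \<nu>) N * r ^ k)) (C * real (Suc N) ^ N / (1 - r) ^ N)"
      unfolding s(3) by (rule kernel_bound_mono)
  qed
qed

text \<open>For an integer N > t and a = N - t, the Gamma quotient is 1/Gamma(a) times a Beta value
  times a Pochhammer symbol. The Beta values are moments, so the integer bound (1 - r s)^(-N) is
  averaged against (1 - s)^(a-1), which lowers the exponent from N to t.\<close>

lemma kernel_bound_Gamma:
  assumes t: "t > 0"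
  obtains C where "C \<ge> 0" "\<And>r. 0 \<le> r \<Longrightarrow> r < 1 \<Longrightarrow>
     kernel_bound (\<lambda>k j. of_real (Gamma (real k + \<nu> + t) / Gamma (real k + \<nu>) * r ^ k)) (C * (1 - r) powr (- t))"
proof -
  obtain N :: nat where N: "t < real N" using reals_Archimedean2 by blast
  define a where "a = real N - t"
  have a: "a > 0" using N by (simp add: a_def)
  obtain C where C: "C \<ge> 0" "\<And>r. 0 \<le> r \<Longrightarrow> r < 1 \<Longrightarrow>
     kernel_bound (\<lambda>k j. of_real (pochhammer (real k + \<nu>) N * r ^ k)) (C / (1 - r) ^ N)"
    by (rule kernel_bound_pochhammer[of N]) (rule that)
  let ?c = "\<lambda>k. Beta (real k + \<nu> + t) a"
  define w where "w s = s powr (\<nu> + t - 1) * (1 - s) powr (a - 1)" for s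
  have kn: "real k + \<nu> > 0" for k using nu_ge_1 by (simp add: add_nonneg_pos)
  have Beta0: "?c k \<ge> 0" for k unfolding Beta_def using kn[of k] t a
    by (intro divide_nonneg_nonneg mult_nonneg_nonneg less_imp_le[OF Gamma_real_pos]) auto
  have w: "(\<integral>\<^sup>+s. ennreal (w s * s ^ k) \<partial>I01) = ennreal (?c k)" for k
  proof -
    have "(\<integral>\<^sup>+s. ennreal (w s * s ^ k) \<partial>I01) = (\<integral>\<^sup>+s. ennreal (s powr ((real k + \<nu> + t) - 1) * (1 - s) powr (a - 1)) \<partial>I01)"
    proof (rule nn_integral_cong)
      fix s assume "s \<in> space I01"
      then have s: "s > 0" by simp
      have "s powr ((real k + \<nu> + t) - 1) = s powr (real k + (\<nu> + t - 1))" by (simp add: algebra_simps)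
      also have "\<dots> = s ^ k * s powr (\<nu> + t - 1)" using s by (simp add: powr_add powr_realpow)
      finally show "ennreal (w s * s ^ k) = ennreal (s powr ((real k + \<nu> + t) - 1) * (1 - s) powr (a - 1))"
        by (simp add: w_def mult_ac)
    qed
    also have "\<dots> = ennreal (?c k)" by (rule nn_integral_Beta) (use kn[of k] t a in auto)
    finally show ?thesis .
  qed
  have wm: "w \<in> borel_measurable borel" unfolding w_def[abs_def] by measurable
  have w0: "w s \<ge> 0" for s by (simp add: w_def)
  have Beta_le: "?c k \<le> ?c 0" for k
  proof -
    have "ennreal (?c k) \<le> ennreal (?c 0)"
      unfolding w[symmetric] by (intro nn_integral_mono ennreal_leI) (auto simp: w_def intro!: mult_left_le power_le_one)
    then show ?thesis using Beta0[of 0] by simp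
  qed
  have Gt: "Gamma (real k + \<nu> + t) / Gamma (real k + \<nu>) = (1 / Gamma a) * (?c k * pochhammer (real k + \<nu>) N)" for k
  proof -
    have pos: "Gamma (real k + \<nu>) > 0" "Gamma (real k + \<nu> + t) > 0" "Gamma a > 0" "Gamma (real k + \<nu> + real N) > 0"
      using kn[of k] t a by auto
    have poch: "pochhammer (real k + \<nu>) N = Gamma (real k + \<nu> + real N) / Gamma (real k + \<nu>)"
      using kn[of k] by (intro pochhammer_Gamma) (auto elim!: nonpos_Ints_cases)
    have sum: "real k + \<nu> + t + a = real k + \<nu> + real N" by (simp add: a_def)
    show ?thesis unfolding Beta_def poch sum using pos by (simp add: less_imp_neq[symmetric])
  qed
  have Ga: "Gamma a > 0" using a by simp
  define C' where "C' = 1 / Gamma a * (C * (1 / a + 1 / t))"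
  show ?thesis
  proof
    show "C' \<ge> 0" using C Ga a t by (simp add: C'_def)
    fix r :: real assume r: "0 \<le> r" "r < 1"
    let ?e = "\<lambda>k j. complex_of_real (pochhammer (real k + \<nu>) N * r ^ k)"
    have e: "exp_decay ?e" using C(2)[OF r] by (simp add: kernel_bound_def)
    have ce: "exp_decay (\<lambda>k j. of_real (?c k) * ?e k j)"
      by (rule exp_decay_mult_bounded[OF e, of _ "?c 0"]) (use Beta0[of 0] Beta0 Beta_le in auto)
    have eq: "(\<lambda>k j. complex_of_real (Gamma (real k + \<nu> + t) / Gamma (real k + \<nu>) * r ^ k))
        = (\<lambda>k j. of_real (1 / Gamma a) * (of_real (?c k) * ?e k j))"
      unfolding Gt by (auto simp: fun_eq_iff mult_ac simp flip: of_real_mult)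
    show "kernel_bound (\<lambda>k j. of_real (Gamma (real k + \<nu> + t) / Gamma (real k + \<nu>) * r ^ k)) (C' * (1 - r) powr (- t))"
      unfolding kernel_bound_def eq
    proof (intro conjI allI impI)
      show "exp_decay (\<lambda>k j. of_real (1 / Gamma a) * (of_real (?c k) * ?e k j))"
        by (rule exp_decay_mult_bounded[OF ce, of _ "1 / Gamma a"]) (use Ga in \<open>auto simp: norm_divide\<close>)
      show "0 \<le> C' * (1 - r) powr (- t)" using \<open>C' \<ge> 0\<close> by simp
      fix y :: "real^'n" assume y: "norm y = 1"
      let ?ey = "\<lambda>k j. ?e k j * of_real (Y k j y)"
      have ey: "exp_decay ?ey" by (rule exp_decay_mult_Y[OF e y])
      have "L1 (\<lambda>k j. of_real (?c k) * ?ey k j) \<le> (\<integral>\<^sup>+s. ennreal (w s) * L1 (dilate s ?ey) \<partial>I01)"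
        by (rule L1_mixture[OF sigma_finite_I01 ey, where w=w and g="\<lambda>s. s" and c="?c"])
          (auto simp: w0 Beta0 w intro!: measurable_I01 wm)
      also have "\<dots> \<le> (\<integral>\<^sup>+s. ennreal C * ennreal ((1 - s) powr (a - 1) * (1 - r * s) powr (- (a + t))) \<partial>I01)"
      proof (rule nn_integral_mono)
        fix s assume "s \<in> space I01"
        then have s: "0 < s" "s < 1" by auto
        have rs: "0 \<le> r * s" "r * s < 1" using r s by (auto intro: le_less_trans[of _ s] simp: mult_left_le_one_le)
        have "dilate s ?ey = (\<lambda>k j. of_real (pochhammer (real k + \<nu>) N * (r * s) ^ k) * of_real (Y k j y))"
          by (auto simp: dilate_def fun_eq_iff power_mult_distrib mult_ac)
        then have "L1 (dilate s ?ey) \<le> ennreal (C / (1 - r * s) ^ N)"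
          using C(2)[OF rs] y by (simp add: kernel_bound_def)
        also have "C / (1 - r * s) ^ N = C * (1 - r * s) powr (- (a + t))"
          using rs by (simp add: a_def powr_minus powr_realpow divide_inverse)
        finally have 1: "L1 (dilate s ?ey) \<le> ennreal (C * (1 - r * s) powr (- (a + t)))" .
        have "w s \<le> (1 - s) powr (a - 1)"
        proof -
          have "s powr (\<nu> + t - 1) \<le> 1" using s nu_ge_1 t by (intro powr_le1) auto
          then show ?thesis unfolding w_def by (intro mult_left_le_one_le) auto
        qed
        then have "ennreal (w s) * L1 (dilate s ?ey) \<le> ennreal ((1 - s) powr (a - 1)) * ennreal (C * (1 - r * s) powr (- (a + t)))"
          by (intro mult_mono ennreal_leI 1) auto
        also have "\<dots> = ennreal C * ennreal ((1 - s) powr (a - 1) * (1 - r * s) powr (- (a + t)))"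
          using C(1) by (simp add: mult_ac flip: ennreal_mult)
        finally show "ennreal (w s) * L1 (dilate s ?ey) \<le> \<dots>" .
      qed
      also have "\<dots> = ennreal C * (\<integral>\<^sup>+s. ennreal ((1 - s) powr (a - 1) * (1 - r * s) powr (- (a + t))) \<partial>I01)"
        by (rule nn_integral_cmult) (intro measurable_I01, measurable)
      also have "\<dots> \<le> ennreal C * ennreal ((1 / a + 1 / t) * (1 - r) powr (- t))"
        by (intro mult_left_mono nn_integral_two_powr_le a t r) simp
      also have "\<dots> = ennreal (C * (1 / a + 1 / t) * (1 - r) powr (- t))"
        using C(1) a t by (simp add: mult.assoc flip: ennreal_mult)
      finally have le: "L1 (\<lambda>k j. of_real (?c k) * ?ey k j) \<le> ennreal (C * (1 / a + 1 / t) * (1 - r) powr (- t))" .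
      have cey: "exp_decay (\<lambda>k j. of_real (?c k) * ?ey k j)"
        by (rule exp_decay_mult_bounded[OF ey, of _ "?c 0"]) (use Beta0[of 0] Beta0 Beta_le in auto)
      have "L1 (\<lambda>k j. of_real (1 / Gamma a) * (of_real (?c k) * ?ey k j)) = ennreal (1 / Gamma a) * L1 (\<lambda>k j. of_real (?c k) * ?ey k j)"
        unfolding L1_scale[OF cey] norm_of_real using Ga by simp
      also have "\<dots> \<le> ennreal (1 / Gamma a) * ennreal (C * (1 / a + 1 / t) * (1 - r) powr (- t))"
        by (intro mult_left_mono le) simp
      also have "\<dots> = ennreal (C' * (1 - r) powr (- t))"
        using C(1) a t Ga by (simp add: C'_def mult.assoc flip: ennreal_mult)
      finally show "L1 (\<lambda>k j. of_real (1 / Gamma a) * (of_real (?c k) * ?e k j) * of_real (Y k j y)) \<le> ennreal (C' * (1 - r) powr (- t))"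
        by (simp only: mult.assoc)
    qed
  qed
qed

end

section \<open>Weighted norms of monotone means\<close>

lemma powr_mult_le:
  fixes c u e :: real
  assumes "0 < u" "1 \<le> c" "c \<le> 2"
  shows "(c * u) powr e \<le> 2 powr \<bar>e\<bar> * u powr e" and "u powr e \<le> 2 powr \<bar>e\<bar> * (c * u) powr e"
proof -
  have *: "c powr e \<le> 2 powr \<bar>e\<bar>" for e :: real
  proof -
    have "c powr e \<le> c powr \<bar>e\<bar>" using assms by (intro powr_mono) auto
    also have "\<dots> \<le> 2 powr \<bar>e\<bar>" using assms by (intro powr_mono2) auto
    finally show ?thesis .
  qed
  have m: "(c * u) powr e = c powr e * u powr e" using assms by (simp add: powr_mult)
  show "(c * u) powr e \<le> 2 powr \<bar>e\<bar> * u powr e"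
    unfolding m using *[of e] by (rule mult_right_mono) simp
  have "c powr (- e) * c powr e = 1" using assms by (simp flip: powr_add)
  then have "u powr e = c powr (- e) * (c * u) powr e" unfolding m by (simp flip: mult.assoc)
  also have "\<dots> \<le> 2 powr \<bar>e\<bar> * (c * u) powr e" using *[of "- e"] by (intro mult_right_mono) auto
  finally show "u powr e \<le> 2 powr \<bar>e\<bar> * (c * u) powr e" .
qed

text \<open>Makes the weights in 1 - s^2 and in 1 - s interchangeable. The constant has |e| because
  exponents of both signs occur, for instance \<alpha>p - 1.\<close>

lemma powr_one_minus_square:
  assumes "0 \<le> s" "s < (1::real)"
  shows "(1 - s\<^sup>2) powr e \<le> 2 powr \<bar>e\<bar> * (1 - s) powr e" and "(1 - s) powr e \<le> 2 powr \<bar>e\<bar> * (1 - s\<^sup>2) powr e"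
proof -
  have "1 - s\<^sup>2 = (1 + s) * (1 - s)" by (simp add: power2_eq_square algebra_simps)
  then show "(1 - s\<^sup>2) powr e \<le> 2 powr \<bar>e\<bar> * (1 - s) powr e" "(1 - s) powr e \<le> 2 powr \<bar>e\<bar> * (1 - s\<^sup>2) powr e"
    using powr_mult_le[of "1 - s" "1 + s" e] assms by auto
qed

text \<open>Convexity of the Q-th power at the point l, with equality for f = l. It linearizes
  Jensen's inequality, which can then be integrated.\<close>

lemma powr_tangent:
  assumes Q: "Q \<ge> 1" and f: "f \<ge> 0" and l: "l > (0::real)"
  shows "f \<le> (f powr Q * l powr (1 - Q) + (Q - 1) * l) / Q"
proof (cases "f = 0")
  case True
  then show ?thesis using assms by simp
next
  case False
  then have f: "f > 0" using f by simp
  have "((f / l) powr Q) powr (1 / Q) * 1 powr (1 - 1 / Q) \<le> (1 / Q) * (f / l) powr Q + (1 - 1 / Q) * 1"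
    using Q f l by (intro Youngs_inequality_0) auto
  moreover have "((f / l) powr Q) powr (1 / Q) = f / l" using Q f l by (simp add: powr_powr)
  ultimately have "f / l \<le> (1 / Q) * (f / l) powr Q + (1 - 1 / Q)" by simp
  then have "f / l * l \<le> ((1 / Q) * (f / l) powr Q + (1 - 1 / Q)) * l" using l by (intro mult_right_mono) auto
  moreover have "(f / l) powr Q * l = f powr Q * l powr (1 - Q)"
    using f l by (simp add: powr_divide powr_diff)
  moreover have "((1 / Q) * F + (1 - 1 / Q)) * l = (F * l + (Q - 1) * l) / Q" for F
    using Q by (simp add: field_simps)
  ultimately show ?thesis using l by simp
qed

text \<open>Jensen's inequality for the measure k dM of mass at most A. It follows by integrating
  \<open>powr_tangent\<close> with l = X/A: the linear part contributes (Q-1)/Q X, which is absorbed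
  on the left. One form serves both an integral over (0,1) and a weighted series.\<close>

lemma nn_integral_power_mean:
  fixes f k :: "'a \<Rightarrow> real"
  assumes Q: "Q \<ge> 1" and A: "A > 0" and k[measurable]: "k \<in> borel_measurable M" and f[measurable]: "f \<in> borel_measurable M"
    and k0: "\<And>t. t \<in> space M \<Longrightarrow> 0 \<le> k t" and f0: "\<And>t. t \<in> space M \<Longrightarrow> 0 \<le> f t"
    and kA: "(\<integral>\<^sup>+t. ennreal (k t) \<partial>M) \<le> ennreal A"
    and X: "0 \<le> X" "ennreal X \<le> (\<integral>\<^sup>+t. ennreal (k t * f t) \<partial>M)"
  shows "ennreal (X powr Q) \<le> ennreal (A powr (Q - 1)) * (\<integral>\<^sup>+t. ennreal (k t * f t powr Q) \<partial>M)"
proof (cases "(\<integral>\<^sup>+t. ennreal (k t * f t powr Q) \<partial>M) = \<infinity> \<or> X = 0")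
  case True
  then show ?thesis using A Q by (auto simp: ennreal_mult_top)
next
  case False
  then have X0: "X > 0" using X by simp
  obtain I where I: "(\<integral>\<^sup>+t. ennreal (k t * f t powr Q) \<partial>M) = ennreal I" "I \<ge> 0"
    using False by (cases "(\<integral>\<^sup>+t. ennreal (k t * f t powr Q) \<partial>M)") auto
  define l where "l = X / A"
  have l: "l > 0" using X0 A by (simp add: l_def)
  have "ennreal X \<le> (\<integral>\<^sup>+t. ennreal (k t * f t) \<partial>M)" by (rule X)
  also have "\<dots> \<le> (\<integral>\<^sup>+t. ennreal (l powr (1 - Q) / Q) * ennreal (k t * f t powr Q) + ennreal ((Q - 1) * l / Q) * ennreal (k t) \<partial>M)"
  proof (rule nn_integral_mono)
    fix t assume t: "t \<in> space M"
    have "k t * f t \<le> k t * ((f t powr Q * l powr (1 - Q) + (Q - 1) * l) / Q)"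
      by (intro mult_left_mono powr_tangent Q f0 l k0 t)
    also have "\<dots> = l powr (1 - Q) / Q * (k t * f t powr Q) + (Q - 1) * l / Q * k t"
      using Q by (simp add: field_simps)
    finally show "ennreal (k t * f t) \<le> ennreal (l powr (1 - Q) / Q) * ennreal (k t * f t powr Q) + ennreal ((Q - 1) * l / Q) * ennreal (k t)"
      using Q l k0[OF t] by (simp add: ennreal_leI flip: ennreal_mult ennreal_plus)
  qed
  also have "\<dots> = ennreal (l powr (1 - Q) / Q) * ennreal I + ennreal ((Q - 1) * l / Q) * (\<integral>\<^sup>+t. ennreal (k t) \<partial>M)"
    by (subst nn_integral_add) (auto simp: nn_integral_cmult I)
  also have "\<dots> \<le> ennreal (l powr (1 - Q) / Q) * ennreal I + ennreal ((Q - 1) * l / Q) * ennreal A"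
    by (intro add_left_mono mult_left_mono kA) simp
  also have "\<dots> = ennreal (l powr (1 - Q) / Q * I + (Q - 1) * l / Q * A)"
    using Q l I A by (simp flip: ennreal_mult ennreal_plus)
  finally have "X \<le> l powr (1 - Q) / Q * I + (Q - 1) * l / Q * A"
    using Q l I A by (subst (asm) ennreal_le_iff) auto
  moreover have "(Q - 1) * l / Q * A = (Q - 1) / Q * X" using A by (simp add: l_def)
  ultimately have "Q * X \<le> Q * (l powr (1 - Q) / Q * I + (Q - 1) / Q * X)" using Q by (intro mult_left_mono) auto
  moreover have "Q * (l powr (1 - Q) / Q * I + (Q - 1) / Q * X) = l powr (1 - Q) * I + (Q - 1) * X"
    using Q by (simp add: distrib_left)
  ultimately have "X \<le> l powr (1 - Q) * I" by (simp add: left_diff_distrib)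
  then have "l powr (Q - 1) * X \<le> l powr (Q - 1) * (l powr (1 - Q) * I)" by (intro mult_left_mono) auto
  also have "\<dots> = I" using l by (simp flip: powr_add mult.assoc)
  finally have "l powr (Q - 1) * X \<le> I" .
  then have "A powr (Q - 1) * (l powr (Q - 1) * X) \<le> A powr (Q - 1) * I" by (intro mult_left_mono) auto
  moreover have "A powr (Q - 1) * (l powr (Q - 1) * X) = X powr Q"
    using X0 A by (simp add: l_def powr_divide powr_diff)
  ultimately show ?thesis using I by (simp add: ennreal_leI flip: ennreal_mult)
qed

text \<open>The mixed norm as a condition on the means as a function of the radius, with N = n - 1.
  The outer power 1/p is dropped since only finiteness is recorded.\<close>

definition finite_norm :: "nat \<Rightarrow> ennreal \<Rightarrow> real \<Rightarrow> (real \<Rightarrow> real) \<Rightarrow> bool" where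
  "finite_norm N p \<alpha> \<phi> \<longleftrightarrow> (if p = \<infinity> then \<exists>B. \<forall>r\<in>{0..<1}. \<phi> r * (1 - r\<^sup>2) powr \<alpha> \<le> B
     else (\<integral>\<^sup>+r. ennreal (\<phi> r powr enn2real p * ((1 - r\<^sup>2) powr (\<alpha> * enn2real p - 1) * r ^ N)) \<partial>I01) < \<infinity>)"

text \<open>Monotonicity turns one value into a lower bound on [r, (1+r)/2], where the weight is
  comparable to (1-r)^(\<alpha>p-1); the length of the interval supplies the last power of 1 - r.
  Radii below 1/2, where r^N may be small, are compared with the value at 1/2.\<close>

lemma finite_norm_growth:
  assumes fin: "finite_norm N p \<alpha> \<phi>" and p: "1 < p" and al: "\<alpha> > 0"
    and nn: "\<And>r. 0 \<le> \<phi> r" and mono: "\<And>r s. 0 \<le> r \<Longrightarrow> r \<le> s \<Longrightarrow> s < 1 \<Longrightarrow> \<phi> r \<le> \<phi> s"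
  obtains B where "B > 0" "\<And>r. 0 \<le> r \<Longrightarrow> r < 1 \<Longrightarrow> \<phi> r * (1 - r\<^sup>2) powr \<alpha> \<le> B"
proof (cases "p = \<infinity>")
  case True
  then obtain B where "\<forall>r\<in>{0..<1}. \<phi> r * (1 - r\<^sup>2) powr \<alpha> \<le> B" using fin by (auto simp: finite_norm_def)
  then show ?thesis by (intro that[of "max B 1"]) (auto simp: le_max_iff_disj)
next
  case False
  define P where "P = enn2real p"
  have P: "P > 1" unfolding P_def using p False
    by (cases p) (auto simp: ennreal_less_iff simp flip: ennreal_1)
  define e where "e = \<alpha> * P - 1"
  obtain J where J: "(\<integral>\<^sup>+r. ennreal (\<phi> r powr P * ((1 - r\<^sup>2) powr e * r ^ N)) \<partial>I01) = ennreal J" "J \<ge> 0"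
    using fin False unfolding finite_norm_def P_def e_def
    by (cases "(\<integral>\<^sup>+r. ennreal (\<phi> r powr P * ((1 - r\<^sup>2) powr e * r ^ N)) \<partial>I01)") (auto simp: P_def e_def)
  \<comment> \<open>The three losses on [r, (1+r)/2]: (1/2)^N for s^N, and one factor
    \<open>2 powr \<bar>e\<bar>\<close> each for replacing 1 - r by 1 - s and 1 - s by 1 -
    s^2.\<close>
  define c where "c = (1/2) ^ N / (2 powr \<bar>e\<bar> * 2 powr \<bar>e\<bar>)"
  have c: "c > 0" by (simp add: c_def)
  define K where "K = (J / (c / 2)) powr (1 / P)"
  have main: "\<phi> r * (1 - r) powr \<alpha> \<le> K" if r: "1/2 \<le> r" "r < 1" for r
  proof -
    let ?u = "1 - r"
    have u: "?u > 0" using r by simp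
    have "ennreal (\<phi> r powr P * (c * ?u powr e)) * ennreal (?u / 2)
        = (\<integral>\<^sup>+s. ennreal (\<phi> r powr P * (c * ?u powr e)) * indicator {r..(1 + r) / 2} s \<partial>lborel)"
    proof -
      have "emeasure lborel {r..(1 + r) / 2} = ennreal (?u / 2)" using r by (simp add: field_simps)
      then show ?thesis by (subst nn_integral_cmult_indicator) auto
    qed
    also have "\<dots> \<le> (\<integral>\<^sup>+s. ennreal (\<phi> s powr P * ((1 - s\<^sup>2) powr e * s ^ N)) \<partial>I01)"
      unfolding nn_integral_I01
    proof (rule nn_integral_mono)
      fix s :: real
      show "ennreal (\<phi> r powr P * (c * ?u powr e)) * indicator {r..(1 + r) / 2} s
        \<le> ennreal (\<phi> s powr P * ((1 - s\<^sup>2) powr e * s ^ N)) * indicator {0<..<1} s"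
      proof (cases "s \<in> {r..(1 + r) / 2}")
        case True
        then have s: "r \<le> s" "s \<le> (1 + r) / 2" "0 < s" "s < 1" using r by auto
        have "?u powr e \<le> 2 powr \<bar>e\<bar> * (1 - s) powr e"
        proof -
          have "?u / (1 - s) \<ge> 1" "?u / (1 - s) \<le> 2" using s r by (auto simp: field_simps)
          from powr_mult_le(1)[OF _ this, of "1 - s" e] show ?thesis using s by simp
        qed
        also have "\<dots> \<le> 2 powr \<bar>e\<bar> * (2 powr \<bar>e\<bar> * (1 - s\<^sup>2) powr e)"
          using s by (intro mult_left_mono powr_one_minus_square) auto
        finally have "?u powr e / (2 powr \<bar>e\<bar> * 2 powr \<bar>e\<bar>) \<le> (1 - s\<^sup>2) powr e"
          by (simp add: field_simps)
        moreover have "(1/2) ^ N \<le> s ^ N" using s r by (intro power_mono) auto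
        ultimately have "?u powr e / (2 powr \<bar>e\<bar> * 2 powr \<bar>e\<bar>) * (1/2) ^ N \<le> (1 - s\<^sup>2) powr e * s ^ N"
          by (intro mult_mono) auto
        moreover have "\<phi> r powr P \<le> \<phi> s powr P" using s r nn P by (intro powr_mono2 mono) auto
        ultimately have "\<phi> r powr P * (?u powr e / (2 powr \<bar>e\<bar> * 2 powr \<bar>e\<bar>) * (1/2) ^ N) \<le> \<phi> s powr P * ((1 - s\<^sup>2) powr e * s ^ N)"
          using r by (intro mult_mono[of "\<phi> r powr P"]) auto
        then have "\<phi> r powr P * (c * ?u powr e) \<le> \<phi> s powr P * ((1 - s\<^sup>2) powr e * s ^ N)"
          by (simp add: c_def mult_ac)
        then show ?thesis using True s by (simp add: ennreal_leI)
      qed auto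
    qed
    finally have "ennreal (\<phi> r powr P * (c * ?u powr e) * (?u / 2)) \<le> ennreal J"
      using c u by (subst ennreal_mult) (auto simp: J)
    then have "\<phi> r powr P * (c * ?u powr e) * (?u / 2) \<le> J" using J by simp
    moreover have "?u powr e * ?u = ?u powr (\<alpha> * P)" using u by (simp add: e_def powr_diff)
    then have "\<phi> r powr P * (c * ?u powr e) * (?u / 2) = (\<phi> r powr P * ?u powr (\<alpha> * P)) * (c / 2)"
      by (simp add: mult_ac)
    ultimately have "\<phi> r powr P * ?u powr (\<alpha> * P) \<le> J / (c / 2)" using c by (simp add: field_simps)
    moreover have "(\<phi> r * ?u powr \<alpha>) powr P = \<phi> r powr P * ?u powr (\<alpha> * P)"
      using nn u by (simp add: powr_mult powr_powr)
    ultimately have "((\<phi> r * ?u powr \<alpha>) powr P) powr (1 / P) \<le> K"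
      unfolding K_def using P by (intro powr_mono2) auto
    then show ?thesis using P nn[of r] by (simp add: powr_powr)
  qed
  have K0: "K \<ge> 0" by (simp add: K_def)
  show ?thesis
  proof (rule that)
    show "2 powr \<alpha> * K + \<phi> (1/2) + 1 > 0" using K0 nn[of "1/2"] by (simp add: add_nonneg_pos)
    fix r :: real assume r: "0 \<le> r" "r < 1"
    show "\<phi> r * (1 - r\<^sup>2) powr \<alpha> \<le> 2 powr \<alpha> * K + \<phi> (1/2) + 1"
    proof (cases "r \<ge> 1/2")
      case True
      have "\<phi> r * (1 - r\<^sup>2) powr \<alpha> \<le> \<phi> r * (2 powr \<alpha> * (1 - r) powr \<alpha>)"
        using powr_one_minus_square(1)[OF r, of \<alpha>] al nn by (intro mult_left_mono) auto
      also have "\<dots> \<le> 2 powr \<alpha> * K" using main[OF True r(2)] by (simp add: mult_left_mono mult.left_commute)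
      finally show ?thesis using nn[of "1/2"] by linarith
    next
      case False
      have "(1 - r\<^sup>2) powr \<alpha> \<le> 1" using r al by (intro powr_le1) (auto simp: power_le_one)
      then have "\<phi> r * (1 - r\<^sup>2) powr \<alpha> \<le> \<phi> (1/2) * 1"
        using r False nn by (intro mult_mono mono) auto
      moreover have "0 \<le> 2 powr \<alpha> * K" using K0 by simp
      ultimately show ?thesis by linarith
    qed
  qed
qed

text \<open>The integrand for Q is the integrand for P times (\<phi> v^\<alpha>)^(Q-P) with v = 1 -
  r^2, and the growth estimate bounds this factor.\<close>

lemma finite_norm_embed:
  assumes fin: "finite_norm N p \<alpha> \<phi>" and p: "1 < p" "p \<le> q" and al: "\<alpha> > 0"
    and nn: "\<And>r. 0 \<le> \<phi> r" and mono: "\<And>r s. 0 \<le> r \<Longrightarrow> r \<le> s \<Longrightarrow> s < 1 \<Longrightarrow> \<phi> r \<le> \<phi> s"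
  shows "finite_norm N q \<alpha> \<phi>"
proof -
  obtain B where B: "B > 0" "\<And>r. 0 \<le> r \<Longrightarrow> r < 1 \<Longrightarrow> \<phi> r * (1 - r\<^sup>2) powr \<alpha> \<le> B"
    using finite_norm_growth[OF fin p(1) al nn mono] by metis
  show ?thesis
  proof (cases "q = \<infinity>")
    case True
    then show ?thesis using B by (auto simp: finite_norm_def intro!: exI[of _ B])
  next
    case False
    then have pf: "p \<noteq> \<infinity>" using p by (auto simp: top_unique)
    define P where "P = enn2real p"
    define Q where "Q = enn2real q"
    have PQ: "0 \<le> P" "P \<le> Q"
      unfolding P_def Q_def using p False by (auto intro!: enn2real_mono simp: less_top)
    have "(\<integral>\<^sup>+r. ennreal (\<phi> r powr Q * ((1 - r\<^sup>2) powr (\<alpha> * Q - 1) * r ^ N)) \<partial>I01)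
       \<le> (\<integral>\<^sup>+r. ennreal (B powr (Q - P)) * ennreal (\<phi> r powr P * ((1 - r\<^sup>2) powr (\<alpha> * P - 1) * r ^ N)) \<partial>I01)"
    proof (rule nn_integral_mono)
      fix r assume "r \<in> space I01"
      then have r: "0 < r" "r < 1" by auto
      define v where "v = 1 - r\<^sup>2"
      have v: "v > 0" using r by (simp add: v_def power_less_one_iff abs_square_less_1)
      have "\<phi> r powr Q * v powr (\<alpha> * Q - 1) = (\<phi> r * v powr \<alpha>) powr (Q - P) * (\<phi> r powr P * v powr (\<alpha> * P - 1))"
      proof -
        have "(\<phi> r * v powr \<alpha>) powr (Q - P) = \<phi> r powr (Q - P) * v powr (\<alpha> * (Q - P))"
          using nn v by (simp add: powr_mult powr_powr)
        moreover have "\<phi> r powr (Q - P) * \<phi> r powr P = \<phi> r powr Q" by (simp flip: powr_add)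
        moreover have "v powr (\<alpha> * (Q - P)) * v powr (\<alpha> * P - 1) = v powr (\<alpha> * Q - 1)"
          by (simp flip: powr_add) (simp add: algebra_simps)
        ultimately show ?thesis by (simp add: mult_ac)
      qed
      also have "\<dots> \<le> B powr (Q - P) * (\<phi> r powr P * v powr (\<alpha> * P - 1))"
        using B(2)[of r] r nn PQ by (intro mult_right_mono powr_mono2) (auto simp: v_def)
      finally have "\<phi> r powr Q * v powr (\<alpha> * Q - 1) * r ^ N \<le> B powr (Q - P) * (\<phi> r powr P * v powr (\<alpha> * P - 1)) * r ^ N"
        using r by (intro mult_right_mono) auto
      then show "ennreal (\<phi> r powr Q * ((1 - r\<^sup>2) powr (\<alpha> * Q - 1) * r ^ N))
        \<le> ennreal (B powr (Q - P)) * ennreal (\<phi> r powr P * ((1 - r\<^sup>2) powr (\<alpha> * P - 1) * r ^ N))"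
        using r unfolding v_def by (simp add: mult.assoc ennreal_leI flip: ennreal_mult)
    qed
    also have "\<dots> = ennreal (B powr (Q - P)) * (\<integral>\<^sup>+r. ennreal (\<phi> r powr P * ((1 - r\<^sup>2) powr (\<alpha> * P - 1) * r ^ N)) \<partial>I01)"
    proof (rule nn_integral_cmult)
      have "mono_on {0<..<1} \<phi>" using mono by (auto simp: mono_on_def)
      then have "\<phi> \<in> borel_measurable (restrict_space borel {0<..<1})" by (rule borel_measurable_mono_on_fnc)
      then have [measurable]: "\<phi> \<in> borel_measurable I01"
        unfolding I01_def using measurable_cong_sets[OF sets_restrict_space_cong[OF sets_lborel] refl] by blast
      have [measurable]: "(\<lambda>x. x) \<in> borel_measurable I01" by (rule measurable_I01) simp
      show "(\<lambda>r. ennreal (\<phi> r powr P * ((1 - r\<^sup>2) powr (\<alpha> * P - 1) * r ^ N))) \<in> borel_measurable I01"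
        by measurable
    qed
    also have "\<dots> < \<infinity>" using fin pf by (auto simp: finite_norm_def P_def ennreal_mult_less_top)
    finally show ?thesis using False by (simp add: finite_norm_def Q_def)
  qed
qed

lemma measurable_I01_monotone:
  fixes \<phi> :: "real \<Rightarrow> real"
  assumes "\<And>r s. 0 \<le> r \<Longrightarrow> r \<le> s \<Longrightarrow> s < 1 \<Longrightarrow> \<phi> r \<le> \<phi> s"
  shows "\<phi> \<in> borel_measurable I01"
proof -
  have "mono_on {0<..<1} \<phi>" using assms by (auto simp: mono_on_def)
  then have "\<phi> \<in> borel_measurable (restrict_space borel {0<..<1})" by (rule borel_measurable_mono_on_fnc)
  then show ?thesis
    unfolding I01_def using measurable_cong_sets[OF sets_restrict_space_cong[OF sets_lborel] refl] by blast
qed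

lemma measurable_I01_id: "(\<lambda>x. x) \<in> borel_measurable I01"
  by (rule measurable_I01) simp

lemma one_minus_sq_pos: "0 \<le> t \<Longrightarrow> t < 1 \<Longrightarrow> 0 < 1 - (t::real)\<^sup>2"
  by (simp add: abs_square_less_1)

lemma one_minus_mult_pos: "0 \<le> r \<Longrightarrow> r < 1 \<Longrightarrow> 0 \<le> s \<Longrightarrow> s \<le> 1 \<Longrightarrow> 0 < 1 - r * (s::real)"
  by (smt (verit) mult_left_le)

lemma nn_integral_schur_kernel:
  assumes a: "a > (0::real)" and b: "b > 0" and r: "0 \<le> r" "r < 1"
  shows "(\<integral>\<^sup>+t. ennreal (t ^ N * (1 - t\<^sup>2) powr (a - 1) * (1 - r * t) powr (- (a + b))) \<partial>I01)
    \<le> ennreal (2 powr \<bar>a - 1\<bar> * (1 / a + 1 / b) * (1 - r) powr (- b))"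
proof -
  have "(\<integral>\<^sup>+t. ennreal (t ^ N * (1 - t\<^sup>2) powr (a - 1) * (1 - r * t) powr (- (a + b))) \<partial>I01)
    \<le> (\<integral>\<^sup>+t. ennreal (2 powr \<bar>a - 1\<bar>) * ennreal ((1 - t) powr (a - 1) * (1 - r * t) powr (- (a + b))) \<partial>I01)"
  proof (rule nn_integral_mono)
    fix t assume "t \<in> space I01"
    then have t: "0 \<le> t" "t < 1" by auto
    have "t ^ N * (1 - t\<^sup>2) powr (a - 1) \<le> 1 * (2 powr \<bar>a - 1\<bar> * (1 - t) powr (a - 1))"
      using t by (intro mult_mono powr_one_minus_square power_le_one) auto
    then have "t ^ N * (1 - t\<^sup>2) powr (a - 1) * (1 - r * t) powr (- (a + b))
      \<le> 2 powr \<bar>a - 1\<bar> * (1 - t) powr (a - 1) * (1 - r * t) powr (- (a + b))"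
      by (intro mult_right_mono) auto
    then show "ennreal (t ^ N * (1 - t\<^sup>2) powr (a - 1) * (1 - r * t) powr (- (a + b)))
      \<le> ennreal (2 powr \<bar>a - 1\<bar>) * ennreal ((1 - t) powr (a - 1) * (1 - r * t) powr (- (a + b)))"
      by (simp add: ennreal_leI mult.assoc flip: ennreal_mult)
  qed
  also have "\<dots> = ennreal (2 powr \<bar>a - 1\<bar>) * (\<integral>\<^sup>+t. ennreal ((1 - t) powr (a - 1) * (1 - r * t) powr (- (a + b))) \<partial>I01)"
    by (rule nn_integral_cmult) (intro measurable_I01, measurable)
  also have "\<dots> \<le> ennreal (2 powr \<bar>a - 1\<bar>) * ennreal ((1 / a + 1 / b) * (1 - r) powr (- b))"
    by (intro mult_left_mono nn_integral_two_powr_le a b r) simp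
  also have "\<dots> = ennreal (2 powr \<bar>a - 1\<bar> * (1 / a + 1 / b) * (1 - r) powr (- b))"
    using a b by (simp add: mult.assoc flip: ennreal_mult)
  finally show ?thesis .
qed

text \<open>
  Schur's test with constant test functions: with \<open>a = m + 1 - \<alpha>\<close> and \<open>b = \<beta>\<close>, the kernel
  \<open>(1 - \<rho>)\<^sup>b (1 - t)\<^sup>a / (1 - \<rho> t)\<^bsup>a+b\<^esup>\<close> has bounded marginals with respect to \<open>dt / (1 - t)\<close>.
\<close>
lemma finite_norm_schur:
  assumes fin: "finite_norm N q \<alpha> \<phi>" and q: "1 < q" and al: "\<alpha> > 0" and be: "\<beta> > 0" and m: "m > \<alpha> - 1"
    and nn: "\<And>r. 0 \<le> \<phi> r" and mono: "\<And>r s. 0 \<le> r \<Longrightarrow> r \<le> s \<Longrightarrow> s < 1 \<Longrightarrow> \<phi> r \<le> \<phi> s"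
    and psi0: "\<And>r. 0 \<le> \<psi> r" and C: "C > 0"
    and psi: "\<And>r. 0 \<le> r \<Longrightarrow> r < 1 \<Longrightarrow> ennreal (\<psi> r) \<le> ennreal C *
       (\<integral>\<^sup>+t. ennreal (t ^ N * (1 - t\<^sup>2) powr m * (1 - r * t) powr (- (m + 1 - \<alpha> + \<beta>)) * \<phi> t) \<partial>I01)"
  shows "finite_norm N q \<beta> \<psi>"
proof -
  define a where "a = m + 1 - \<alpha>"
  have a: "a > 0" using m by (simp add: a_def)
  \<comment> \<open>Moving (1 - t^2)^\<alpha> into the function leaves the exponent a - 1 in the
    kernel \<open>k\<close>, whose marginals can then be computed.\<close>
  define h where "h t = \<phi> t * (1 - t\<^sup>2) powr \<alpha>" for t
  define k where "k r t = t ^ N * (1 - t\<^sup>2) powr (a - 1) * (1 - r * t) powr (- (a + \<beta>))" for r t :: real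
  have h0: "h t \<ge> 0" for t using nn by (simp add: h_def)
  have k0: "k r t \<ge> 0" if "0 < t" for r t using that by (simp add: k_def)
  have [measurable]: "\<phi> \<in> borel_measurable I01" by (rule measurable_I01_monotone[OF mono])
  note measurable_I01_id[measurable]
  have hm[measurable]: "h \<in> borel_measurable I01" unfolding h_def[abs_def] by measurable
  have km[measurable]: "k r \<in> borel_measurable I01" for r unfolding k_def[abs_def] by measurable
  define A where "A = 2 powr \<bar>a - 1\<bar> * (1 / a + 1 / \<beta>)"
  have A: "A > 0" using a be by (simp add: A_def add_pos_pos)
  have mass: "(\<integral>\<^sup>+t. ennreal (k r t) \<partial>I01) \<le> ennreal (A * (1 - r) powr (- \<beta>))" if "0 \<le> r" "r < 1" for r
    unfolding k_def A_def by (rule nn_integral_schur_kernel[OF a be that])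
  have psi': "ennreal (\<psi> r) \<le> ennreal C * (\<integral>\<^sup>+t. ennreal (k r t * h t) \<partial>I01)" if r: "0 \<le> r" "r < 1" for r
  proof -
    have "(\<integral>\<^sup>+t. ennreal (t ^ N * (1 - t\<^sup>2) powr m * (1 - r * t) powr (- (m + 1 - \<alpha> + \<beta>)) * \<phi> t) \<partial>I01)
      = (\<integral>\<^sup>+t. ennreal (k r t * h t) \<partial>I01)"
    proof (rule nn_integral_cong)
      fix t assume "t \<in> space I01"
      have "(1 - t\<^sup>2) powr m = (1 - t\<^sup>2) powr (a - 1) * (1 - t\<^sup>2) powr \<alpha>" by (simp add: a_def flip: powr_add)
      then show "ennreal (t ^ N * (1 - t\<^sup>2) powr m * (1 - r * t) powr (- (m + 1 - \<alpha> + \<beta>)) * \<phi> t) = ennreal (k r t * h t)"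
        by (simp add: k_def h_def a_def mult_ac)
    qed
    then show ?thesis using psi[OF r] by simp
  qed
  show ?thesis
  proof (cases "q = \<infinity>")
    case True
    obtain B where B: "B > 0" "\<And>r. 0 \<le> r \<Longrightarrow> r < 1 \<Longrightarrow> h r \<le> B"
      unfolding h_def using finite_norm_growth[OF fin q al nn mono] by metis
    have "\<psi> r * (1 - r\<^sup>2) powr \<beta> \<le> C * A * B * 2 powr \<beta>" if r: "0 \<le> r" "r < 1" for r
    proof -
      have "(\<integral>\<^sup>+t. ennreal (k r t * h t) \<partial>I01) \<le> (\<integral>\<^sup>+t. ennreal (k r t) * ennreal B \<partial>I01)"
        by (intro nn_integral_mono) (auto simp: B k0 mult_left_mono ennreal_leI h0 less_imp_le[OF B(1)] simp flip: ennreal_mult)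
      also have "\<dots> = (\<integral>\<^sup>+t. ennreal (k r t) \<partial>I01) * ennreal B" by (rule nn_integral_multc) measurable
      also have "\<dots> \<le> ennreal (A * (1 - r) powr (- \<beta>)) * ennreal B" by (intro mult_right_mono mass r) simp
      finally have "ennreal (\<psi> r) \<le> ennreal C * (ennreal (A * (1 - r) powr (- \<beta>)) * ennreal B)"
        using psi'[OF r] by (meson mult_left_mono order_trans zero_le)
      also have "\<dots> = ennreal (C * (A * (1 - r) powr (- \<beta>) * B))" using C A B by (simp flip: ennreal_mult)
      finally have "\<psi> r \<le> C * (A * (1 - r) powr (- \<beta>) * B)" using C A B by (subst (asm) ennreal_le_iff) auto
      moreover have "(1 - r\<^sup>2) powr \<beta> \<le> 2 powr \<beta> * (1 - r) powr \<beta>"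
        using powr_one_minus_square(1)[OF r, of \<beta>] be by simp
      ultimately have "\<psi> r * (1 - r\<^sup>2) powr \<beta> \<le> C * (A * (1 - r) powr (- \<beta>) * B) * (2 powr \<beta> * (1 - r) powr \<beta>)"
        using psi0 C A B by (intro mult_mono) auto
      also have "\<dots> = C * A * B * 2 powr \<beta> * ((1 - r) powr (- \<beta>) * (1 - r) powr \<beta>)" by (simp add: mult_ac)
      also have "(1 - r) powr (- \<beta>) * (1 - r) powr \<beta> = 1" using r by (simp flip: powr_add)
      finally show ?thesis by simp
    qed
    then show ?thesis using True by (auto simp: finite_norm_def intro!: exI[of _ "C * A * B * 2 powr \<beta>"])
  next
    case False
    define Q where "Q = enn2real q"
    have Q: "Q > 1" unfolding Q_def using q False
      by (cases q) (auto simp: ennreal_less_iff simp flip: ennreal_1)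
    define e where "e = \<beta> * Q - 1"
    define D where "D = (C * A) powr (Q - 1) * C * 2 powr \<bar>e\<bar>"
    have D: "D > 0" using C A by (simp add: D_def)
    have hQ: "h t powr Q = \<phi> t powr Q * (1 - t\<^sup>2) powr (\<alpha> * Q)" if "0 < t" "t < 1" for t
      using nn one_minus_sq_pos[of t] that by (simp add: h_def powr_mult powr_powr)
    \<comment> \<open>Jensen with the kernel of mass C A (1 - r)^(-\<beta>). The powers of 1 - r
      combine to -\<beta>(Q-1) + \<beta>Q - 1 = \<beta> - 1, the exponent for which the integral in
      r converges.\<close>
    have ptw: "ennreal (\<psi> r powr Q * ((1 - r\<^sup>2) powr e * r ^ N))
        \<le> (\<integral>\<^sup>+t. ennreal (D * (1 - r) powr (\<beta> - 1) * (k r t * h t powr Q)) \<partial>I01)" if r: "0 < r" "r < 1" for r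
    proof -
      have r1: "(1 - r) > 0" using r by simp
      have "ennreal (\<psi> r powr Q) \<le> ennreal ((C * (A * (1 - r) powr (- \<beta>))) powr (Q - 1)) * (\<integral>\<^sup>+t. ennreal (C * k r t * h t powr Q) \<partial>I01)"
      proof (rule nn_integral_power_mean)
        show "C * (A * (1 - r) powr (- \<beta>)) > 0" using C A r1 by simp
        have "(\<integral>\<^sup>+t. ennreal (C * k r t) \<partial>I01) = ennreal C * (\<integral>\<^sup>+t. ennreal (k r t) \<partial>I01)"
          using C by (simp add: ennreal_mult' nn_integral_cmult)
        also have "\<dots> \<le> ennreal C * ennreal (A * (1 - r) powr (- \<beta>))" using r by (intro mult_left_mono mass) auto
        finally show "(\<integral>\<^sup>+t. ennreal (C * k r t) \<partial>I01) \<le> ennreal (C * (A * (1 - r) powr (- \<beta>)))"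
          using C A by (simp add: ennreal_mult)
        have "ennreal C * (\<integral>\<^sup>+t. ennreal (k r t * h t) \<partial>I01) = (\<integral>\<^sup>+t. ennreal (C * k r t * h t) \<partial>I01)"
          using C by (simp add: ennreal_mult' mult.assoc flip: nn_integral_cmult)
        then show "ennreal (\<psi> r) \<le> (\<integral>\<^sup>+t. ennreal (C * k r t * h t) \<partial>I01)" using psi'[of r] r by simp
      qed (use Q C k0 h0 psi0 in auto)
      then have "ennreal (\<psi> r powr Q) * ennreal ((1 - r\<^sup>2) powr e * r ^ N) \<le>
          ennreal ((C * (A * (1 - r) powr (- \<beta>))) powr (Q - 1)) * (\<integral>\<^sup>+t. ennreal (C * k r t * h t powr Q) \<partial>I01) * ennreal (2 powr \<bar>e\<bar> * (1 - r) powr e)"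
      proof (rule mult_mono)
        have "(1 - r\<^sup>2) powr e * r ^ N \<le> (2 powr \<bar>e\<bar> * (1 - r) powr e) * 1"
          using r by (intro mult_mono powr_one_minus_square power_le_one) auto
        then show "ennreal ((1 - r\<^sup>2) powr e * r ^ N) \<le> ennreal (2 powr \<bar>e\<bar> * (1 - r) powr e)" by (simp add: ennreal_leI)
      qed auto
      also have "\<dots> = ennreal ((C * (A * (1 - r) powr (- \<beta>))) powr (Q - 1) * (2 powr \<bar>e\<bar> * (1 - r) powr e)) * (\<integral>\<^sup>+t. ennreal (C * k r t * h t powr Q) \<partial>I01)"
        by (subst ennreal_mult) (auto simp: mult_ac)
      also have "\<dots> = (\<integral>\<^sup>+t. ennreal ((C * (A * (1 - r) powr (- \<beta>))) powr (Q - 1) * (2 powr \<bar>e\<bar> * (1 - r) powr e)) * ennreal (C * k r t * h t powr Q) \<partial>I01)"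
        by (rule nn_integral_cmult[symmetric]) measurable
      also have "\<dots> = (\<integral>\<^sup>+t. ennreal (D * (1 - r) powr (\<beta> - 1) * (k r t * h t powr Q)) \<partial>I01)"
      proof (rule nn_integral_cong)
        fix t assume "t \<in> space I01"
        have "(C * (A * (1 - r) powr (- \<beta>))) powr (Q - 1) = (C * A) powr (Q - 1) * (1 - r) powr (- \<beta> * (Q - 1))"
          using C A r1 by (simp add: powr_powr powr_mult mult.assoc[symmetric])
        moreover have "(1 - r) powr (- \<beta> * (Q - 1)) * (1 - r) powr e = (1 - r) powr (\<beta> - 1)"
          by (simp only: powr_add[symmetric]) (rule arg_cong[where f="\<lambda>z. (1 - r) powr z"], simp add: e_def algebra_simps)
        ultimately have eq: "(C * (A * (1 - r) powr (- \<beta>))) powr (Q - 1) * (2 powr \<bar>e\<bar> * (1 - r) powr e) * (C * k r t * h t powr Q)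
          = D * (1 - r) powr (\<beta> - 1) * (k r t * h t powr Q)"
          by (simp add: D_def mult_ac)
        show "ennreal ((C * (A * (1 - r) powr (- \<beta>))) powr (Q - 1) * (2 powr \<bar>e\<bar> * (1 - r) powr e)) * ennreal (C * k r t * h t powr Q)
          = ennreal (D * (1 - r) powr (\<beta> - 1) * (k r t * h t powr Q))"
          unfolding eq[symmetric] by (rule ennreal_mult'[symmetric]) simp
      qed
      finally show ?thesis by (simp add: ennreal_mult')
    qed
    interpret S: sigma_finite_measure I01 by (rule sigma_finite_I01)
    interpret SS: pair_sigma_finite I01 I01 ..
    have meas: "(\<lambda>(r, t). ennreal (D * (1 - r) powr (\<beta> - 1) * (k r t * h t powr Q))) \<in> borel_measurable (I01 \<Otimes>\<^sub>M I01)"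
    proof -
      have [measurable]: "fst \<in> borel_measurable (I01 \<Otimes>\<^sub>M I01)" "snd \<in> borel_measurable (I01 \<Otimes>\<^sub>M I01)"
        using measurable_compose[OF measurable_fst measurable_I01_id] measurable_compose[OF measurable_snd measurable_I01_id] by auto
      have [measurable]: "(\<lambda>p. h (snd p)) \<in> borel_measurable (I01 \<Otimes>\<^sub>M I01)"
        by (rule measurable_compose[OF measurable_snd hm])
      show ?thesis unfolding k_def split_beta by measurable
    qed
    define A2 where "A2 = 1 / \<beta> + 1 / a"
    have "(\<integral>\<^sup>+r. ennreal (\<psi> r powr Q * ((1 - r\<^sup>2) powr e * r ^ N)) \<partial>I01)
        \<le> (\<integral>\<^sup>+r. \<integral>\<^sup>+t. ennreal (D * (1 - r) powr (\<beta> - 1) * (k r t * h t powr Q)) \<partial>I01 \<partial>I01)"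
      by (intro nn_integral_mono ptw) auto
    also have "\<dots> = (\<integral>\<^sup>+t. \<integral>\<^sup>+r. ennreal (D * (1 - r) powr (\<beta> - 1) * (k r t * h t powr Q)) \<partial>I01 \<partial>I01)"
      by (rule SS.Fubini'[symmetric]) (rule meas)
    also have "\<dots> \<le> (\<integral>\<^sup>+t. ennreal (D * A2 * 2 powr a) * ennreal (\<phi> t powr Q * ((1 - t\<^sup>2) powr (\<alpha> * Q - 1) * t ^ N)) \<partial>I01)"
    proof (rule nn_integral_mono)
      fix t assume "t \<in> space I01"
      then have t: "0 < t" "t < 1" by auto
      \<comment> \<open>After the exchange the integral in r is the same two-power integral with a
        and \<beta> swapped. It yields (1-t)^(-a), which together with (a-1) + \<alpha>Q restores
        the weight exponent \<alpha>Q - 1.\<close>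
      define w where "w = D * t ^ N * (1 - t\<^sup>2) powr (a - 1) * h t powr Q"
      have w: "w \<ge> 0" using D t by (simp add: w_def)
      have "(\<integral>\<^sup>+r. ennreal (D * (1 - r) powr (\<beta> - 1) * (k r t * h t powr Q)) \<partial>I01)
        = (\<integral>\<^sup>+r. ennreal w * ennreal ((1 - r) powr (\<beta> - 1) * (1 - t * r) powr (- (\<beta> + a))) \<partial>I01)"
      proof (rule nn_integral_cong)
        fix r
        have "D * (1 - r) powr (\<beta> - 1) * (k r t * h t powr Q) = w * ((1 - r) powr (\<beta> - 1) * (1 - t * r) powr (- (\<beta> + a)))"
          by (simp add: w_def k_def mult_ac add_ac)
        then show "ennreal (D * (1 - r) powr (\<beta> - 1) * (k r t * h t powr Q)) = ennreal w * ennreal ((1 - r) powr (\<beta> - 1) * (1 - t * r) powr (- (\<beta> + a)))"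
          by (simp only: ennreal_mult'[OF w])
      qed
      also have "\<dots> = ennreal w * (\<integral>\<^sup>+r. ennreal ((1 - r) powr (\<beta> - 1) * (1 - t * r) powr (- (\<beta> + a))) \<partial>I01)"
        by (rule nn_integral_cmult) (intro measurable_I01, measurable)
      also have "\<dots> \<le> ennreal w * ennreal (A2 * (1 - t) powr (- a))"
        unfolding A2_def using t by (intro mult_left_mono nn_integral_two_powr_le be a) auto
      also have "\<dots> = ennreal (w * (A2 * (1 - t) powr (- a)))"
        using w be a by (simp add: A2_def flip: ennreal_mult)
      also have "\<dots> \<le> ennreal (w * (A2 * (2 powr a * (1 - t\<^sup>2) powr (- a))))"
        using powr_one_minus_square(2)[of t "- a"] t w be a by (intro ennreal_leI mult_left_mono) (auto simp: A2_def)
      also have "w * (A2 * (2 powr a * (1 - t\<^sup>2) powr (- a))) = D * A2 * 2 powr a * (\<phi> t powr Q * ((1 - t\<^sup>2) powr (\<alpha> * Q - 1) * t ^ N))"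
      proof -
        have "(1 - t\<^sup>2) powr (a - 1) * ((1 - t\<^sup>2) powr (\<alpha> * Q) * (1 - t\<^sup>2) powr (- a)) = (1 - t\<^sup>2) powr (\<alpha> * Q - 1)"
          by (simp only: powr_add[symmetric]) (rule arg_cong[where f="\<lambda>z. (1 - t\<^sup>2) powr z"], simp)
        then show ?thesis unfolding w_def hQ[OF t] by (simp add: mult_ac)
      qed
      also have "ennreal (D * A2 * 2 powr a * (\<phi> t powr Q * ((1 - t\<^sup>2) powr (\<alpha> * Q - 1) * t ^ N)))
        = ennreal (D * A2 * 2 powr a) * ennreal (\<phi> t powr Q * ((1 - t\<^sup>2) powr (\<alpha> * Q - 1) * t ^ N))"
        using D be a t by (intro ennreal_mult) (auto simp: A2_def)
      finally show "(\<integral>\<^sup>+r. ennreal (D * (1 - r) powr (\<beta> - 1) * (k r t * h t powr Q)) \<partial>I01)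
        \<le> ennreal (D * A2 * 2 powr a) * ennreal (\<phi> t powr Q * ((1 - t\<^sup>2) powr (\<alpha> * Q - 1) * t ^ N))" .
    qed
    also have "\<dots> = ennreal (D * A2 * 2 powr a) * (\<integral>\<^sup>+t. ennreal (\<phi> t powr Q * ((1 - t\<^sup>2) powr (\<alpha> * Q - 1) * t ^ N)) \<partial>I01)"
      by (rule nn_integral_cmult) measurable
    also have "\<dots> < \<infinity>" using fin False by (auto simp: finite_norm_def Q_def ennreal_mult_less_top)
    finally show ?thesis using False by (simp add: finite_norm_def Q_def e_def)
  qed
qed

text \<open>Each term has a norm bounded independently of \<open>\<rho> i\<close>. For p =
  \<infinity>, the exponent m+1 splits as (m+1-\<alpha>) + \<alpha>, since 1 - \<rho>r dominates
  both 1 - \<rho> and 1 - r. For finite p, Jensen with respect to the weights 3^(-i), of total mass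
  3/2, replaces the triangle inequality.\<close>

lemma finite_norm_series:
  fixes \<rho> :: "nat \<Rightarrow> real"
  assumes p: "1 < p" and al: "\<alpha> > 0" and m: "m > \<alpha> - 1" and C: "C > 0"
    and rho: "\<And>i. 0 \<le> \<rho> i" "\<And>i. \<rho> i < 1" and nn: "\<And>r. 0 \<le> \<phi> r"
    and phi: "\<And>r. 0 \<le> r \<Longrightarrow> r < 1 \<Longrightarrow> ennreal (\<phi> r) \<le>
      (\<Sum>i. ennreal ((1/3) ^ i * (C * (1 - \<rho> i) powr (m + 1 - \<alpha>) * (1 - \<rho> i * r) powr (- (m + 1)))))"
  shows "finite_norm N p \<alpha> \<phi>"
proof -
  define g where "g i r = C * (1 - \<rho> i) powr (m + 1 - \<alpha>) * (1 - \<rho> i * r) powr (- (m + 1))" for i r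
  have g0: "g i r \<ge> 0" for i r using C by (simp add: g_def)
  have geo: "(\<Sum>i. ennreal ((1/3) ^ i)) = ennreal (3/2)"
    by (rule suminf_ennreal_eq) (use geometric_sums[of "1/3::real"] in auto)
  show ?thesis
  proof (cases "p = \<infinity>")
    case True
    have "\<phi> r * (1 - r\<^sup>2) powr \<alpha> \<le> 3/2 * (C * 2 powr \<alpha>)" if r: "0 \<le> r" "r < 1" for r
    proof -
      have gr: "g i r * (1 - r\<^sup>2) powr \<alpha> \<le> C * 2 powr \<alpha>" for i
      proof -
        have x: "1 - \<rho> i * r > 0" "1 - r \<le> 1 - \<rho> i * r" "1 - \<rho> i \<le> 1 - \<rho> i * r"
          using rho[of i] r one_minus_mult_pos[of "\<rho> i" r] by (simp_all add: mult_left_le mult_left_le_one_le)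
        have "(1 - \<rho> i * r) powr (- (m + 1)) = (1 - \<rho> i * r) powr (- (m + 1 - \<alpha>)) * (1 - \<rho> i * r) powr (- \<alpha>)"
          by (simp flip: powr_add)
        also have "\<dots> \<le> (1 - \<rho> i) powr (- (m + 1 - \<alpha>)) * (1 - r) powr (- \<alpha>)"
          using x rho[of i] r m al by (intro mult_mono powr_mono2') auto
        finally have "g i r \<le> C * (1 - \<rho> i) powr (m + 1 - \<alpha>) * ((1 - \<rho> i) powr (- (m + 1 - \<alpha>)) * (1 - r) powr (- \<alpha>))"
          unfolding g_def using C by (intro mult_left_mono) auto
        also have "\<dots> = C * (1 - r) powr (- \<alpha>) * ((1 - \<rho> i) powr (m + 1 - \<alpha>) * (1 - \<rho> i) powr (- (m + 1 - \<alpha>)))"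
          by (simp only: mult_ac)
        also have "(1 - \<rho> i) powr (m + 1 - \<alpha>) * (1 - \<rho> i) powr (- (m + 1 - \<alpha>)) = 1"
          using rho(2)[of i] by (simp flip: powr_add)
        finally have "g i r \<le> C * (1 - r) powr (- \<alpha>)" by simp
        moreover have "(1 - r\<^sup>2) powr \<alpha> \<le> 2 powr \<alpha> * (1 - r) powr \<alpha>"
          using powr_one_minus_square(1)[OF r, of \<alpha>] al by simp
        ultimately have "g i r * (1 - r\<^sup>2) powr \<alpha> \<le> C * (1 - r) powr (- \<alpha>) * (2 powr \<alpha> * (1 - r) powr \<alpha>)"
          using C by (intro mult_mono) auto
        also have "\<dots> = C * 2 powr \<alpha> * ((1 - r) powr (- \<alpha>) * (1 - r) powr \<alpha>)" by simp
        also have "(1 - r) powr (- \<alpha>) * (1 - r) powr \<alpha> = 1" using r by (simp flip: powr_add)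
        finally show ?thesis by simp
      qed
      have "ennreal (\<phi> r * (1 - r\<^sup>2) powr \<alpha>) \<le> (\<Sum>i. ennreal ((1/3) ^ i * g i r)) * ennreal ((1 - r\<^sup>2) powr \<alpha>)"
        using phi[OF r] nn by (simp add: ennreal_mult mult_right_mono g_def)
      also have "\<dots> = (\<Sum>i. ennreal ((1/3) ^ i * g i r) * ennreal ((1 - r\<^sup>2) powr \<alpha>))"
        by (rule ennreal_suminf_multc[symmetric])
      also have "\<dots> \<le> (\<Sum>i. ennreal ((1/3) ^ i) * ennreal (C * 2 powr \<alpha>))"
      proof (rule suminf_le)
        fix i
        have "(1/3) ^ i * g i r * (1 - r\<^sup>2) powr \<alpha> \<le> (1/3) ^ i * (C * 2 powr \<alpha>)"
          using gr[of i] by (simp only: mult.assoc) (rule mult_left_mono, auto)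
        then show "ennreal ((1/3) ^ i * g i r) * ennreal ((1 - r\<^sup>2) powr \<alpha>) \<le> ennreal ((1/3) ^ i) * ennreal (C * 2 powr \<alpha>)"
          using g0[of i r] C by (simp add: ennreal_leI flip: ennreal_mult)
      qed auto
      also have "\<dots> = ennreal (3/2) * ennreal (C * 2 powr \<alpha>)"
        by (simp only: ennreal_suminf_multc geo)
      also have "\<dots> = ennreal (3/2 * (C * 2 powr \<alpha>))" using C by (simp flip: ennreal_mult)
      finally show ?thesis using C by (subst (asm) ennreal_le_iff) auto
    qed
    then show ?thesis using True by (auto simp: finite_norm_def intro!: exI[of _ "3/2 * (C * 2 powr \<alpha>)"])
  next
    case False
    define P where "P = enn2real p"
    have P: "P > 1" unfolding P_def using p False
      by (cases p) (auto simp: ennreal_less_iff simp flip: ennreal_1)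
    \<comment> \<open>With these values a + b = (m+1) p, so the p-th power of a term matches the
      kernel of \<open>nn_integral_schur_kernel\<close>, and the resulting (1-\<rho>)^(-b) cancels
      its normalization.\<close>
    define a where "a = \<alpha> * P"
    define b where "b = (m + 1 - \<alpha>) * P"
    have ab: "a > 0" "b > 0" using al m P by (auto simp: a_def b_def)
    define E where "E = C powr P * (2 powr \<bar>a - 1\<bar> * (1 / a + 1 / b))"
    have E: "E \<ge> 0" using ab by (simp add: E_def)
    have gint: "(\<integral>\<^sup>+r. ennreal (g i r powr P * ((1 - r\<^sup>2) powr (a - 1) * r ^ N)) \<partial>I01) \<le> ennreal E" for i
    proof -
      define G where "G = C powr P * (1 - \<rho> i) powr b"
      have "(\<integral>\<^sup>+r. ennreal (g i r powr P * ((1 - r\<^sup>2) powr (a - 1) * r ^ N)) \<partial>I01)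
        = (\<integral>\<^sup>+r. ennreal G * ennreal (r ^ N * (1 - r\<^sup>2) powr (a - 1) * (1 - \<rho> i * r) powr (- (a + b))) \<partial>I01)"
      proof (rule nn_integral_cong)
        fix r assume "r \<in> space I01"
        then have r: "0 < r" "r < 1" by auto
        have x: "1 - \<rho> i * r > 0" using rho[of i] r by (intro one_minus_mult_pos) auto
        have "g i r powr P = C powr P * (1 - \<rho> i) powr b * (1 - \<rho> i * r) powr (- (m + 1) * P)"
          unfolding g_def b_def using C by (simp add: powr_mult powr_powr)
        also have "- (m + 1) * P = - (a + b)" by (simp add: a_def b_def algebra_simps)
        finally show "ennreal (g i r powr P * ((1 - r\<^sup>2) powr (a - 1) * r ^ N))
          = ennreal G * ennreal (r ^ N * (1 - r\<^sup>2) powr (a - 1) * (1 - \<rho> i * r) powr (- (a + b)))"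
          using r by (simp add: G_def mult_ac flip: ennreal_mult)
      qed
      also have "\<dots> = ennreal G * (\<integral>\<^sup>+r. ennreal (r ^ N * (1 - r\<^sup>2) powr (a - 1) * (1 - \<rho> i * r) powr (- (a + b))) \<partial>I01)"
        by (rule nn_integral_cmult) (intro measurable_I01, measurable)
      also have "\<dots> \<le> ennreal G * ennreal (2 powr \<bar>a - 1\<bar> * (1 / a + 1 / b) * (1 - \<rho> i) powr (- b))"
        by (intro mult_left_mono nn_integral_schur_kernel ab rho) simp
      also have "\<dots> = ennreal (E * ((1 - \<rho> i) powr b * (1 - \<rho> i) powr (- b)))"
        using ab C by (simp add: G_def E_def mult_ac flip: ennreal_mult)
      also have "(1 - \<rho> i) powr b * (1 - \<rho> i) powr (- b) = 1" using rho(2)[of i] by (simp flip: powr_add)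
      finally show ?thesis by simp
    qed
    have ptw: "ennreal (\<phi> r powr P * ((1 - r\<^sup>2) powr (a - 1) * r ^ N))
      \<le> (\<Sum>i. ennreal ((3/2) powr (P - 1) * (1/3) ^ i) * ennreal (g i r powr P * ((1 - r\<^sup>2) powr (a - 1) * r ^ N)))"
      if r: "0 < r" "r < 1" for r
    proof -
      let ?v = "(1 - r\<^sup>2) powr (a - 1) * r ^ N"
      have v: "?v \<ge> 0" using r by simp
      have "ennreal (\<phi> r powr P) \<le> ennreal ((3/2) powr (P - 1)) * (\<integral>\<^sup>+i. ennreal ((1/3) ^ i * g i r powr P) \<partial>count_space UNIV)"
      proof (rule nn_integral_power_mean)
        show "1 \<le> P" using P by simp
        show "(\<integral>\<^sup>+i. ennreal ((1/3) ^ i) \<partial>count_space UNIV) \<le> ennreal (3/2)"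
          by (simp only: nn_integral_count_space_nat geo order_refl)
        show "ennreal (\<phi> r) \<le> (\<integral>\<^sup>+i. ennreal ((1/3) ^ i * g i r) \<partial>count_space UNIV)"
          using phi[of r] r by (simp only: nn_integral_count_space_nat g_def)
      qed (simp_all add: g0 nn)
      then have "ennreal (\<phi> r powr P) * ennreal ?v \<le> ennreal ((3/2) powr (P - 1)) * (\<Sum>i. ennreal ((1/3) ^ i * g i r powr P)) * ennreal ?v"
        by (intro mult_right_mono) (auto simp: nn_integral_count_space_nat)
      also have "\<dots> = (\<Sum>i. ennreal ((3/2) powr (P - 1)) * ennreal ((1/3) ^ i * g i r powr P) * ennreal ?v)"
        by (simp only: ennreal_suminf_cmult ennreal_suminf_multc)
      also have "\<dots> = (\<Sum>i. ennreal ((3/2) powr (P - 1) * (1/3) ^ i) * ennreal (g i r powr P * ?v))"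
        using v by (intro suminf_cong) (simp add: mult.assoc flip: ennreal_mult)
      finally show ?thesis using v by (simp add: ennreal_mult)
    qed
    have gm[measurable]: "g i \<in> borel_measurable I01" for i
      unfolding g_def[abs_def] by (intro measurable_I01) measurable
    note measurable_I01_id[measurable]
    have "(\<integral>\<^sup>+r. ennreal (\<phi> r powr P * ((1 - r\<^sup>2) powr (a - 1) * r ^ N)) \<partial>I01)
      \<le> (\<integral>\<^sup>+r. (\<Sum>i. ennreal ((3/2) powr (P - 1) * (1/3) ^ i) * ennreal (g i r powr P * ((1 - r\<^sup>2) powr (a - 1) * r ^ N))) \<partial>I01)"
      by (intro nn_integral_mono ptw) auto
    also have "\<dots> = (\<Sum>i. \<integral>\<^sup>+r. ennreal ((3/2) powr (P - 1) * (1/3) ^ i) * ennreal (g i r powr P * ((1 - r\<^sup>2) powr (a - 1) * r ^ N)) \<partial>I01)"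
      by (rule nn_integral_suminf) measurable
    also have "\<dots> = (\<Sum>i. ennreal ((3/2) powr (P - 1) * (1/3) ^ i) * (\<integral>\<^sup>+r. ennreal (g i r powr P * ((1 - r\<^sup>2) powr (a - 1) * r ^ N)) \<partial>I01))"
      by (intro suminf_cong nn_integral_cmult) measurable
    also have "\<dots> \<le> (\<Sum>i. ennreal ((3/2) powr (P - 1) * (1/3) ^ i) * ennreal E)"
      by (intro suminf_le mult_left_mono gint) auto
    also have "\<dots> = ennreal ((3/2) powr (P - 1)) * ennreal (3/2) * ennreal E"
      by (simp add: ennreal_mult geo)
    also have "\<dots> < \<infinity>" by (simp add: ennreal_mult_less_top)
    finally show ?thesis using False by (simp add: finite_norm_def P_def a_def)
  qed
qed

lemma epowr_less_top_iff: "epowr x a < top \<longleftrightarrow> x < top"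
  by (auto simp: epowr_def less_top[symmetric])

lemma epowr_one: "epowr x 1 = x"
  by (cases x) (auto simp: epowr_def)

context spherical_expansion
begin

section \<open>From the kernel condition to multipliers\<close>

definition l1_mean :: "(nat \<Rightarrow> nat \<Rightarrow> complex) \<Rightarrow> real \<Rightarrow> real" where
  "l1_mean a r = enn2real (L1 (dilate r a))"

lemma l1_mean_nonneg: "l1_mean a r \<ge> 0"
  by (simp add: l1_mean_def)

lemma ennreal_l1_mean: "tame a \<Longrightarrow> 0 \<le> r \<Longrightarrow> r < 1 \<Longrightarrow> ennreal (l1_mean a r) = L1 (dilate r a)"
  using L1_finite[OF tame_exp_decay[of a r]] by (simp add: l1_mean_def less_top)

lemma l1_mean_mono: "tame a \<Longrightarrow> 0 \<le> r \<Longrightarrow> r \<le> s \<Longrightarrow> s < 1 \<Longrightarrow> l1_mean a r \<le> l1_mean a s"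
  unfolding l1_mean_def using L1_finite[OF tame_exp_decay[of a s]]
  by (intro enn2real_mono L1_dilate_mono) auto

lemma integral_mean_1:
  assumes "\<And>u. norm u = 1 \<Longrightarrow> f (r *\<^sub>R u) = sphere_series b u"
  shows "integral_mean \<sigma> 1 f r = L1 b"
proof -
  have "(\<integral>\<^sup>+x. ennreal (cmod (f (r *\<^sub>R x)) powr enn2real 1) \<partial>\<sigma>) = L1 b"
    unfolding L1_def by (rule nn_integral_cong) (simp add: assms)
  then show ?thesis by (simp add: integral_mean_def epowr_one)
qed

abbreviation fin_norm :: "ennreal \<Rightarrow> real \<Rightarrow> (nat \<Rightarrow> nat \<Rightarrow> complex) \<Rightarrow> bool" where
  "fin_norm p \<alpha> a \<equiv> finite_norm (CARD('n) - 1) p \<alpha> (l1_mean a)"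

text \<open>For tame coefficients the means are finite at every radius, so they may be read as real
  numbers, and the outer power 1/p preserves finiteness.\<close>

lemma mixed_norm_finite_iff:
  assumes a: "tame a" and f: "\<And>u r. norm u = 1 \<Longrightarrow> 0 \<le> r \<Longrightarrow> r < 1 \<Longrightarrow> f (r *\<^sub>R u) = sphere_series (dilate r a) u"
  shows "mixed_norm \<sigma> p 1 \<alpha> f < \<infinity> \<longleftrightarrow> fin_norm p \<alpha> a"
proof -
  have m: "integral_mean \<sigma> 1 f r = ennreal (l1_mean a r)" if "0 \<le> r" "r < 1" for r
    using integral_mean_1[of f r "dilate r a"] f that by (simp add: ennreal_l1_mean[OF a])
  show ?thesis
  proof (cases "p = \<infinity>")
    case True
    have e: "(SUP r\<in>{0..<1}. integral_mean \<sigma> 1 f r * ennreal ((1 - r\<^sup>2) powr \<alpha>))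
        = (SUP r\<in>{0..<1}. ennreal (l1_mean a r * (1 - r\<^sup>2) powr \<alpha>))"
      by (intro SUP_cong) (auto simp: m l1_mean_nonneg ennreal_mult)
    have "(SUP r\<in>{0..<1}. ennreal (l1_mean a r * (1 - r\<^sup>2) powr \<alpha>)) < \<infinity> \<longleftrightarrow>
      (\<exists>B. \<forall>r\<in>{0..<1}. l1_mean a r * (1 - r\<^sup>2) powr \<alpha> \<le> B)" (is "?S < \<infinity> \<longleftrightarrow> _")
    proof
      assume "?S < \<infinity>"
      then obtain B where B: "?S = ennreal B" "B \<ge> 0" by (cases ?S) auto
      have "l1_mean a r * (1 - r\<^sup>2) powr \<alpha> \<le> B" if "r \<in> {0..<1}" for r
      proof -
        have "ennreal (l1_mean a r * (1 - r\<^sup>2) powr \<alpha>) \<le> ennreal B"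
          unfolding B(1)[symmetric] by (rule SUP_upper[OF that])
        then show ?thesis using B(2) by simp
      qed
      then show "\<exists>B. \<forall>r\<in>{0..<1}. l1_mean a r * (1 - r\<^sup>2) powr \<alpha> \<le> B" by blast
    next
      assume "\<exists>B. \<forall>r\<in>{0..<1}. l1_mean a r * (1 - r\<^sup>2) powr \<alpha> \<le> B"
      then obtain B where "\<forall>r\<in>{0..<1}. l1_mean a r * (1 - r\<^sup>2) powr \<alpha> \<le> B" by blast
      then have "?S \<le> ennreal B" by (intro SUP_least ennreal_leI) auto
      then show "?S < \<infinity>" using le_less_trans ennreal_less_top by (simp add: le_less_trans)
    qed
    then show ?thesis using True by (simp add: mixed_norm_def finite_norm_def e)
  next
    case False
    have "(\<integral>\<^sup>+r\<in>{0<..<1}. epowr (integral_mean \<sigma> 1 f r) (enn2real p) *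
            ennreal ((1 - r\<^sup>2) powr (\<alpha> * enn2real p - 1) * r ^ (CARD('n) - 1)) \<partial>lborel)
      = (\<integral>\<^sup>+r. ennreal (l1_mean a r powr enn2real p * ((1 - r\<^sup>2) powr (\<alpha> * enn2real p - 1) * r ^ (CARD('n) - 1))) \<partial>I01)"
      unfolding nn_integral_I01[symmetric]
    proof (rule nn_integral_cong)
      fix r assume "r \<in> space I01"
      then have r: "0 < r" "r < 1" by auto
      have "epowr (integral_mean \<sigma> 1 f r) (enn2real p) = ennreal (l1_mean a r powr enn2real p)"
        using m[of r] r by (simp add: epowr_def l1_mean_nonneg)
      then show "epowr (integral_mean \<sigma> 1 f r) (enn2real p) * ennreal ((1 - r\<^sup>2) powr (\<alpha> * enn2real p - 1) * r ^ (CARD('n) - 1))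
        = ennreal (l1_mean a r powr enn2real p * ((1 - r\<^sup>2) powr (\<alpha> * enn2real p - 1) * r ^ (CARD('n) - 1)))"
        by (simp add: ennreal_mult')
    qed
    then show ?thesis using False by (simp add: mixed_norm_def finite_norm_def epowr_less_top_iff)
  qed
qed

lemma sph_series_mem_iff:
  assumes a: "tame a"
  shows "sph_series Y a \<in> mixed_norm_space \<sigma> p 1 \<alpha> \<longleftrightarrow> fin_norm p \<alpha> a"
  unfolding mixed_norm_space_def using harmonic_on_sph_series[OF a]
    mixed_norm_finite_iff[OF a, of "sph_series Y a" p \<alpha>] by (simp add: sph_series_eq)

lemma sph_coeff_mem:
  assumes "f \<in> mixed_norm_space \<sigma> p 1 \<alpha>"
  shows "tame (sph_coeff Y f)" "fin_norm p \<alpha> (sph_coeff Y f)"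
proof -
  have h: "harmonic_on f (ball 0 1)" and n: "mixed_norm \<sigma> p 1 \<alpha> f < \<infinity>"
    using assms by (auto simp: mixed_norm_space_def)
  show t: "tame (sph_coeff Y f)" by (rule harmonic_sph_coeff(1)[OF h])
  show "fin_norm p \<alpha> (sph_coeff Y f)"
    using mixed_norm_finite_iff[OF t harmonic_sph_coeff(2)[OF h], of p \<alpha>] n by blast
qed

text \<open>The harmonic sum has a tame expansion of its own, and uniqueness of coefficients
  identifies it with the given array.\<close>

lemma converges_harmonic_tame:
  assumes "sph_converges Y a" and h: "harmonic_on (sph_series Y a) (ball 0 1)"
  shows "tame a"
proof -
  obtain b where b: "tame b" "\<forall>x\<in>ball 0 1. sph_term Y b x sums sph_series Y a x"
    using harmonic_expansion[OF h] by blast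
  have "\<forall>x\<in>ball 0 1. sph_term Y a x sums sph_series Y a x"
    using assms(1) unfolding sph_converges_def sph_series_def by (auto intro: summable_sums)
  then have "a k j = b k j" if "j \<in> {1..d k}" for k j
    by (rule coeff_unique[OF _ b(2) that])
  then show ?thesis using tame_cong[of a b] b(1) by blast
qed

lemma sph_series_cong:
  "(\<And>k j. j \<in> {1..d k} \<Longrightarrow> a k j = b k j) \<Longrightarrow> sph_series Y a = sph_series Y b"
  using sph_term_cong[of a b] by (auto simp: sph_series_def)

text \<open>The bridge from functions to arrays. \<open>sph_coeff\<close> returns the array of a
  series only at indices in range, so the translation passes through the congruence lemmas.\<close>

lemma multipliers_iff:
  "c \<in> multipliers Y (mixed_norm_space \<sigma> p 1 \<alpha>) (mixed_norm_space \<sigma> q 1 \<beta>) \<longleftrightarrow>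
    (\<forall>a. tame a \<and> fin_norm p \<alpha> a \<longrightarrow> tame (\<lambda>k j. c k j * a k j) \<and> fin_norm q \<beta> (\<lambda>k j. c k j * a k j))"
proof (intro iffI allI impI; (elim conjE)?)
  fix a assume c: "c \<in> multipliers Y (mixed_norm_space \<sigma> p 1 \<alpha>) (mixed_norm_space \<sigma> q 1 \<beta>)"
    and a: "tame a" "fin_norm p \<alpha> a"
  let ?f = "sph_series Y a"
  have eq: "c k j * sph_coeff Y ?f k j = c k j * a k j" if "j \<in> {1..d k}" for k j
    using sph_coeff_sph_series[OF a(1) that] by simp
  have "?f \<in> mixed_norm_space \<sigma> p 1 \<alpha>" using a by (simp add: sph_series_mem_iff)
  then have "sph_converges Y (\<lambda>k j. c k j * sph_coeff Y ?f k j)"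
    "sph_series Y (\<lambda>k j. c k j * sph_coeff Y ?f k j) \<in> mixed_norm_space \<sigma> q 1 \<beta>"
    using c unfolding multipliers_def by blast+
  moreover have "sph_term Y (\<lambda>k j. c k j * sph_coeff Y ?f k j) = sph_term Y (\<lambda>k j. c k j * a k j)"
    by (rule sph_term_cong[OF eq])
  ultimately have 1: "sph_converges Y (\<lambda>k j. c k j * a k j)" "sph_series Y (\<lambda>k j. c k j * a k j) \<in> mixed_norm_space \<sigma> q 1 \<beta>"
    by (simp_all add: sph_converges_def sph_series_def[abs_def])
  then have "harmonic_on (sph_series Y (\<lambda>k j. c k j * a k j)) (ball 0 1)" by (simp add: mixed_norm_space_def)
  then have t: "tame (\<lambda>k j. c k j * a k j)" by (rule converges_harmonic_tame[OF 1(1)])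
  then show "tame (\<lambda>k j. c k j * a k j) \<and> fin_norm q \<beta> (\<lambda>k j. c k j * a k j)"
    using 1(2) sph_series_mem_iff[OF t] by blast
next
  assume H: "\<forall>a. tame a \<and> fin_norm p \<alpha> a \<longrightarrow> tame (\<lambda>k j. c k j * a k j) \<and> fin_norm q \<beta> (\<lambda>k j. c k j * a k j)"
  show "c \<in> multipliers Y (mixed_norm_space \<sigma> p 1 \<alpha>) (mixed_norm_space \<sigma> q 1 \<beta>)"
    unfolding multipliers_def
  proof (intro CollectI ballI)
    fix f assume f: "f \<in> mixed_norm_space \<sigma> p 1 \<alpha>"
    have "tame (\<lambda>k j. c k j * sph_coeff Y f k j)" "fin_norm q \<beta> (\<lambda>k j. c k j * sph_coeff Y f k j)"
      using H sph_coeff_mem[OF f] by blast+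
    then show "sph_converges Y (\<lambda>k j. c k j * sph_coeff Y f k j) \<and>
        sph_series Y (\<lambda>k j. c k j * sph_coeff Y f k j) \<in> mixed_norm_space \<sigma> q 1 \<beta>"
      by (simp add: tame_sph_converges sph_series_mem_iff)
  qed
qed

lemma tame_mult:
  assumes a: "tame a" and b: "tame b"
  shows "tame (\<lambda>k j. a k j * b k j)"
  unfolding tame_def
proof (intro allI impI)
  fix s :: real assume s: "0 < s" "s < 1"
  then have q: "0 < sqrt s" "sqrt s < 1" by auto
  obtain A where A: "A \<ge> 0" "\<And>k j. j \<in> {1..d k} \<Longrightarrow> sqrt s ^ k * cmod (a k j) \<le> A" by (rule tameD[OF a q]) (rule that)
  obtain B where B: "B \<ge> 0" "\<And>k j. j \<in> {1..d k} \<Longrightarrow> sqrt s ^ k * cmod (b k j) \<le> B" by (rule tameD[OF b q]) (rule that)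
  have "s ^ k * cmod (a k j * b k j) \<le> A * B" if j: "j \<in> {1..d k}" for k j
  proof -
    have "s ^ k = sqrt s ^ k * sqrt s ^ k" using s by (simp flip: power_mult_distrib)
    then have "s ^ k * cmod (a k j * b k j) = (sqrt s ^ k * cmod (a k j)) * (sqrt s ^ k * cmod (b k j))"
      by (simp add: norm_mult)
    also have "\<dots> \<le> A * B" using A B j s by (intro mult_mono) auto
    finally show ?thesis .
  qed
  then show "\<exists>C. \<forall>k. \<forall>j\<in>{1..d k}. s ^ k * cmod (a k j * b k j) \<le> C" by blast
qed

lemma tame_Y:
  assumes y: "norm y = 1"
  shows "tame (\<lambda>k j. of_real (Y k j y))"
  unfolding tame_def
proof (intro allI impI)
  fix s :: real assume s: "0 < s" "s < 1"
  show "\<exists>C. \<forall>k. \<forall>j\<in>{1..d k}. s ^ k * cmod (of_real (Y k j y)) \<le> C"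
    using abs_Y_le[OF s _ y] by (intro exI[of _ "weight_const s"]) auto
qed

text \<open>Given a dummy index \<open>j\<close> so that it multiplies coefficient arrays like any
  other array.\<close>

definition frac_factor :: "real \<Rightarrow> nat \<Rightarrow> nat \<Rightarrow> complex" where
  "frac_factor t k j = of_real (Gamma (real k + \<nu> + t) / (Gamma (real k + \<nu>) * Gamma t))"

lemma kernel_bound_frac_factor:
  assumes t: "t > 0"
  obtains C where "C > 0" "\<And>r. 0 \<le> r \<Longrightarrow> r < 1 \<Longrightarrow> kernel_bound (dilate r (frac_factor t)) (C * (1 - r) powr (- t))"
proof -
  obtain C where C: "C \<ge> 0" "\<And>r. 0 \<le> r \<Longrightarrow> r < 1 \<Longrightarrow>
     kernel_bound (\<lambda>k j. of_real (Gamma (real k + \<nu> + t) / Gamma (real k + \<nu>) * r ^ k)) (C * (1 - r) powr (- t))"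
    by (rule kernel_bound_Gamma[OF t]) (rule that)
  have Gt: "Gamma t > 0" using t by simp
  show ?thesis
  proof (rule that)
    show "C / Gamma t + 1 > 0" using C(1) Gt by (simp add: add_nonneg_pos)
    fix r :: real assume r: "0 \<le> r" "r < 1"
    let ?c = "\<lambda>k j. complex_of_real (Gamma (real k + \<nu> + t) / Gamma (real k + \<nu>) * r ^ k)"
    have eq: "dilate r (frac_factor t) = (\<lambda>k j. of_real (1 / Gamma t) * ?c k j)"
      by (auto simp: dilate_def frac_factor_def fun_eq_iff mult.commute)
    have c: "exp_decay ?c" using C(2)[OF r] by (simp add: kernel_bound_def)
    have "kernel_bound (dilate r (frac_factor t)) (1 / Gamma t * (C * (1 - r) powr (- t)))"
      unfolding kernel_bound_def eq
    proof (intro conjI allI impI)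
      show "exp_decay (\<lambda>k j. of_real (1 / Gamma t) * ?c k j)"
        by (rule exp_decay_mult_bounded[OF c, of _ "1 / Gamma t"]) (use Gt in \<open>auto simp: norm_divide\<close>)
      show "0 \<le> 1 / Gamma t * (C * (1 - r) powr (- t))" using C Gt by simp
      fix y :: "real^'n" assume y: "norm y = 1"
      have "L1 (\<lambda>k j. of_real (1 / Gamma t) * (?c k j * of_real (Y k j y))) = ennreal (1 / Gamma t) * L1 (\<lambda>k j. ?c k j * of_real (Y k j y))"
        unfolding L1_scale[OF exp_decay_mult_Y[OF c y]] norm_of_real using Gt by simp
      also have "\<dots> \<le> ennreal (1 / Gamma t) * ennreal (C * (1 - r) powr (- t))"
        using C(2)[OF r] y by (intro mult_left_mono) (auto simp: kernel_bound_def)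
      also have "\<dots> = ennreal (1 / Gamma t * (C * (1 - r) powr (- t)))"
        using C(1) Gt by (intro ennreal_mult[symmetric]) auto
      finally show "L1 (\<lambda>k j. of_real (1 / Gamma t) * ?c k j * of_real (Y k j y)) \<le> ennreal (1 / Gamma t * (C * (1 - r) powr (- t)))"
        by (simp only: mult.assoc)
    qed
    then show "kernel_bound (dilate r (frac_factor t)) ((C / Gamma t + 1) * (1 - r) powr (- t))"
      by (rule kernel_bound_mono) (simp add: distrib_right)
  qed
qed

lemma tame_frac_factor:
  assumes t: "t > 0"
  shows "tame (frac_factor t)"
  unfolding tame_def
proof (intro allI impI)
  fix s :: real assume s: "0 < s" "s < 1"
  obtain C where "\<And>r. 0 \<le> r \<Longrightarrow> r < 1 \<Longrightarrow> kernel_bound (dilate r (frac_factor t)) (C * (1 - r) powr (- t))"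
    by (rule kernel_bound_frac_factor[OF t]) (rule that)
  then have "exp_decay (dilate s (frac_factor t))" using s by (auto simp: kernel_bound_def)
  then obtain D q where D: "decays D q (dilate s (frac_factor t))" unfolding exp_decay_def by blast
  have "s ^ k * cmod (frac_factor t k j) \<le> D" if "j \<in> {1..d k}" for k j
    using decays_bounded[OF D that] s by (simp add: dilate_def norm_mult norm_power)
  then show "\<exists>C. \<forall>k. \<forall>j\<in>{1..d k}. s ^ k * cmod (frac_factor t k j) \<le> C" by blast
qed

lemma frac_deriv_eq:
  assumes c: "tame c" and t: "t > 0" and x: "norm x = 1" and y: "norm y = 1" and r: "0 \<le> r" "r < 1"
  shows "frac_deriv Y t (harmonic_conv Y (sph_series Y c) (poisson_kernel Y x)) (r *\<^sub>R y)
    = sphere_kernel (dilate r (\<lambda>k j. frac_factor t k j * c k j)) x y"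
proof -
  have conv: "harmonic_conv Y (sph_series Y c) (poisson_kernel Y x) = sph_series Y (\<lambda>k j. c k j * of_real (Y k j x))"
    unfolding harmonic_conv_def poisson_kernel_def
    by (rule sph_series_cong) (simp add: sph_coeff_sph_series[OF c] sph_coeff_sph_series[OF tame_Y[OF x]])
  have "frac_deriv Y t (sph_series Y (\<lambda>k j. c k j * of_real (Y k j x)))
      = sph_series Y (\<lambda>k j. frac_factor t k j * (c k j * of_real (Y k j x)))"
    unfolding frac_deriv_def
    by (rule sph_series_cong) (simp add: sph_coeff_sph_series[OF tame_mult[OF c tame_Y[OF x]]] frac_factor_def \<nu>_def)
  then show ?thesis unfolding conv sphere_kernel_def
    using sph_series_eq[OF y r(1), of "\<lambda>k j. frac_factor t k j * (c k j * of_real (Y k j x))"]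
    by (simp add: dilate_def[abs_def] mult.assoc)
qed

text \<open>By symmetry of the kernel, the integral over x' is the L^1 norm of its column at y';
  finiteness of \<open>N1\<close> thus becomes a family of kernel bounds.\<close>

lemma N1_eq:
  assumes c: "tame c" and m: "m + 1 > 0"
  shows "N1 \<sigma> Y \<alpha> \<beta> m (sph_series Y c) =
    (SUP r\<in>{0..<1}. SUP y\<in>sphere 0 1. ennreal ((1 - r) powr (m + 1 - \<alpha> + \<beta>)) *
       L1 (\<lambda>k j. dilate r (\<lambda>k j. frac_factor (m + 1) k j * c k j) k j * of_real (Y k j y)))"
  unfolding N1_def
proof (intro SUP_cong refl arg_cong2[where f="\<lambda>a b. a * b"])
  fix r y assume r: "r \<in> {0..<1::real}" and y: "y \<in> sphere (0::real^'n) 1"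
  show "(\<integral>\<^sup>+x. ennreal (cmod (frac_deriv Y (m + 1) (harmonic_conv Y (sph_series Y c) (poisson_kernel Y x)) (r *\<^sub>R y))) \<partial>\<sigma>)
    = L1 (\<lambda>k j. dilate r (\<lambda>k j. frac_factor (m + 1) k j * c k j) k j * of_real (Y k j y))"
    unfolding L1_kernel using r y by (intro nn_integral_cong) (simp add: frac_deriv_eq[OF c m])
qed

text \<open>
  The factor \<open>1 / frac_factor (m + 1)\<close> is the Beta integral
  \<open>\<integral>\<^sub>0\<^sup>1 2 t\<^bsup>2k+n-1\<^esup> (1 - t\<^sup>2)\<^sup>m dt\<close>; the power \<open>t\<^bsup>2k\<^esup>\<close> is split between the two factors of the convolution.
\<close>
lemma l1_mean_conv_le:
  assumes c: "tame c" and a: "tame a" and m: "m + 1 > 0" and M: "M > 0"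
    and bound: "\<And>r. 0 \<le> r \<Longrightarrow> r < 1 \<Longrightarrow> kernel_bound (dilate r (\<lambda>k j. frac_factor (m + 1) k j * c k j)) (M * (1 - r) powr (- \<gamma>))"
    and r: "0 \<le> r" "r < 1"
  shows "ennreal (l1_mean (\<lambda>k j. c k j * a k j) r) \<le> ennreal (2 * M) *
    (\<integral>\<^sup>+t. ennreal (t ^ (CARD('n) - 1) * (1 - t\<^sup>2) powr m * (1 - r * t) powr (- \<gamma>) * l1_mean a t) \<partial>I01)"
proof -
  define e where "e = dilate r (\<lambda>k j. frac_factor (m + 1) k j * (c k j * a k j))"
  have te: "tame (\<lambda>k j. frac_factor (m + 1) k j * (c k j * a k j))"
    by (intro tame_mult tame_frac_factor m c a)
  have e: "exp_decay e" unfolding e_def by (rule tame_exp_decay[OF te r])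
  define w where "w t = 2 * t ^ (CARD('n) - 1) * (1 - t\<^sup>2) powr m" for t :: real
  have w0: "0 \<le> w t" if "t > 0" for t using that by (simp add: w_def)
  let ?B = "\<lambda>k. Beta (real k + \<nu>) (m + 1)"
  have kn: "real k + \<nu> > 0" for k using nu_ge_1 by (simp add: add_nonneg_pos)
  have B0: "?B k \<ge> 0" for k unfolding Beta_def using kn[of k] m
    by (intro divide_nonneg_nonneg mult_nonneg_nonneg less_imp_le[OF Gamma_real_pos]) auto
  have wint: "(\<integral>\<^sup>+t. ennreal (w t * (t\<^sup>2) ^ k) \<partial>I01) = ennreal (?B k)" for k
  proof -
    have "(\<integral>\<^sup>+t. ennreal (w t * (t\<^sup>2) ^ k) \<partial>I01)
      = (\<integral>\<^sup>+t. ennreal (2 * t powr (2 * (real k + \<nu>) - 1) * (1 - t\<^sup>2) powr ((m + 1) - 1)) \<partial>I01)"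
    proof (rule nn_integral_cong)
      fix t assume "t \<in> space I01"
      then have t: "t > 0" by simp
      have "2 * (real k + \<nu>) - 1 = real (2 * k + (CARD('n) - 1))"
        using card_ge_2 by (simp add: \<nu>_def of_nat_diff)
      then have tpow: "t powr (2 * (real k + \<nu>) - 1) = t ^ (2 * k + (CARD('n) - 1))" using t by (simp only: powr_realpow)
      have tsplit: "t ^ (2 * k + (CARD('n) - 1)) = (t\<^sup>2) ^ k * t ^ (CARD('n) - 1)"
        by (simp only: power_add power_mult)
      show "ennreal (w t * (t\<^sup>2) ^ k) = ennreal (2 * t powr (2 * (real k + \<nu>) - 1) * (1 - t\<^sup>2) powr ((m + 1) - 1))"
        by (simp only: trans[OF tpow tsplit] w_def mult_ac add_diff_cancel_right')
    qed
    also have "\<dots> = ennreal (?B k)" by (rule nn_integral_Beta_square) (use kn m in auto)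
    finally show ?thesis .
  qed
  have Bfrac: "complex_of_real (?B k) * frac_factor (m + 1) k j = 1" for k j
  proof -
    have "Gamma (real k + \<nu>) > 0" "Gamma (m + 1) > 0" "Gamma (real k + \<nu> + (m + 1)) > 0"
      using kn[of k] m by (auto intro!: Gamma_real_pos)
    then have "?B k * (Gamma (real k + \<nu> + (m + 1)) / (Gamma (real k + \<nu>) * Gamma (m + 1))) = 1"
      by (simp add: Beta_def less_imp_neq[symmetric])
    then show ?thesis unfolding frac_factor_def by (metis of_real_1 of_real_mult)
  qed
  have "dilate r (\<lambda>k j. c k j * a k j) = (\<lambda>k j. of_real (?B k) * e k j)"
  proof (intro ext)
    fix k j
    have "of_real (?B k) * e k j = (complex_of_real (?B k) * frac_factor (m + 1) k j) * (of_real (r ^ k) * (c k j * a k j))"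
      by (simp add: e_def dilate_def mult_ac)
    then show "dilate r (\<lambda>k j. c k j * a k j) k j = of_real (?B k) * e k j"
      unfolding Bfrac by (simp add: dilate_def)
  qed
  then have "ennreal (l1_mean (\<lambda>k j. c k j * a k j) r) = L1 (\<lambda>k j. of_real (?B k) * e k j)"
    using ennreal_l1_mean[OF tame_mult[OF c a] r] by simp
  also have "\<dots> \<le> (\<integral>\<^sup>+t. ennreal (w t) * L1 (dilate (t\<^sup>2) e) \<partial>I01)"
  proof (rule L1_mixture[OF sigma_finite_I01 e])
    show "w \<in> borel_measurable I01" unfolding w_def[abs_def] by (intro measurable_I01) measurable
    show "(\<lambda>t. t\<^sup>2) \<in> borel_measurable I01" by (intro measurable_I01) measurable
  qed (auto simp: w0 B0 wint power_le_one)
  also have "\<dots> \<le> (\<integral>\<^sup>+t. ennreal (2 * M) * ennreal (t ^ (CARD('n) - 1) * (1 - t\<^sup>2) powr m * (1 - r * t) powr (- \<gamma>) * l1_mean a t) \<partial>I01)"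
  proof (rule nn_integral_mono)
    fix t assume "t \<in> space I01"
    then have t: "0 < t" "t < 1" by auto
    have rt: "0 \<le> r * t" "r * t < 1" using one_minus_mult_pos[of r t] r t by auto
    have "dilate (t\<^sup>2) e = (\<lambda>k j. dilate (r * t) (\<lambda>k j. frac_factor (m + 1) k j * c k j) k j * dilate t a k j)"
      by (auto simp: e_def dilate_def fun_eq_iff power_mult_distrib power2_eq_square mult_ac)
    then have "L1 (dilate (t\<^sup>2) e) \<le> ennreal (M * (1 - r * t) powr (- \<gamma>)) * L1 (dilate t a)"
      using L1_mult[OF bound[OF rt] tame_exp_decay[OF a]] t by simp
    then have "ennreal (w t) * L1 (dilate (t\<^sup>2) e) \<le> ennreal (w t) * (ennreal (M * (1 - r * t) powr (- \<gamma>)) * ennreal (l1_mean a t))"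
      using ennreal_l1_mean[OF a, of t] t by (intro mult_left_mono) auto
    also have "\<dots> = ennreal (w t * (M * (1 - r * t) powr (- \<gamma>) * l1_mean a t))"
      using t M l1_mean_nonneg by (simp add: w_def ennreal_mult)
    also have "w t * (M * (1 - r * t) powr (- \<gamma>) * l1_mean a t)
      = (2 * M) * (t ^ (CARD('n) - 1) * (1 - t\<^sup>2) powr m * (1 - r * t) powr (- \<gamma>) * l1_mean a t)"
      by (simp add: w_def mult_ac)
    also have "ennreal \<dots> = ennreal (2 * M) * ennreal (t ^ (CARD('n) - 1) * (1 - t\<^sup>2) powr m * (1 - r * t) powr (- \<gamma>) * l1_mean a t)"
      using M by (intro ennreal_mult') simp
    finally show "ennreal (w t) * L1 (dilate (t\<^sup>2) e)
      \<le> ennreal (2 * M) * ennreal (t ^ (CARD('n) - 1) * (1 - t\<^sup>2) powr m * (1 - r * t) powr (- \<gamma>) * l1_mean a t)" .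
  qed
  also have "\<dots> = ennreal (2 * M) * (\<integral>\<^sup>+t. ennreal (t ^ (CARD('n) - 1) * (1 - t\<^sup>2) powr m * (1 - r * t) powr (- \<gamma>) * l1_mean a t) \<partial>I01)"
  proof (rule nn_integral_cmult)
    have [measurable]: "l1_mean a \<in> borel_measurable I01" by (rule measurable_I01_monotone) (rule l1_mean_mono[OF a])
    note measurable_I01_id[measurable]
    show "(\<lambda>t. ennreal (t ^ (CARD('n) - 1) * (1 - t\<^sup>2) powr m * (1 - r * t) powr (- \<gamma>) * l1_mean a t)) \<in> borel_measurable I01"
      by measurable
  qed
  finally show ?thesis .
qed

lemma kernel_condition_imp_multiplier:
  assumes c: "tame c" and pq: "1 < p" "p \<le> q" and al: "\<alpha> > 0" and be: "\<beta> > 0" and m: "m > \<alpha> - 1" and M: "M > 0"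
    and bound: "\<And>r. 0 \<le> r \<Longrightarrow> r < 1 \<Longrightarrow>
      kernel_bound (dilate r (\<lambda>k j. frac_factor (m + 1) k j * c k j)) (M * (1 - r) powr (- (m + 1 - \<alpha> + \<beta>)))"
    and a: "tame a" "fin_norm p \<alpha> a"
  shows "fin_norm q \<beta> (\<lambda>k j. c k j * a k j)"
proof (rule finite_norm_schur)
  show "fin_norm q \<alpha> a"
    by (rule finite_norm_embed[OF a(2) pq al l1_mean_nonneg l1_mean_mono[OF a(1)]])
  show "1 < q" using pq by (rule less_le_trans)
  show "l1_mean a r \<le> l1_mean a s" if "0 \<le> r" "r \<le> s" "s < 1" for r s by (rule l1_mean_mono[OF a(1) that])
  show "0 < 2 * M" using M by simp
  show "ennreal (l1_mean (\<lambda>k j. c k j * a k j) r) \<le> ennreal (2 * M) *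
    (\<integral>\<^sup>+t. ennreal (t ^ (CARD('n) - 1) * (1 - t\<^sup>2) powr m * (1 - r * t) powr (- (m + 1 - \<alpha> + \<beta>)) * l1_mean a t) \<partial>I01)"
    if "0 \<le> r" "r < 1" for r
    by (rule l1_mean_conv_le[OF c a(1) _ M bound that]) (use al m in auto)
qed (use al be m l1_mean_nonneg in auto)

end

section \<open>From multipliers to the kernel condition\<close>

lemma finite_norm_bounded:
  assumes p: "1 < p" and al: "\<alpha> > 0" and nn: "\<And>r. 0 \<le> \<phi> r" and B: "\<And>r. 0 \<le> r \<Longrightarrow> r < 1 \<Longrightarrow> \<phi> r \<le> B"
  shows "finite_norm N p \<alpha> \<phi>"
proof (cases "p = \<infinity>")
  case True
  have "\<phi> r * (1 - r\<^sup>2) powr \<alpha> \<le> B * 1" if "0 \<le> r" "r < 1" for r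
    using nn order_trans[OF nn B[of 0]] that al
    by (intro mult_mono B powr_le1) (auto simp: power_le_one)
  then show ?thesis using True by (auto simp: finite_norm_def intro!: exI[of _ B])
next
  case False
  define P where "P = enn2real p"
  have P: "P > 1" unfolding P_def using p False
    by (cases p) (auto simp: ennreal_less_iff simp flip: ennreal_1)
  have a: "\<alpha> * P > 0" using al P by simp
  \<comment> \<open>The factor with base 1 - 0 r equals 1; it casts the majorant as the Schur kernel
    at radius 0, whose integral is finite.\<close>
  have "(\<integral>\<^sup>+r. ennreal (\<phi> r powr P * ((1 - r\<^sup>2) powr (\<alpha> * P - 1) * r ^ N)) \<partial>I01)
    \<le> (\<integral>\<^sup>+r. ennreal (B powr P) * ennreal (r ^ N * (1 - r\<^sup>2) powr (\<alpha> * P - 1) * (1 - 0 * r) powr (- (\<alpha> * P + 1))) \<partial>I01)"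
  proof (rule nn_integral_mono)
    fix r assume "r \<in> space I01"
    then have r: "0 < r" "r < 1" by auto
    have "\<phi> r powr P * ((1 - r\<^sup>2) powr (\<alpha> * P - 1) * r ^ N) \<le> B powr P * ((1 - r\<^sup>2) powr (\<alpha> * P - 1) * r ^ N)"
      using r P nn by (intro mult_right_mono powr_mono2 B) auto
    then show "ennreal (\<phi> r powr P * ((1 - r\<^sup>2) powr (\<alpha> * P - 1) * r ^ N))
      \<le> ennreal (B powr P) * ennreal (r ^ N * (1 - r\<^sup>2) powr (\<alpha> * P - 1) * (1 - 0 * r) powr (- (\<alpha> * P + 1)))"
      using r by (simp add: mult.commute ennreal_leI flip: ennreal_mult)
  qed
  also have "\<dots> = ennreal (B powr P) * (\<integral>\<^sup>+r. ennreal (r ^ N * (1 - r\<^sup>2) powr (\<alpha> * P - 1) * (1 - 0 * r) powr (- (\<alpha> * P + 1))) \<partial>I01)"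
    by (rule nn_integral_cmult) (intro measurable_I01, measurable)
  also have "\<dots> < \<infinity>"
    using nn_integral_schur_kernel[OF a zero_less_one, of 0 N] by (auto simp: ennreal_mult_less_top less_top intro: le_less_trans)
  finally show ?thesis using False by (simp add: finite_norm_def P_def)
qed

context spherical_expansion
begin

lemma emeasure_sphere: "emeasure \<sigma> (space \<sigma>) = ennreal \<omega>"
  unfolding \<omega>_def by (rule emeasure_eq_measure)

section \<open>L^1 norms of sums and series of coefficient arrays\<close>

lemma L1_le_sup:
  assumes "\<And>x. norm x = 1 \<Longrightarrow> cmod (sphere_series a x) \<le> B" and B: "0 \<le> B"
  shows "L1 a \<le> ennreal (\<omega> * B)"
proof -
  have "L1 a \<le> (\<integral>\<^sup>+x. ennreal B \<partial>\<sigma>)"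
    unfolding L1_def by (intro nn_integral_mono ennreal_leI assms) auto
  also have "\<dots> = ennreal B * emeasure \<sigma> (space \<sigma>)" by (rule nn_integral_const)
  also have "\<dots> = ennreal (\<omega> * B)"
    unfolding emeasure_sphere using B omega_pos by (simp add: mult.commute flip: ennreal_mult)
  finally show ?thesis .
qed

lemma L1_le_decays:
  assumes "decays C s a"
  shows "L1 a \<le> ennreal (\<omega> * (C * weight_const s / (1 - sqrt s)))"
proof (rule L1_le_sup)
  show "cmod (sphere_series a x) \<le> C * weight_const s / (1 - sqrt s)" if "norm x = 1" for x
    by (rule sphere_series_bound[OF assms that])
  have "0 < s" "s < 1" "0 \<le> C" using assms by (auto simp: decays_def)
  then show "0 \<le> C * weight_const s / (1 - sqrt s)"
    using weight_const(1) by (intro divide_nonneg_nonneg mult_nonneg_nonneg) auto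
qed

lemma exp_decay_add:
  assumes "exp_decay a" "exp_decay b"
  shows "exp_decay (\<lambda>k j. a k j + b k j)"
proof -
  obtain C s D t where a: "decays C s a" and b: "decays D t b" using assms unfolding exp_decay_def by blast
  define q where "q = max s t"
  have "decays (C + D) q (\<lambda>k j. a k j + b k j)"
    unfolding decays_def
  proof (intro conjI allI ballI)
    fix k j assume j: "j \<in> {1..d k}"
    have "cmod (a k j) \<le> C * q ^ k"
    proof -
      have "cmod (a k j) \<le> C * s ^ k" using a j by (auto simp: decays_def)
      also have "\<dots> \<le> C * q ^ k" using a by (intro mult_left_mono power_mono) (auto simp: decays_def q_def)
      finally show ?thesis .
    qed
    moreover have "cmod (b k j) \<le> D * q ^ k"
    proof -
      have "cmod (b k j) \<le> D * t ^ k" using b j by (auto simp: decays_def)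
      also have "\<dots> \<le> D * q ^ k" using b by (intro mult_left_mono power_mono) (auto simp: decays_def q_def)
      finally show ?thesis .
    qed
    ultimately show "cmod (a k j + b k j) \<le> (C + D) * q ^ k"
      using norm_triangle_ineq[of "a k j" "b k j"] by (simp add: distrib_right)
  qed (use a b in \<open>auto simp: decays_def q_def\<close>)
  then show ?thesis unfolding exp_decay_def by blast
qed

lemma exp_decay_scale: "exp_decay a \<Longrightarrow> exp_decay (\<lambda>k j. z * a k j)"
  by (rule exp_decay_mult_bounded[where D="cmod z"]) auto

lemma L1_integrand_measurable: "(\<lambda>x. ennreal (cmod (sphere_series a x))) \<in> borel_measurable \<sigma>"
  using sphere_series_measurable[of a] by measurable

lemma L1_add:
  assumes "exp_decay a" "exp_decay b"
  shows "L1 (\<lambda>k j. a k j + b k j) \<le> L1 a + L1 b"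
proof -
  have blk: "block (\<lambda>k j. a k j + b k j) k x = block a k x + block b k x" for k x
    by (simp add: block_def distrib_right sum.distrib)
  have "sphere_series (\<lambda>k j. a k j + b k j) x = sphere_series a x + sphere_series b x" if "norm x = 1" for x
    unfolding sphere_series_def blk
    by (rule suminf_add[symmetric]) (intro summable_norm_cancel[OF summable_norm_block] assms that)+
  then have "L1 (\<lambda>k j. a k j + b k j) \<le> (\<integral>\<^sup>+x. ennreal (cmod (sphere_series a x)) + ennreal (cmod (sphere_series b x)) \<partial>\<sigma>)"
    unfolding L1_def by (intro nn_integral_mono) (simp add: norm_triangle_ineq ennreal_leI flip: ennreal_plus)
  also have "\<dots> = L1 a + L1 b"
    unfolding L1_def by (intro nn_integral_add L1_integrand_measurable)
  finally show ?thesis .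
qed

text \<open>2b is the difference of a + b and a - b, so both norms cannot be smaller than that of b.
  This is the choice of sign in the gliding hump.\<close>

lemma L1_sign_choice:
  assumes a: "exp_decay a" and b: "exp_decay b"
  shows "L1 b \<le> L1 (\<lambda>k j. a k j + b k j) \<or> L1 b \<le> L1 (\<lambda>k j. a k j - b k j)"
proof (rule ccontr)
  assume neg: "\<not> ?thesis"
  have m: "exp_decay (\<lambda>k j. - 1 * b k j)" by (rule exp_decay_scale[OF b])
  have p1: "exp_decay (\<lambda>k j. a k j + b k j)" by (rule exp_decay_add[OF a b])
  have p2: "exp_decay (\<lambda>k j. a k j - b k j)" using exp_decay_add[OF a m] by simp
  have p3: "exp_decay (\<lambda>k j. - 1 * (a k j - b k j))" by (rule exp_decay_scale[OF p2])
  have "ennreal 2 * L1 b = L1 (\<lambda>k j. 2 * b k j)" using L1_scale[OF b, of 2] by simp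
  also have "(\<lambda>k j. 2 * b k j) = (\<lambda>k j. (a k j + b k j) + - 1 * (a k j - b k j))" by (simp add: fun_eq_iff)
  also have "L1 \<dots> \<le> L1 (\<lambda>k j. a k j + b k j) + L1 (\<lambda>k j. - 1 * (a k j - b k j))" by (rule L1_add[OF p1 p3])
  also have "L1 (\<lambda>k j. - 1 * (a k j - b k j)) = L1 (\<lambda>k j. a k j - b k j)" using L1_scale[OF p2, of "- 1"] by simp
  finally have le: "ennreal 2 * L1 b \<le> L1 (\<lambda>k j. a k j + b k j) + L1 (\<lambda>k j. a k j - b k j)" .
  obtain u where u: "L1 b = ennreal u" "u \<ge> 0" using L1_finite[OF b] by (cases "L1 b") auto
  obtain v where v: "L1 (\<lambda>k j. a k j + b k j) = ennreal v" "v \<ge> 0"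
    using L1_finite[OF p1] by (cases "L1 (\<lambda>k j. a k j + b k j)") auto
  obtain w where w: "L1 (\<lambda>k j. a k j - b k j) = ennreal w" "w \<ge> 0"
    using L1_finite[OF p2] by (cases "L1 (\<lambda>k j. a k j - b k j)") auto
  have "ennreal (2 * u) = ennreal 2 * ennreal u" by (rule ennreal_mult') simp
  moreover have "ennreal (v + w) = ennreal v + ennreal w" by (rule ennreal_plus) (rule v w)+
  ultimately have "ennreal (2 * u) \<le> ennreal (v + w)" using le unfolding u(1) v(1) w(1) by (simp only:)
  then have "2 * u \<le> v + w" using v(2) w(2) by (subst (asm) ennreal_le_iff) auto
  moreover have "v < u" "w < u" using neg u(2) v(2) w(2) unfolding u(1) v(1) w(1) by auto
  ultimately show False by simp
qed

lemma exp_decay_zero: "exp_decay (\<lambda>k j. 0)"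
  unfolding exp_decay_def decays_def by (intro exI[of _ 1] exI[of _ "1/2"]) auto

lemma exp_decay_sum:
  fixes u :: "nat \<Rightarrow> nat \<Rightarrow> nat \<Rightarrow> complex"
  assumes "\<And>i. exp_decay (u i)"
  shows "exp_decay (\<lambda>k j. \<Sum>i<n. z i * u i k j)"
proof (induction n)
  case 0
  then show ?case by (simp add: exp_decay_zero)
next
  case (Suc n)
  show ?case using exp_decay_add[OF Suc exp_decay_scale[OF assms]] by simp
qed

lemma L1_sum:
  fixes u :: "nat \<Rightarrow> nat \<Rightarrow> nat \<Rightarrow> complex"
  assumes u: "\<And>i. exp_decay (u i)"
  shows "L1 (\<lambda>k j. \<Sum>i<n. of_real (e i) * u i k j) \<le> (\<Sum>i<n. ennreal \<bar>e i\<bar> * L1 (u i))"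
proof (induction n)
  case 0
  then show ?case by (simp add: L1_def sphere_series_def block_def)
next
  case (Suc n)
  have "L1 (\<lambda>k j. \<Sum>i<Suc n. of_real (e i) * u i k j)
    \<le> L1 (\<lambda>k j. \<Sum>i<n. of_real (e i) * u i k j) + L1 (\<lambda>k j. of_real (e n) * u n k j)"
    using L1_add[OF exp_decay_sum[OF u, where n=n and z="\<lambda>i. of_real (e i)"] exp_decay_scale[OF u[of n], of "of_real (e n)"]] by simp
  also have "\<dots> \<le> (\<Sum>i<Suc n. ennreal \<bar>e i\<bar> * L1 (u i))"
    using Suc L1_scale[OF u[of n], of "of_real (e n)"] by (simp add: add_right_mono)
  finally show ?case .
qed

lemma geometric_third: "(\<lambda>i. K * (1/3) ^ i) sums (K * (3/2))" for K :: real
  using sums_mult[OF geometric_sums[of "1/3::real"], of K] by simp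

lemma series_summable:
  assumes u: "\<And>i. decays C s (u i)" and e: "\<And>i. \<bar>e i\<bar> \<le> K * (1/3) ^ i" and j: "j \<in> {1..d k}"
  shows "summable (\<lambda>i. of_real (e i) * u i k j)" "cmod (\<Sum>i. of_real (e i) * u i k j) \<le> (K * (3/2) * C) * s ^ k"
proof -
  have C: "0 \<le> C" "0 < s" using u[of 0] by (auto simp: decays_def)
  have le: "cmod (of_real (e i) * u i k j) \<le> (K * (1/3) ^ i) * (C * s ^ k)" for i
    unfolding norm_mult norm_of_real using u[of i] j e[of i]
    by (intro mult_mono) (auto simp: decays_def intro: order_trans[OF abs_ge_zero])
  have sm: "(\<lambda>i. (K * (1/3) ^ i) * (C * s ^ k)) sums (K * (3/2) * (C * s ^ k))"
    by (rule sums_mult2[OF geometric_third])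
  have sn: "summable (\<lambda>i. cmod (of_real (e i) * u i k j))"
    by (rule summable_comparison_test'[OF sums_summable[OF sm]]) (use le in simp)
  then show "summable (\<lambda>i. of_real (e i) * u i k j)" by (rule summable_norm_cancel)
  have "cmod (\<Sum>i. of_real (e i) * u i k j) \<le> (\<Sum>i. cmod (of_real (e i) * u i k j))" by (rule summable_norm[OF sn])
  also have "\<dots> \<le> (\<Sum>i. (K * (1/3) ^ i) * (C * s ^ k))" by (intro suminf_le le sn sums_summable[OF sm])
  also have "\<dots> = (K * (3/2) * C) * s ^ k" using sums_unique[OF sm] by (simp add: mult.assoc)
  finally show "cmod (\<Sum>i. of_real (e i) * u i k j) \<le> (K * (3/2) * C) * s ^ k" .
qed

lemma decays_series:
  assumes u: "\<And>i. decays C s (u i)" and e: "\<And>i. \<bar>e i\<bar> \<le> K * (1/3) ^ i"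
  shows "decays (K * (3/2) * C) s (\<lambda>k j. \<Sum>i. of_real (e i) * u i k j)"
proof -
  have "0 \<le> K" using e[of 0] abs_ge_zero[of "e 0"] by simp
  then show ?thesis using u[of 0] series_summable(2)[OF u e] by (auto simp: decays_def)
qed

text \<open>Finite subadditivity, plus a tail that is uniformly small on the sphere because the
  arrays share their decay constants and the scalars are geometric.\<close>

lemma L1_series:
  assumes u: "\<And>i. decays C s (u i)" and e: "\<And>i. \<bar>e i\<bar> \<le> K * (1/3) ^ i"
  shows "L1 (\<lambda>k j. \<Sum>i. of_real (e i) * u i k j) \<le> (\<Sum>i. ennreal \<bar>e i\<bar> * L1 (u i))"
proof (rule ennreal_le_epsilon)
  fix \<epsilon> :: real assume eps: "\<epsilon> > 0"
  have ud: "exp_decay (u i)" for i using u[of i] unfolding exp_decay_def by blast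
  define Q where "Q = \<omega> * (K * (3/2) * C * weight_const s / (1 - sqrt s))"
  have "(\<lambda>n. Q * (1/3) ^ n) \<longlonglongrightarrow> Q * 0" by (intro tendsto_mult tendsto_const LIMSEQ_power_zero) simp
  then have "eventually (\<lambda>n. Q * (1/3) ^ n < \<epsilon>) sequentially" by (rule order_tendstoD) (use eps in simp)
  then obtain n where n: "Q * (1/3) ^ n < \<epsilon>" by (auto simp: eventually_sequentially)
  let ?tail = "\<lambda>k j. \<Sum>i. of_real (e (i + n)) * u (i + n) k j"
  have tail: "decays ((K * (1/3) ^ n) * (3/2) * C) s ?tail"
    by (rule decays_series[of C s "\<lambda>i. u (i + n)" "\<lambda>i. e (i + n)"]) (use u e[of "_ + n"] in \<open>auto simp: power_add mult_ac\<close>)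
  have "L1 (\<lambda>k j. \<Sum>i. of_real (e i) * u i k j) = L1 (\<lambda>k j. (\<Sum>i<n. of_real (e i) * u i k j) + ?tail k j)"
  proof (rule L1_cong)
    fix k j assume j: "j \<in> {1..d k}"
    show "(\<Sum>i. of_real (e i) * u i k j) = (\<Sum>i<n. of_real (e i) * u i k j) + ?tail k j"
      using suminf_split_initial_segment[OF series_summable(1)[OF u e j], where k=n] by (simp add: add.commute)
  qed
  also have "\<dots> \<le> L1 (\<lambda>k j. \<Sum>i<n. of_real (e i) * u i k j) + L1 ?tail"
    by (rule L1_add[OF exp_decay_sum[OF ud]]) (use tail in \<open>auto simp: exp_decay_def\<close>)
  also have "\<dots> \<le> (\<Sum>i<n. ennreal \<bar>e i\<bar> * L1 (u i)) + ennreal (\<omega> * (((K * (1/3) ^ n) * (3/2) * C) * weight_const s / (1 - sqrt s)))"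
    by (intro add_mono L1_sum ud L1_le_decays[OF tail])
  also have "\<omega> * (((K * (1/3) ^ n) * (3/2) * C) * weight_const s / (1 - sqrt s)) = Q * (1/3) ^ n"
    by (simp add: Q_def mult_ac)
  also have "(\<Sum>i<n. ennreal \<bar>e i\<bar> * L1 (u i)) + ennreal (Q * (1/3) ^ n) \<le> (\<Sum>i. ennreal \<bar>e i\<bar> * L1 (u i)) + ennreal \<epsilon>"
    using n by (intro add_mono sum_le_suminf ennreal_leI) auto
  finally show "L1 (\<lambda>k j. \<Sum>i. of_real (e i) * u i k j) \<le> (\<Sum>i. ennreal \<bar>e i\<bar> * L1 (u i)) + ennreal \<epsilon>" .
qed

text \<open>One input suffices: an array that is constant in j, small enough to give a bounded
  function, yet bounded below subexponentially. Dividing the tame image by it leaves c tame.\<close>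

lemma multiplier_imp_tame:
  assumes H: "\<And>a. tame a \<Longrightarrow> fin_norm p \<alpha> a \<Longrightarrow> tame (\<lambda>k j. c k j * a k j)" and p: "1 < p" and al: "\<alpha> > 0"
  shows "tame c"
proof -
  define W where "W k x = (\<Sum>j=1..d k. 1 + (Y k j x)\<^sup>2)" for k x
  define S where "S k = (SUP x\<in>sphere 0 1. W k x)" for k
  have ne: "sphere (0::real^'n) 1 \<noteq> {}" using norm_axis_1 by (metis mem_sphere_0 empty_iff)
  have Wle: "s ^ k * W k x \<le> weight_const s" if s: "0 < s" "s < 1" and x: "norm x = 1" for s k x
  proof -
    have "s ^ k * W k x \<le> weight_const s * sqrt s ^ k" unfolding W_def by (rule weight_const(2)[OF s x])
    also have "\<dots> \<le> weight_const s * 1" using s by (intro mult_left_mono weight_const(1)) (auto simp: power_le_one)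
    finally show ?thesis by simp
  qed
  have Wdiv: "W k x \<le> weight_const s / s ^ k" if s: "0 < s" "s < 1" and x: "norm x = 1" for s k x
    using Wle[OF s x, of k] s by (simp add: field_simps)
  have bdd: "bdd_above (W k ` sphere 0 1)" for k
    by (rule bdd_aboveI2[of _ _ "weight_const (1/2) / (1/2) ^ k"]) (use Wdiv[of "1/2"] in auto)
  have WS: "W k x \<le> S k" if "norm x = 1" for k x
    unfolding S_def by (rule cSUP_upper[OF _ bdd]) (use that in simp)
  have W0: "W k x \<ge> 0" for k x unfolding W_def by (intro sum_nonneg) simp
  obtain x0 :: "real^'n" where x0: "norm x0 = 1" using norm_axis_1 by blast
  have S0: "S k \<ge> 0" for k using W0[of k x0] WS[OF x0, of k] by linarith
  have Sle: "s ^ k * S k \<le> weight_const s" if s: "0 < s" "s < 1" for s k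
  proof -
    have "S k \<le> weight_const s / s ^ k" unfolding S_def
      by (rule cSUP_least[OF ne]) (use Wdiv[OF s] in auto)
    then show ?thesis using s by (simp add: field_simps)
  qed
  \<comment> \<open>1 + \<open>S k\<close> makes the block of order k bounded on the sphere, and
    (k+1)^2 makes these bounds summable. Both grow subexponentially, so
    1/\<open>\<epsilon> k\<close> does as well.\<close>
  define \<epsilon> where "\<epsilon> k = 1 / ((real k + 1)\<^sup>2 * (1 + S k))" for k
  have eps0: "\<epsilon> k > 0" for k unfolding \<epsilon>_def using S0[of k]
    by (intro divide_pos_pos mult_pos_pos) (auto intro: add_pos_nonneg)
  have epsW: "\<epsilon> k * W k x \<le> inverse (real (Suc k) ^ 2)" if x: "norm x = 1" for k x
  proof -
    have "W k x \<le> 1 + S k" using WS[OF x, of k] by simp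
    then have "\<epsilon> k * W k x \<le> \<epsilon> k * (1 + S k)" using eps0[of k] by (intro mult_left_mono) auto
    also have "\<dots> = inverse (real (Suc k) ^ 2)"
    proof -
      have "1 + S k \<noteq> 0" using S0[of k] by linarith
      then show ?thesis by (simp add: \<epsilon>_def inverse_eq_divide add.commute)
    qed
    finally show ?thesis .
  qed
  have sm: "summable (\<lambda>k. inverse (real (Suc k) ^ 2))"
    using inverse_power_summable[of 2, where ?'a=real] summable_Suc_iff[of "\<lambda>k. inverse (real k ^ 2)"] by simp
  define B where "B = (\<Sum>k. inverse (real (Suc k) ^ 2))"
  have B0: "B \<ge> 0" unfolding B_def by (intro suminf_nonneg sm) simp
  let ?a = "\<lambda>k j::nat. complex_of_real (\<epsilon> k)"
  have eps1: "\<epsilon> k \<le> 1" for k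
  proof -
    have "1 \<le> (real k + 1)\<^sup>2" by (intro one_le_power) simp
    then have "1 * 1 \<le> (real k + 1)\<^sup>2 * (1 + S k)" using S0[of k] by (intro mult_mono) auto
    then show ?thesis by (simp add: \<epsilon>_def field_simps)
  qed
  have ta: "tame ?a" unfolding tame_def
  proof (intro allI impI)
    fix s :: real assume s: "0 < s" "s < 1"
    have "s ^ k * cmod (?a k j) \<le> 1" for k j
      using s eps0[of k] eps1[of k] by (intro mult_le_one) (auto simp: power_le_one)
    then show "\<exists>C. \<forall>k. \<forall>j\<in>{1..d k}. s ^ k * cmod (?a k j) \<le> C" by blast
  qed
  have "l1_mean ?a r \<le> \<omega> * B" if r: "0 \<le> r" "r < 1" for r
  proof -
    have le: "cmod (sphere_series (dilate r ?a) x) \<le> B" if x: "norm x = 1" for x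
    proof -
      have b: "cmod (block (dilate r ?a) k x) \<le> inverse (real (Suc k) ^ 2)" for k
      proof -
        have "cmod (block ?a k x) \<le> (\<Sum>j=1..d k. \<epsilon> k * (1 + (Y k j x)\<^sup>2))"
          unfolding block_def
          by (rule order_trans[OF norm_sum]) (use eps0[of k] in \<open>auto intro!: sum_mono mult_left_mono abs_le_weight simp: norm_mult\<close>)
        also have "\<dots> = \<epsilon> k * W k x" by (simp add: W_def sum_distrib_left)
        also have "\<dots> \<le> inverse (real (Suc k) ^ 2)" by (rule epsW[OF x])
        finally have "cmod (block ?a k x) \<le> inverse (real (Suc k) ^ 2)" .
        then have "r ^ k * cmod (block ?a k x) \<le> 1 * inverse (real (Suc k) ^ 2)"
          using r by (intro mult_mono) (auto simp: power_le_one)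
        then show ?thesis using r by (simp add: block_dilate norm_mult norm_power)
      qed
      have "cmod (sphere_series (dilate r ?a) x) \<le> (\<Sum>k. cmod (block (dilate r ?a) k x))"
        unfolding sphere_series_def by (intro summable_norm summable_norm_block tame_exp_decay ta r x)
      also have "\<dots> \<le> B" unfolding B_def
        by (intro suminf_le b sm summable_norm_block tame_exp_decay ta r x)
      finally show ?thesis .
    qed
    have "ennreal (l1_mean ?a r) \<le> ennreal (\<omega> * B)"
      unfolding ennreal_l1_mean[OF ta r] by (rule L1_le_sup[OF le B0])
    then show ?thesis using omega_pos B0 by simp
  qed
  then have "fin_norm p \<alpha> ?a" by (intro finite_norm_bounded p al l1_mean_nonneg)
  from H[OF ta this] have ca: "tame (\<lambda>k j. c k j * ?a k j)" .
  show ?thesis unfolding tame_def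
  proof (intro allI impI)
    fix s :: real assume s: "0 < s" "s < 1"
    \<comment> \<open>The fourth root: one power q^k for the image, two for the factors k+1 and one
      for 1 + \<open>S k\<close>.\<close>
    define q where "q = root 4 s"
    have q: "0 < q" "q < 1" "q ^ 4 = s" using s by (auto simp: q_def)
    obtain C1 where C1: "C1 \<ge> 0" "\<And>k j. j \<in> {1..d k} \<Longrightarrow> q ^ k * cmod (c k j * ?a k j) \<le> C1"
      by (rule tameD[OF ca q(1,2)]) (rule that)
    obtain C2 t where C2: "decays C2 t (\<lambda>k j. of_real ((real k + 1) * q ^ k))"
      using exp_decay_linear[OF q(1,2), of 1] unfolding exp_decay_def by blast
    have "s ^ k * cmod (c k j) \<le> C1 * (C2 * C2 * (1 + weight_const q))" if j: "j \<in> {1..d k}" for k j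
    proof -
      have k1: "(real k + 1) * q ^ k \<le> C2" using decays_bounded[OF C2 j] q by (simp add: norm_mult norm_power) (metis abs_of_nonneg add_nonneg_nonneg of_nat_0_le_iff of_real_1 of_real_add of_real_of_nat_eq norm_of_real zero_le_one)
      have k2: "q ^ k * (1 + S k) \<le> 1 + weight_const q"
        using Sle[OF q(1,2), of k] q power_le_one[of q k] by (simp add: distrib_left)
      have "s ^ k = q ^ k * (q ^ k * q ^ k) * q ^ k" unfolding q(3)[symmetric] power_mult[symmetric]
        by (simp only: power_add[symmetric]) (rule arg_cong[where f="\<lambda>i. q ^ i"], simp)
      moreover have "cmod (c k j) = cmod (c k j * ?a k j) * ((real k + 1) * (real k + 1) * (1 + S k))"
      proof -
        have "(real k + 1) * (real k + 1) * (1 + S k) \<noteq> 0"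
          using S0[of k] by (simp add: add_eq_0_iff)
        then have e: "\<epsilon> k * ((real k + 1) * (real k + 1) * (1 + S k)) = 1"
          unfolding \<epsilon>_def power2_eq_square by (metis divide_inverse_commute left_inverse mult_1_right inverse_eq_divide)
        have "cmod (c k j * ?a k j) = cmod (c k j) * \<epsilon> k" using eps0[of k] by (simp add: norm_mult)
        then show ?thesis by (simp only: mult.assoc e[unfolded mult.assoc] mult_1_right)
      qed
      ultimately have "s ^ k * cmod (c k j) = (q ^ k * cmod (c k j * ?a k j)) *
         (((real k + 1) * q ^ k) * ((real k + 1) * q ^ k) * (q ^ k * (1 + S k)))"
        by (simp only: mult_ac)
      also have "\<dots> \<le> C1 * (C2 * C2 * (1 + weight_const q))"
        using q S0[of k] C1(1) order_trans[OF _ k1, of 0]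
        by (intro mult_mono[OF C1(2)[OF j] mult_mono[OF mult_mono[OF k1 k1] k2]]) auto
      finally show ?thesis .
    qed
    then show "\<exists>C. \<forall>k. \<forall>j\<in>{1..d k}. s ^ k * cmod (c k j) \<le> C" by blast
  qed
qed

text \<open>With e the factors of the fractional derivative these are the coefficients of the test
  function with parameters \<tau> and y; with e multiplied by c they are those of its image.\<close>

definition test_coeff :: "real \<Rightarrow> (nat \<Rightarrow> nat \<Rightarrow> complex) \<Rightarrow> real \<Rightarrow> real^'n \<Rightarrow> nat \<Rightarrow> nat \<Rightarrow> complex" where
  "test_coeff \<delta> e \<tau> y k j = of_real ((1 - \<tau>) powr \<delta> * \<tau> ^ k) * (e k j * of_real (Y k j y))"

text \<open>At a fixed radius the whole family of test arrays shares its decay constants. Suprema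
  over \<tau> and y are therefore finite there, and only the radius can be responsible for
  unboundedness.\<close>

lemma test_coeff_decays:
  assumes e: "tame e" and del: "\<delta> > 0" and r: "0 \<le> r" "r < 1"
  obtains C s where "\<And>\<tau> y. 0 \<le> \<tau> \<Longrightarrow> \<tau> < 1 \<Longrightarrow> norm y = 1 \<Longrightarrow> decays C s (dilate r (test_coeff \<delta> e \<tau> y))"
proof -
  have r': "0 < (1 + r) / 2" "(1 + r) / 2 < 1" using r by auto
  obtain C s where C: "\<And>t. 0 \<le> t \<Longrightarrow> t \<le> (1 + r) / 2 \<Longrightarrow> decays C s (dilate t e)"
    by (rule tame_decays[OF e r']) (rule that)
  have Cr: "decays C s (dilate r e)" using C[of r] r by auto
  have "decays (1 * (C * weight_const s)) (sqrt s) (dilate r (test_coeff \<delta> e \<tau> y))"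
    if tau: "0 \<le> \<tau>" "\<tau> < 1" and y: "norm y = 1" for \<tau> y
  proof -
    have "(1 - \<tau>) powr \<delta> * \<tau> ^ k \<le> 1" for k
      using tau del by (intro mult_le_one powr_le1) (auto simp: power_le_one)
    then have "decays (1 * (C * weight_const s)) (sqrt s)
      (\<lambda>k j. of_real ((1 - \<tau>) powr \<delta> * \<tau> ^ k) * (dilate r e k j * of_real (Y k j y)))"
      using tau by (intro decays_mult_bounded[OF decays_mult_Y[OF Cr y]]) (auto simp: norm_mult norm_power)
    moreover have "(\<lambda>k j. of_real ((1 - \<tau>) powr \<delta> * \<tau> ^ k) * (dilate r e k j * of_real (Y k j y))) = dilate r (test_coeff \<delta> e \<tau> y)"
      by (auto simp: fun_eq_iff dilate_def test_coeff_def mult_ac)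
    ultimately show ?thesis by simp
  qed
  then show ?thesis by (rule that)
qed

lemma L1_test_coeff:
  assumes e: "tame e" and tau: "0 \<le> \<tau>" "\<tau> < 1" and y: "norm y = 1" and r: "0 \<le> r" "r < 1"
  shows "L1 (dilate r (test_coeff \<delta> e \<tau> y)) = ennreal ((1 - \<tau>) powr \<delta>) * L1 (\<lambda>k j. dilate (\<tau> * r) e k j * of_real (Y k j y))"
proof -
  have tr: "0 \<le> \<tau> * r" "\<tau> * r < 1" using one_minus_mult_pos[of \<tau> r] tau r by auto
  have "dilate r (test_coeff \<delta> e \<tau> y) = (\<lambda>k j. of_real ((1 - \<tau>) powr \<delta>) * (dilate (\<tau> * r) e k j * of_real (Y k j y)))"
    by (auto simp: fun_eq_iff dilate_def test_coeff_def power_mult_distrib mult_ac)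
  then show ?thesis
    using L1_scale[OF exp_decay_mult_Y[OF tame_exp_decay[OF e tr] y], of "of_real ((1 - \<tau>) powr \<delta>)"] by simp
qed

text \<open>
  Uniform boundedness by Sokal's gliding hump: if the test functions were not mapped to a bounded set, a signed
  series of them with coefficients \<open>\<plusminus>3\<^sup>-\<^sup>i\<close> would be mapped outside the target space.
\<close>
lemma multiplier_uniform_bound:
  assumes H: "\<And>a. tame a \<Longrightarrow> fin_norm p \<alpha> a \<Longrightarrow> tame (\<lambda>k j. c k j * a k j) \<and> fin_norm q \<beta> (\<lambda>k j. c k j * a k j)"
    and c: "tame c" and p: "1 < p" and q: "1 < q" and al: "\<alpha> > 0" and be: "\<beta> > 0" and m: "m > \<alpha> - 1"
  shows "\<exists>B. \<forall>\<tau> y. 0 \<le> \<tau> \<longrightarrow> \<tau> < 1 \<longrightarrow> norm y = 1 \<longrightarrow>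
    (1 - \<tau>) powr \<beta> * l1_mean (test_coeff (m + 1 - \<alpha>) (\<lambda>k j. frac_factor (m + 1) k j * c k j) \<tau> y) \<tau> \<le> B"
proof (rule ccontr)
  define \<delta> where "\<delta> = m + 1 - \<alpha>"
  define lam where "lam = frac_factor (m + 1)"
  define cl where "cl = (\<lambda>k j. lam k j * c k j)"
  define A where "A \<rho> \<tau> y = (1 - \<rho>) powr \<beta> * l1_mean (test_coeff \<delta> cl \<tau> y) \<rho>" for \<rho> \<tau> and y :: "real^'n"
  assume "\<not> ?thesis"
  then have unb: "\<exists>\<tau> y. 0 \<le> \<tau> \<and> \<tau> < 1 \<and> norm y = 1 \<and> A \<tau> \<tau> y > B" for B
    unfolding A_def \<delta>_def cl_def lam_def by (auto simp: not_le)
  have del: "\<delta> > 0" and m1: "m + 1 > 0" using m al by (auto simp: \<delta>_def)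
  have tlam: "tame lam" unfolding lam_def by (rule tame_frac_factor[OF m1])
  have tcl: "tame cl" unfolding cl_def by (rule tame_mult[OF tlam c])
  have A0: "A \<rho> \<tau> y \<ge> 0" for \<rho> \<tau> y by (simp add: A_def l1_mean_nonneg)
  have Abdd: "\<exists>K. \<forall>\<tau> y. 0 \<le> \<tau> \<longrightarrow> \<tau> < 1 \<longrightarrow> norm y = 1 \<longrightarrow> A \<rho> \<tau> y \<le> K" if rho: "0 \<le> \<rho>" "\<rho> < 1" for \<rho>
  proof -
    obtain C s where C: "\<And>\<tau> y. 0 \<le> \<tau> \<Longrightarrow> \<tau> < 1 \<Longrightarrow> norm y = 1 \<Longrightarrow> decays C s (dilate \<rho> (test_coeff \<delta> cl \<tau> y))"
      by (rule test_coeff_decays[OF tcl del rho]) (rule that)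
    define K where "K = max 0 (\<omega> * (C * weight_const s / (1 - sqrt s)))"
    have "A \<rho> \<tau> y \<le> 1 * K" if "0 \<le> \<tau>" "\<tau> < 1" "norm y = 1" for \<tau> y
    proof -
      have "L1 (dilate \<rho> (test_coeff \<delta> cl \<tau> y)) \<le> ennreal K"
        using L1_le_decays[OF C[OF that]] unfolding K_def by (simp add: ennreal_leI order_trans)
      then have "l1_mean (test_coeff \<delta> cl \<tau> y) \<rho> \<le> K"
        unfolding l1_mean_def by (rule enn2real_leI[rotated]) (simp add: K_def)
      then show ?thesis unfolding A_def using rho be
        by (intro mult_mono powr_le1) (auto simp: l1_mean_nonneg)
    qed
    then show ?thesis by auto
  qed
  \<comment> \<open>The radius \<rho> comes from an unbounded diagonal value, and S is the supremum
    over all test functions at that radius. The pair (\<tau>, y) is then chosen anew to come within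
    3/4 of S, so that S also controls every other term of the series at radius \<rho>.\<close>
  have "\<forall>n. \<exists>t. case t of (\<rho>, \<tau>, y, S) \<Rightarrow> 0 \<le> \<rho> \<and> \<rho> < 1 \<and> 0 \<le> \<tau> \<and> \<tau> < 1 \<and> norm (y::real^'n) = 1 \<and> S > 4 ^ n \<and>
      A \<rho> \<tau> y \<ge> 3/4 * S \<and> (\<forall>\<tau>' y'. 0 \<le> \<tau>' \<longrightarrow> \<tau>' < 1 \<longrightarrow> norm y' = 1 \<longrightarrow> A \<rho> \<tau>' y' \<le> S)"
  proof
    fix n :: nat
    obtain \<rho> y where rho: "0 \<le> \<rho>" "\<rho> < 1" and y: "norm y = 1" and big: "A \<rho> \<rho> y > 4 ^ n" using unb by blast
    define X where "X = {A \<rho> \<tau>' y' | \<tau>' y'. 0 \<le> \<tau>' \<and> \<tau>' < 1 \<and> norm y' = 1}"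
    have Xne: "X \<noteq> {}" and inX: "A \<rho> \<rho> y \<in> X" using rho y unfolding X_def by blast+
    obtain K where K: "\<forall>\<tau> y. 0 \<le> \<tau> \<longrightarrow> \<tau> < 1 \<longrightarrow> norm y = 1 \<longrightarrow> A \<rho> \<tau> y \<le> K" using Abdd[OF rho] by blast
    have bdd: "bdd_above X" by (rule bdd_aboveI[of _ K]) (use K in \<open>auto simp: X_def\<close>)
    define S where "S = Sup X"
    have S4: "S > 4 ^ n" unfolding S_def using big cSup_upper[OF inX bdd] by linarith
    then have "S > 0" by (meson less_trans zero_less_numeral zero_less_power)
    then have "3/4 * S < Sup X" by (simp add: S_def)
    then obtain z where "z \<in> X" "3/4 * S < z" using less_cSup_iff[OF Xne bdd] by blast
    then obtain \<tau> y' where t: "0 \<le> \<tau>" "\<tau> < 1" "norm y' = 1" "A \<rho> \<tau> y' > 3/4 * S" unfolding X_def by blast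
    have "A \<rho> \<tau>' y' \<le> S" if "0 \<le> \<tau>'" "\<tau>' < 1" "norm y' = 1" for \<tau>' y'
      unfolding S_def by (rule cSup_upper[OF _ bdd]) (use that in \<open>auto simp: X_def\<close>)
    then show "\<exists>t. case t of (\<rho>, \<tau>, y, S) \<Rightarrow> 0 \<le> \<rho> \<and> \<rho> < 1 \<and> 0 \<le> \<tau> \<and> \<tau> < 1 \<and> norm (y::real^'n) = 1 \<and> S > 4 ^ n \<and>
      A \<rho> \<tau> y \<ge> 3/4 * S \<and> (\<forall>\<tau>' y'. 0 \<le> \<tau>' \<longrightarrow> \<tau>' < 1 \<longrightarrow> norm y' = 1 \<longrightarrow> A \<rho> \<tau>' y' \<le> S)"
      using rho t S4 by (intro exI[of _ "(\<rho>, \<tau>, y', S)"]) auto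
  qed
  from choice[OF this] obtain t where t: "\<And>n. case t n of (\<rho>, \<tau>, y, S) \<Rightarrow> 0 \<le> \<rho> \<and> \<rho> < 1 \<and> 0 \<le> \<tau> \<and> \<tau> < 1 \<and> norm (y::real^'n) = 1 \<and> S > 4 ^ n \<and>
      A \<rho> \<tau> y \<ge> 3/4 * S \<and> (\<forall>\<tau>' y'. 0 \<le> \<tau>' \<longrightarrow> \<tau>' < 1 \<longrightarrow> norm y' = 1 \<longrightarrow> A \<rho> \<tau>' y' \<le> S)" by blast
  define \<rho> where "\<rho> n = fst (t n)" for n
  define \<tau> where "\<tau> n = fst (snd (t n))" for n
  define y where "y n = fst (snd (snd (t n)))" for n
  define S where "S n = snd (snd (snd (t n)))" for n
  have rho: "0 \<le> \<rho> n" "\<rho> n < 1" and tau: "0 \<le> \<tau> n" "\<tau> n < 1" and y: "norm (y n) = 1" and S4: "S n > 4 ^ n"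
    and AS: "A (\<rho> n) (\<tau> n) (y n) \<ge> 3/4 * S n"
    and AleS: "\<And>\<tau>' y'. 0 \<le> \<tau>' \<Longrightarrow> \<tau>' < 1 \<Longrightarrow> norm y' = 1 \<Longrightarrow> A (\<rho> n) \<tau>' y' \<le> S n" for n
    using t[of n] by (auto simp: \<rho>_def \<tau>_def y_def S_def split: prod.splits)
  define G where "G n = test_coeff \<delta> cl (\<tau> n) (y n)" for n
  define F where "F n = test_coeff \<delta> lam (\<tau> n) (y n)" for n
  have GF: "G n k j = c k j * F n k j" for n k j by (simp add: G_def F_def test_coeff_def cl_def mult_ac)
  have Gd: "\<exists>C s. \<forall>i. decays C s (dilate r (G i))" if r: "0 \<le> r" "r < 1" for r
  proof -
    obtain C s where "\<And>\<tau> y. 0 \<le> \<tau> \<Longrightarrow> \<tau> < 1 \<Longrightarrow> norm y = 1 \<Longrightarrow> decays C s (dilate r (test_coeff \<delta> cl \<tau> y))"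
      by (rule test_coeff_decays[OF tcl del r]) (rule that)
    then show ?thesis using tau y unfolding G_def by blast
  qed
  have Fd: "\<exists>C s. \<forall>i. decays C s (dilate r (F i))" if r: "0 \<le> r" "r < 1" for r
  proof -
    obtain C s where "\<And>\<tau> y. 0 \<le> \<tau> \<Longrightarrow> \<tau> < 1 \<Longrightarrow> norm y = 1 \<Longrightarrow> decays C s (dilate r (test_coeff \<delta> lam \<tau> y))"
      by (rule test_coeff_decays[OF tlam del r]) (rule that)
    then show ?thesis using tau y unfolding F_def by blast
  qed
  have Ge: "exp_decay (dilate r (G i))" if "0 \<le> r" "r < 1" for r i using Gd[OF that] unfolding exp_decay_def by blast
  define st where "st n = (1/3::real) ^ n" for n :: nat
  have st0: "st n > 0" for n by (simp add: st_def)
  \<comment> \<open>Records whether the sign + keeps the n-th hump visible at radius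
    \<open>\<rho> n\<close> on top of the partial sum z; otherwise the sign - does, by
    \<open>L1_sign_choice\<close>. The signs thus depend on all earlier ones, whence the recursion
    for Z.\<close>
  define good where "good n z \<longleftrightarrow>
    L1 (\<lambda>k j. of_real (st n) * dilate (\<rho> n) (G n) k j) \<le> L1 (\<lambda>k j. dilate (\<rho> n) z k j + of_real (st n) * dilate (\<rho> n) (G n) k j)" for n z
  define Z where "Z = rec_nat (\<lambda>k j. 0 :: complex)
    (\<lambda>n z k j. z k j + of_real (if good n z then st n else - st n) * G n k j)"
  define e where "e n = (if good n (Z n) then st n else - st n)" for n
  have Z0: "Z 0 = (\<lambda>k j. 0)" by (simp add: Z_def)
  have ZSuc: "Z (Suc n) = (\<lambda>k j. Z n k j + of_real (e n) * G n k j)" for n by (simp add: Z_def e_def)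
  have Zsum: "Z n k j = (\<Sum>i<n. of_real (e i) * G i k j)" for n k j
    by (induction n) (auto simp: Z0 ZSuc)
  have dZ: "dilate r (Z n) = (\<lambda>k j. \<Sum>i<n. of_real (e i) * dilate r (G i) k j)" for r n
    by (auto simp: fun_eq_iff dilate_def Zsum sum_distrib_left mult_ac)
  have Ze: "exp_decay (dilate r (Z n))" if "0 \<le> r" "r < 1" for r n
    unfolding dZ by (rule exp_decay_sum) (rule Ge[OF that])
  have eabs: "\<bar>e n\<bar> = 1 * (1/3) ^ n" for n by (simp add: e_def st_def)
  have hump: "L1 (\<lambda>k j. of_real (st n) * dilate (\<rho> n) (G n) k j) \<le> L1 (dilate (\<rho> n) (Z (Suc n)))" for n
  proof (cases "good n (Z n)")
    case True
    have "dilate (\<rho> n) (Z (Suc n)) = (\<lambda>k j. dilate (\<rho> n) (Z n) k j + of_real (st n) * dilate (\<rho> n) (G n) k j)"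
      using True by (auto simp: fun_eq_iff dilate_def ZSuc e_def distrib_left mult_ac)
    then show ?thesis using True unfolding good_def by simp
  next
    case False
    have "dilate (\<rho> n) (Z (Suc n)) = (\<lambda>k j. dilate (\<rho> n) (Z n) k j - of_real (st n) * dilate (\<rho> n) (G n) k j)"
      using False by (auto simp: fun_eq_iff dilate_def ZSuc e_def algebra_simps)
    then show ?thesis
      using False L1_sign_choice[OF Ze[OF rho[of n], of n] exp_decay_scale[OF Ge[OF rho[of n], of n], where z="of_real (st n)"]] unfolding good_def by auto
  qed
  \<comment> \<open>The signs were chosen along the images \<open>G\<close>; the input is the series
    of the test functions \<open>F\<close> with the same scalars, and multiplying by c gives the
    series of the \<open>G\<close>.\<close>
  define x where "x k j = (\<Sum>i. of_real (e i) * F i k j)" for k j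
  have ele: "\<bar>e i\<bar> \<le> 1 * (1/3) ^ i" for i using eabs[of i] by simp
  have xr: "dilate r x k j = (\<Sum>i. of_real (e i) * dilate r (F i) k j)" if j: "j \<in> {1..d k}" for r k j
  proof -
    obtain C s where C: "\<And>i. decays C s (dilate (1/2) (F i))" using Fd[of "1/2"] by auto
    have "summable (\<lambda>i. of_real (2 ^ k) * (of_real (e i) * dilate (1/2) (F i) k j))"
      by (rule summable_mult[OF series_summable(1)[OF C ele j]])
    then have sm: "summable (\<lambda>i. of_real (e i) * F i k j)" by (simp add: dilate_def power_divide mult_ac)
    have "dilate r x k j = (\<Sum>i. of_real (r ^ k) * (of_real (e i) * F i k j))"
      unfolding dilate_def x_def by (rule suminf_mult[OF sm, symmetric])
    then show ?thesis by (simp add: dilate_def mult_ac)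
  qed
  have tx: "tame x" unfolding tame_def
  proof (intro allI impI)
    fix r :: real assume r: "0 < r" "r < 1"
    obtain C s where C: "\<And>i. decays C s (dilate r (F i))" using Fd[of r] r by auto
    have "r ^ k * cmod (x k j) \<le> 1 * (3/2) * C" if j: "j \<in> {1..d k}" for k j
    proof -
      have "cmod (dilate r x k j) \<le> 1 * (3/2) * C"
        unfolding xr[OF j] using r by (intro decays_bounded[OF decays_series[of C s "\<lambda>i. dilate r (F i)" e, OF C ele] j])
      then show ?thesis using r by (simp add: dilate_def norm_mult norm_power)
    qed
    then show "\<exists>C. \<forall>k. \<forall>j\<in>{1..d k}. r ^ k * cmod (x k j) \<le> C" by blast
  qed
  obtain C0 where C0: "C0 > 0" "\<And>r. 0 \<le> r \<Longrightarrow> r < 1 \<Longrightarrow> kernel_bound (dilate r lam) (C0 * (1 - r) powr (- (m + 1)))"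
    by (rule kernel_bound_frac_factor[OF m1, folded lam_def]) (rule that)
  have fx: "fin_norm p \<alpha> x"
  proof (rule finite_norm_series[where \<rho>=\<tau> and C=C0 and m=m])
    fix r :: real assume r: "0 \<le> r" "r < 1"
    obtain C s where C: "\<And>i. decays C s (dilate r (F i))" using Fd[OF r] by auto
    have "ennreal (l1_mean x r) = L1 (\<lambda>k j. \<Sum>i. of_real (e i) * dilate r (F i) k j)"
      unfolding ennreal_l1_mean[OF tx r] by (rule L1_cong) (rule xr)
    also have "\<dots> \<le> (\<Sum>i. ennreal \<bar>e i\<bar> * L1 (dilate r (F i)))" by (rule L1_series[of C s "\<lambda>i. dilate r (F i)" e, OF C ele])
    also have "\<dots> \<le> (\<Sum>i. ennreal ((1/3) ^ i * (C0 * (1 - \<tau> i) powr (m + 1 - \<alpha>) * (1 - \<tau> i * r) powr (- (m + 1)))))"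
    proof (rule suminf_le)
      fix i
      have tr: "0 \<le> \<tau> i * r" "\<tau> i * r < 1" using one_minus_mult_pos[of "\<tau> i" r] tau[of i] r by auto
      have "L1 (dilate r (F i)) \<le> ennreal ((1 - \<tau> i) powr \<delta>) * ennreal (C0 * (1 - \<tau> i * r) powr (- (m + 1)))"
        unfolding F_def L1_test_coeff[OF tlam tau y r]
        using C0(2)[OF tr] y[of i] by (intro mult_left_mono) (auto simp: kernel_bound_def)
      then have "ennreal \<bar>e i\<bar> * L1 (dilate r (F i)) \<le> ennreal ((1/3) ^ i) * (ennreal ((1 - \<tau> i) powr \<delta>) * ennreal (C0 * (1 - \<tau> i * r) powr (- (m + 1))))"
        unfolding eabs by (intro mult_mono) auto
      also have "\<dots> = ennreal ((1/3) ^ i * ((1 - \<tau> i) powr \<delta> * (C0 * (1 - \<tau> i * r) powr (- (m + 1)))))"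
        using C0(1) by (simp add: ennreal_mult)
      finally show "ennreal \<bar>e i\<bar> * L1 (dilate r (F i)) \<le> ennreal ((1/3) ^ i * (C0 * (1 - \<tau> i) powr (m + 1 - \<alpha>) * (1 - \<tau> i * r) powr (- (m + 1))))"
        by (simp add: \<delta>_def mult_ac)
    qed auto
    finally show "ennreal (l1_mean x r) \<le> (\<Sum>i. ennreal ((1/3) ^ i * (C0 * (1 - \<tau> i) powr (m + 1 - \<alpha>) * (1 - \<tau> i * r) powr (- (m + 1)))))" .
  qed (use p al m C0 tau l1_mean_nonneg in auto)
  let ?cx = "\<lambda>k j. c k j * x k j"
  have tcx: "tame ?cx" and fcx: "fin_norm q \<beta> ?cx" using H[OF tx fx] by auto
  obtain B where B: "B > 0" "\<And>r. 0 \<le> r \<Longrightarrow> r < 1 \<Longrightarrow> l1_mean ?cx r * (1 - r\<^sup>2) powr \<beta> \<le> B"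
    by (rule finite_norm_growth[OF fcx q be l1_mean_nonneg l1_mean_mono[OF tcx]]) (assumption | rule that)+
  have cxr: "dilate r ?cx k j = (\<Sum>i. of_real (e i) * dilate r (G i) k j)" if j: "j \<in> {1..d k}" for r k j
  proof -
    obtain C s where C: "\<And>i. decays C s (dilate (1/2) (F i))" using Fd[of "1/2"] by auto
    have "summable (\<lambda>i. of_real (2 ^ k) * (of_real (e i) * dilate (1/2) (F i) k j))"
      by (rule summable_mult[OF series_summable(1)[OF C ele j]])
    then have sm: "summable (\<lambda>i. of_real (e i) * F i k j)" by (simp add: dilate_def power_divide mult_ac)
    have "dilate r ?cx k j = (of_real (r ^ k) * c k j) * x k j" by (simp add: dilate_def)
    also have "\<dots> = (\<Sum>i. (of_real (r ^ k) * c k j) * (of_real (e i) * F i k j))"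
      unfolding x_def by (rule suminf_mult[OF sm, symmetric])
    finally show ?thesis by (simp add: dilate_def GF mult_ac)
  qed
  \<comment> \<open>At radius \<open>\<rho> n\<close> the hump contributes at least 3/4 of 3^(-n)
    \<open>S n\<close>, and the later terms at most 3^(-n) \<open>S n\<close> times 1/3 + 1/9 + ...
    = 1/2. A quarter remains, and \<open>S n\<close> > 4^n makes it grow like (4/3)^n.\<close>
  have key: "(4/3) ^ n / 4 \<le> B" for n
  proof -
    let ?r = "\<rho> n"
    define P where "P = (1 - ?r) powr \<beta>"
    have P0: "P > 0" using rho[of n] by (simp add: P_def)
    obtain C s where C: "\<And>i. decays C s (dilate ?r (G i))" using Gd[OF rho[of n]] by auto
    let ?tail = "\<lambda>k j. \<Sum>i. of_real (- e (i + Suc n)) * dilate ?r (G (i + Suc n)) k j"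
    have e': "\<bar>- e (i + Suc n)\<bar> \<le> (1/3) ^ Suc n * (1/3) ^ i" for i using eabs[of "i + Suc n"] by (simp add: power_add)
    have taild: "exp_decay ?tail"
      using decays_series[of C s "\<lambda>i. dilate ?r (G (i + Suc n))" "\<lambda>i. - e (i + Suc n)", OF C e'] unfolding exp_decay_def by blast
    have Gle: "L1 (dilate ?r (G i)) \<le> ennreal (S n / P)" for i
    proof -
      have "P * l1_mean (G i) ?r \<le> S n" using AleS[of "\<tau> i" "y i" n] tau[of i] y[of i] by (simp add: A_def P_def G_def)
      then have "l1_mean (G i) ?r \<le> S n / P" using P0 by (simp add: field_simps)
      moreover have "L1 (dilate ?r (G i)) = ennreal (l1_mean (G i) ?r)"
        using L1_finite[OF Ge[OF rho[of n], of i]] by (simp add: l1_mean_def less_top)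
      ultimately show ?thesis by (simp add: ennreal_leI)
    qed
    have SP: "S n / P > 0" using S4[of n] P0 by (meson divide_pos_pos less_trans zero_less_numeral zero_less_power)
    have SQ: "0 \<le> (1/3) ^ n / 2 * (S n / P)" by (rule mult_nonneg_nonneg) (use SP in auto)
    have geo: "(\<Sum>i. ennreal ((1/3) ^ Suc n * (1/3) ^ i)) = ennreal ((1/3) ^ Suc n * (3/2))"
      by (rule suminf_ennreal_eq[OF _ geometric_third]) simp
    have "L1 ?tail \<le> (\<Sum>i. ennreal \<bar>- e (i + Suc n)\<bar> * L1 (dilate ?r (G (i + Suc n))))"
      by (rule L1_series[of C s "\<lambda>i. dilate ?r (G (i + Suc n))" "\<lambda>i. - e (i + Suc n)", OF C e'])
    also have "\<dots> \<le> (\<Sum>i. ennreal ((1/3) ^ Suc n * (1/3) ^ i) * ennreal (S n / P))"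
      by (intro suminf_le mult_mono Gle ennreal_leI e') auto
    also have "\<dots> = ennreal ((1/3) ^ Suc n * (3/2)) * ennreal (S n / P)" by (simp only: ennreal_suminf_multc geo)
    also have "\<dots> = ennreal ((1/3) ^ n / 2 * (S n / P))" using SP by (subst ennreal_mult[symmetric]) auto
    finally have tl: "L1 ?tail \<le> ennreal ((1/3) ^ n / 2 * (S n / P))" .
    have "L1 (\<lambda>k j. of_real (st n) * dilate ?r (G n) k j) \<le> L1 (dilate ?r (Z (Suc n)))" by (rule hump)
    also have "\<dots> = L1 (\<lambda>k j. dilate ?r ?cx k j + ?tail k j)"
    proof (rule L1_cong)
      fix k j assume j: "j \<in> {1..d k}"
      have sm: "summable (\<lambda>i. of_real (e i) * dilate ?r (G i) k j)" by (rule series_summable(1)[OF C ele j])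
      have sm': "summable (\<lambda>i. of_real (e (i + Suc n)) * dilate ?r (G (i + Suc n)) k j)"
        using summable_ignore_initial_segment[OF sm, of "Suc n"] by simp
      have "(\<Sum>i. of_real (- e (i + Suc n)) * dilate ?r (G (i + Suc n)) k j) = - (\<Sum>i. of_real (e (i + Suc n)) * dilate ?r (G (i + Suc n)) k j)"
        using suminf_minus[OF sm'] by simp
      then show "dilate ?r (Z (Suc n)) k j = dilate ?r ?cx k j + ?tail k j"
        using suminf_split_initial_segment[OF sm, where k="Suc n"] by (simp only: dZ cxr[OF j]) simp
    qed
    also have "\<dots> \<le> L1 (dilate ?r ?cx) + L1 ?tail"
      by (rule L1_add[OF tame_exp_decay[OF tcx rho[of n]] taild])
    also have "\<dots> \<le> ennreal (l1_mean ?cx ?r) + ennreal ((1/3) ^ n / 2 * (S n / P))"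
      using tl by (simp add: ennreal_l1_mean[OF tcx rho[of n]] add_left_mono)
    also have "\<dots> = ennreal (l1_mean ?cx ?r + (1/3) ^ n / 2 * (S n / P))"
      by (rule ennreal_plus[symmetric, OF l1_mean_nonneg SQ])
    finally have 1: "L1 (\<lambda>k j. of_real (st n) * dilate ?r (G n) k j) \<le> ennreal (l1_mean ?cx ?r + (1/3) ^ n / 2 * (S n / P))" .
    have "L1 (\<lambda>k j. of_real (st n) * dilate ?r (G n) k j) = ennreal (st n) * ennreal (l1_mean (G n) ?r)"
      using L1_scale[OF Ge[OF rho[of n], of n], of "of_real (st n)"] st0[of n] L1_finite[OF Ge[OF rho[of n], of n]]
      by (simp add: l1_mean_def less_top abs_of_pos)
    also have "\<dots> = ennreal (st n * l1_mean (G n) ?r)" using st0[of n] by (intro ennreal_mult[symmetric]) (auto simp: l1_mean_nonneg)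
    finally have "ennreal (st n * l1_mean (G n) ?r) \<le> ennreal (l1_mean ?cx ?r + (1/3) ^ n / 2 * (S n / P))" using 1 by simp
    then have 2: "st n * l1_mean (G n) ?r \<le> l1_mean ?cx ?r + (1/3) ^ n / 2 * (S n / P)"
      by (subst (asm) ennreal_le_iff[OF add_nonneg_nonneg[OF l1_mean_nonneg SQ]])
    have 3: "P * l1_mean (G n) ?r \<ge> 3/4 * S n" using AS[of n] by (simp add: A_def P_def G_def)
    have "(1/3) ^ n * (3/4 * S n) \<le> (1/3) ^ n * (P * l1_mean (G n) ?r)" using 3 by (intro mult_left_mono) auto
    also have "\<dots> = P * (st n * l1_mean (G n) ?r)" by (simp add: st_def mult_ac)
    also have "\<dots> \<le> P * (l1_mean ?cx ?r + (1/3) ^ n / 2 * (S n / P))" using 2 P0 by (intro mult_left_mono) auto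
    also have "\<dots> = P * l1_mean ?cx ?r + (1/3) ^ n * (S n / 2)" using P0 by (simp add: distrib_left)
    also have "P * l1_mean ?cx ?r \<le> B"
    proof -
      have "?r\<^sup>2 \<le> ?r" using rho[of n] by (simp add: power2_eq_square mult_left_le)
      then have "P \<le> (1 - ?r\<^sup>2) powr \<beta>" unfolding P_def using rho[of n] be by (intro powr_mono2) auto
      then have "P * l1_mean ?cx ?r \<le> (1 - ?r\<^sup>2) powr \<beta> * l1_mean ?cx ?r" by (intro mult_right_mono) (simp_all add: l1_mean_nonneg)
      also have "\<dots> \<le> B" using B(2)[OF rho[of n]] by (simp add: mult.commute)
      finally show ?thesis .
    qed
    finally have "(1/3) ^ n * (3/4 * S n) \<le> B + (1/3) ^ n * (S n / 2)" by simp
    then have "(1/3) ^ n * (S n / 4) \<le> B" by (simp add: algebra_simps)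
    moreover have "(4/3) ^ n / 4 = (1/3) ^ n * (4 ^ n / 4 :: real)" by (simp add: power_divide)
    moreover have "(1/3) ^ n * (4 ^ n / 4) \<le> (1/3) ^ n * (S n / 4)" using S4[of n] by (intro mult_left_mono) auto
    ultimately show ?thesis by linarith
  qed
  obtain n where "4 * B < (4/3) ^ n" using real_arch_pow[of "4/3" "4 * B"] by auto
  with key[of n] show False by simp
qed

lemma multiplier_imp_kernel_condition:
  assumes H: "\<And>a. tame a \<Longrightarrow> fin_norm p \<alpha> a \<Longrightarrow> tame (\<lambda>k j. c k j * a k j) \<and> fin_norm q \<beta> (\<lambda>k j. c k j * a k j)"
    and c: "tame c" and p: "1 < p" and q: "1 < q" and al: "\<alpha> > 0" and be: "\<beta> > 0" and m: "m > \<alpha> - 1"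
  shows "N1 \<sigma> Y \<alpha> \<beta> m (sph_series Y c) < \<infinity>"
proof -
  have m1: "m + 1 > 0" using m al by simp
  define cl where "cl = (\<lambda>k j. frac_factor (m + 1) k j * c k j)"
  have tcl: "tame cl" unfolding cl_def by (intro tame_mult tame_frac_factor m1 c)
  define \<gamma> where "\<gamma> = m + 1 - \<alpha> + \<beta>"
  have gam: "\<gamma> > 0" using m be by (simp add: \<gamma>_def)
  obtain B where B: "\<forall>\<tau> y. 0 \<le> \<tau> \<longrightarrow> \<tau> < 1 \<longrightarrow> norm y = 1 \<longrightarrow>
    (1 - \<tau>) powr \<beta> * l1_mean (test_coeff (m + 1 - \<alpha>) cl \<tau> y) \<tau> \<le> B"
    using multiplier_uniform_bound[OF H c p q al be m] unfolding cl_def by blast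
  have "ennreal ((1 - r) powr \<gamma>) * L1 (\<lambda>k j. dilate r cl k j * of_real (Y k j y)) \<le> ennreal (2 powr \<gamma> * B)"
    if r: "0 \<le> r" "r < 1" and y: "norm y = 1" for r y
  proof -
    \<comment> \<open>The test function with parameter \<tau>, seen at radius \<tau>, involves only
      \<tau>^2 = r. The powers \<beta> and m+1-\<alpha> of 1 - \<tau> add up to \<gamma>, and 1 - r
      \<le> 2(1 - \<tau>) returns to the variable r.\<close>
    define \<tau> where "\<tau> = sqrt r"
    have tau: "0 \<le> \<tau>" "\<tau> < 1" "\<tau> * \<tau> = r" using r by (auto simp: \<tau>_def)
    let ?L = "L1 (\<lambda>k j. dilate r cl k j * of_real (Y k j y))"
    obtain l where l: "?L = ennreal l" "l \<ge> 0"
      using L1_finite[OF exp_decay_mult_Y[OF tame_exp_decay[OF tcl r] y]] by (cases ?L) auto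
    have "L1 (dilate \<tau> (test_coeff (m + 1 - \<alpha>) cl \<tau> y)) = ennreal ((1 - \<tau>) powr (m + 1 - \<alpha>) * l)"
      using L1_test_coeff[OF tcl tau(1,2) y tau(1,2)] l by (simp add: tau(3) ennreal_mult)
    then have "l1_mean (test_coeff (m + 1 - \<alpha>) cl \<tau> y) \<tau> = (1 - \<tau>) powr (m + 1 - \<alpha>) * l"
      using l by (simp add: l1_mean_def)
    then have "(1 - \<tau>) powr \<beta> * ((1 - \<tau>) powr (m + 1 - \<alpha>) * l) \<le> B" using B tau y by metis
    moreover have "(1 - \<tau>) powr \<beta> * (1 - \<tau>) powr (m + 1 - \<alpha>) = (1 - \<tau>) powr \<gamma>"
      by (simp add: \<gamma>_def add_ac flip: powr_add)
    ultimately have le: "(1 - \<tau>) powr \<gamma> * l \<le> B" by (simp add: mult.assoc[symmetric])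
    have "(1 - r) powr \<gamma> \<le> 2 powr \<gamma> * (1 - \<tau>) powr \<gamma>"
      using powr_one_minus_square(1)[OF tau(1,2), of \<gamma>] gam tau(3) by (simp add: power2_eq_square)
    then have "(1 - r) powr \<gamma> * l \<le> (2 powr \<gamma> * (1 - \<tau>) powr \<gamma>) * l" using l(2) by (rule mult_right_mono)
    also have "\<dots> \<le> 2 powr \<gamma> * B" using le by (simp add: mult.assoc mult_left_mono)
    finally show ?thesis using l by (simp add: ennreal_leI flip: ennreal_mult)
  qed
  then have "N1 \<sigma> Y \<alpha> \<beta> m (sph_series Y c) \<le> ennreal (2 powr \<gamma> * B)"
    unfolding N1_eq[OF c m1] cl_def[symmetric] \<gamma>_def[symmetric] by (intro SUP_least) auto
  then show ?thesis using ennreal_less_top by (auto intro: le_less_trans)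
qed

lemma kernel_condition_bound:
  assumes c: "tame c" and m1: "m + 1 > 0" and N: "N1 \<sigma> Y \<alpha> \<beta> m (sph_series Y c) < \<infinity>"
  obtains M where "M > 0" "\<And>r. 0 \<le> r \<Longrightarrow> r < 1 \<Longrightarrow>
      kernel_bound (dilate r (\<lambda>k j. frac_factor (m + 1) k j * c k j)) (M * (1 - r) powr (- (m + 1 - \<alpha> + \<beta>)))"
proof -
  define cl where "cl = (\<lambda>k j. frac_factor (m + 1) k j * c k j)"
  have tcl: "tame cl" unfolding cl_def by (intro tame_mult tame_frac_factor m1 c)
  define \<gamma> where "\<gamma> = m + 1 - \<alpha> + \<beta>"
  obtain M where M: "N1 \<sigma> Y \<alpha> \<beta> m (sph_series Y c) = ennreal M" "M \<ge> 0"
    using N by (cases "N1 \<sigma> Y \<alpha> \<beta> m (sph_series Y c)") auto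
  have "kernel_bound (dilate r cl) ((M + 1) * (1 - r) powr (- \<gamma>))" if r: "0 \<le> r" "r < 1" for r
    unfolding kernel_bound_def
  proof (intro conjI allI impI tame_exp_decay tcl r)
    show "0 \<le> (M + 1) * (1 - r) powr (- \<gamma>)" using M by simp
    fix y :: "real^'n" assume y: "norm y = 1"
    let ?L = "L1 (\<lambda>k j. dilate r cl k j * of_real (Y k j y))"
    have "ennreal ((1 - r) powr \<gamma>) * ?L \<le> N1 \<sigma> Y \<alpha> \<beta> m (sph_series Y c)"
      unfolding N1_eq[OF c m1] cl_def[symmetric] \<gamma>_def[symmetric]
      by (rule SUP_upper2[of r], use r in simp, rule SUP_upper2[of y]) (use y in auto)
    moreover obtain l where l: "?L = ennreal l" "l \<ge> 0"
      using L1_finite[OF exp_decay_mult_Y[OF tame_exp_decay[OF tcl r] y]] by (cases ?L) auto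
    ultimately have "ennreal ((1 - r) powr \<gamma> * l) \<le> ennreal M" using M by (simp add: ennreal_mult)
    then have "(1 - r) powr \<gamma> * l \<le> M" using M(2) by simp
    then have "(1 - r) powr (- \<gamma>) * ((1 - r) powr \<gamma> * l) \<le> (1 - r) powr (- \<gamma>) * (M + 1)"
      by (intro mult_left_mono) auto
    moreover have "(1 - r) powr (- \<gamma>) * (1 - r) powr \<gamma> = 1" using r by (simp flip: powr_add)
    ultimately have "l \<le> (M + 1) * (1 - r) powr (- \<gamma>)" by (metis mult.assoc mult.commute mult_1)
    then show "?L \<le> ennreal ((M + 1) * (1 - r) powr (- \<gamma>))" unfolding l by (rule ennreal_leI)
  qed
  then show ?thesis using that[of "M + 1"] M unfolding cl_def \<gamma>_def by simp
qed

end

theorem theorem3: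
  fixes \<sigma> :: "(real^'n) measure"
    and Y :: "nat \<Rightarrow> nat \<Rightarrow> real^'n \<Rightarrow> real"
    and c :: "nat \<Rightarrow> nat \<Rightarrow> complex"
    and p q :: ennreal
    and \<alpha> \<beta> m \<kappa> :: real
  assumes "CARD('n) \<ge> 2"
    and "\<kappa> > 0" and "\<sigma> = scale_measure (ennreal \<kappa>) surface_measure"
    and "spherical_basis \<sigma> Y"
    and "\<alpha> > 0" and "\<beta> > 0" and "1 < p" and "p \<le> q" and "m > \<alpha> - 1"
  shows "c \<in> multipliers Y (mixed_norm_space \<sigma> p 1 \<alpha>) (mixed_norm_space \<sigma> q 1 \<beta>) \<longleftrightarrow>
    (sph_converges Y c \<and> harmonic_on (sph_series Y c) (ball 0 1) \<and>
     N1 \<sigma> Y \<alpha> \<beta> m (sph_series Y c) < \<infinity>)"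
proof -
  interpret spherical_expansion \<sigma> \<kappa> Y "sph_dim TYPE('n)"
    by unfold_locales (rule assms refl)+
  have q: "1 < q" using assms(7,8) by (rule less_le_trans)
  have m1: "m + 1 > 0" using assms(5,9) by simp
  show ?thesis unfolding multipliers_iff
  proof
    assume H: "\<forall>a. tame a \<and> fin_norm p \<alpha> a \<longrightarrow> tame (\<lambda>k j. c k j * a k j) \<and> fin_norm q \<beta> (\<lambda>k j. c k j * a k j)"
    have c: "tame c" by (rule multiplier_imp_tame[OF _ assms(7,5)]) (use H in blast)
    have "N1 \<sigma> Y \<alpha> \<beta> m (sph_series Y c) < \<infinity>"
      by (rule multiplier_imp_kernel_condition[OF _ c assms(7) q assms(5,6,9)]) (use H in blast)
    then show "sph_converges Y c \<and> harmonic_on (sph_series Y c) (ball 0 1) \<and> N1 \<sigma> Y \<alpha> \<beta> m (sph_series Y c) < \<infinity>"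
      using tame_sph_converges[OF c] harmonic_on_sph_series[OF c] by blast
  next
    assume R: "sph_converges Y c \<and> harmonic_on (sph_series Y c) (ball 0 1) \<and> N1 \<sigma> Y \<alpha> \<beta> m (sph_series Y c) < \<infinity>"
    then have c: "tame c" by (intro converges_harmonic_tame) auto
    obtain M where M: "M > 0" "\<And>r. 0 \<le> r \<Longrightarrow> r < 1 \<Longrightarrow>
      kernel_bound (dilate r (\<lambda>k j. frac_factor (m + 1) k j * c k j)) (M * (1 - r) powr (- (m + 1 - \<alpha> + \<beta>)))"
      by (rule kernel_condition_bound[OF c m1, of \<alpha> \<beta>]) (use R in auto)
    show "\<forall>a. tame a \<and> fin_norm p \<alpha> a \<longrightarrow> tame (\<lambda>k j. c k j * a k j) \<and> fin_norm q \<beta> (\<lambda>k j. c k j * a k j)"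
      using tame_mult[OF c] kernel_condition_imp_multiplier[OF c assms(7,8,5,6,9) M] by blast
  qed
qed

end
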